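(* Let $m,n\ge 2$ be integers, let $\Omega\subset\mathbb{R}^n$ be a bounded domain with Lipschitz boundary, let $L\in\mathbb{M}^{m\times n}\setminus\{0\}$, $t\in\mathbb{R}$, and $\Sigma_t=\{\xi\in\mathbb{M}^{m\times n} : \sum_{i,j}L_{ij}\xi_{ij}=t\}$. Assume that $$Lb\ne 0\in\mathbb{R}^m\quad\text{for all } b\in\mathbb{R}^n\setminus\{0\},$$ and let $K\subset\Sigma_t$. Let $\{U_j\}_{j\in\mathbb{N}}$ be an in-approximation of $K$ in $\Sigma_t$, and let $v\in W^{1,\infty}(\Omega;\mathbb{R}^m)$ be a piecewise $C^1$ map satisfying $\nabla v\in U_1$ a.e. in $\Omega$. Then for each $\epsilon>0$ there exists a map $u\in W^{1,\infty}(\Omega;\mathbb{R}^m)$ such that $$\nabla u\in K \ \text{ a.e. in }\Omega,\qquad u=v\ \text{ on }\partial\Omega,\qquad \|u-v\|_{L^\infty(\Omega)}<\epsilon.$$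
   Context: $\mathbb{M}^{m\times n}$ is the space of real $m\times n$ matrices. For $u:\Omega\subset\mathbb{R}^n\to\mathbb{R}^m$, $\nabla u$ is the $m\times n$ matrix with entries $\partial u^i/\partial x_j$. "$u=v$ on $\partial\Omega$" means $u\in v+W^{1,\infty}_0(\Omega;\mathbb{R}^m)$. A map $v:\Omega\to\mathbb{R}^m$ is piecewise $C^1$ if there is a sequence $\{\Omega_j\}_{j\in\mathbb{N}}$ of disjoint open subsets of $\Omega$ whose union has Lebesgue measure $|\Omega|$ and such that $v\in C^1(\bar\Omega_j;\mathbb{R}^m)$ for all $j$. A function $f:\mathbb{M}^{m\times n}\to\mathbb{R}$ is rank-one convex if $f(\lambda\xi_1+(1-\lambda)\xi_2)\le\lambda f(\xi_1)+(1-\lambda)f(\xi_2)$ for all $\xi_1,\xi_2$ with $\operatorname{rank}(\xi_1-\xi_2)=1$ and all $\lambda\in[0,1]$. For compact $C\subset\mathbb{M}^{m\times n}$, $C^{rc}=\{\xi : f(\xi)\le\sup_C f\ \text{for all rank-one convex } f:\mathbb{M}^{m\times n}\to\mathbb{R}\}$, and for an arbitrary set $E\subset\mathbb{M}^{m\times n}$, $E^{rc}=\bigcup\{C^{rc} : C\subset E,\ C\text{ compact}\}$. In-approximation: for $K\subset\Sigma_t$, a sequence $\{U_j\}_{j\in\mathbb{N}}$ of (relatively) open sets in $\Sigma_t$ is an in-approximation of $K$ in $\Sigma_t$ if (i) the $U_j$ are uniformly bounded; (ii) $U_j\subset U_{j+1}^{rc}$ for every $j\in\mathbb{N}$; (iii)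 whenever $\xi_i\in U_i$ for all $i\in\mathbb{N}$ and $\xi_j\to\xi$ as $j\to\infty$ for some $\xi\in\Sigma_t$, then $\xi\in K$. *)

theory Defs
  imports "HOL-Analysis.Analysis" "HOL-Probability.Essential_Supremum"
begin

text \<open>Real \<open>m \<times> n\<close> matrices are of type \<^typ>\<open>real^'n^'m\<close>, with \<open>\<xi> $ i $ j\<close> the entry in row
  \<open>i\<close> and column \<open>j\<close>; their type class norm is the Frobenius norm.\<close>


section \<open>Domains with Lipschitz boundary\<close>

text \<open>Near each boundary point, for a suitable unit vector \<open>e\<close> (the last axis of a rotated
  coordinate system), \<open>\<Omega>\<close> is the region strictly above the graph of a Lipschitz function \<open>\<gamma>\<close> on
  the hyperplane orthogonal to \<open>e\<close>.\<close>

definition lipschitz_boundary :: "(real^'n) set \<Rightarrow> bool" where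
  "lipschitz_boundary \<Omega> \<longleftrightarrow>
     (\<forall>x0\<in>frontier \<Omega>. \<exists>r>0. \<exists>e \<gamma> C. norm e = 1 \<and> C-lipschitz_on {y. y \<bullet> e = 0} \<gamma> \<and>
        \<Omega> \<inter> ball x0 r = {x \<in> ball x0 r. x \<bullet> e > \<gamma> (x - (x \<bullet> e) *\<^sub>R e)})"

definition bounded_lipschitz_domain :: "(real^'n) set \<Rightarrow> bool" where
  "bounded_lipschitz_domain \<Omega> \<longleftrightarrow>
     open \<Omega> \<and> connected \<Omega> \<and> \<Omega> \<noteq> {} \<and> bounded \<Omega> \<and> lipschitz_boundary \<Omega>"


section \<open>Sobolev spaces\<close>

primrec C_k :: "nat \<Rightarrow> (real^'n \<Rightarrow> 'b::real_normed_vector) \<Rightarrow> bool" where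
  "C_k 0 f \<longleftrightarrow> continuous_on UNIV f"
| "C_k (Suc k) f \<longleftrightarrow> (\<forall>x. f differentiable (at x)) \<and>
     (\<forall>j. C_k k (\<lambda>x. frechet_derivative f (at x) (axis j 1)))"

definition test_functions :: "(real^'n) set \<Rightarrow> (real^'n \<Rightarrow> 'b::real_normed_vector) set" where
  "test_functions \<Omega> = {\<phi>. (\<forall>k. C_k k \<phi>) \<and>
     compact (closure {x. \<phi> x \<noteq> 0}) \<and> closure {x. \<phi> x \<noteq> 0} \<subseteq> \<Omega>}"

text \<open>Functions are total on \<open>\<real>\<^sup>n\<close>, but only their values on \<open>\<Omega>\<close> matter. A weak gradient is
  determined up to a null set, so it is treated as a relation.\<close>

definition has_weak_gradient ::
  "(real^'n) set \<Rightarrow> (real^'n \<Rightarrow> real^'m) \<Rightarrow> (real^'n \<Rightarrow> real^'n^'m) \<Rightarrow> bool" where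
  "has_weak_gradient \<Omega> u G \<longleftrightarrow>
     (\<forall>C. compact C \<and> C \<subseteq> \<Omega> \<longrightarrow> integrable (lebesgue_on C) u \<and> integrable (lebesgue_on C) G) \<and>
     (\<forall>\<phi>::real^'n \<Rightarrow> real. \<phi> \<in> test_functions \<Omega> \<longrightarrow>
        (\<forall>i j. (LINT x|lebesgue_on \<Omega>. u x $ i * frechet_derivative \<phi> (at x) (axis j 1)) =
               - (LINT x|lebesgue_on \<Omega>. G x $ i $ j * \<phi> x)))"

definition Linf_norm :: "(real^'n) set \<Rightarrow> (real^'n \<Rightarrow> 'b::real_normed_vector) \<Rightarrow> ereal" where
  "Linf_norm \<Omega> f = esssup (lebesgue_on \<Omega>) (\<lambda>x. ereal (norm (f x)))"

definition Linf :: "(real^'n) set \<Rightarrow> (real^'n \<Rightarrow> 'b::real_normed_vector) set" where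
  "Linf \<Omega> = {f. f \<in> borel_measurable (lebesgue_on \<Omega>) \<and> Linf_norm \<Omega> f < \<infinity>}"

definition W1inf :: "(real^'n) set \<Rightarrow> (real^'n \<Rightarrow> real^'m) set" where
  "W1inf \<Omega> = {u \<in> Linf \<Omega>. \<exists>G\<in>Linf \<Omega>. has_weak_gradient \<Omega> u G}"

text \<open>\<open>W\<^sub>0\<^sup>1\<^sup>,\<^sup>1\<close> is the closure of the test functions in the \<open>W\<^sup>1\<^sup>,\<^sup>1\<close> norm.\<close>

definition W11_0 :: "(real^'n) set \<Rightarrow> (real^'n \<Rightarrow> real^'m) set" where
  "W11_0 \<Omega> = {u. \<exists>G. integrable (lebesgue_on \<Omega>) u \<and> integrable (lebesgue_on \<Omega>) G \<and>
     has_weak_gradient \<Omega> u G \<and>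
     (\<exists>\<phi>. (\<forall>k::nat. \<phi> k \<in> test_functions \<Omega>) \<and>
        (\<lambda>k. LINT x|lebesgue_on \<Omega>. norm (\<phi> k x - u x)) \<longlonglongrightarrow> 0 \<and>
        (\<lambda>k. LINT x|lebesgue_on \<Omega>. norm (jacobian (\<phi> k) (at x) - G x)) \<longlonglongrightarrow> 0)}"

text \<open>The usual convention \<open>W\<^sub>0\<^sup>1\<^sup>,\<^sup>\<infinity> = W\<^sup>1\<^sup>,\<^sup>\<infinity> \<inter> W\<^sub>0\<^sup>1\<^sup>,\<^sup>1\<close>; the closure of the test functions in the
  \<open>W\<^sup>1\<^sup>,\<^sup>\<infinity>\<close> norm would contain \<open>C\<^sup>1\<close> functions only.\<close>

definition W1inf_0 :: "(real^'n) set \<Rightarrow> (real^'n \<Rightarrow> real^'m) set" where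
  "W1inf_0 \<Omega> = W1inf \<Omega> \<inter> W11_0 \<Omega>"

definition eq_on_boundary ::
  "(real^'n) set \<Rightarrow> (real^'n \<Rightarrow> real^'m) \<Rightarrow> (real^'n \<Rightarrow> real^'m) \<Rightarrow> bool" where
  "eq_on_boundary \<Omega> u v \<longleftrightarrow> (\<lambda>x. u x - v x) \<in> W1inf_0 \<Omega>"

text \<open>\<open>\<nabla>u \<in> S\<close> almost everywhere in \<open>\<Omega>\<close>; no measurability of \<open>S\<close> is needed.\<close>

definition gradient_in_ae ::
  "(real^'n) set \<Rightarrow> (real^'n \<Rightarrow> real^'m) \<Rightarrow> (real^'n^'m) set \<Rightarrow> bool" where
  "gradient_in_ae \<Omega> u S \<longleftrightarrow>
     (\<exists>G. has_weak_gradient \<Omega> u G \<and> (AE x in lebesgue_on \<Omega>. G x \<in> S))"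


section \<open>Piecewise $C^1$ maps\<close>

text \<open>\<open>v\<close> is \<open>C\<^sup>1\<close> on the open set \<open>D\<close>, and both \<open>v\<close> and its gradient extend continuously to the
  closure of \<open>D\<close>.\<close>

definition C1_closure :: "(real^'n) set \<Rightarrow> (real^'n \<Rightarrow> real^'m) \<Rightarrow> bool" where
  "C1_closure D v \<longleftrightarrow>
     (\<exists>w G. continuous_on (closure D) w \<and> continuous_on (closure D) G \<and>
        (\<forall>x\<in>D. w x = v x \<and> (v has_derivative (\<lambda>h. G x *v h)) (at x)))"

text \<open>Pieces may be empty, so finitely many pieces are allowed.\<close>

definition piecewise_C1 :: "(real^'n) set \<Rightarrow> (real^'n \<Rightarrow> real^'m) \<Rightarrow> bool" where
  "piecewise_C1 \<Omega> v \<longleftrightarrow>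
     (\<exists>D :: nat \<Rightarrow> (real^'n) set. disjoint_family D \<and> (\<forall>j. open (D j) \<and> D j \<subseteq> \<Omega>) \<and>
        emeasure lebesgue (\<Union>j. D j) = emeasure lebesgue \<Omega> \<and> (\<forall>j. C1_closure (D j) v))"


section \<open>Rank-one convex hulls and in-approximations\<close>

definition rank_one_convex :: "(real^'n^'m \<Rightarrow> real) \<Rightarrow> bool" where
  "rank_one_convex f \<longleftrightarrow>
     (\<forall>\<xi>1 \<xi>2. rank (\<xi>1 - \<xi>2) = 1 \<longrightarrow> (\<forall>l\<in>{0..1}.
        f (l *\<^sub>R \<xi>1 + (1 - l) *\<^sub>R \<xi>2) \<le> l * f \<xi>1 + (1 - l) * f \<xi>2))"

text \<open>The supremum is taken in the extended reals, so that the hull of the empty set is empty.\<close>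

definition rc_hull_compact :: "(real^'n^'m) set \<Rightarrow> (real^'n^'m) set" where
  "rc_hull_compact C = {\<xi>. \<forall>f. rank_one_convex f \<longrightarrow> ereal (f \<xi>) \<le> (SUP \<eta>\<in>C. ereal (f \<eta>))}"

definition rc_hull :: "(real^'n^'m) set \<Rightarrow> (real^'n^'m) set" where
  "rc_hull E = \<Union> {rc_hull_compact C | C. C \<subseteq> E \<and> compact C}"

definition Sigma_t :: "real^'n^'m \<Rightarrow> real \<Rightarrow> (real^'n^'m) set" where
  "Sigma_t L t = {\<xi>. (\<Sum>i\<in>UNIV. \<Sum>j\<in>UNIV. L $ i $ j * \<xi> $ i $ j) = t}"

text \<open>Sequences are indexed from 0, so the first set of the in-approximation is \<open>U 0\<close>.\<close>

definition in_approximation ::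
  "(real^'n^'m) set \<Rightarrow> (real^'n^'m) set \<Rightarrow> (nat \<Rightarrow> (real^'n^'m) set) \<Rightarrow> bool" where
  "in_approximation S K U \<longleftrightarrow>
     (\<forall>j. openin (top_of_set S) (U j)) \<and>
     bounded (\<Union>j. U j) \<and>
     (\<forall>j. U j \<subseteq> rc_hull (U (Suc j))) \<and>
     (\<forall>X. \<forall>\<xi>\<in>S. (\<forall>i. X i \<in> U i) \<and> X \<longlonglongrightarrow> \<xi> \<longrightarrow> \<xi> \<in> K)"

end

theory Submission
  imports Defs
begin

text \<open>The map is built by convex integration. On the plane \<open>S\<close>, replace the rank-one convex hull of
  \<open>U\<close> by \<open>lhull U\<close>, the zero sets of the largest lamination convex minorants of \<open>dist(., C)\<^sup>2\<close>,
  \<open>C\<close> compact in \<open>U\<close>. Let \<open>bad U \<xi>\<close> be the least fraction of a ball on which an affine map with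
  gradient \<open>\<xi>\<close>, perturbed by test functions whose gradient stays in \<open>S\<close> and in the hull, misses
  \<open>U\<close>. Nondegeneracy of \<open>L\<close> allows one to correct a laminate by a small second component so that
  its gradient stays exactly in \<open>S\<close>; with the maximum principle this makes \<open>bad U\<close> convex along
  rank-one segments, so it vanishes on the hull. Hence one can push the gradient from \<open>U\<^sub>j\<close> into
  \<open>U\<^sub>j\<^sub>+\<^sub>1\<close> off a set of small measure, with perturbations that are uniformly small and nearly
  orthogonal to all earlier gradients. Orthogonality makes the gradients Cauchy in \<open>L\<^sup>2\<close>, and
  uniform smallness relative to the scale on which earlier gradients oscillate makes the whole
  sequence converge almost everywhere, so property (iii) of the in-approximation puts the limit
  in \<open>K\<close>.\<close>

section \<open>Lamination convex hulls in the constraint plane\<close>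

text \<open>The constraint \<open>L \<bullet> J \<phi> x = 0\<close> says that the field
  \<open>transpose L *v \<phi> x\<close> is divergence free. Cutting off a plane wave destroys this,
  which is the obstacle to copying ordinary laminates. Nondegeneracy makes
  \<open>transpose L\<close> surjective, so that a rotation field tangent to thin ellipsoids, which
  survives every cutoff constant on them, can be lifted to a map. No laminate of finite order is
  constructed: membership in a hull defined by functions is exploited by letting \<open>bad\<close>
  itself compete. Since \<open>bad\<close> is controlled only on the hull, this forces a
  localization to sublevel sets of an envelope. Squared distances make the envelope coercive and
  match the quadratic penalty off \<open>S\<close>. A stage misses its target on a small set; those
  points stay in the same hull and are tried again, so the stage at which a point reaches
  \<open>U j\<close> depends on the point. Convergence along a subsequence of stages could skip
  exactly these stages, which is why the whole sequence of gradients has to converge almost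
  everywhere.\<close>

definition outer :: "real^'m \<Rightarrow> real^'n \<Rightarrow> real^'n^'m" where
  "outer a b = (\<chi> i j. a $ i * b $ j)"

lemma outer_nth [simp]: "outer a b $ i $ j = a $ i * b $ j"
  by (simp add: outer_def)

lemma matrix_eqI: "(\<And>i j. A $ i $ j = B $ i $ j) \<Longrightarrow> A = B" for A B :: "'a^'n^'m"
  by (simp add: vec_eq_iff)

lemma outer_simps:
  "outer (a + a') b = outer a b + outer a' b" "outer (a - a') b = outer a b - outer a' b"
  "outer a (b + b') = outer a b + outer a b'" "outer a (b - b') = outer a b - outer a b'"
  "outer (c *\<^sub>R a) b = c *\<^sub>R outer a b" "outer a (c *\<^sub>R b) = c *\<^sub>R outer a b"
  "outer 0 b = 0" "outer a 0 = 0"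
  by (auto intro!: matrix_eqI simp: algebra_simps)

lemma inner_outer: "L \<bullet> outer a b = a \<bullet> (L *v b)"
  by (simp add: inner_vec_def matrix_vector_mult_def sum_distrib_left mult_ac)

lemma outer_inner_outer: "outer a b \<bullet> outer c d = (a \<bullet> c) * (b \<bullet> d)"
  unfolding inner_vec_def sum_product by (simp add: inner_vec_def mult_ac)

lemma norm_outer: "norm (outer a b) = norm a * norm b"
  by (simp add: norm_eq_sqrt_inner outer_inner_outer real_sqrt_mult)

lemma outer_mult_vec: "outer a b *v x = (b \<bullet> x) *\<^sub>R a"
  by (simp add: vec_eq_iff matrix_vector_mult_def inner_vec_def sum_distrib_left mult_ac)

text \<open>The row space is a line, spanned by some \<open>b\<close>; the coefficients of the rows
  along \<open>b\<close> form the left factor.\<close>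

lemma rank_one_outer:
  fixes A :: "real^'n^'m"
  assumes "rank A = 1"
  shows "\<exists>a b. A = outer a b"
proof -
  obtain B where B: "B \<subseteq> rows A" "independent B" "rows A \<subseteq> span B" "card B = dim (rows A)"
    using basis_exists by blast
  then obtain b where b: "B = {b}"
    using assms by (auto simp: row_rank_def card_1_singleton_iff)
  have "\<exists>k. row i A = k *\<^sub>R b" for i
  proof -
    have "row i A \<in> span {b}"
      using B(3) b by (auto simp: rows_def)
    then show ?thesis
      by (auto simp: span_singleton)
  qed
  then obtain k where k: "\<And>i. row i A = k i *\<^sub>R b"
    by metis
  have "A = outer (\<chi> i. k i) b"
  proof (rule matrix_eqI)
    fix i j show "A $ i $ j = outer (\<chi> i. k i) b $ i $ j"
      using arg_cong[OF k[of i], of "\<lambda>v. v $ j"] by (simp add: row_def)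
  qed
  then show ?thesis by blast
qed

lemma Sigma_t_iff: "\<xi> \<in> Sigma_t L t \<longleftrightarrow> L \<bullet> \<xi> = t"
  by (simp add: Sigma_t_def inner_vec_def)

text \<open>The defect of convexity of the squared norm. Applied to matrices it produces the error
  of a tangent correction, applied to real numbers the gain of the penalty, and these two are later
  balanced against each other.\<close>

lemma norm_sq_convex_comb:
  fixes x y :: "'a::real_inner"
  shows "l * (norm x)\<^sup>2 + (1 - l) * (norm y)\<^sup>2
    = (norm (l *\<^sub>R x + (1 - l) *\<^sub>R y))\<^sup>2 + l * (1 - l) * (norm (x - y))\<^sup>2"
  unfolding power2_norm_eq_inner by (simp add: inner_simps inner_commute algebra_simps)

lemma norm_sq_add_le: "(norm (x + y))\<^sup>2 \<le> 2 * (norm x)\<^sup>2 + 2 * (norm y)\<^sup>2"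
  for x y :: "'a::real_normed_vector"
proof -
  have "(norm (x + y))\<^sup>2 \<le> (norm x + norm y)\<^sup>2"
    by (simp add: norm_triangle_ineq power_mono)
  also have "\<dots> \<le> 2 * (norm x)\<^sup>2 + 2 * (norm y)\<^sup>2"
    using sum_squares_bound[of "norm x" "norm y"] by (simp add: power2_sum)
  finally show ?thesis .
qed

lemma real_sq_add_le: "(x + y)\<^sup>2 \<le> 2 * x\<^sup>2 + 2 * y\<^sup>2" for x y :: real
  using norm_sq_add_le[of x y] by simp

section \<open>Lamination convexity in the plane and the envelope of the squared distance\<close>

locale linear_constraint =
  fixes L :: "real^'n^'m" and t :: real
  assumes nondegenerate: "b \<noteq> 0 \<Longrightarrow> L *v b \<noteq> 0"
begin

abbreviation S :: "(real^'n^'m) set" where "S \<equiv> Sigma_t L t"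

lemma closed_S: "closed S"
proof -
  have "S = {\<xi>. L \<bullet> \<xi> = t}" by (auto simp: Sigma_t_iff)
  then show ?thesis by (simp add: closed_hyperplane)
qed

lemma S_convex: "\<xi> \<in> S \<Longrightarrow> \<eta> \<in> S \<Longrightarrow> l *\<^sub>R \<xi> + (1 - l) *\<^sub>R \<eta> \<in> S"
  by (simp add: Sigma_t_iff inner_add_right algebra_simps)

text \<open>Differences of the form \<open>outer a b\<close> cover rank one together with the zero
  matrix, so no rank has to be computed. Only values on \<open>S\<close> are restricted.\<close>

definition lam_convex :: "(real^'n^'m \<Rightarrow> real) \<Rightarrow> bool" where
  "lam_convex f \<longleftrightarrow> (\<forall>\<xi>\<in>S. \<forall>\<eta>\<in>S. \<forall>a b. \<xi> - \<eta> = outer a b \<longrightarrow>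
     (\<forall>l\<in>{0..1}. f (l *\<^sub>R \<xi> + (1 - l) *\<^sub>R \<eta>) \<le> l * f \<xi> + (1 - l) * f \<eta>))"

lemma lam_convexD:
  "lam_convex f \<Longrightarrow> \<xi> \<in> S \<Longrightarrow> \<eta> \<in> S \<Longrightarrow> \<xi> - \<eta> = outer a b \<Longrightarrow> 0 \<le> l \<Longrightarrow> l \<le> 1 \<Longrightarrow>
    f (l *\<^sub>R \<xi> + (1 - l) *\<^sub>R \<eta>) \<le> l * f \<xi> + (1 - l) * f \<eta>"
  unfolding lam_convex_def by (meson atLeastAtMost_iff)

definition minorants :: "(real^'n^'m) set \<Rightarrow> (real^'n^'m \<Rightarrow> real) set" where
  "minorants C = {h. lam_convex h \<and> (\<forall>\<eta>\<in>S. h \<eta> \<le> (infdist \<eta> C)\<^sup>2)}"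

text \<open>The lamination convex envelope of the squared distance, relative to \<open>S\<close>. On
  \<open>S\<close> the supremum is bounded by the squared distance, and it is nonnegative because
  the zero function competes.\<close>

definition env :: "(real^'n^'m) set \<Rightarrow> real^'n^'m \<Rightarrow> real" where
  "env C \<xi> = (SUP h\<in>minorants C. h \<xi>)"

lemma zero_minorant: "(\<lambda>_. 0) \<in> minorants C"
  by (simp add: minorants_def lam_convex_def)

lemma env_ge: "h \<in> minorants C \<Longrightarrow> \<xi> \<in> S \<Longrightarrow> h \<xi> \<le> env C \<xi>"
  unfolding env_def
  by (rule cSUP_upper) (auto simp: minorants_def intro!: bdd_aboveI[of _ "(infdist \<xi> C)\<^sup>2"])

lemma env_leI: "(\<And>h. h \<in> minorants C \<Longrightarrow> h \<xi> \<le> c) \<Longrightarrow> env C \<xi> \<le> c"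
  unfolding env_def using zero_minorant by (intro cSUP_least) auto

lemma env_minorant: "env C \<in> minorants C"
  unfolding minorants_def lam_convex_def
proof (intro CollectI conjI ballI allI impI)
  fix \<xi> \<eta> a b l assume A: "\<xi> \<in> S" "\<eta> \<in> S" "\<xi> - \<eta> = outer a b" "l \<in> {0..1::real}"
  show "env C (l *\<^sub>R \<xi> + (1 - l) *\<^sub>R \<eta>) \<le> l * env C \<xi> + (1 - l) * env C \<eta>"
  proof (rule env_leI)
    fix h assume h: "h \<in> minorants C"
    then have "h (l *\<^sub>R \<xi> + (1 - l) *\<^sub>R \<eta>) \<le> l * h \<xi> + (1 - l) * h \<eta>"
      using A lam_convexD[of h \<xi> \<eta> a b l] by (auto simp: minorants_def)
    also have "\<dots> \<le> l * env C \<xi> + (1 - l) * env C \<eta>"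
      using A env_ge[OF h] by (intro add_mono mult_left_mono) auto
    finally show "h (l *\<^sub>R \<xi> + (1 - l) *\<^sub>R \<eta>) \<le> l * env C \<xi> + (1 - l) * env C \<eta>" .
  qed
next
  fix \<eta> assume "\<eta> \<in> S"
  then show "env C \<eta> \<le> (infdist \<eta> C)\<^sup>2"
    by (intro env_leI) (auto simp: minorants_def)
qed

lemma env_le: "\<eta> \<in> S \<Longrightarrow> env C \<eta> \<le> (infdist \<eta> C)\<^sup>2"
  using env_minorant by (auto simp: minorants_def)

lemma env_lam_convex: "lam_convex (env C)"
  using env_minorant by (auto simp: minorants_def)

lemma lam_convex_shift:
  assumes "lam_convex f" "L \<bullet> \<zeta> = 0"
  shows "lam_convex (\<lambda>\<eta>. f (\<eta> + \<zeta>))"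
  unfolding lam_convex_def
proof (intro ballI allI impI)
  fix \<xi> \<eta> a b and l :: real assume A: "\<xi> \<in> S" "\<eta> \<in> S" "\<xi> - \<eta> = outer a b" "l \<in> {0..1}"
  have eq: "l *\<^sub>R \<xi> + (1 - l) *\<^sub>R \<eta> + \<zeta> = l *\<^sub>R (\<xi> + \<zeta>) + (1 - l) *\<^sub>R (\<eta> + \<zeta>)"
    by (simp add: algebra_simps)
  show "f (l *\<^sub>R \<xi> + (1 - l) *\<^sub>R \<eta> + \<zeta>) \<le> l * f (\<xi> + \<zeta>) + (1 - l) * f (\<eta> + \<zeta>)"
    unfolding eq using A assms(2)
    by (intro lam_convexD[OF assms(1), where a=a and b=b]) (auto simp: Sigma_t_iff inner_add_right)
qed

text \<open>The shifted envelope, lowered by \<open>2 * (norm \<zeta>)\<^sup>2\<close> and halved,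
  competes for the envelope; the factor 2 comes from squaring the triangle inequality. This stands
  in for continuity: if \<open>env C\<close> tends to 0 along a sequence, then
  \<open>env C \<le> 0\<close> at the limit.\<close>

lemma env_shift_le:
  assumes "\<xi> \<in> S" "L \<bullet> \<zeta> = 0"
  shows "env C (\<xi> + \<zeta>) \<le> 2 * env C \<xi> + 2 * (norm \<zeta>)\<^sup>2"
proof -
  let ?h = "\<lambda>\<eta>. (env C (\<eta> + \<zeta>) - 2 * (norm \<zeta>)\<^sup>2) / 2"
  have conv: "lam_convex ?h"
    using lam_convex_shift[OF env_lam_convex[of C] assms(2)]
    unfolding lam_convex_def by (fastforce simp: field_simps)
  have "?h \<eta> \<le> (infdist \<eta> C)\<^sup>2" if "\<eta> \<in> S" for \<eta>
  proof -
    have "env C (\<eta> + \<zeta>) \<le> (infdist (\<eta> + \<zeta>) C)\<^sup>2"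
      using that assms by (intro env_le) (auto simp: Sigma_t_iff inner_add_right)
    also have "\<dots> \<le> (infdist \<eta> C + norm \<zeta>)\<^sup>2"
      using infdist_triangle[of "\<eta> + \<zeta>" C \<eta>] by (intro power_mono) (auto simp: infdist_nonneg dist_norm)
    also have "\<dots> \<le> 2 * (infdist \<eta> C)\<^sup>2 + 2 * (norm \<zeta>)\<^sup>2"
      by (rule real_sq_add_le)
    finally show ?thesis by simp
  qed
  with conv have "?h \<in> minorants C" by (auto simp: minorants_def)
  from env_ge[OF this assms(1)] show ?thesis by simp
qed

text \<open>The envelope of the translated set, pulled back, competes for that of \<open>C\<close>,
  since the point of \<open>C\<close> nearest to \<open>\<eta>\<close> is translated along with
  \<open>\<eta>\<close>.\<close>

lemma env_translate_le:
  assumes "\<xi> \<in> S" "L \<bullet> \<zeta> = 0" "compact C" "C \<noteq> {}"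
  shows "env ((\<lambda>\<eta>. \<eta> + \<zeta>) ` C) (\<xi> + \<zeta>) \<le> env C \<xi>"
proof -
  let ?D = "(\<lambda>\<eta>. \<eta> + \<zeta>) ` C"
  have "env ?D (\<eta> + \<zeta>) \<le> (infdist \<eta> C)\<^sup>2" if "\<eta> \<in> S" for \<eta>
  proof -
    obtain c where c: "c \<in> C" "infdist \<eta> C = dist \<eta> c"
      using infdist_attains_inf[of C \<eta>] assms compact_imp_closed by blast
    have "env ?D (\<eta> + \<zeta>) \<le> (infdist (\<eta> + \<zeta>) ?D)\<^sup>2"
      using that assms by (intro env_le) (auto simp: Sigma_t_iff inner_add_right)
    also have "\<dots> \<le> (dist (\<eta> + \<zeta>) (c + \<zeta>))\<^sup>2"
      using c by (intro power_mono infdist_le) (auto simp: infdist_nonneg)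
    finally show ?thesis using c by simp
  qed
  with lam_convex_shift[OF env_lam_convex[of ?D] assms(2)]
  have "(\<lambda>\<eta>. env ?D (\<eta> + \<zeta>)) \<in> minorants C" by (auto simp: minorants_def)
  from env_ge[OF this assms(1)] show ?thesis by simp
qed

text \<open>Half the squared norm minus \<open>R\<^sup>2\<close> is convex and lies below the
  squared distance to any nonempty compact set in the ball of radius \<open>R\<close>. Sublevel sets
  of the envelope in \<open>S\<close> are therefore bounded.\<close>

lemma env_growth:
  assumes "\<xi> \<in> S" "compact C" "C \<noteq> {}" "C \<subseteq> cball 0 R"
  shows "(norm \<xi>)\<^sup>2 / 2 - R\<^sup>2 \<le> env C \<xi>"
proof -
  let ?h = "\<lambda>\<xi>::real^'n^'m. (norm \<xi>)\<^sup>2 / 2 - R\<^sup>2"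
  have "lam_convex ?h"
    unfolding lam_convex_def
  proof (intro ballI allI impI)
    fix \<xi> \<eta> a b and l :: real assume A: "\<xi> \<in> S" "\<eta> \<in> S" "\<xi> - \<eta> = outer a b" "l \<in> {0..1}"
    have "(norm (l *\<^sub>R \<xi> + (1 - l) *\<^sub>R \<eta>))\<^sup>2 \<le> l * (norm \<xi>)\<^sup>2 + (1 - l) * (norm \<eta>)\<^sup>2"
      unfolding norm_sq_convex_comb using A by auto
    then show "?h (l *\<^sub>R \<xi> + (1 - l) *\<^sub>R \<eta>) \<le> l * ?h \<xi> + (1 - l) * ?h \<eta>"
      by (simp add: field_simps)
  qed
  moreover have "?h \<eta> \<le> (infdist \<eta> C)\<^sup>2" for \<eta>
  proof -
    obtain c where c: "c \<in> C" "infdist \<eta> C = dist \<eta> c"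
      using infdist_attains_inf[of C \<eta>] assms compact_imp_closed by blast
    have "(norm \<eta>)\<^sup>2 \<le> 2 * (norm (\<eta> - c))\<^sup>2 + 2 * (norm c)\<^sup>2"
      using norm_sq_add_le[of "\<eta> - c" c] by simp
    moreover have "(norm c)\<^sup>2 \<le> R\<^sup>2"
      using c assms by (intro power_mono) auto
    ultimately show ?thesis using c by (simp add: dist_norm)
  qed
  ultimately have "?h \<in> minorants C" by (simp add: minorants_def)
  from env_ge[OF this assms(1)] show ?thesis .
qed

lemma coercive: obtains c where "c > 0" "\<And>b. c * norm b \<le> norm (L *v b)"
proof -
  have "inj ((*v) L)"
    using nondegenerate by (subst linear_injective_0) auto
  then obtain c where "c > 0" "\<And>b. c * norm b \<le> norm (L *v b)"
    using linear_inj_bounded_below_pos[of "(*v) L"] by (metis matrix_vector_mul_linear mult.commute)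
  then show ?thesis using that by blast
qed

text \<open>Every rank-one direction \<open>outer a b\<close> is close to one tangent to the constraint, up to its
  own constraint violation.\<close>

lemma tangent_correction:
  assumes c: "c > 0" "\<And>b. c * norm b \<le> norm (L *v b)"
  obtains a' where "L \<bullet> outer a' b = 0" "c * norm (outer a b - outer a' b) \<le> \<bar>L \<bullet> outer a b\<bar>"
proof (cases "b = 0")
  case True
  then show ?thesis using that[of a] by (simp add: outer_simps)
next
  case False
  define w where "w = L *v b"
  have w: "w \<noteq> 0" using nondegenerate[OF False] by (simp add: w_def)
  \<comment> \<open>\<open>k *\<^sub>R w\<close> is the orthogonal projection of \<open>a\<close> to
    the line of \<open>w\<close>; subtracting it removes the constraint violation exactly.\<close>
  define k where "k = (a \<bullet> w) / (norm w)\<^sup>2"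
  have "L \<bullet> outer (a - k *\<^sub>R w) b = 0"
    unfolding inner_outer w_def[symmetric] using w
    by (simp add: inner_diff_left k_def power2_norm_eq_inner)
  moreover have "c * norm (outer a b - outer (a - k *\<^sub>R w) b) \<le> \<bar>L \<bullet> outer a b\<bar>"
  proof -
    have "c * norm (outer a b - outer (a - k *\<^sub>R w) b) = \<bar>k\<bar> * norm w * (c * norm b)"
      by (simp add: outer_simps norm_outer)
    also have "\<dots> \<le> \<bar>k\<bar> * norm w * norm w"
      using c(2)[of b] by (intro mult_left_mono) (auto simp: w_def)
    also have "\<dots> = \<bar>a \<bullet> w\<bar>"
      using w by (simp add: k_def power2_eq_square)
    finally show ?thesis by (simp add: inner_outer w_def)
  qed
  ultimately show ?thesis using that by blast
qed

text \<open>A lamination convex function on the constraint plane extends to a rank-one convex function on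
  all matrices: the quadratic penalty of the constraint pays for the tangent corrections.\<close>

lemma env_rc_hull_compact:
  assumes C: "compact C" "C \<noteq> {}" "C \<subseteq> S" and \<xi>: "\<xi> \<in> S" "\<xi> \<in> rc_hull_compact C"
  shows "env C \<xi> \<le> 0"
proof -
  obtain c where c: "c > 0" "\<And>b. c * norm b \<le> norm (L *v b)"
    using coercive by blast
  \<comment> \<open>The supremum over \<open>\<zeta>\<close> in \<open>S\<close> is a
    sup-convolution, which extends the envelope off the plane. The coefficient 2 is just large
    enough for \<open>P_le\<close>: moving the base point by \<open>\<eta> - \<zeta>\<close> costs
    \<open>2 * (norm (\<eta> - \<zeta>))\<^sup>2\<close> in the squared distance.\<close>
  define P where "P \<eta> \<zeta> = env C \<zeta> - 2 * (norm (\<eta> - \<zeta>))\<^sup>2" for \<eta> \<zeta>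
  \<comment> \<open>The penalty gains \<open>l * (1 - l) * (L \<bullet> outer a b)\<^sup>2\<close>
    in convexity; the factor \<open>2 / c\<^sup>2\<close> lets this pay for twice the squared
    tangent correction.\<close>
  define F where "F \<eta> = (SUP \<zeta>\<in>S. P \<eta> \<zeta>) + 2 / c\<^sup>2 * (L \<bullet> \<eta> - t)\<^sup>2" for \<eta>
  have P_le: "P \<eta> \<zeta> \<le> 2 * (infdist \<eta> C)\<^sup>2" if "\<zeta> \<in> S" for \<eta> \<zeta>
  proof -
    have "env C \<zeta> \<le> (infdist \<zeta> C)\<^sup>2" by (rule env_le[OF that])
    also have "\<dots> \<le> (infdist \<eta> C + norm (\<eta> - \<zeta>))\<^sup>2"
      using infdist_triangle[of \<zeta> C \<eta>]
      by (intro power_mono) (auto simp: infdist_nonneg dist_norm norm_minus_commute)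
    also have "\<dots> \<le> 2 * (infdist \<eta> C)\<^sup>2 + 2 * (norm (\<eta> - \<zeta>))\<^sup>2"
      by (rule real_sq_add_le)
    finally show ?thesis by (simp add: P_def)
  qed
  have ne: "S \<noteq> {}" using \<xi> by auto
  have bdd: "bdd_above (P \<eta> ` S)" for \<eta>
    using P_le by (auto intro!: bdd_aboveI)
  have F_ge: "P \<eta> \<zeta> + 2 / c\<^sup>2 * (L \<bullet> \<eta> - t)\<^sup>2 \<le> F \<eta>" if "\<zeta> \<in> S" for \<eta> \<zeta>
    unfolding F_def using cSUP_upper[OF that bdd] by simp
  have "rank_one_convex F"
    unfolding rank_one_convex_def
  proof (intro allI impI ballI)
    fix \<xi>1 \<xi>2 :: "real^'n^'m" and l :: real
    assume rk: "rank (\<xi>1 - \<xi>2) = 1" and l: "l \<in> {0..1}"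
    let ?\<eta> = "l *\<^sub>R \<xi>1 + (1 - l) *\<^sub>R \<xi>2"
    obtain a b where ab: "\<xi>1 - \<xi>2 = outer a b"
      using rank_one_outer[OF rk] by auto
    obtain a' where a': "L \<bullet> outer a' b = 0"
      "c * norm (outer a b - outer a' b) \<le> \<bar>L \<bullet> outer a b\<bar>"
      using tangent_correction[OF c] by metis
    have "P ?\<eta> \<zeta> \<le> l * F \<xi>1 + (1 - l) * F \<xi>2 - 2 / c\<^sup>2 * (L \<bullet> ?\<eta> - t)\<^sup>2" if "\<zeta> \<in> S" for \<zeta>
    proof -
      \<comment> \<open>\<open>\<zeta>\<close> is split with the weights of \<open>\<xi>1\<close>
        and \<open>\<xi>2\<close>, but in the tangent direction \<open>outer a' b\<close>, so both
        points remain in \<open>S\<close> and lamination convexity of the envelope applies.\<close>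
      define \<zeta>1 where "\<zeta>1 = \<zeta> + (1 - l) *\<^sub>R outer a' b"
      define \<zeta>2 where "\<zeta>2 = \<zeta> - l *\<^sub>R outer a' b"
      have S12: "\<zeta>1 \<in> S" "\<zeta>2 \<in> S"
        using that a' by (auto simp: Sigma_t_iff \<zeta>1_def \<zeta>2_def inner_add_right inner_diff_right)
      have diff: "\<zeta>1 - \<zeta>2 = outer a' b" and comb: "l *\<^sub>R \<zeta>1 + (1 - l) *\<^sub>R \<zeta>2 = \<zeta>"
        by (simp_all add: \<zeta>1_def \<zeta>2_def algebra_simps)
      have 1: "env C \<zeta> \<le> l * env C \<zeta>1 + (1 - l) * env C \<zeta>2"
        using lam_convexD[OF env_lam_convex S12 diff, of l C] l by (simp add: comb)
      have "l *\<^sub>R (\<xi>1 - \<zeta>1) + (1 - l) *\<^sub>R (\<xi>2 - \<zeta>2) = ?\<eta> - (l *\<^sub>R \<zeta>1 + (1 - l) *\<^sub>R \<zeta>2)"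
        by (simp add: algebra_simps)
      then have e1: "l *\<^sub>R (\<xi>1 - \<zeta>1) + (1 - l) *\<^sub>R (\<xi>2 - \<zeta>2) = ?\<eta> - \<zeta>"
        by (simp only: comb)
      have e2: "(\<xi>1 - \<zeta>1) - (\<xi>2 - \<zeta>2) = outer a b - outer a' b"
        using ab diff by (simp add: algebra_simps)
      have 2: "l * (norm (\<xi>1 - \<zeta>1))\<^sup>2 + (1 - l) * (norm (\<xi>2 - \<zeta>2))\<^sup>2
        = (norm (?\<eta> - \<zeta>))\<^sup>2 + l * (1 - l) * (norm (outer a b - outer a' b))\<^sup>2"
        unfolding norm_sq_convex_comb e1 e2 ..
      define s1 s2 where "s1 = L \<bullet> \<xi>1 - t" and "s2 = L \<bullet> \<xi>2 - t"
      have s: "l * s1 + (1 - l) * s2 = L \<bullet> ?\<eta> - t" "s1 - s2 = L \<bullet> outer a b"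
        by (simp_all add: s1_def s2_def inner_add_right algebra_simps flip: ab)
      have 3: "l * s1\<^sup>2 + (1 - l) * s2\<^sup>2 = (L \<bullet> ?\<eta> - t)\<^sup>2 + l * (1 - l) * (L \<bullet> outer a b)\<^sup>2"
        using norm_sq_convex_comb[of l s1 s2] by (simp add: s)
      have "c\<^sup>2 * (norm (outer a b - outer a' b))\<^sup>2 \<le> (L \<bullet> outer a b)\<^sup>2"
        using power_mono[OF a'(2), of 2] c(1) by (simp add: power_mult_distrib)
      then have "(norm (outer a b - outer a' b))\<^sup>2 \<le> (L \<bullet> outer a b)\<^sup>2 / c\<^sup>2"
        using c(1) by (simp add: field_simps)
      then have 4: "l * (1 - l) * (norm (outer a b - outer a' b))\<^sup>2
          \<le> l * (1 - l) * ((L \<bullet> outer a b)\<^sup>2 / c\<^sup>2)"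
        using l by (intro mult_left_mono) auto
      have aux: "e - 2 * N + K \<le> x - 2 * (N + n) + (K + 2 * q)"
        if "e \<le> x" "n \<le> q" for e x n q N K :: real
        using that by (simp add: algebra_simps)
      have gen: "(l * e1 + (1 - l) * e2) - 2 * (l * n1 + (1 - l) * n2) + m * (l * q1 + (1 - l) * q2)
        = l * (e1 - 2 * n1 + m * q1) + (1 - l) * (e2 - 2 * n2 + m * q2)"
        for e1 e2 n1 n2 m q1 q2 :: real
        by (simp add: algebra_simps)
      have 5: "2 / c\<^sup>2 * ((L \<bullet> ?\<eta> - t)\<^sup>2 + l * (1 - l) * (L \<bullet> outer a b)\<^sup>2)
        = 2 / c\<^sup>2 * (L \<bullet> ?\<eta> - t)\<^sup>2 + 2 * (l * (1 - l) * ((L \<bullet> outer a b)\<^sup>2 / c\<^sup>2))"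
        by (simp only: distrib_left) simp
      have "P ?\<eta> \<zeta> + 2 / c\<^sup>2 * (L \<bullet> ?\<eta> - t)\<^sup>2
         \<le> (l * env C \<zeta>1 + (1 - l) * env C \<zeta>2)
           - 2 * (l * (norm (\<xi>1 - \<zeta>1))\<^sup>2 + (1 - l) * (norm (\<xi>2 - \<zeta>2))\<^sup>2)
           + 2 / c\<^sup>2 * (l * s1\<^sup>2 + (1 - l) * s2\<^sup>2)"
        unfolding 2 3 5 P_def by (rule aux[OF 1 4])
      also have "\<dots> = l * (P \<xi>1 \<zeta>1 + 2 / c\<^sup>2 * (L \<bullet> \<xi>1 - t)\<^sup>2)
           + (1 - l) * (P \<xi>2 \<zeta>2 + 2 / c\<^sup>2 * (L \<bullet> \<xi>2 - t)\<^sup>2)"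
        unfolding P_def s1_def s2_def by (rule gen)
      also have "\<dots> \<le> l * F \<xi>1 + (1 - l) * F \<xi>2"
        using l F_ge S12 by (intro add_mono mult_left_mono) auto
      finally show ?thesis by simp
    qed
    then have "(SUP \<zeta>\<in>S. P ?\<eta> \<zeta>) \<le> l * F \<xi>1 + (1 - l) * F \<xi>2 - 2 / c\<^sup>2 * (L \<bullet> ?\<eta> - t)\<^sup>2"
      by (intro cSUP_least[OF ne])
    then show "F ?\<eta> \<le> l * F \<xi>1 + (1 - l) * F \<xi>2"
      by (simp add: F_def)
  qed
  then have "ereal (F \<xi>) \<le> (SUP \<eta>\<in>C. ereal (F \<eta>))"
    using \<xi> by (auto simp: rc_hull_compact_def)
  also have "\<dots> \<le> 0"
  proof (rule SUP_least)
    fix \<eta> assume \<eta>: "\<eta> \<in> C"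
    then have "infdist \<eta> C = 0" by simp
    then have "(SUP \<zeta>\<in>S. P \<eta> \<zeta>) \<le> 0"
      using P_le[of _ \<eta>] by (intro cSUP_least[OF ne]) auto
    moreover have "L \<bullet> \<eta> = t" using \<eta> C(3) by (auto simp: Sigma_t_iff)
    ultimately show "ereal (F \<eta>) \<le> 0" by (simp add: F_def)
  qed
  finally have "F \<xi> \<le> 0" by simp
  moreover have "env C \<xi> \<le> F \<xi>"
    using F_ge[OF \<xi>(1), of \<xi>] \<xi>(1) by (simp add: P_def Sigma_t_iff)
  ultimately show ?thesis by simp
qed

text \<open>Nonemptiness of \<open>C\<close> matters: \<open>infdist\<close> to the empty set is 0,
  so the envelope of the empty set would be at most 0 everywhere on \<open>S\<close>.\<close>

definition lhull :: "(real^'n^'m) set \<Rightarrow> (real^'n^'m) set" where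
  "lhull U = {\<xi>\<in>S. \<exists>C. compact C \<and> C \<noteq> {} \<and> C \<subseteq> U \<and> env C \<xi> \<le> 0}"

lemma hull_subset_S: "lhull U \<subseteq> S"
  by (auto simp: lhull_def)

lemma rc_hull_subset_hull:
  assumes "U \<subseteq> S"
  shows "rc_hull U \<inter> S \<subseteq> lhull U"
proof
  fix \<xi> assume "\<xi> \<in> rc_hull U \<inter> S"
  then obtain C where C: "C \<subseteq> U" "compact C" "\<xi> \<in> rc_hull_compact C" "\<xi> \<in> S"
    by (auto simp: rc_hull_def)
  \<comment> \<open>For empty \<open>C\<close> the supremum would be \<open>-\<infinity>\<close>,
    which the constant function 0 exceeds.\<close>
  have "rank_one_convex (\<lambda>_. 0)" by (simp add: rank_one_convex_def)
  then have "C \<noteq> {}"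
    using C(3) by (auto simp: rc_hull_compact_def bot_ereal_def dest!: spec[of _ "\<lambda>_. 0"])
  then show "\<xi> \<in> lhull U"
    using C env_rc_hull_compact[of C \<xi>] assms by (auto simp: lhull_def)
qed

lemma subset_hull: assumes "U \<subseteq> S" shows "U \<subseteq> lhull U"
proof
  fix \<xi> assume "\<xi> \<in> U"
  then show "\<xi> \<in> lhull U"
    using assms env_le[of \<xi> "{\<xi>}"] by (auto simp: lhull_def intro!: exI[of _ "{\<xi>}"])
qed

lemma hull_bounded:
  assumes "U \<subseteq> cball 0 R" "\<xi> \<in> lhull U"
  shows "(norm \<xi>)\<^sup>2 \<le> 2 * R\<^sup>2"
proof -
  obtain C where C: "compact C" "C \<noteq> {}" "C \<subseteq> U" "env C \<xi> \<le> 0" "\<xi> \<in> S"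
    using assms(2) by (auto simp: lhull_def)
  then show ?thesis using env_growth[of \<xi> C R] subset_trans[OF C(3) assms(1)] by simp
qed

text \<open>Makes openness quantitative on compact sets. Small errors can be absorbed in this way as
  long as the perturbed matrix lies exactly in \<open>S\<close>, which is why perturbations are
  required to be exactly tangent.\<close>

lemma openin_margin:
  assumes "openin (top_of_set S) U" "compact C" "C \<subseteq> U"
  obtains r where "r > 0" "\<And>\<xi> \<eta>. \<xi> \<in> C \<Longrightarrow> \<eta> \<in> S \<Longrightarrow> dist \<xi> \<eta> < r \<Longrightarrow> \<eta> \<in> U"
proof -
  obtain T where T: "open T" "U = S \<inter> T" using assms(1) by (auto simp: openin_open)
  obtain r where r: "r > 0" "(\<Union>x\<in>C. ball x r) \<subseteq> T"
    using compact_subset_open_imp_ball_epsilon_subset[of C T] assms T by auto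
  show ?thesis by (rule that[OF r(1)]) (use r T in \<open>auto simp: subset_iff\<close>)
qed

text \<open>Translating \<open>C\<close> by \<open>\<eta> - \<xi>\<close> stays inside
  \<open>U\<close> and carries the envelope along. The radius depends only on \<open>C\<close> and
  \<open>U\<close>, so it serves all points with \<open>env C \<xi> \<le> 0\<close> at once.\<close>

lemma hull_ball:
  assumes U: "openin (top_of_set S) U" and C: "compact C" "C \<noteq> {}" "C \<subseteq> U"
  obtains r where "r > 0" "\<And>\<xi> \<eta>. \<xi> \<in> S \<Longrightarrow> env C \<xi> \<le> 0 \<Longrightarrow> \<eta> \<in> S \<Longrightarrow> dist \<xi> \<eta> < r \<Longrightarrow> \<eta> \<in> lhull U"
    "\<And>\<eta>. \<eta> \<in> S \<Longrightarrow> infdist \<eta> C < r \<Longrightarrow> \<eta> \<in> U"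
proof -
  obtain r where r: "r > 0" "\<And>\<xi> \<eta>. \<xi> \<in> C \<Longrightarrow> \<eta> \<in> S \<Longrightarrow> dist \<xi> \<eta> < r \<Longrightarrow> \<eta> \<in> U"
    using openin_margin[OF U C(1,3)] by blast
  have US: "U \<subseteq> S" using U openin_imp_subset by blast
  show ?thesis
  proof (rule that[OF r(1)])
    fix \<xi> \<eta> assume A: "\<xi> \<in> S" "env C \<xi> \<le> 0" "\<eta> \<in> S" "dist \<xi> \<eta> < r"
    define \<zeta> where "\<zeta> = \<eta> - \<xi>"
    have \<zeta>: "L \<bullet> \<zeta> = 0" using A by (simp add: \<zeta>_def inner_diff_right Sigma_t_iff)
    let ?D = "(\<lambda>\<eta>. \<eta> + \<zeta>) ` C"
    have "compact ?D" using C(1) by (intro compact_continuous_image continuous_intros)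
    moreover have "?D \<subseteq> U"
    proof
      fix x assume "x \<in> ?D"
      then obtain c where c: "c \<in> C" "x = c + \<zeta>" by auto
      moreover have "x \<in> S" using c C(3) US \<zeta> by (auto simp: Sigma_t_iff inner_add_right)
      moreover have "dist c x < r" using A(4) c by (simp add: dist_norm \<zeta>_def norm_minus_commute)
      ultimately show "x \<in> U" using r(2) by blast
    qed
    moreover have "env ?D (\<xi> + \<zeta>) \<le> 0"
      using env_translate_le[OF A(1) \<zeta> C(1,2)] A(2) by simp
    ultimately show "\<eta> \<in> lhull U"
      using A(3) C(2) by (auto simp: lhull_def \<zeta>_def intro!: exI[of _ ?D])
  next
    fix \<eta> assume "\<eta> \<in> S" "infdist \<eta> C < r"
    moreover obtain c where "c \<in> C" "infdist \<eta> C = dist \<eta> c"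
      using infdist_attains_inf[of C \<eta>] C compact_imp_closed by blast
    ultimately show "\<eta> \<in> U" using r(2)[of c \<eta>] by (simp add: dist_commute)
  qed
qed

lemma openin_hull:
  assumes U: "openin (top_of_set S) U"
  shows "openin (top_of_set S) (lhull U)"
  unfolding openin_euclidean_subtopology_iff
proof (intro conjI ballI)
  fix \<xi> assume \<xi>: "\<xi> \<in> lhull U"
  then obtain C where C: "compact C" "C \<noteq> {}" "C \<subseteq> U" "env C \<xi> \<le> 0" "\<xi> \<in> S"
    by (auto simp: lhull_def)
  obtain r where r: "r > 0" "\<And>\<xi> \<eta>. \<xi> \<in> S \<Longrightarrow> env C \<xi> \<le> 0 \<Longrightarrow> \<eta> \<in> S \<Longrightarrow> dist \<xi> \<eta> < r \<Longrightarrow> \<eta> \<in> lhull U"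
    "\<And>\<eta>. \<eta> \<in> S \<Longrightarrow> infdist \<eta> C < r \<Longrightarrow> \<eta> \<in> U"
    using hull_ball[OF U C(1,2,3)] by blast
  show "\<exists>e>0. \<forall>x'\<in>S. dist x' \<xi> < e \<longrightarrow> x' \<in> lhull U"
    using r(2)[OF C(5,4)] r(1) by (metis dist_commute)
qed (use hull_subset_S in auto)

text \<open>Compactness: points of \<open>S\<close> outside the hull with envelope tending to 0 are
  bounded by \<open>env_growth\<close> and accumulate at a point where the envelope is at most 0 by
  \<open>env_shift_le\<close>; a whole ball about that point lies in the hull. The constant is also
  kept below the squared distance of \<open>C\<close> to the part of \<open>S\<close> outside
  \<open>U\<close>.\<close>

lemma env_sublevel_subset_hull:
  assumes U: "openin (top_of_set S) U" and C: "compact C" "C \<noteq> {}" "C \<subseteq> U"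
  obtains c where "c > 0" "\<And>\<xi>. \<xi> \<in> S \<Longrightarrow> env C \<xi> < c \<Longrightarrow> \<xi> \<in> lhull U"
    "\<And>\<xi>. \<xi> \<in> S \<Longrightarrow> \<xi> \<notin> U \<Longrightarrow> c \<le> (infdist \<xi> C)\<^sup>2"
proof -
  obtain r where r: "r > 0"
    "\<And>\<xi> \<eta>. \<xi> \<in> S \<Longrightarrow> env C \<xi> \<le> 0 \<Longrightarrow> \<eta> \<in> S \<Longrightarrow> dist \<xi> \<eta> < r \<Longrightarrow> \<eta> \<in> lhull U"
    "\<And>\<eta>. \<eta> \<in> S \<Longrightarrow> infdist \<eta> C < r \<Longrightarrow> \<eta> \<in> U"
    using hull_ball[OF U C] by blast
  obtain R where R: "C \<subseteq> cball 0 R"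
    using compact_imp_bounded[OF C(1)] by (auto simp: bounded_iff subset_iff)
  have "\<exists>c>0. \<forall>\<xi>\<in>S. env C \<xi> < c \<longrightarrow> \<xi> \<in> lhull U"
  proof (rule ccontr)
    assume neg: "\<not> ?thesis"
    have "\<exists>\<xi>. \<xi> \<in> S \<and> env C \<xi> < inverse (Suc k) \<and> \<xi> \<notin> lhull U" for k :: nat
    proof -
      have "inverse (real (Suc k)) > 0" by simp
      with neg show ?thesis by blast
    qed
    then obtain X where X: "\<And>k. X k \<in> S" "\<And>k::nat. env C (X k) < inverse (Suc k)" "\<And>k. X k \<notin> lhull U"
      by metis
    have "(norm (X k))\<^sup>2 \<le> 2 * R\<^sup>2 + 2" for k
    proof -
      have "(norm (X k))\<^sup>2 / 2 - R\<^sup>2 \<le> env C (X k)"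
        by (rule env_growth[OF X(1) C(1,2) R])
      also have "\<dots> \<le> 1" using less_imp_le[OF X(2)[of k]] le_imp_inverse_le[of 1 "real (Suc k)"] by simp
      finally show ?thesis by simp
    qed
    then have "norm (X k) \<le> sqrt (2 * R\<^sup>2 + 2)" for k
      by (rule real_le_rsqrt)
    then have "bounded (range X)" unfolding bounded_iff by blast
    then obtain \<xi> s where s: "strict_mono s" "(X \<circ> s) \<longlonglongrightarrow> \<xi>"
      using bounded_imp_convergent_subsequence by blast
    have \<xi>S: "\<xi> \<in> S"
      using closed_sequentially[OF closed_S, of "X \<circ> s" \<xi>] X(1) s(2) by auto
    have l1: "(\<lambda>k. inverse (real (Suc (s k)))) \<longlonglongrightarrow> 0"
      using LIMSEQ_subseq_LIMSEQ[OF LIMSEQ_inverse_real_of_nat s(1)] by (simp add: o_def)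
    have l2: "(\<lambda>k. X (s k)) \<longlonglongrightarrow> \<xi>"
      using s(2) by (simp add: o_def)
    have lim: "(\<lambda>k. 2 * inverse (real (Suc (s k))) + 2 * (norm (\<xi> - X (s k)))\<^sup>2) \<longlonglongrightarrow> 2 * 0 + 2 * (norm (\<xi> - \<xi>))\<^sup>2"
      by (intro tendsto_intros l1 l2)
    have "env C \<xi> \<le> 2 * inverse (real (Suc (s k))) + 2 * (norm (\<xi> - X (s k)))\<^sup>2" for k
    proof -
      have "L \<bullet> (\<xi> - X (s k)) = 0"
        using X(1)[of "s k"] \<xi>S by (simp add: Sigma_t_iff inner_diff_right)
      from env_shift_le[OF X(1)[of "s k"] this, of C]
      have "env C \<xi> \<le> 2 * env C (X (s k)) + 2 * (norm (\<xi> - X (s k)))\<^sup>2"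
        by (simp only: add.commute[of "X (s k)"] diff_add_cancel)
      with less_imp_le[OF X(2)[of "s k"]] show ?thesis by linarith
    qed
    then have "env C \<xi> \<le> 2 * 0 + 2 * (norm (\<xi> - \<xi>))\<^sup>2"
      by (intro LIMSEQ_le_const[OF lim]) blast
    then have "env C \<xi> \<le> 0" by simp
    obtain k where "dist (X (s k)) \<xi> < r"
      using metric_LIMSEQ_D[OF l2 r(1)] by blast
    then have "dist \<xi> (X (s k)) < r"
      by (simp only: dist_commute)
    then have "X (s k) \<in> lhull U"
      by (rule r(2)[OF \<xi>S \<open>env C \<xi> \<le> 0\<close> X(1)])
    then show False using X(3) by blast
  qed
  then obtain c where c: "c > 0" "\<And>\<xi>. \<xi> \<in> S \<Longrightarrow> env C \<xi> < c \<Longrightarrow> \<xi> \<in> lhull U" by blast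
  show ?thesis
  proof (rule that[of "min c (r\<^sup>2)"])
    show "min c (r\<^sup>2) \<le> (infdist \<xi> C)\<^sup>2" if "\<xi> \<in> S" "\<xi> \<notin> U" for \<xi>
    proof -
      have "r \<le> infdist \<xi> C" 
      proof (rule ccontr)
        assume "\<not> r \<le> infdist \<xi> C"
        then have "infdist \<xi> C < r" by (simp only: not_le)
        from r(3)[OF that(1) this] that(2) show False by contradiction
      qed
      then have "r\<^sup>2 \<le> (infdist \<xi> C)\<^sup>2" 
        by (rule power_mono) (rule less_imp_le[OF r(1)])
      then show ?thesis by (rule min.coboundedI2)
    qed
    show "\<xi> \<in> lhull U" if "\<xi> \<in> S" "env C \<xi> < min c (r\<^sup>2)" for \<xi>
      by (rule c(2)[OF that(1)]) (use that(2) in \<open>simp only: min_less_iff_conj\<close>)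
    show "0 < min c (r\<^sup>2)"
      by (simp only: min_less_iff_conj c(1) zero_less_power[OF r(1)])
  qed
qed



text \<open>The whole line lies in \<open>S\<close>, so convexity holds on all of \<real> and brings
  continuity with it; the exit point from a sublevel set is then found by the intermediate value
  theorem.\<close>

lemma convex_on_env_line:
  assumes "\<xi>1 \<in> S" "\<xi>2 \<in> S" "\<xi>1 - \<xi>2 = outer a b"
  shows "convex_on UNIV (\<lambda>s. env C (s *\<^sub>R \<xi>1 + (1 - s) *\<^sub>R \<xi>2))"
proof (rule convex_onI)
  fix u x y :: real assume u: "0 < u" "u < 1"
  let ?p = "\<lambda>s. s *\<^sub>R \<xi>1 + (1 - s) *\<^sub>R \<xi>2"
  have "?p y - ?p x = (y - x) *\<^sub>R (\<xi>1 - \<xi>2)" by (simp add: algebra_simps)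
  then have "?p y - ?p x = outer ((y - x) *\<^sub>R a) b" by (simp add: assms outer_simps)
  then have "env C (u *\<^sub>R ?p y + (1 - u) *\<^sub>R ?p x) \<le> u * env C (?p y) + (1 - u) * env C (?p x)"
    using u assms S_convex by (intro lam_convexD[OF env_lam_convex]) auto
  moreover have "u *\<^sub>R ?p y + (1 - u) *\<^sub>R ?p x = ?p ((1 - u) *\<^sub>R x + u *\<^sub>R y)"
    by (simp add: algebra_simps)
  ultimately show "env C (?p ((1 - u) *\<^sub>R x + u *\<^sub>R y)) \<le> (1 - u) * env C (?p x) + u * env C (?p y)"
    by simp
qed auto

text \<open>On the small sublevel set \<open>{env C < c}\<close>, which is convex along rank-one lines, the maximum of
  \<open>env C\<close> and \<open>c f\<close> glues with \<open>env C\<close> outside to a lamination convex minorant of the squared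
  distance, so \<open>c f \<le> env C\<close> there.\<close>

lemma lhull_localization:
  assumes U: "openin (top_of_set S) U"
    and f01: "\<And>\<xi>. \<xi> \<in> lhull U \<Longrightarrow> 0 \<le> f \<xi> \<and> f \<xi> \<le> 1"
    and f0: "\<And>\<xi>. \<xi> \<in> U \<Longrightarrow> f \<xi> = 0"
    and conv: "\<And>\<xi> \<eta> a b l. (\<And>s. 0 \<le> s \<Longrightarrow> s \<le> 1 \<Longrightarrow> s *\<^sub>R \<xi> + (1 - s) *\<^sub>R \<eta> \<in> lhull U) \<Longrightarrow>
       \<xi> - \<eta> = outer a b \<Longrightarrow> 0 \<le> l \<Longrightarrow> l \<le> 1 \<Longrightarrow>
       f (l *\<^sub>R \<xi> + (1 - l) *\<^sub>R \<eta>) \<le> l * f \<xi> + (1 - l) * f \<eta>"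
    and \<xi>0: "\<xi>0 \<in> lhull U"
  shows "f \<xi>0 = (0::real)"
proof -
  obtain C where C: "compact C" "C \<noteq> {}" "C \<subseteq> U" "env C \<xi>0 \<le> 0" "\<xi>0 \<in> S"
    using \<xi>0 by (auto simp: lhull_def)
  obtain c where c: "c > 0" "\<And>\<xi>. \<xi> \<in> S \<Longrightarrow> env C \<xi> < c \<Longrightarrow> \<xi> \<in> lhull U"
    "\<And>\<xi>. \<xi> \<in> S \<Longrightarrow> \<xi> \<notin> U \<Longrightarrow> c \<le> (infdist \<xi> C)\<^sup>2"
    using env_sublevel_subset_hull[OF U C(1-3)] by blast
  define H where "H \<xi> = (if env C \<xi> < c then max (env C \<xi>) (c * f \<xi>) else env C \<xi>)" for \<xi>
  have H_ge: "env C \<xi> \<le> H \<xi>" for \<xi> by (simp add: H_def)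
  \<comment> \<open>The mixed case: \<open>\<xi>2\<close> and the intermediate point lie in the
    sublevel set, \<open>\<xi>1\<close> does not. Convexity of \<open>f\<close> is used up to the
    exit point \<open>s1\<close>, where the bound \<open>f \<le> 1\<close> meets the value
    \<open>c\<close> of the envelope; from there on convexity of the envelope takes over.\<close>
  have cross: "c * f (l *\<^sub>R \<xi>1 + (1 - l) *\<^sub>R \<xi>2) \<le> l * H \<xi>1 + (1 - l) * H \<xi>2"
    if A: "\<xi>1 \<in> S" "\<xi>2 \<in> S" "\<xi>1 - \<xi>2 = outer a b" "0 \<le> l" "l \<le> 1"
      "env C (l *\<^sub>R \<xi>1 + (1 - l) *\<^sub>R \<xi>2) < c" "env C \<xi>2 < c" "\<not> env C \<xi>1 < c" for \<xi>1 \<xi>2 a b l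
  proof -
    let ?p = "\<lambda>s. s *\<^sub>R \<xi>1 + (1 - s) *\<^sub>R \<xi>2"
    define k where "k s = env C (?p s)" for s
    have kc: "convex_on UNIV k"
      unfolding k_def by (rule convex_on_env_line[OF A(1-3)])
    then have "continuous_on {l..1} k"
      using convex_on_continuous[of UNIV k] continuous_on_subset by blast
    then obtain s1 where s1: "l \<le> s1" "s1 \<le> 1" "k s1 = c"
      using IVT'[of k l c 1] A by (auto simp: k_def)
    have ls1: "l < s1" using s1 A(6) by (cases "l = s1") (auto simp: k_def)
    have below: "k s < c" if "0 \<le> s" "s < s1" for s
    proof (cases "s \<le> l")
      case True
      show ?thesis
      proof (cases "l = 0")
        case True then show ?thesis using \<open>s \<le> l\<close> that A(6) by (simp add: k_def)
      next
        case False
        have "k ((1 - s / l) *\<^sub>R 0 + (s / l) *\<^sub>R l) \<le> (1 - s / l) * k 0 + s / l * k l"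
          using True False that A by (intro convex_onD[OF kc]) (auto simp: field_simps)
        also have "\<dots> \<le> (1 - s / l) * max (k 0) (k l) + s / l * max (k 0) (k l)"
          using True False that A by (intro add_mono mult_left_mono) (auto simp: field_simps)
        also have "\<dots> = max (k 0) (k l)" by (simp add: algebra_simps)
        also have "\<dots> < c" using A by (simp add: k_def)
        finally show ?thesis using False by simp
      qed
    next
      case False
      define u where "u = (s - l) / (s1 - l)"
      have u: "0 < u" "u < 1" using False that ls1 by (auto simp: u_def field_simps)
      have "k ((1 - u) *\<^sub>R l + u *\<^sub>R s1) \<le> (1 - u) * k l + u * k s1"
        using u by (intro convex_onD[OF kc]) auto
      also have "(1 - u) * k l + u * k s1 < (1 - u) * c + u * c"
        using u A(6) s1 by (intro add_less_le_mono mult_strict_left_mono) (auto simp: k_def)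
      also have "(1 - u) *\<^sub>R l + u *\<^sub>R s1 = l + u * (s1 - l)" by (simp add: algebra_simps)
      also have "\<dots> = s" using ls1 by (simp add: u_def)
      finally show ?thesis by (simp add: algebra_simps)
    qed
    \<comment> \<open>Only points strictly before \<open>s1\<close> are known to lie in the hull, so
      the inequality is proved for \<open>s < s1\<close> and then passed to the limit from the
      left.\<close>
    have ineq: "c * f (?p l) * s \<le> l * c + (s - l) * H \<xi>2" if s: "l < s" "s < s1" for s
    proof -
      have pos: "0 < s" using s A by simp
      have diff: "?p s - \<xi>2 = outer (s *\<^sub>R a) b"
        using A(3) by (simp add: outer_simps flip: A(3)) (simp add: algebra_simps)
      have comb: "r *\<^sub>R ?p s + (1 - r) *\<^sub>R \<xi>2 = ?p (r * s)" for r
        by (simp add: algebra_simps)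
      have "f ((l / s) *\<^sub>R ?p s + (1 - l / s) *\<^sub>R \<xi>2) \<le> l / s * f (?p s) + (1 - l / s) * f \<xi>2"
      proof (rule conv[OF _ diff])
        fix r :: real assume r: "0 \<le> r" "r \<le> 1"
        have "0 \<le> r * s" "r * s < s1"
          using r pos s mult_right_mono[of r 1 s] by (simp, linarith)
        then show "r *\<^sub>R ?p s + (1 - r) *\<^sub>R \<xi>2 \<in> lhull U"
          unfolding comb using below A S_convex by (intro c(2)) (auto simp: k_def)
      qed (use s pos A in auto)
      also have "\<dots> \<le> l / s * 1 + (1 - l / s) * f \<xi>2"
        using f01[OF c(2)[of "?p s"]] below[of s] s pos A S_convex
        by (intro add_right_mono mult_left_mono) (auto simp: k_def)
      finally have "f (?p l) \<le> l / s + (1 - l / s) * f \<xi>2" using pos by (simp add: comb)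
      then have "c * s * f (?p l) \<le> c * s * (l / s + (1 - l / s) * f \<xi>2)"
        using c pos by (intro mult_left_mono) auto
      also have "\<dots> = l * c + (s - l) * (c * f \<xi>2)" using pos by (simp add: field_simps)
      also have "\<dots> \<le> l * c + (s - l) * H \<xi>2"
        using s A by (intro add_left_mono mult_left_mono) (auto simp: H_def)
      finally show ?thesis by (simp add: algebra_simps)
    qed
    have "((\<lambda>s. l * c + (s - l) * H \<xi>2 - c * f (?p l) * s) \<longlongrightarrow> l * c + (s1 - l) * H \<xi>2 - c * f (?p l) * s1) (at_left s1)"
      by (intro tendsto_intros)
    moreover have "\<forall>\<^sub>F s in at_left s1. 0 \<le> l * c + (s - l) * H \<xi>2 - c * f (?p l) * s"
      unfolding eventually_at_left_field using ineq ls1 by (intro exI[of _ l]) auto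
    ultimately have "0 \<le> l * c + (s1 - l) * H \<xi>2 - c * f (?p l) * s1"
      by (intro tendsto_lowerbound) auto
    moreover have "c \<le> s1 * env C \<xi>1 + (1 - s1) * env C \<xi>2"
      using lam_convexD[OF env_lam_convex A(1-3), of s1 C] s1 A(4) by (auto simp: k_def)
    then have "c \<le> s1 * H \<xi>1 + (1 - s1) * H \<xi>2"
      using H_ge s1 A(4) by (smt (verit) mult_left_mono)
    then have "l * c \<le> l * (s1 * H \<xi>1 + (1 - s1) * H \<xi>2)"
      using A by (intro mult_left_mono) auto
    ultimately have "s1 * (c * f (?p l)) \<le> s1 * (l * H \<xi>1 + (1 - l) * H \<xi>2)"
      by (simp add: algebra_simps)
    then show ?thesis using ls1 A(4) by simp
  qed
  have "lam_convex H"
    unfolding lam_convex_def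
  proof (intro ballI allI impI)
    fix \<xi>1 \<xi>2 a b and l :: real
    assume A: "\<xi>1 \<in> S" "\<xi>2 \<in> S" "\<xi>1 - \<xi>2 = outer a b" "l \<in> {0..1}"
    let ?p = "l *\<^sub>R \<xi>1 + (1 - l) *\<^sub>R \<xi>2"
    have e: "env C ?p \<le> l * env C \<xi>1 + (1 - l) * env C \<xi>2"
      using lam_convexD[OF env_lam_convex A(1-3), of l] A(4) by auto
    also have e': "\<dots> \<le> l * H \<xi>1 + (1 - l) * H \<xi>2"
      using H_ge A(4) by (intro add_mono mult_left_mono) auto
    finally have e'': "env C ?p \<le> l * H \<xi>1 + (1 - l) * H \<xi>2" .
    have "c * f ?p \<le> l * H \<xi>1 + (1 - l) * H \<xi>2" if p: "env C ?p < c"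
    proof -
      consider "env C \<xi>1 < c" "env C \<xi>2 < c" | "\<not> env C \<xi>1 < c" "env C \<xi>2 < c"
        | "env C \<xi>1 < c" "\<not> env C \<xi>2 < c" | "\<not> env C \<xi>1 < c" "\<not> env C \<xi>2 < c" by blast
      then show ?thesis
      proof cases
        case 1
        have "f ?p \<le> l * f \<xi>1 + (1 - l) * f \<xi>2"
        proof (rule conv[OF _ A(3)])
          fix s :: real assume s: "0 \<le> s" "s \<le> 1"
          have "env C (s *\<^sub>R \<xi>1 + (1 - s) *\<^sub>R \<xi>2) \<le> s * env C \<xi>1 + (1 - s) * env C \<xi>2"
            using lam_convexD[OF env_lam_convex A(1-3) s] .
          also have "\<dots> < c"
            using 1 s convex_bound_lt[of "env C \<xi>1" c "env C \<xi>2" s "1 - s"] by simp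
          finally show "s *\<^sub>R \<xi>1 + (1 - s) *\<^sub>R \<xi>2 \<in> lhull U"
            using A S_convex c(2) by blast
        qed (use A in auto)
        then have "c * f ?p \<le> c * (l * f \<xi>1 + (1 - l) * f \<xi>2)" using c by simp
        also have "\<dots> = l * (c * f \<xi>1) + (1 - l) * (c * f \<xi>2)" by (simp add: algebra_simps)
        also have "\<dots> \<le> l * H \<xi>1 + (1 - l) * H \<xi>2"
          using 1 A(4) by (intro add_mono mult_left_mono) (auto simp: H_def)
        finally show ?thesis .
      next
        case 2
        then show ?thesis using cross[OF A(1-3) _ _ p] A(4) by auto
      next
        case 3
        have "\<xi>2 - \<xi>1 = - outer a b" by (simp flip: A(3))
        then have d: "\<xi>2 - \<xi>1 = outer (- 1 *\<^sub>R a) b" by (simp only: outer_simps) simp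
        show ?thesis using cross[OF A(2,1) d, of "1 - l"] A(4) 3 p by (auto simp: add.commute)
      next
        case 4
        have "f ?p \<le> 1" using f01 c(2) S_convex A p by blast
        then have "c * f ?p \<le> c" using c by simp
        also have "c = l * c + (1 - l) * c" by (simp add: algebra_simps)
        also have "\<dots> \<le> l * env C \<xi>1 + (1 - l) * env C \<xi>2"
          using 4 A(4) by (intro add_mono mult_left_mono) auto
        finally show ?thesis using e' by simp
      qed
    qed
    then show "H ?p \<le> l * H \<xi>1 + (1 - l) * H \<xi>2"
      using e'' by (auto simp: H_def)
  qed
  moreover have "H \<eta> \<le> (infdist \<eta> C)\<^sup>2" if "\<eta> \<in> S" for \<eta>
  proof -
    \<comment> \<open>On \<open>U\<close> the function \<open>f\<close> vanishes; off
      \<open>U\<close> the bound \<open>f \<le> 1\<close> suffices because \<open>c\<close> is below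
      the squared distance.\<close>
    have "c * f \<eta> \<le> (infdist \<eta> C)\<^sup>2" if "env C \<eta> < c"
    proof (cases "\<eta> \<in> U")
      case False
      have "c * f \<eta> \<le> c" using f01[OF c(2)[OF \<open>\<eta> \<in> S\<close> that]] c by simp
      then show ?thesis using c(3)[OF \<open>\<eta> \<in> S\<close> False] by simp
    qed (simp add: f0)
    then show ?thesis using env_le[OF that] by (auto simp: H_def)
  qed
  ultimately have "H \<in> minorants C" by (simp add: minorants_def)
  from env_ge[OF this C(5)] have "H \<xi>0 \<le> 0" using C(4) by simp
  then have "c * f \<xi>0 \<le> 0" using C(4) c(1) by (auto simp: H_def split: if_splits)
  then show ?thesis using f01[OF \<xi>0] c(1) by (simp add: mult_le_0_iff)
qed

end

section \<open>Smooth functions\<close>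

lemma C_k_SucI:
  assumes "\<And>x. (f has_derivative f' x) (at x)" "\<And>j. C_k k (\<lambda>x. f' x (axis j 1))"
  shows "C_k (Suc k) f"
proof -
  have "frechet_derivative f (at x) = f' x" for x
    using assms(1) frechet_derivative_at by metis
  with assms show ?thesis by (auto simp: differentiable_def)
qed

lemma C_k_has_derivative:
  assumes "C_k (Suc k) f"
  shows "(f has_derivative frechet_derivative f (at x)) (at x)"
  using assms by (simp flip: frechet_derivative_works)

lemma C_k_Suc_imp: "C_k (Suc k) f \<Longrightarrow> C_k k f"
proof (induction k arbitrary: f)
  case 0
  then show ?case
    by (auto intro!: differentiable_imp_continuous_on simp: differentiable_on_def)
next
  case (Suc k)
  then show ?case by (metis C_k.simps(2))
qed

lemma C_k_const: "C_k k (\<lambda>x. c)"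
  by (induction k arbitrary: c) (auto intro: C_k_SucI[of _ "\<lambda>_ _. 0"] simp del: C_k.simps(2))

lemma C_k_add: "C_k k f \<Longrightarrow> C_k k g \<Longrightarrow> C_k k (\<lambda>x. f x + g x)"
proof (induction k arbitrary: f g)
  case (Suc k)
  show ?case
  proof (rule C_k_SucI)
    show "((\<lambda>x. f x + g x) has_derivative
      (\<lambda>h. frechet_derivative f (at x) h + frechet_derivative g (at x) h)) (at x)" for x
      by (intro has_derivative_add C_k_has_derivative[OF Suc.prems(1)] C_k_has_derivative[OF Suc.prems(2)])
    show "C_k k (\<lambda>x. frechet_derivative f (at x) (axis j 1) + frechet_derivative g (at x) (axis j 1))" for j
      using Suc by auto
  qed
qed (simp add: continuous_on_add)

lemma C_k_bounded_linear:
  assumes T: "bounded_linear T"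
  shows "C_k k f \<Longrightarrow> C_k k (\<lambda>x. T (f x))"
proof (induction k arbitrary: f)
  case 0
  then show ?case using bounded_linear.continuous_on[OF T] by auto
next
  case (Suc k)
  show ?case
  proof (rule C_k_SucI)
    show "((\<lambda>x. T (f x)) has_derivative (\<lambda>h. T (frechet_derivative f (at x) h))) (at x)" for x
      by (intro bounded_linear.has_derivative[OF T] C_k_has_derivative[OF Suc.prems(1)])
    show "C_k k (\<lambda>x. T (frechet_derivative f (at x) (axis j 1)))" for j
      using Suc by auto
  qed
qed

lemma C_k_linear:
  assumes T: "bounded_linear T"
  shows "C_k k T"
proof (cases k)
  case 0
  then show ?thesis using linear_continuous_on[OF T] by simp
next
  case (Suc k')
  show ?thesis unfolding Suc
    by (rule C_k_SucI[where f'="\<lambda>_. T"]) (auto intro: bounded_linear_imp_has_derivative[OF T] C_k_const)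
qed

lemma C_k_scaleR: "C_k k f \<Longrightarrow> C_k k g \<Longrightarrow> C_k k (\<lambda>x. f x *\<^sub>R g x)"
proof (induction k arbitrary: f g)
  case (Suc k)
  show ?case
  proof (rule C_k_SucI)
    show "((\<lambda>x. f x *\<^sub>R g x) has_derivative
      (\<lambda>h. f x *\<^sub>R frechet_derivative g (at x) h + frechet_derivative f (at x) h *\<^sub>R g x)) (at x)" for x
      by (intro has_derivative_scaleR C_k_has_derivative[OF Suc.prems(1)] C_k_has_derivative[OF Suc.prems(2)])
    show "C_k k (\<lambda>x. f x *\<^sub>R frechet_derivative g (at x) (axis j 1)
        + frechet_derivative f (at x) (axis j 1) *\<^sub>R g x)" for j
      using Suc by (intro C_k_add Suc.IH) (auto intro: C_k_Suc_imp simp del: C_k.simps(2) simp: C_k.simps(2)[THEN iffD1])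
  qed
qed (simp add: continuous_on_scaleR)

lemma C_k_mult: "C_k k f \<Longrightarrow> C_k k g \<Longrightarrow> C_k k (\<lambda>x. f x * g x :: real)"
  using C_k_scaleR[of k f g] by simp

lemma C_k_diff: "C_k k f \<Longrightarrow> C_k k g \<Longrightarrow> C_k k (\<lambda>x. f x - g x)"
  using C_k_add[of k f "\<lambda>x. - g x"] C_k_bounded_linear[OF bounded_linear_minus[OF bounded_linear_ident], of k g]
  by simp

lemma C_k_sum: "(\<And>i. i \<in> I \<Longrightarrow> C_k k (f i)) \<Longrightarrow> C_k k (\<lambda>x. \<Sum>i\<in>I. f i x)"
  by (induction I rule: infinite_finite_induct) (auto intro: C_k_const C_k_add)

lemma C_k_prod: "(\<And>i. i \<in> I \<Longrightarrow> C_k k (f i)) \<Longrightarrow> C_k k (\<lambda>x. \<Prod>i\<in>I. f i x :: real)"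
  by (induction I rule: infinite_finite_induct) (auto intro: C_k_const C_k_mult)

lemma C_k_affine: "C_k k f \<Longrightarrow> C_k k (\<lambda>x. f (c *\<^sub>R (x - x0)))"
proof (induction k arbitrary: f)
  case 0
  then show ?case
    by (auto intro!: continuous_intros continuous_on_compose2[of UNIV f])
next
  case (Suc k)
  show ?case
  proof (rule C_k_SucI)
    show "((\<lambda>x. f (c *\<^sub>R (x - x0))) has_derivative
      (\<lambda>h. frechet_derivative f (at (c *\<^sub>R (x - x0))) (c *\<^sub>R h))) (at x)" for x
      by (rule has_derivative_compose[OF _ C_k_has_derivative[OF Suc.prems]]) (auto intro!: derivative_eq_intros)
    have "frechet_derivative f (at (c *\<^sub>R (x - x0))) (c *\<^sub>R h)
      = c *\<^sub>R frechet_derivative f (at (c *\<^sub>R (x - x0))) h" for x h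
      using has_derivative_linear[OF C_k_has_derivative[OF Suc.prems]] by (rule linear_scale)
    then show "C_k k (\<lambda>x. frechet_derivative f (at (c *\<^sub>R (x - x0))) (c *\<^sub>R axis j 1))" for j
      using Suc.prems
      by (auto intro!: C_k_bounded_linear[OF bounded_linear_scaleR_right]
            Suc.IH[of "\<lambda>y. frechet_derivative f (at y) (axis j 1)"])
  qed
qed

text \<open>This is exp(-1/s) s^(-p), extended by zero. The power is carried along because
  differentiation leads from index \<open>p\<close> to \<open>p + 1\<close> and
  \<open>p + 2\<close>; index 0 is the usual flat function.\<close>

definition expinv :: "nat \<Rightarrow> real \<Rightarrow> real" where
  "expinv p s = (if s > 0 then exp (- inverse s) * inverse s ^ p else 0)"

lemma expinv_nonneg: "0 \<le> expinv p s"
  by (simp add: expinv_def)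

lemma expinv_tendsto_0: "(expinv p \<longlongrightarrow> 0) (at_right 0)"
proof -
  have "((\<lambda>s. inverse s ^ p / exp (inverse s)) \<longlongrightarrow> 0) (at_right (0::real))"
    by (rule filterlim_compose[OF tendsto_power_div_exp_0 filterlim_inverse_at_top_right])
  then show ?thesis
    by (rule Lim_transform_eventually)
       (auto simp: expinv_def exp_minus field_simps eventually_at_right_field intro!: exI[of _ 1])
qed

text \<open>At 0 the right difference quotient at index \<open>p\<close> is the function of index
  \<open>p + 1\<close>, which tends to 0; the left one is 0.\<close>

lemma DERIV_expinv: "(expinv p has_real_derivative (expinv (p + 2) s - p * expinv (p + 1) s)) (at s)"
proof -
  consider "s < 0" | "s = 0" | "s > 0" by linarith
  then show ?thesis
  proof cases
    case 1
    have "((\<lambda>_. 0) has_real_derivative 0) (at s)" by simp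
    then have "(expinv p has_real_derivative 0) (at s)"
      by (rule has_field_derivative_transform_within_open[where S="{..<0}"]) (use 1 in \<open>auto simp: expinv_def\<close>)
    then show ?thesis using 1 by (simp add: expinv_def)
  next
    case 2
    have "((\<lambda>h. expinv p h / h) \<longlongrightarrow> 0) (at_right 0)"
      by (rule Lim_transform_eventually[OF expinv_tendsto_0[of "Suc p"]])
         (auto simp: expinv_def field_simps eventually_at_right_field intro!: exI[of _ 1])
    moreover have "((\<lambda>h. expinv p h / h) \<longlongrightarrow> 0) (at_left 0)"
      by (rule Lim_transform_eventually[OF tendsto_const])
         (auto simp: expinv_def eventually_at_left_field intro!: exI[of _ "-1"])
    ultimately have "((\<lambda>h. expinv p h / h) \<longlongrightarrow> 0) (at 0)"
      by (simp add: filterlim_split_at)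
    then show ?thesis using 2 by (simp add: DERIV_def expinv_def)
  next
    case 3
    have "((\<lambda>s. exp (- inverse s) * inverse s ^ p) has_real_derivative
        (expinv (p + 2) s - p * expinv (p + 1) s)) (at s)"
      using 3 by (auto intro!: derivative_eq_intros simp: expinv_def power2_eq_square field_simps)
         (cases p; simp add: field_simps)
    then show ?thesis
      by (rule has_field_derivative_transform_within_open[where S="{0<..}"]) (use 3 in \<open>auto simp: expinv_def\<close>)
  qed
qed

lemma continuous_on_expinv: "continuous_on A (expinv p)"
  using DERIV_expinv DERIV_isCont continuous_at_imp_continuous_on by blast

lemma C_k_expinv: "C_k k f \<Longrightarrow> C_k k (\<lambda>x. expinv p (f x))"
proof (induction k arbitrary: p f)
  case 0
  then show ?case by (auto intro: continuous_on_compose2[OF continuous_on_expinv[of UNIV]])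
next
  case (Suc k)
  show ?case
  proof (rule C_k_SucI)
    show "((\<lambda>x. expinv p (f x)) has_derivative (\<lambda>h. frechet_derivative f (at x) h *
        (expinv (p + 2) (f x) - p * expinv (p + 1) (f x)))) (at x)" for x
      by (rule has_derivative_compose[OF C_k_has_derivative[OF Suc.prems]
          DERIV_expinv[unfolded has_field_derivative_def], THEN has_derivative_eq_rhs]) (simp add: mult.commute)
    show "C_k k (\<lambda>x. frechet_derivative f (at x) (axis j 1) *
        (expinv (p + 2) (f x) - p * expinv (p + 1) (f x)))" for j
      using Suc.prems by (intro C_k_mult C_k_diff C_k_const Suc.IH C_k_Suc_imp[OF Suc.prems]) auto
  qed
qed

lemma C_k_exp: "C_k k f \<Longrightarrow> C_k k (\<lambda>x. exp (f x :: real))"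
proof (induction k arbitrary: f)
  case 0
  then show ?case by (auto intro: continuous_on_exp)
next
  case (Suc k)
  show ?case
  proof (rule C_k_SucI)
    show "((\<lambda>x. exp (f x)) has_derivative (\<lambda>h. frechet_derivative f (at x) h * exp (f x))) (at x)" for x
      by (rule has_derivative_compose[OF C_k_has_derivative[OF Suc.prems]
          DERIV_exp[unfolded has_field_derivative_def], THEN has_derivative_eq_rhs]) (simp add: mult.commute)
    show "C_k k (\<lambda>x. frechet_derivative f (at x) (axis j 1) * exp (f x))" for j
      using Suc.prems by (intro C_k_mult Suc.IH C_k_Suc_imp[OF Suc.prems]) auto
  qed
qed

section \<open>Test functions\<close>

lemma test_functionsI:
  assumes "\<And>k. C_k k \<phi>" "compact K" "K \<subseteq> D" "\<And>x. x \<notin> K \<Longrightarrow> \<phi> x = 0"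
  shows "\<phi> \<in> test_functions D"
proof -
  have "closure {x. \<phi> x \<noteq> 0} \<subseteq> K"
    using assms(2,4) by (intro closure_minimal compact_imp_closed) auto
  moreover from this have "compact (closure {x. \<phi> x \<noteq> 0})"
    using assms(2) by (meson closed_closure compact_Int_closed compact_closure bounded_subset compact_imp_bounded closure_subset subset_trans)
  ultimately show ?thesis using assms by (auto simp: test_functions_def)
qed

lemma test_function_support:
  assumes "\<phi> \<in> test_functions D"
  obtains K where "compact K" "K \<subseteq> D" "\<And>x. x \<notin> K \<Longrightarrow> \<phi> x = 0"
    "\<And>x. x \<notin> K \<Longrightarrow> frechet_derivative \<phi> (at x) = (\<lambda>_. 0)"
proof -
  let ?K = "closure {x. \<phi> x \<noteq> 0}"
  have z: "\<phi> x = 0" if "x \<notin> ?K" for x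
    using that closure_subset by (metis (mono_tags, lifting) mem_Collect_eq subsetD)
  have "frechet_derivative \<phi> (at x) = (\<lambda>_. 0)" if "x \<notin> ?K" for x
  proof -
    have "((\<lambda>_. 0) has_derivative (\<lambda>_. 0)) (at x)" by simp
    then have "(\<phi> has_derivative (\<lambda>_. 0)) (at x)"
      by (rule has_derivative_transform_within_open[where s="- ?K"])
         (simp_all only: open_Compl closed_closure Compl_iff that z not_False_eq_True)
    then show ?thesis using frechet_derivative_at by metis
  qed
  moreover have "compact ?K" "?K \<subseteq> D" using assms by (simp_all add: test_functions_def)
  ultimately show ?thesis using z by (intro that[of ?K])
qed

lemma test_function_C_k: "\<phi> \<in> test_functions D \<Longrightarrow> C_k k \<phi>"
  by (simp add: test_functions_def)

lemma test_function_has_derivative: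
  "\<phi> \<in> test_functions D \<Longrightarrow> (\<phi> has_derivative frechet_derivative \<phi> (at x)) (at x)"
  using C_k_has_derivative[OF test_function_C_k[of \<phi> D "Suc 0"]] .

lemma test_function_continuous: "\<phi> \<in> test_functions D \<Longrightarrow> continuous_on A \<phi>"
  using test_function_C_k[of \<phi> D 0] continuous_on_subset by auto

lemma test_function_continuous_partial:
  "\<phi> \<in> test_functions D \<Longrightarrow> continuous_on A (\<lambda>x. frechet_derivative \<phi> (at x) (axis j 1))"
  using test_function_C_k[of \<phi> D "Suc 0"] by (auto intro: continuous_on_subset[of UNIV])

lemma test_functions_mono: "D \<subseteq> D' \<Longrightarrow> test_functions D \<subseteq> test_functions D'"
  by (auto simp: test_functions_def)

lemma test_function_zero: "(\<lambda>_. 0) \<in> test_functions D"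
  by (rule test_functionsI[of _ "{}"]) (auto intro: C_k_const)

lemma test_function_add:
  assumes "\<phi> \<in> test_functions D" "\<psi> \<in> test_functions D"
  shows "(\<lambda>x. \<phi> x + \<psi> x) \<in> test_functions D"
proof -
  obtain K K' where "compact K" "K \<subseteq> D" "\<And>x. x \<notin> K \<Longrightarrow> \<phi> x = 0"
    "compact K'" "K' \<subseteq> D" "\<And>x. x \<notin> K' \<Longrightarrow> \<psi> x = 0"
    using test_function_support[OF assms(1)] test_function_support[OF assms(2)] by metis
  then show ?thesis
    using assms by (intro test_functionsI[of _ "K \<union> K'"]) (auto intro: C_k_add test_function_C_k)
qed

lemma test_function_sum:
  "(\<And>i. i \<in> I \<Longrightarrow> f i \<in> test_functions D) \<Longrightarrow> (\<lambda>x. \<Sum>i\<in>I. f i x) \<in> test_functions D"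
  by (induction I rule: infinite_finite_induct) (auto intro: test_function_zero test_function_add)

lemma test_function_bounded_linear:
  assumes "bounded_linear T" "\<phi> \<in> test_functions D"
  shows "(\<lambda>x. T (\<phi> x)) \<in> test_functions D"
proof -
  obtain K where "compact K" "K \<subseteq> D" "\<And>x. x \<notin> K \<Longrightarrow> \<phi> x = 0"
    using test_function_support[OF assms(2)] by metis
  then show ?thesis
    using assms by (intro test_functionsI[of _ K])
      (auto intro: C_k_bounded_linear test_function_C_k simp: bounded_linear.linear linear_0)
qed

text \<open>The prefactor \<open>r\<close> keeps the values of the gradient unchanged while the sup
  norm shrinks with \<open>r\<close>. Perturbations built on the unit ball can thus be used at every
  scale.\<close>

lemma test_function_rescale:
  assumes \<phi>: "\<phi> \<in> test_functions (ball 0 1)" and r: "r > 0"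
  shows "(\<lambda>x. r *\<^sub>R \<phi> (inverse r *\<^sub>R (x - x0))) \<in> test_functions (ball x0 r)"
proof -
  obtain K where K: "compact K" "K \<subseteq> ball 0 1" "\<And>x. x \<notin> K \<Longrightarrow> \<phi> x = 0"
    using test_function_support[OF \<phi>] by metis
  let ?K = "(\<lambda>y. x0 + r *\<^sub>R y) ` K"
  show ?thesis
  proof (rule test_functionsI[of _ ?K])
    show "C_k k (\<lambda>x. r *\<^sub>R \<phi> (inverse r *\<^sub>R (x - x0)))" for k
      by (intro C_k_bounded_linear[OF bounded_linear_scaleR_right] C_k_affine test_function_C_k[OF \<phi>])
    show "compact ?K" using K(1) by (intro compact_continuous_image continuous_intros)
    show "?K \<subseteq> ball x0 r" using K(2) r by (auto simp: dist_norm subset_iff)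
    show "r *\<^sub>R \<phi> (inverse r *\<^sub>R (x - x0)) = 0" if "x \<notin> ?K" for x
    proof -
      have "x = x0 + r *\<^sub>R (inverse r *\<^sub>R (x - x0))" using r by simp
      then have "inverse r *\<^sub>R (x - x0) \<notin> K" using that by (metis imageI)
      then show ?thesis using K(3) by simp
    qed
  qed
qed


section \<open>Integration by parts\<close>

lemma integral_lebesgue_on_eq:
  fixes f :: "'a::euclidean_space \<Rightarrow> 'b::euclidean_space"
  assumes "S \<in> sets lebesgue" "\<And>x. x \<notin> S \<Longrightarrow> f x = 0"
  shows "integral\<^sup>L (lebesgue_on S) f = integral\<^sup>L lebesgue f"
    "integrable (lebesgue_on S) f \<longleftrightarrow> integrable lebesgue f"
proof -
  have eq: "(\<lambda>x. indicator S x *\<^sub>R f x) = f"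
    using assms(2) by (auto simp: fun_eq_iff indicator_def)
  show "integral\<^sup>L (lebesgue_on S) f = integral\<^sup>L lebesgue f"
    using assms(1) by (subst integral_restrict_space) (simp_all add: eq)
  show "integrable (lebesgue_on S) f \<longleftrightarrow> integrable lebesgue f"
    using assms(1) by (subst integrable_restrict_space) (simp_all add: eq)
qed

lemma integrable_continuous_compact_support:
  fixes f :: "'a::euclidean_space \<Rightarrow> 'b::euclidean_space"
  assumes "continuous_on UNIV f" "compact K" "\<And>x. x \<notin> K \<Longrightarrow> f x = 0"
  shows "integrable lebesgue f"
proof -
  have "integrable lborel (\<lambda>x. indicator K x *\<^sub>R f x)"
    using assms by (intro borel_integrable_compact) (auto intro: continuous_on_subset)
  then have "integrable lborel f"
    using assms(3) by (subst (asm) Bochner_Integration.integrable_cong[where g=f]) (auto simp: indicator_def)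
  then show ?thesis by (simp add: integrable_completion)
qed

lemma bounded_continuous_compact_support:
  fixes f :: "'a::euclidean_space \<Rightarrow> 'b::euclidean_space"
  assumes "continuous_on UNIV f" "compact K" "\<And>x. x \<notin> K \<Longrightarrow> f x = 0"
  obtains B where "B > 0" "\<And>x. norm (f x) \<le> B"
proof -
  have "compact (f ` K)"
    using assms by (intro compact_continuous_image) (auto intro: continuous_on_subset)
  then obtain B where "B > 0" "\<And>y. y \<in> f ` K \<Longrightarrow> norm y \<le> B"
    using compact_imp_bounded bounded_pos by metis
  then show ?thesis using assms(3) by (intro that[of B]) (metis image_eqI less_imp_le norm_zero)+
qed

lemma lebesgue_integral_translate:
  fixes f :: "'a::euclidean_space \<Rightarrow> real"
  assumes "continuous_on UNIV f"
  shows "integral\<^sup>L lebesgue (\<lambda>x. f (c + x)) = integral\<^sup>L lebesgue f"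
proof -
  have m: "f \<in> borel_measurable borel" "(\<lambda>x. f (c + x)) \<in> borel_measurable borel"
    using assms by (auto intro!: borel_measurable_continuous_onI continuous_on_compose2[OF assms] continuous_intros)
  have "integral\<^sup>L lborel f = integral\<^sup>L (distr lborel borel ((+) c)) f"
    by (simp add: lborel_distr_plus)
  also have "\<dots> = integral\<^sup>L lborel (\<lambda>x. f (c + x))"
    using m by (subst integral_distr) auto
  finally show ?thesis using m by (simp add: integral_completion)
qed

text \<open>Difference quotients have integral 0 by translation invariance, and dominated
  convergence passes this to the derivative.\<close>

lemma integral_partial_derivative_eq_0:
  fixes f :: "'a::euclidean_space \<Rightarrow> real"
  assumes f: "\<And>x. (f has_derivative f' x) (at x)"
    and g: "continuous_on UNIV (\<lambda>x. f' x e)" and K: "compact K" "\<And>x. x \<notin> K \<Longrightarrow> f x = 0"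
    "\<And>x. x \<notin> K \<Longrightarrow> f' x e = 0"
  shows "integral\<^sup>L lebesgue (\<lambda>x. f' x e) = 0"
proof -
  obtain R where R: "R > 0" "\<And>x. x \<in> K \<Longrightarrow> norm x \<le> R"
    using compact_imp_bounded[OF K(1)] bounded_pos by metis
  obtain B where B: "B > 0" "\<And>x. norm (f' x e) \<le> B"
    using bounded_continuous_compact_support[OF g K(1,3)] by blast
  have cf: "continuous_on A f" for A
    using f by (meson has_derivative_continuous continuous_at_imp_continuous_on)
  define h where "h k = inverse (real (Suc k))" for k
  have h: "0 < h k" "h k \<le> 1" for k by (auto simp: h_def field_simps)
  define q where "q k x = (f (h k *\<^sub>R e + x) - f x) / h k" for k x
  have line: "((\<lambda>s. f (x + s *\<^sub>R e)) has_real_derivative f' (x + s *\<^sub>R e) e) (at s)" for x s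
  proof -
    have "((\<lambda>s. f (x + s *\<^sub>R e)) has_derivative (\<lambda>d. f' (x + s *\<^sub>R e) (d *\<^sub>R e))) (at s)"
      by (rule has_derivative_compose[OF _ f]) (auto intro!: derivative_eq_intros)
    moreover have "(\<lambda>d. f' (x + s *\<^sub>R e) (d *\<^sub>R e)) = (*) (f' (x + s *\<^sub>R e) e)"
      using linear_scale[OF has_derivative_linear[OF f]] by (auto simp: fun_eq_iff mult.commute)
    ultimately show ?thesis by (simp add: has_field_derivative_def)
  qed
  \<comment> \<open>Outside the ball of radius \<open>R + norm e\<close> neither \<open>x\<close>
    nor its translate meets \<open>K\<close>, since the steps \<open>h k\<close> are at most 1;
    inside, the mean value theorem bounds the quotient.\<close>
  have bound: "norm (q k x) \<le> B * indicator (cball 0 (R + norm e)) x" for k x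
  proof (cases "norm x \<le> R + norm e")
    case True
    have "\<exists>s>0. s < h k \<and> f (x + h k *\<^sub>R e) - f (x + 0 *\<^sub>R e) = (h k - 0) * f' (x + s *\<^sub>R e) e"
      using MVT2[of 0 "h k" "\<lambda>s. f (x + s *\<^sub>R e)" "\<lambda>s. f' (x + s *\<^sub>R e) e"] h line by auto
    then obtain s where "f (x + h k *\<^sub>R e) - f x = h k * f' (x + s *\<^sub>R e) e" by auto
    then have "q k x = f' (x + s *\<^sub>R e) e" using h[of k] by (simp add: q_def add.commute)
    then show ?thesis using B True by simp
  next
    case False
    have "x \<notin> K"
    proof
      assume "x \<in> K"
      from R(2)[OF this] False norm_ge_zero[of e] show False by linarith
    qed
    moreover have "h k *\<^sub>R e + x \<notin> K"
    proof
      assume "h k *\<^sub>R e + x \<in> K"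
      then have "norm (h k *\<^sub>R e + x) \<le> R" by (rule R(2))
      moreover have "norm x \<le> norm (h k *\<^sub>R e + x) + norm (h k *\<^sub>R e)"
        using norm_triangle_ineq4[of "h k *\<^sub>R e + x" "h k *\<^sub>R e"] by simp
      moreover have "norm (h k *\<^sub>R e) \<le> norm e"
        using h[of k] by (simp add: mult_left_le_one_le)
      ultimately show False using False by linarith
    qed
    ultimately show ?thesis using K(2) B(1) by (simp add: q_def)
  qed
  have qlim: "(\<lambda>k. q k x) \<longlonglongrightarrow> f' x e" for x
  proof -
    have "((\<lambda>s. (f (x + s *\<^sub>R e) - f x) / s) \<longlongrightarrow> f' x e) (at 0)"
      using line[of x 0] by (simp add: DERIV_def)
    moreover have "filterlim h (at 0) sequentially"
      unfolding filterlim_at h_def[abs_def] using LIMSEQ_inverse_real_of_nat by auto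
    ultimately show ?thesis
      unfolding q_def by (auto dest: filterlim_compose simp: add.commute)
  qed
  have cq: "continuous_on UNIV (q k)" for k
    unfolding q_def using h[of k] by (intro continuous_intros continuous_on_compose2[OF cf[of UNIV]]) auto
  have "(\<lambda>k. integral\<^sup>L lebesgue (q k)) \<longlonglongrightarrow> integral\<^sup>L lebesgue (\<lambda>x. f' x e)"
  proof (rule integral_dominated_convergence[where w="\<lambda>x. B * indicator (cball 0 (R + norm e)) x"])
    show "(\<lambda>x. f' x e) \<in> borel_measurable lebesgue" "q k \<in> borel_measurable lebesgue" for k
      using borel_measurable_integrable[OF integrable_continuous_compact_support[OF g K(1,3)]]
        borel_measurable_continuous_onI[OF cq[of k]] by (auto simp: measurable_completion)
    show "integrable lebesgue (\<lambda>x. B * indicat_real (cball 0 (R + norm e)) x)"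
      using lmeasurable_cball by (intro integrable_mult_right) (simp add: lmeasurable_iff_integrable)
  qed (use qlim bound in auto)
  moreover have "integral\<^sup>L lebesgue (q k) = 0" for k
  proof -
    have i1: "integrable lebesgue f" using integrable_continuous_compact_support[OF cf K(1,2)] .
    have i2: "integrable lebesgue (\<lambda>x. f (h k *\<^sub>R e + x))"
    proof (rule integrable_continuous_compact_support)
      show "continuous_on UNIV (\<lambda>x. f (h k *\<^sub>R e + x))"
        by (intro continuous_on_compose2[OF cf[of UNIV]] continuous_intros) auto
      show "compact ((+) (- (h k *\<^sub>R e)) ` K)" using K(1) by (rule compact_translation)
      show "f (h k *\<^sub>R e + x) = 0" if "x \<notin> (+) (- (h k *\<^sub>R e)) ` K" for x
        using that by (intro K(2)) (auto simp: image_iff)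
    qed
    show ?thesis
      unfolding q_def using i1 i2 lebesgue_integral_translate[OF cf, of "h k *\<^sub>R e"] by simp
  qed
  ultimately show ?thesis by (simp add: LIMSEQ_const_iff)
qed

text \<open>The product of \<open>u\<close> and \<open>\<phi>\<close> vanishes off a compact subset
  of \<open>D\<close>, so it is differentiable on the whole space with derivative extended by zero,
  whatever \<open>u\<close> does off \<open>D\<close>.\<close>

lemma integration_by_parts:
  fixes u :: "real^'n \<Rightarrow> real"
  assumes D: "open D" and u: "\<And>x. x \<in> D \<Longrightarrow> (u has_derivative u' x) (at x)"
    and u': "continuous_on D (\<lambda>x. u' x (axis j 1))" and \<phi>: "\<phi> \<in> test_functions D"
  shows "integrable lebesgue (\<lambda>x. u x * frechet_derivative \<phi> (at x) (axis j 1))"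
    "integrable lebesgue (\<lambda>x. u' x (axis j 1) * \<phi> x)"
    "integral\<^sup>L lebesgue (\<lambda>x. u x * frechet_derivative \<phi> (at x) (axis j 1))
      = - integral\<^sup>L lebesgue (\<lambda>x. u' x (axis j 1) * \<phi> x)"
proof -
  obtain K where K: "compact K" "K \<subseteq> D" "\<And>x. x \<notin> K \<Longrightarrow> \<phi> x = 0"
    "\<And>x. x \<notin> K \<Longrightarrow> frechet_derivative \<phi> (at x) = (\<lambda>_. 0)"
    using test_function_support[OF \<phi>] by blast
  have cont: "continuous_on UNIV g" if "continuous_on D g" "\<And>x. x \<notin> K \<Longrightarrow> g x = 0" for g :: "real^'n \<Rightarrow> real"
  proof -
    have "continuous_on (- K) g" using that(2) by (subst continuous_on_cong[OF refl, of _ _ "\<lambda>_. 0"]) auto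
    moreover have "open (- K)" using K(1) compact_imp_closed by auto
    ultimately have "continuous_on (D \<union> - K) g" using that(1) D continuous_on_open_Un by blast
    moreover have "D \<union> - K = UNIV" using K(2) by auto
    ultimately show ?thesis by simp
  qed
  have cu: "continuous_on D u"
    using u by (meson has_derivative_continuous continuous_at_imp_continuous_on)
  let ?a = "\<lambda>x. u x * frechet_derivative \<phi> (at x) (axis j 1)"
  let ?b = "\<lambda>x. u' x (axis j 1) * \<phi> x"
  have ca: "continuous_on UNIV ?a"
    using K(4) by (intro cont continuous_on_mult cu test_function_continuous_partial[OF \<phi>]) auto
  have cb: "continuous_on UNIV ?b"
    using K(3) by (intro cont continuous_on_mult u' test_function_continuous[OF \<phi>]) auto
  show ia: "integrable lebesgue ?a"
    by (rule integrable_continuous_compact_support[OF ca K(1)]) (simp add: K(4))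
  show ib: "integrable lebesgue ?b"
    by (rule integrable_continuous_compact_support[OF cb K(1)]) (simp add: K(3))
  define f' where "f' x h = (if x \<in> D then u x * frechet_derivative \<phi> (at x) h + u' x h * \<phi> x else 0)" for x h
  have f'e: "f' x (axis j 1) = ?a x + ?b x" for x
    using subsetD[OF K(2), of x] K(3,4)[of x] by (cases "x \<in> D"; cases "x \<in> K") (auto simp: f'_def)
  have der: "((\<lambda>x. u x * \<phi> x) has_derivative f' x) (at x)" for x
  proof (cases "x \<in> D")
    case True
    show ?thesis
      by (rule has_derivative_eq_rhs[OF has_derivative_mult[OF u[OF True] test_function_has_derivative[OF \<phi>]]])
         (use True in \<open>auto simp: f'_def\<close>)
  next
    case False
    then have "x \<notin> K" using K(2) by auto
    have "((\<lambda>_. 0) has_derivative (\<lambda>_. 0)) (at x)" by simp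
    then have "((\<lambda>x. u x * \<phi> x) has_derivative (\<lambda>_. 0)) (at x)"
      by (rule has_derivative_transform_within_open[where s="- K"])
         (simp_all add: K \<open>x \<notin> K\<close> compact_imp_closed open_Compl)
    moreover have "f' x = (\<lambda>_. 0)" using False by (auto simp: f'_def)
    ultimately show ?thesis by simp
  qed
  have "integral\<^sup>L lebesgue (\<lambda>x. f' x (axis j 1)) = 0"
    by (rule integral_partial_derivative_eq_0[OF der _ K(1)])
       (use ca cb K in \<open>auto simp: f'e intro!: continuous_on_add\<close>)
  then show "integral\<^sup>L lebesgue ?a = - integral\<^sup>L lebesgue ?b"
    using ia ib by (simp add: f'e)
qed


section \<open>The fundamental lemma of the calculus of variations\<close>

definition box_bump :: "real^'n \<Rightarrow> real^'n \<Rightarrow> real^'n \<Rightarrow> real" where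
  "box_bump a b x = (\<Prod>i\<in>UNIV. expinv 0 (x $ i - a $ i) * expinv 0 (b $ i - x $ i))"

lemma C_k_box_bump: "C_k k (box_bump a b)"
proof -
  have "C_k k (\<lambda>x::real^'n. x $ i)" for i
    by (rule C_k_linear) (rule bounded_linear_vec_nth)
  then show ?thesis
    unfolding box_bump_def by (intro C_k_prod C_k_mult C_k_expinv C_k_diff C_k_const)
qed

lemma box_bump_pos_iff: "0 < box_bump a b x \<longleftrightarrow> x \<in> box a b"
  and box_bump_nonneg: "0 \<le> box_bump a b x"
proof -
  have n: "0 \<le> expinv 0 (x $ i - a $ i) * expinv 0 (b $ i - x $ i)" for i
    by (simp add: expinv_nonneg)
  show nn: "0 \<le> box_bump a b x"
    unfolding box_bump_def by (intro prod_nonneg) (use n in auto)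
  have p: "0 < expinv 0 s \<longleftrightarrow> s > 0" for s by (simp add: expinv_def)
  have z: "expinv 0 s = 0 \<longleftrightarrow> s \<le> 0" for s by (simp add: expinv_def)
  have "box_bump a b x = 0 \<longleftrightarrow> x \<notin> box a b"
    unfolding box_bump_def by (auto simp: mem_box_cart z not_less)
  then show "0 < box_bump a b x \<longleftrightarrow> x \<in> box a b"
    using nn by (metis less_le)
qed

text \<open>The functions \<open>1 - exp (- real k * box_bump a b x)\<close> are test functions that
  increase to the indicator of the open box; dominated convergence puts this indicator in place of
  the test function.\<close>

lemma weak_uniqueness_box:
  fixes g :: "real^'n \<Rightarrow> real"
  assumes Q: "cbox a b \<subseteq> D" and g: "integrable (lebesgue_on (cbox a b)) g"
    and D: "open D"
    and zero: "\<And>\<phi>. \<phi> \<in> test_functions D \<Longrightarrow> integral\<^sup>L (lebesgue_on D) (\<lambda>x. g x * \<phi> x) = 0"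
  shows "integral (cbox a b) g = 0"
proof -
  define \<phi> where "\<phi> k x = 1 - exp (- real k * box_bump a b x)" for k x
  have test: "\<phi> k \<in> test_functions D" for k
  proof (rule test_functionsI[of _ "cbox a b"])
    show "C_k j (\<phi> k)" for j
      unfolding \<phi>_def by (intro C_k_diff C_k_const C_k_exp C_k_mult C_k_box_bump)
    show "\<phi> k x = 0" if "x \<notin> cbox a b" for x
    proof -
      have "x \<notin> box a b" using that box_subset_cbox by blast
      then have "box_bump a b x = 0" using box_bump_pos_iff[of a b x] box_bump_nonneg[of a b x] by linarith
      then show ?thesis by (simp add: \<phi>_def)
    qed
  qed (use Q in auto)
  have out: "\<phi> k x = 0" if "x \<notin> box a b" for k x
    using that box_bump_pos_iff[of a b x] box_bump_nonneg[of a b x] by (simp add: \<phi>_def)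
  have out': "\<phi> k x = 0" if "x \<notin> cbox a b" for k x
    using that out box_subset_cbox by blast
  have eq: "integral\<^sup>L (lebesgue_on D) (\<lambda>x. g x * \<phi> k x)
      = integral\<^sup>L (lebesgue_on (cbox a b)) (\<lambda>x. g x * \<phi> k x)" for k
    using integral_lebesgue_on_eq(1)[of D "\<lambda>x. g x * \<phi> k x"]
      integral_lebesgue_on_eq(1)[of "cbox a b" "\<lambda>x. g x * \<phi> k x"] out' Q D by (auto simp: subset_iff)
  have \<phi>01: "0 \<le> \<phi> k x" "\<phi> k x \<le> 1" for k x
    using box_bump_nonneg[of a b x] by (auto simp: \<phi>_def)
  have lim: "(\<lambda>k. \<phi> k x) \<longlonglongrightarrow> indicator (box a b) x" for x
  proof (cases "x \<in> box a b")
    case True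
    then have pos: "0 < box_bump a b x" using box_bump_pos_iff by blast
    have "(\<lambda>k. 1 - exp (- real k * box_bump a b x)) \<longlonglongrightarrow> 1 - 0"
      using pos by (intro tendsto_intros filterlim_compose[OF exp_at_bot])
        (simp add: filterlim_uminus_at_bot filterlim_at_top_mult_tendsto_pos[OF tendsto_const _ filterlim_real_sequentially])
    then show ?thesis using True by (simp add: \<phi>_def)
  qed (simp add: out)
  have "(\<lambda>k. integral\<^sup>L (lebesgue_on (cbox a b)) (\<lambda>x. g x * \<phi> k x))
      \<longlonglongrightarrow> integral\<^sup>L (lebesgue_on (cbox a b)) (\<lambda>x. g x * indicator (box a b) x)"
  proof (rule integral_dominated_convergence[where w="\<lambda>x. \<bar>g x\<bar>"])
    have m: "\<phi> k \<in> borel_measurable (lebesgue_on (cbox a b))" for k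
      using test_function_continuous[OF test] by (intro continuous_imp_measurable_on_sets_lebesgue) auto
    show "(\<lambda>x. g x * \<phi> k x) \<in> borel_measurable (lebesgue_on (cbox a b))" for k
      using borel_measurable_integrable[OF g] m by measurable
    have "indicat_real (box a b) \<in> borel_measurable (lebesgue_on (cbox a b))"
      by (intro borel_measurable_indicator) (auto simp: sets_restrict_space intro!: image_eqI[of _ _ "box a b"] box_subset_cbox[THEN Int_absorb1, symmetric])
    then show "(\<lambda>x. g x * indicator (box a b) x) \<in> borel_measurable (lebesgue_on (cbox a b))"
      using borel_measurable_integrable[OF g] by measurable
    show "integrable (lebesgue_on (cbox a b)) (\<lambda>x. \<bar>g x\<bar>)" using g by simp
    show "AE x in lebesgue_on (cbox a b). (\<lambda>k. g x * \<phi> k x) \<longlonglongrightarrow> g x * indicator (box a b) x"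
      using lim by (intro AE_I2 tendsto_intros)
    show "AE x in lebesgue_on (cbox a b). norm (g x * \<phi> k x) \<le> \<bar>g x\<bar>" for k
      using \<phi>01[of k] by (intro AE_I2) (auto simp: abs_mult intro!: mult_left_le)
  qed
  then have "integral\<^sup>L (lebesgue_on (cbox a b)) (\<lambda>x. g x * indicator (box a b) x) = 0"
    using zero[OF test] by (simp add: eq LIMSEQ_const_iff)
  moreover have "integral\<^sup>L (lebesgue_on (cbox a b)) (\<lambda>x. g x * indicator (box a b) x)
      = integral\<^sup>L (lebesgue_on (cbox a b)) g"
  proof (rule integral_cong_AE)
    show "AE x in lebesgue_on (cbox a b). g x * indicator (box a b) x = g x"
    proof -
      have "negligible (cbox a b - box a b)" by (rule negligible_frontier_interval)
      then have "AE x in lebesgue. x \<notin> cbox a b - box a b"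
        using AE_not_in negligible_iff_null_sets by blast
      then show ?thesis
        by (subst AE_restrict_space_iff) (auto simp: indicator_def elim!: eventually_mono)
    qed
  qed (use borel_measurable_integrable[OF g] in \<open>auto intro!: borel_measurable_times borel_measurable_indicator
      simp: sets_restrict_space intro!: image_eqI[of _ _ "box a b"] box_subset_cbox[THEN Int_absorb1, symmetric]\<close>)
  ultimately show ?thesis using lebesgue_integral_eq_integral[OF g] by simp
qed

text \<open>Integrals over all small cubes vanish, so the Lebesgue differentiation theorem, applied
  in each of countably many boxes that fill \<open>D\<close>, gives the claim.\<close>

lemma weak_uniqueness:
  fixes g :: "real^'n \<Rightarrow> real"
  assumes D: "open D" and g: "\<And>C. compact C \<Longrightarrow> C \<subseteq> D \<Longrightarrow> integrable (lebesgue_on C) g"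
    and zero: "\<And>\<phi>. \<phi> \<in> test_functions D \<Longrightarrow> integral\<^sup>L (lebesgue_on D) (\<lambda>x. g x * \<phi> x) = 0"
  shows "negligible {x \<in> D. g x \<noteq> 0}"
proof -
  obtain \<D> :: "(real^'n) set set" where \<D>: "countable \<D>" "\<And>X. X \<in> \<D> \<Longrightarrow> X \<subseteq> D \<and> (\<exists>a b. X = cbox a b)" "\<Union>\<D> = D"
  proof (rule open_countable_Union_open_cbox[OF D])
    fix \<D> :: "(real^'n) set set"
    assume "countable \<D>" "\<D> \<subseteq> Pow D" "\<And>X. X \<in> \<D> \<Longrightarrow> \<exists>a b. X = cbox a b" "\<Union>\<D> = D"
    then show thesis by (intro that[of \<D>]) auto
  qed
  have "negligible {x \<in> X. g x \<noteq> 0}" if X: "X \<in> \<D>" for X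
  proof -
    obtain a b where ab: "X = cbox a b" "cbox a b \<subseteq> D" using \<D>(2)[OF X] by auto
    define f where "f x = (if x \<in> cbox a b then g x else 0)" for x
    have gi: "integrable (lebesgue_on (cbox a b)) g" using g ab by auto
    then have "integrable (lebesgue_on (cbox a b)) f"
      by (subst Bochner_Integration.integrable_cong[where g=g]) (auto simp: f_def)
    then have "integrable lebesgue f"
      by (subst (asm) integral_lebesgue_on_eq(2)) (auto simp: f_def)
    then have "f integrable_on UNIV"
      using has_integral_integral_lebesgue integrable_on_def by blast
    then have "f integrable_on cbox c d" for c d
      using integrable_on_subcbox by blast
    then obtain N where N: "negligible N" "\<And>x e. \<lbrakk>x \<notin> N; 0 < e\<rbrakk> \<Longrightarrow>
       \<exists>d>0. \<forall>h. 0 < h \<and> h < d \<longrightarrow> norm (integral (cbox x (x + h *\<^sub>R One)) f /\<^sub>R h ^ DIM(real^'n) - f x) < e"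
      using integrable_ccontinuous_explicit[of f] by blast
    have "g x = 0" if x: "x \<in> box a b" "x \<notin> N" for x
    proof (rule ccontr)
      assume "g x \<noteq> 0"
      then obtain d where d: "d > 0" "\<And>h. 0 < h \<Longrightarrow> h < d \<Longrightarrow>
          norm (integral (cbox x (x + h *\<^sub>R One)) f /\<^sub>R h ^ DIM(real^'n) - f x) < \<bar>g x\<bar>"
        using N(2)[OF x(2), of "\<bar>g x\<bar>"] by auto
      obtain e where e: "e > 0" "cball x e \<subseteq> box a b"
        using open_contains_cball[of "box a b"] open_box x(1) by blast
      define h where "h = min (d / 2) (e / (1 + norm (One::real^'n)))"
      have h: "0 < h" "h < d" using d e by (auto simp: h_def add_pos_nonneg)
      have "h * norm (One::real^'n) \<le> e / (1 + norm (One::real^'n)) * norm (One::real^'n)"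
        by (intro mult_right_mono) (auto simp: h_def)
      also have "\<dots> \<le> e" using e by (simp add: field_simps add_pos_nonneg)
      finally have he: "norm (h *\<^sub>R (One::real^'n)) \<le> e" using h by simp
      have "cbox x (x + h *\<^sub>R One) \<subseteq> cball x e"
      proof
        fix y assume y: "y \<in> cbox x (x + h *\<^sub>R One)"
        have "norm (y - x) \<le> norm (h *\<^sub>R (One::real^'n))"
          using y by (intro norm_le_componentwise) (auto simp: mem_box inner_simps)
        then show "y \<in> cball x e" using he by (simp add: dist_norm norm_minus_commute)
      qed
      then have sub: "cbox x (x + h *\<^sub>R One) \<subseteq> cbox a b" using e box_subset_cbox by blast
      have "integral (cbox x (x + h *\<^sub>R One)) f = integral (cbox x (x + h *\<^sub>R One)) g"
        using sub by (intro integral_cong) (auto simp: f_def)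
      also have "\<dots> = 0"
        using sub ab(2) by (intro weak_uniqueness_box[OF _ g D zero]) auto
      finally have "norm (f x) < \<bar>g x\<bar>" using d(2)[OF h] by simp
      then show False using subsetD[OF box_subset_cbox x(1)] by (simp add: f_def)
    qed
    then have "{x \<in> X. g x \<noteq> 0} \<subseteq> N \<union> (cbox a b - box a b)" using ab by auto
    moreover have "negligible (N \<union> (cbox a b - box a b))"
      using N(1) negligible_frontier_interval by (rule negligible_Un)
    ultimately show ?thesis using negligible_subset by blast
  qed
  then have "negligible (\<Union>X\<in>\<D>. {x \<in> X. g x \<noteq> 0})"
    using \<D>(1) by (intro negligible_countable_Union) auto
  moreover have "{x \<in> D. g x \<noteq> 0} = (\<Union>X\<in>\<D>. {x \<in> X. g x \<noteq> 0})" using \<D>(3) by auto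
  ultimately show ?thesis by simp
qed

section \<open>Perturbations tangent to the constraint\<close>

definition J :: "(real^'n \<Rightarrow> real^'m) \<Rightarrow> real^'n \<Rightarrow> real^'n^'m" where
  "J \<phi> x = jacobian \<phi> (at x)"

lemma J_eqI: "(\<phi> has_derivative (\<lambda>h. A *v h)) (at x) \<Longrightarrow> J \<phi> x = A"
  unfolding J_def jacobian_def by (metis frechet_derivative_at matrix_of_matrix_vector_mul)

lemma J_has_derivative:
  "\<phi> \<in> test_functions D \<Longrightarrow> (\<phi> has_derivative (\<lambda>h. J \<phi> x *v h)) (at x)"
  unfolding J_def using test_function_has_derivative jacobian_works differentiable_def by blast

lemma J_nth: "J \<phi> x $ i $ j = frechet_derivative \<phi> (at x) (axis j 1) $ i"
  by (simp add: J_def jacobian_def matrix_def)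

lemma continuous_on_J: "\<phi> \<in> test_functions D \<Longrightarrow> continuous_on A (J \<phi>)"
  unfolding continuous_on_componentwise[where f="J \<phi>"]
  by (intro ballI) (auto simp: Basis_vec_def inner_axis J_nth
      intro!: continuous_on_component test_function_continuous_partial)

lemma J_support:
  assumes "\<phi> \<in> test_functions D"
  obtains K where "compact K" "K \<subseteq> D" "\<And>x. x \<notin> K \<Longrightarrow> \<phi> x = 0" "\<And>x. x \<notin> K \<Longrightarrow> J \<phi> x = 0"
proof -
  obtain K where K: "compact K" "K \<subseteq> D" "\<And>x. x \<notin> K \<Longrightarrow> \<phi> x = 0"
    "\<And>x. x \<notin> K \<Longrightarrow> frechet_derivative \<phi> (at x) = (\<lambda>_. 0)"
    using test_function_support[OF assms] by blast
  then show ?thesis by (intro that[of K]) (auto intro!: matrix_eqI simp: J_nth)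
qed

lemma J_outside: "\<phi> \<in> test_functions D \<Longrightarrow> x \<notin> D \<Longrightarrow> \<phi> x = 0 \<and> J \<phi> x = 0"
  by (meson J_support subsetD)

lemma J_bounded:
  assumes "\<phi> \<in> test_functions D"
  obtains B where "B > 0" "\<And>x. norm (\<phi> x) \<le> B" "\<And>x. norm (J \<phi> x) \<le> B"
proof -
  obtain K where K: "compact K" "\<And>x. x \<notin> K \<Longrightarrow> \<phi> x = 0" "\<And>x. x \<notin> K \<Longrightarrow> J \<phi> x = 0"
    using J_support[OF assms] by metis
  obtain B where B: "B > 0" "\<And>x. norm (\<phi> x) \<le> B"
    using bounded_continuous_compact_support[OF test_function_continuous[OF assms] K(1,2)] by blast
  obtain B' where B': "B' > 0" "\<And>x. norm (J \<phi> x) \<le> B'"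
    using bounded_continuous_compact_support[OF continuous_on_J[OF assms] K(1,3)] by blast
  show ?thesis using B B' by (intro that[of "max B B'"]) (auto simp: le_max_iff_disj)
qed

lemma J_add:
  assumes "\<phi> \<in> test_functions D" "\<psi> \<in> test_functions D"
  shows "J (\<lambda>x. \<phi> x + \<psi> x) x = J \<phi> x + J \<psi> x"
  by (rule J_eqI) (auto simp: matrix_vector_mult_add_rdistrib
      intro!: has_derivative_add J_has_derivative[OF assms(1)] J_has_derivative[OF assms(2)])

lemma J_zero: "J (\<lambda>_. 0) x = 0"
  by (rule J_eqI) simp

lemma J_sum:
  assumes "finite I" "\<And>i. i \<in> I \<Longrightarrow> f i \<in> test_functions D"
  shows "J (\<lambda>x. \<Sum>i\<in>I. f i x) x = (\<Sum>i\<in>I. J (f i) x)"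
  using assms
proof (induction I rule: finite_induct)
  case (insert a F)
  then have "J (\<lambda>x. f a x + (\<Sum>i\<in>F. f i x)) x = J (f a) x + J (\<lambda>x. \<Sum>i\<in>F. f i x) x"
    by (intro J_add[of _ D] test_function_sum) auto
  with insert show ?case by simp
qed (simp add: J_zero)

lemma J_rescale:
  assumes "\<phi> \<in> test_functions D" "r > 0"
  shows "J (\<lambda>x. r *\<^sub>R \<phi> (inverse r *\<^sub>R (x - x0))) x = J \<phi> (inverse r *\<^sub>R (x - x0))"
proof (rule J_eqI)
  let ?y = "inverse r *\<^sub>R (x - x0)"
  have "((\<lambda>x. r *\<^sub>R \<phi> (inverse r *\<^sub>R (x - x0))) has_derivative
      (\<lambda>h. r *\<^sub>R (J \<phi> ?y *v (inverse r *\<^sub>R h)))) (at x)"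
    by (intro has_derivative_scaleR_right has_derivative_compose[OF _ J_has_derivative[OF assms(1)]])
       (auto intro!: derivative_eq_intros)
  then show "((\<lambda>x. r *\<^sub>R \<phi> (inverse r *\<^sub>R (x - x0))) has_derivative (\<lambda>h. J \<phi> ?y *v h)) (at x)"
    using assms(2) by (simp add: matrix_vector_mult_scaleR)
qed

lemma J_integrable: "\<phi> \<in> test_functions D \<Longrightarrow> integrable lebesgue (J \<phi>)"
  by (meson J_support continuous_on_J integrable_continuous_compact_support)

text \<open>Each entry of \<open>J \<phi>\<close> is a partial derivative of a compactly supported
  function. A perturbation therefore never changes the mean gradient: affine functions of the
  gradient stay in balance, and a slowly varying field is nearly orthogonal to a fine
  perturbation.\<close>

lemma J_integral_inner:
  assumes "\<phi> \<in> test_functions D"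
  shows "integral\<^sup>L lebesgue (\<lambda>x. A \<bullet> J \<phi> x) = 0"
proof -
  obtain K where K: "compact K" "\<And>x. x \<notin> K \<Longrightarrow> \<phi> x = 0" "\<And>x. x \<notin> K \<Longrightarrow> J \<phi> x = 0"
    using J_support[OF assms] by metis
  have "integral\<^sup>L lebesgue (\<lambda>x. J \<phi> x $ i $ j) = 0" for i j
  proof -
    have "integral\<^sup>L lebesgue (\<lambda>x. (J \<phi> x *v axis j 1) $ i) = 0"
    proof (rule integral_partial_derivative_eq_0[where f="\<lambda>x. \<phi> x $ i" and f'="\<lambda>x h. (J \<phi> x *v h) $ i"])
      show "((\<lambda>x. \<phi> x $ i) has_derivative (\<lambda>h. (J \<phi> x *v h) $ i)) (at x)" for x
        by (rule bounded_linear.has_derivative[OF bounded_linear_vec_nth J_has_derivative[OF assms]])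
      show "continuous_on UNIV (\<lambda>x. (J \<phi> x *v axis j 1) $ i)"
        using continuous_on_J[OF assms, of UNIV]
        by (simp add: matrix_vector_mult_basis column_def continuous_on_component)
    qed (use K in auto)
    then show ?thesis by (simp add: matrix_vector_mult_basis column_def)
  qed
  moreover have "integrable lebesgue (\<lambda>x. J \<phi> x $ i $ j)" for i j
    using integrable_bounded_linear[OF bounded_linear_vec_nth integrable_bounded_linear[OF bounded_linear_vec_nth J_integrable[OF assms]]]
    by simp
  ultimately show ?thesis
    by (simp add: inner_vec_def)
qed

section \<open>Constrained perturbations and the bad fraction\<close>

context linear_constraint
begin

definition pert :: "(real^'n) set \<Rightarrow> (real^'n \<Rightarrow> real^'m) \<Rightarrow> bool" where
  "pert D \<phi> \<longleftrightarrow> \<phi> \<in> test_functions D \<and> (\<forall>x. L \<bullet> J \<phi> x = 0)"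

lemma pert_test: "pert D \<phi> \<Longrightarrow> \<phi> \<in> test_functions D"
  by (simp add: pert_def)

lemma pert_S: "pert D \<phi> \<Longrightarrow> \<xi> + J \<phi> x \<in> S \<longleftrightarrow> \<xi> \<in> S"
  by (simp add: pert_def Sigma_t_iff inner_add_right)

lemma pert_mono: "pert D \<phi> \<Longrightarrow> D \<subseteq> D' \<Longrightarrow> pert D' \<phi>"
  using test_functions_mono by (auto simp: pert_def)

lemma pert_zero: "pert D (\<lambda>_. 0)"
  by (simp add: pert_def test_function_zero J_zero)

lemma pert_add: "pert D \<phi> \<Longrightarrow> pert D \<psi> \<Longrightarrow> pert D (\<lambda>x. \<phi> x + \<psi> x)"
  by (auto simp: pert_def test_function_add J_add inner_add_right)

lemma pert_sum:
  "finite I \<Longrightarrow> (\<And>i. i \<in> I \<Longrightarrow> pert D (f i)) \<Longrightarrow> pert D (\<lambda>x. \<Sum>i\<in>I. f i x)"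
  by (induction I rule: finite_induct) (auto simp: pert_zero pert_add)

lemma pert_rescale:
  assumes "pert (ball 0 1) \<phi>" "r > 0"
  shows "pert (ball x0 r) (\<lambda>x. r *\<^sub>R \<phi> (inverse r *\<^sub>R (x - x0)))"
  using assms by (auto simp: pert_def J_rescale intro!: test_function_rescale)

text \<open>The unit ball is a reference domain; rescaling and Vitali coverings transport the
  fraction to other open sets. Hull membership is demanded at every \<open>x\<close>, and since
  \<open>J \<phi>\<close> vanishes off the ball this includes
  \<open>\<xi> \<in> lhull U\<close>.\<close>

definition ach :: "(real^'n^'m) set \<Rightarrow> real^'n^'m \<Rightarrow> real \<Rightarrow> bool" where
  "ach U \<xi> \<theta> \<longleftrightarrow> 0 \<le> \<theta> \<and> (\<exists>\<phi>. pert (ball 0 1) \<phi> \<and> (\<forall>x. \<xi> + J \<phi> x \<in> lhull U) \<and>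
     measure lebesgue {x \<in> ball 0 1. \<xi> + J \<phi> x \<notin> U} \<le> \<theta> * measure lebesgue (ball (0::real^'n) 1))"

definition bad :: "(real^'n^'m) set \<Rightarrow> real^'n^'m \<Rightarrow> real" where
  "bad U \<xi> = Inf {\<theta>. ach U \<xi> \<theta>}"

lemma ball_pos: "r > 0 \<Longrightarrow> 0 < measure lebesgue (ball (x::real^'n) r)"
  using content_ball_pos[of r x] by simp

lemma ach_1:
  assumes "\<xi> \<in> lhull U"
  shows "ach U \<xi> 1"
proof -
  have "measure lebesgue {x \<in> ball (0::real^'n) 1. \<xi> \<notin> U} \<le> measure lebesgue (ball (0::real^'n) 1)"
  proof (cases "\<xi> \<in> U")
    case False
    then have "{x \<in> ball (0::real^'n) 1. \<xi> \<notin> U} = ball 0 1" by blast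
    then show ?thesis by simp
  qed simp
  then show ?thesis
    unfolding ach_def using assms pert_zero by (intro conjI exI[of _ "\<lambda>_. 0"]) (simp_all add: J_zero)
qed

lemma ach_0:
  assumes "\<xi> \<in> U" "U \<subseteq> S"
  shows "ach U \<xi> 0"
proof -
  have "\<xi> \<in> lhull U" using subset_hull[OF assms(2)] assms(1) by blast
  then show ?thesis
    unfolding ach_def using assms(1) pert_zero by (intro conjI exI[of _ "\<lambda>_. 0"]) (simp_all add: J_zero)
qed

lemma bad_le: "ach U \<xi> \<theta> \<Longrightarrow> bad U \<xi> \<le> \<theta>"
  unfolding bad_def by (rule cInf_lower) (auto simp: ach_def intro!: bdd_belowI[of _ 0])

lemma bad_nonneg:
  assumes "\<xi> \<in> lhull U"
  shows "0 \<le> bad U \<xi>"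
  unfolding bad_def
proof (rule cInf_greatest)
  show "{\<theta>. ach U \<xi> \<theta>} \<noteq> {}" using ach_1[OF assms] by blast
qed (simp add: ach_def)

lemma bad_le_1: "\<xi> \<in> lhull U \<Longrightarrow> bad U \<xi> \<le> 1"
  using bad_le ach_1 by blast

lemma bad_eq_0: "\<xi> \<in> U \<Longrightarrow> U \<subseteq> S \<Longrightarrow> bad U \<xi> = 0"
  using bad_le[OF ach_0] bad_nonneg subset_hull by (metis antisym subsetD)

lemma bad_lessD:
  assumes "bad U \<xi> < \<alpha>" "\<xi> \<in> lhull U"
  shows "\<exists>\<theta><\<alpha>. ach U \<xi> \<theta>"
proof -
  have "{\<theta>. ach U \<xi> \<theta>} \<noteq> {}" using ach_1[OF assms(2)] by blast
  from cInf_lessD[OF this] assms(1) show ?thesis by (auto simp: bad_def)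
qed

text \<open>Compactness gives room around a nearly optimal perturbation: its gradients range over a
  compact subset of the relatively open hull, and a compact part \<open>C\<close> of the good set,
  chosen with little loss of measure, is mapped to a compact subset of \<open>U\<close>.\<close>

lemma bad_margin:
  assumes U: "openin (top_of_set S) U" and \<xi>: "\<xi> \<in> lhull U" "bad U \<xi> < \<alpha>"
  obtains \<phi> C \<mu> where "pert (ball 0 1) \<phi>" "compact C" "C \<subseteq> ball 0 1" "\<mu> > 0"
    "(1 - \<alpha>) * measure lebesgue (ball (0::real^'n) 1) < measure lebesgue C"
    "\<And>y \<zeta>. \<zeta> \<in> S \<Longrightarrow> dist (\<xi> + J \<phi> y) \<zeta> < \<mu> \<Longrightarrow> \<zeta> \<in> lhull U"
    "\<And>y \<zeta>. y \<in> C \<Longrightarrow> \<zeta> \<in> S \<Longrightarrow> dist (\<xi> + J \<phi> y) \<zeta> < \<mu> \<Longrightarrow> \<zeta> \<in> U"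
proof -
  let ?B = "ball (0::real^'n) 1"
  have \<xi>S: "\<xi> \<in> S" using \<xi> hull_subset_S by blast
  obtain \<theta> where \<theta>: "\<theta> < \<alpha>" "ach U \<xi> \<theta>" using bad_lessD \<xi> by blast
  then obtain \<phi> where \<phi>: "pert ?B \<phi>" "\<And>x. \<xi> + J \<phi> x \<in> lhull U"
    "measure lebesgue {x \<in> ?B. \<xi> + J \<phi> x \<notin> U} \<le> \<theta> * measure lebesgue ?B"
    unfolding ach_def by blast
  note test = pert_test[OF \<phi>(1)]
  have cont: "continuous_on A (\<lambda>x. \<xi> + J \<phi> x)" for A
    by (intro continuous_intros continuous_on_J[OF test])
  obtain T where T: "open T" "U = S \<inter> T" using U by (auto simp: openin_open)
  define G where "G = {x \<in> ?B. \<xi> + J \<phi> x \<in> U}"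
  have "G = ?B \<inter> (\<lambda>x. \<xi> + J \<phi> x) -` T"
    using \<xi>S pert_S[OF \<phi>(1)] T by (auto simp: G_def)
  then have oG: "open G"
    using continuous_open_preimage[OF cont[of ?B] open_ball T(1)] by simp
  have Gl: "G \<in> lmeasurable" using oG by (intro lmeasurable_open) (auto simp: G_def intro: bounded_subset[OF bounded_ball[of 0 1]])
  have GB: "G \<subseteq> ?B" by (auto simp: G_def)
  have eq: "{x \<in> ?B. \<xi> + J \<phi> x \<notin> U} = ?B - G" by (auto simp: G_def)
  have "measure lebesgue {x \<in> ?B. \<xi> + J \<phi> x \<notin> U} = measure lebesgue ?B - measure lebesgue G"
    by (simp only: eq measurable_measure_Diff[OF lmeasurable_ball fmeasurableD[OF Gl] GB])
  then have mG: "(1 - \<theta>) * measure lebesgue ?B \<le> measure lebesgue G"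
    using \<phi>(3) by (simp add: algebra_simps)
  define e where "e = (\<alpha> - \<theta>) * measure lebesgue ?B"
  have e: "e > 0" using \<theta>(1) ball_pos[of 1 0] by (simp add: e_def)
  obtain C where C: "closed C" "C \<subseteq> G" "G - C \<in> lmeasurable" "emeasure lebesgue (G - C) < ennreal e"
    using sets_lebesgue_inner_closed[OF fmeasurableD[OF Gl] e] by blast
  have CB: "C \<subseteq> ?B" using C(2) by (auto simp: G_def)
  then have cC: "compact C" using C(1) bounded_subset[OF bounded_ball] by (auto simp: compact_eq_bounded_closed)
  have "measure lebesgue (G - C) = measure lebesgue G - measure lebesgue C"
    using Gl cC C(2) by (simp add: measurable_measure_Diff fmeasurableD lmeasurable_compact)
  moreover have "measure lebesgue (G - C) < e"
    using C(3,4) e by (simp add: emeasure_eq_measure2 ennreal_less_iff)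
  ultimately have mC: "(1 - \<alpha>) * measure lebesgue ?B < measure lebesgue C"
    using mG by (simp add: e_def algebra_simps)
  obtain K where K: "compact K" "\<And>x. x \<notin> K \<Longrightarrow> J \<phi> x = 0"
    using J_support[OF test] by metis
  let ?R = "(\<lambda>x. \<xi> + J \<phi> x) ` insert 0 K \<union> {\<xi>}"
  have R: "compact ?R" "?R \<subseteq> lhull U"
    using K \<phi>(2) \<xi>(1) by (auto intro!: compact_continuous_image cont compact_insert compact_Un)
  have inR: "\<xi> + J \<phi> y \<in> ?R" for y using K(2)[of y] by (cases "y \<in> K") auto
  obtain \<mu>1 where \<mu>1: "\<mu>1 > 0" "\<And>\<eta> \<zeta>. \<eta> \<in> ?R \<Longrightarrow> \<zeta> \<in> S \<Longrightarrow> dist \<eta> \<zeta> < \<mu>1 \<Longrightarrow> \<zeta> \<in> lhull U"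
    using openin_margin[OF openin_hull[OF U] R] by blast
  have R2: "compact ((\<lambda>x. \<xi> + J \<phi> x) ` C)" "(\<lambda>x. \<xi> + J \<phi> x) ` C \<subseteq> U"
    using cC C(2) by (auto intro!: compact_continuous_image cont simp: G_def)
  obtain \<mu>2 where \<mu>2: "\<mu>2 > 0" "\<And>\<eta> \<zeta>. \<eta> \<in> (\<lambda>x. \<xi> + J \<phi> x) ` C \<Longrightarrow> \<zeta> \<in> S \<Longrightarrow> dist \<eta> \<zeta> < \<mu>2 \<Longrightarrow> \<zeta> \<in> U"
    using openin_margin[OF U R2] by blast
  show ?thesis
  proof (rule that[OF \<phi>(1) cC CB _ mC])
    show "0 < min \<mu>1 \<mu>2" using \<mu>1 \<mu>2 by simp
    show "\<zeta> \<in> lhull U" if "\<zeta> \<in> S" "dist (\<xi> + J \<phi> y) \<zeta> < min \<mu>1 \<mu>2" for y \<zeta>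
      by (rule \<mu>1(2)[OF inR[of y] that(1)]) (use that(2) in simp)
    show "\<zeta> \<in> U" if "y \<in> C" "\<zeta> \<in> S" "dist (\<xi> + J \<phi> y) \<zeta> < min \<mu>1 \<mu>2" for y \<zeta>
      using \<mu>2(2)[OF imageI[OF that(1)] that(2)] that(3) by simp
  qed
qed

text \<open>The perturbation for \<open>\<xi>\<close> serves all nearby \<open>\<zeta>\<close> in
  \<open>S\<close> unchanged. This semicontinuity is what makes maxima of \<open>bad\<close> minus
  an affine function attained.\<close>

lemma bad_usc:
  assumes U: "openin (top_of_set S) U" and \<xi>: "\<xi> \<in> lhull U" "bad U \<xi> < \<alpha>"
  obtains \<mu> where "\<mu> > 0" "\<And>\<zeta>. \<zeta> \<in> S \<Longrightarrow> dist \<xi> \<zeta> < \<mu> \<Longrightarrow> \<zeta> \<in> lhull U \<and> bad U \<zeta> < \<alpha>"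
proof -
  let ?B = "ball (0::real^'n) 1"
  obtain \<phi> C \<mu> where *: "pert (ball 0 1) \<phi>" "compact C" "C \<subseteq> ball 0 1" "\<mu> > 0"
    "(1 - \<alpha>) * measure lebesgue ?B < measure lebesgue C"
    "\<And>y \<zeta>. \<zeta> \<in> S \<Longrightarrow> dist (\<xi> + J \<phi> y) \<zeta> < \<mu> \<Longrightarrow> \<zeta> \<in> lhull U"
    "\<And>y \<zeta>. y \<in> C \<Longrightarrow> \<zeta> \<in> S \<Longrightarrow> dist (\<xi> + J \<phi> y) \<zeta> < \<mu> \<Longrightarrow> \<zeta> \<in> U"
    using bad_margin[OF U \<xi>] by blast
  obtain K where K: "compact K" "K \<subseteq> ball 0 1" "\<And>x. x \<notin> K \<Longrightarrow> J \<phi> x = 0"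
    using J_support[OF pert_test[OF *(1)]] by metis
  define \<theta> where "\<theta> = (measure lebesgue ?B - measure lebesgue C) / measure lebesgue ?B"
  have CB: "measure lebesgue C \<le> measure lebesgue ?B"
    using *(2,3) by (intro measure_mono_fmeasurable) (auto simp: lmeasurable_compact fmeasurableD)
  have \<theta>: "0 \<le> \<theta>" "\<theta> < \<alpha>" using CB ball_pos[of 1 0] *(5) by (auto simp: \<theta>_def field_simps)
  have "\<zeta> \<in> lhull U \<and> bad U \<zeta> < \<alpha>" if \<zeta>: "\<zeta> \<in> S" "dist \<xi> \<zeta> < \<mu>" for \<zeta>
  proof -
    have S': "\<zeta> + J \<phi> y \<in> S" for y using pert_S[OF *(1)] \<zeta>(1) by blast
    have d: "dist (\<xi> + J \<phi> y) (\<zeta> + J \<phi> y) < \<mu>" for y using \<zeta>(2) by (simp add: dist_norm)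
    have h: "\<zeta> + J \<phi> y \<in> lhull U" for y using *(6)[OF S' d] .
    have "measure lebesgue {x \<in> ?B. \<zeta> + J \<phi> x \<notin> U} \<le> measure lebesgue (?B - C)"
    proof (rule measure_mono_fmeasurable)
      show "{x \<in> ?B. \<zeta> + J \<phi> x \<notin> U} \<subseteq> ?B - C" using *(7)[OF _ S' d] by auto
      obtain T where T: "open T" "U = S \<inter> T" using U by (auto simp: openin_open)
      have "{x \<in> ?B. \<zeta> + J \<phi> x \<notin> U} = ?B - (\<lambda>x. \<zeta> + J \<phi> x) -` T" using S' T by auto
      moreover have "open ((\<lambda>x. \<zeta> + J \<phi> x) -` T)"
        by (intro open_vimage[OF T(1)] continuous_intros continuous_on_J[OF pert_test[OF *(1)]])
      ultimately show "{x \<in> ?B. \<zeta> + J \<phi> x \<notin> U} \<in> sets lebesgue" by auto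
      show "?B - C \<in> lmeasurable" using *(2) by (intro fmeasurable.Diff) (auto simp: lmeasurable_compact)
    qed
    also have "\<dots> = measure lebesgue ?B - measure lebesgue C"
      using *(2,3) by (simp add: measurable_measure_Diff fmeasurableD lmeasurable_compact)
    also have "\<dots> = \<theta> * measure lebesgue ?B" using ball_pos[of 1 0] by (simp add: \<theta>_def)
    finally have "ach U \<zeta> \<theta>" unfolding ach_def using \<theta> *(1) h by blast
    moreover have "\<zeta> \<in> lhull U"
    proof -
      \<comment> \<open>A point off the support, where \<open>J \<phi>\<close> vanishes, shows that
        \<open>\<zeta>\<close> itself lies in the hull.\<close>
      obtain y where "y \<notin> K" using K(2) not_bounded_UNIV[where 'a="real^'n"] bounded_subset[OF bounded_ball[of 0 1], of UNIV] by blast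
      then show ?thesis using h[of y] K(3) by simp
    qed
    ultimately show ?thesis using bad_le[of U \<zeta> \<theta>] \<theta>(2) by auto
  qed
  with *(4) show ?thesis by (rule that)
qed


lemma measure_ball_image:
  fixes x0 :: "real^'n"
  assumes "r > 0"
  shows "(\<lambda>y. x0 + r *\<^sub>R y) ` ball 0 1 = ball x0 (r::real)"
    "measure lebesgue ((\<lambda>y. x0 + r *\<^sub>R y) ` A) = r ^ CARD('n) * measure lebesgue A"
proof -
  show "(\<lambda>y. x0 + r *\<^sub>R y) ` ball 0 1 = ball x0 r"
  proof (intro equalityI subsetI)
    fix x assume "x \<in> ball x0 r"
    then have "x = x0 + r *\<^sub>R (inverse r *\<^sub>R (x - x0))" "inverse r *\<^sub>R (x - x0) \<in> ball 0 1"
      using assms by (simp_all add: dist_norm norm_minus_commute inverse_eq_divide divide_less_eq)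
    then show "x \<in> (\<lambda>y. x0 + r *\<^sub>R y) ` ball 0 1" by blast
  qed (use assms in \<open>auto simp: dist_norm\<close>)
  show "measure lebesgue ((\<lambda>y. x0 + r *\<^sub>R y) ` A) = r ^ CARD('n) * measure lebesgue A"
    using measure_lebesgue_affine[of r x0 A] assms by (simp add: add.commute)
qed

text \<open>A nearly optimal perturbation for the constant \<open>g x0\<close> is shrunk to a ball
  on which \<open>g\<close> stays within the margin \<open>\<mu>\<close> of that value. The further
  bound \<open>\<epsilon> / B\<close> on the radius makes it uniformly small.\<close>

lemma perturb_local:
  assumes U: "openin (top_of_set S) U" and E: "open E" "x0 \<in> E"
    and g: "continuous_on E g" "\<And>x. x \<in> E \<Longrightarrow> g x \<in> S" "g x0 \<in> lhull U" "bad U (g x0) < \<alpha>"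
    and \<epsilon>: "\<epsilon> > 0"
  obtains r0 where "r0 > 0" "\<And>r. 0 < r \<Longrightarrow> r < r0 \<Longrightarrow> ball x0 r \<subseteq> E"
    "\<And>r. 0 < r \<Longrightarrow> r < r0 \<Longrightarrow> \<exists>\<phi>. pert (ball x0 r) \<phi> \<and> (\<forall>x. norm (\<phi> x) \<le> \<epsilon>) \<and>
      (\<forall>x\<in>ball x0 r. g x + J \<phi> x \<in> lhull U) \<and>
      measure lebesgue {x \<in> ball x0 r. g x + J \<phi> x \<notin> U} \<le> \<alpha> * measure lebesgue (ball x0 r)"
proof -
  let ?B = "ball (0::real^'n) 1"
  obtain \<phi> C \<mu> where *: "pert (ball 0 1) \<phi>" "compact C" "C \<subseteq> ball 0 1" "\<mu> > 0"
    "(1 - \<alpha>) * measure lebesgue ?B < measure lebesgue C"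
    "\<And>y \<zeta>. \<zeta> \<in> S \<Longrightarrow> dist (g x0 + J \<phi> y) \<zeta> < \<mu> \<Longrightarrow> \<zeta> \<in> lhull U"
    "\<And>y \<zeta>. y \<in> C \<Longrightarrow> \<zeta> \<in> S \<Longrightarrow> dist (g x0 + J \<phi> y) \<zeta> < \<mu> \<Longrightarrow> \<zeta> \<in> U"
    using bad_margin[OF U g(3,4)] by blast
  obtain B where B: "B > 0" "\<And>x. norm (\<phi> x) \<le> B" using J_bounded[OF pert_test[OF *(1)]] by metis
  obtain d where d: "d > 0" "ball x0 d \<subseteq> E" using E open_contains_ball by metis
  obtain d' where d': "d' > 0" "\<And>x. x \<in> E \<Longrightarrow> dist x x0 < d' \<Longrightarrow> dist (g x) (g x0) < \<mu>"
    using g(1) E(2) *(4) unfolding continuous_on_iff by metis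
  define r0 where "r0 = min (min d d') (\<epsilon> / B)"
  have r0: "r0 > 0" using d d' \<epsilon> B by (simp add: r0_def)
  show ?thesis
  proof (rule that[OF r0])
    fix r :: real assume r: "0 < r" "r < r0"
    show sub: "ball x0 r \<subseteq> E" using d(2) subset_ball[of r d x0] r by (simp add: r0_def)
    define \<psi> where "\<psi> x = r *\<^sub>R \<phi> (inverse r *\<^sub>R (x - x0))" for x
    have \<psi>: "pert (ball x0 r) \<psi>" unfolding \<psi>_def by (rule pert_rescale[OF *(1) r(1)])
    have J\<psi>: "J \<psi> x = J \<phi> (inverse r *\<^sub>R (x - x0))" for x
      unfolding \<psi>_def by (rule J_rescale[OF pert_test[OF *(1)] r(1)])
    have small: "norm (\<psi> x) \<le> \<epsilon>" for x
    proof -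
      have "norm (\<psi> x) \<le> r * B" using r(1) B(2) by (simp add: \<psi>_def)
      also have "\<dots> \<le> \<epsilon> / B * B" using r B by (intro mult_right_mono) (auto simp: r0_def)
      finally show ?thesis using B by simp
    qed
    have S': "g x + J \<psi> x \<in> S" if "x \<in> ball x0 r" for x
      using pert_S[OF \<psi>] g(2) sub that by blast
    have cl: "dist (g x0 + J \<phi> (inverse r *\<^sub>R (x - x0))) (g x + J \<psi> x) < \<mu>" if "x \<in> ball x0 r" for x
    proof -
      have "dist (g x) (g x0) < \<mu>" using that sub r by (intro d'(2)) (auto simp: dist_commute r0_def)
      then show ?thesis by (simp add: J\<psi> dist_norm norm_minus_commute)
    qed
    have hull': "g x + J \<psi> x \<in> lhull U" if "x \<in> ball x0 r" for x
      by (rule *(6)[OF S'[OF that] cl[OF that]])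
    let ?C = "(\<lambda>y. x0 + r *\<^sub>R y) ` C"
    have cC: "compact ?C" using *(2) by (intro compact_continuous_image continuous_intros)
    have CB: "?C \<subseteq> ball x0 r" using *(3) measure_ball_image(1)[OF r(1), of x0] by blast
    have "measure lebesgue {x \<in> ball x0 r. g x + J \<psi> x \<notin> U} \<le> measure lebesgue (ball x0 r - ?C)"
    proof (rule measure_mono_fmeasurable)
      show "{x \<in> ball x0 r. g x + J \<psi> x \<notin> U} \<subseteq> ball x0 r - ?C"
      proof safe
        fix y assume y: "y \<in> C" "x0 + r *\<^sub>R y \<in> ball x0 r" "g (x0 + r *\<^sub>R y) + J \<psi> (x0 + r *\<^sub>R y) \<notin> U"
        have "inverse r *\<^sub>R (x0 + r *\<^sub>R y - x0) = y" using r(1) by simp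
        then show False using *(7)[OF y(1) S'[OF y(2)]] cl[OF y(2)] y(3) by metis
      qed
      obtain T where T: "open T" "U = S \<inter> T" using U by (auto simp: openin_open)
      have "open (ball x0 r \<inter> (\<lambda>x. g x + J \<psi> x) -` T)"
        using sub by (intro continuous_open_preimage T(1) continuous_intros continuous_on_J[OF pert_test[OF \<psi>]]
            continuous_on_subset[OF g(1)]) auto
      moreover have "{x \<in> ball x0 r. g x + J \<psi> x \<notin> U} = ball x0 r - (ball x0 r \<inter> (\<lambda>x. g x + J \<psi> x) -` T)"
        using S' T by auto
      ultimately show "{x \<in> ball x0 r. g x + J \<psi> x \<notin> U} \<in> sets lebesgue" by auto
      show "ball x0 r - ?C \<in> lmeasurable" using cC by (intro fmeasurable.Diff) (auto simp: lmeasurable_compact)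
    qed
    also have "\<dots> = measure lebesgue (ball x0 r) - measure lebesgue ?C"
      using measurable_measure_Diff[OF lmeasurable_ball fmeasurableD[OF lmeasurable_compact[OF cC]] CB] .
    also have "\<dots> = r ^ CARD('n) * (measure lebesgue ?B - measure lebesgue C)"
      using measure_ball_image(1)[OF r(1), of x0] measure_ball_image(2)[OF r(1), of x0] by (metis right_diff_distrib)
    also have "\<dots> \<le> r ^ CARD('n) * (\<alpha> * measure lebesgue ?B)"
      using *(5) r(1) by (intro mult_left_mono) (auto simp: algebra_simps)
    also have "\<dots> = \<alpha> * measure lebesgue (ball x0 r)"
      using measure_ball_image(1)[OF r(1), of x0] measure_ball_image(2)[OF r(1), of x0 ?B] by (simp add: mult_ac)
    finally show "\<exists>\<phi>. pert (ball x0 r) \<phi> \<and> (\<forall>x. norm (\<phi> x) \<le> \<epsilon>) \<and>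
      (\<forall>x\<in>ball x0 r. g x + J \<phi> x \<in> lhull U) \<and>
      measure lebesgue {x \<in> ball x0 r. g x + J \<phi> x \<notin> U} \<le> \<alpha> * measure lebesgue (ball x0 r)"
      using \<psi> small hull' by blast
  qed
qed

section \<open>Patching local perturbations\<close>

lemma pert_disjoint_sum:
  assumes fin: "finite I" and dis: "\<And>i j. i \<in> I \<Longrightarrow> j \<in> I \<Longrightarrow> i \<noteq> j \<Longrightarrow> D i \<inter> D j = {}"
    and p: "\<And>i. i \<in> I \<Longrightarrow> pert (D i) (\<Phi> i)" "\<And>i. i \<in> I \<Longrightarrow> D i \<subseteq> E"
  defines "\<phi> \<equiv> \<lambda>x. \<Sum>i\<in>I. \<Phi> i x"
  shows "pert E \<phi>" "\<And>x. J \<phi> x = (\<Sum>i\<in>I. J (\<Phi> i) x)"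
    "\<And>i x. i \<in> I \<Longrightarrow> x \<in> D i \<Longrightarrow> \<phi> x = \<Phi> i x \<and> J \<phi> x = J (\<Phi> i) x"
    "\<And>x. (\<And>i. i \<in> I \<Longrightarrow> x \<notin> D i) \<Longrightarrow> \<phi> x = 0 \<and> J \<phi> x = 0"
proof -
  have p': "pert E (\<Phi> i)" if "i \<in> I" for i using p[OF that] pert_mono by blast
  show "pert E \<phi>" unfolding \<phi>_def by (intro pert_sum fin p')
  show Jsum: "J \<phi> x = (\<Sum>i\<in>I. J (\<Phi> i) x)" for x
    unfolding \<phi>_def by (rule J_sum[OF fin pert_test[OF p']])
  have z: "\<Phi> i x = 0" "J (\<Phi> i) x = 0" if "i \<in> I" "x \<notin> D i" for i x
    using J_outside[OF pert_test[OF p(1)[OF that(1)]] that(2)] by auto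
  show "\<phi> x = \<Phi> i x \<and> J \<phi> x = J (\<Phi> i) x" if i: "i \<in> I" "x \<in> D i" for i x
  proof -
    have o: "x \<notin> D j" if "j \<in> I - {i}" for j using dis[of i j] i that by auto
    show ?thesis
      unfolding Jsum unfolding \<phi>_def sum.remove[OF fin i(1)]
      using z o by (auto intro!: sum.neutral)
  qed
  show "\<phi> x = 0 \<and> J \<phi> x = 0" if "\<And>i. i \<in> I \<Longrightarrow> x \<notin> D i" for x
    unfolding Jsum unfolding \<phi>_def using z that by (auto intro!: sum.neutral)
qed

end

text \<open>Vitali covers almost all of \<open>E\<close> by countably many disjoint balls; finitely
  many of them already leave less than \<open>\<eta>\<close>. Finiteness keeps sums of perturbations
  test functions and unions of closed balls closed.\<close>

lemma vitali_finite_balls: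
  fixes E :: "(real^'n) set"
  assumes E: "open E" "bounded E" and r0: "\<And>x. x \<in> E \<Longrightarrow> r0 x > 0" and sub: "\<And>x r. x \<in> E \<Longrightarrow> 0 < r \<Longrightarrow> r < r0 x \<Longrightarrow> ball x r \<subseteq> E"
    and \<eta>: "\<eta> > 0"
  obtains I where "finite I" "\<And>x r. (x, r) \<in> I \<Longrightarrow> x \<in> E \<and> 0 < r \<and> r < r0 x"
    "\<And>i j. i \<in> I \<Longrightarrow> j \<in> I \<Longrightarrow> i \<noteq> j \<Longrightarrow> ball (fst i) (snd i) \<inter> ball (fst j) (snd j) = {}"
    "measure lebesgue (E - (\<Union>i\<in>I. ball (fst i) (snd i))) < (\<eta>::real)"
proof -
  define K where "K = {(x, r). x \<in> E \<and> 0 < r \<and> r < r0 x}"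
  have "\<exists>i. i \<in> K \<and> x \<in> ball (fst i) (snd i) \<and> snd i < d" if "x \<in> E" "0 < d" for x d
    using that r0[OF that(1)] by (intro exI[of _ "(x, min d (r0 x) / 2)"]) (auto simp: K_def min_def)
  then obtain C where C: "countable C" "C \<subseteq> K"
    "pairwise (\<lambda>i j. disjnt (ball (fst i) (snd i)) (ball (fst j) (snd j))) C"
    "negligible (E - (\<Union>i\<in>C. ball (fst i) (snd i)))"
    using Vitali_covering_theorem_balls[of E K fst snd] by blast
  \<comment> \<open>Intersecting with \<open>C\<close> guards against empty \<open>C\<close>, where
    \<open>from_nat_into\<close> returns an arbitrary value.\<close>
  define I where "I N = C \<inter> from_nat_into C ` {..<N}" for N :: nat
  define A where "A N = E - (\<Union>i\<in>I N. ball (fst i) (snd i))" for N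
  have UI: "(\<Union>N. I N) = C"
  proof (cases "C = {}")
    case False
    have "c \<in> (\<Union>N. I N)" if "c \<in> C" for c
    proof -
      have "from_nat_into C (to_nat_on C c) = c" using from_nat_into_to_nat_on[OF C(1) that] .
      then show ?thesis using that by (auto simp: I_def intro!: exI[of _ "Suc (to_nat_on C c)"] image_eqI[of c _ "to_nat_on C c"])
    qed
    then show ?thesis by (auto simp: I_def)
  qed (simp add: I_def)
  have El: "E \<in> lmeasurable" using E by (rule lmeasurable_open[rotated])
  have Al: "A N \<in> lmeasurable" for N
  proof -
    have "open (\<Union>i\<in>I N. ball (fst i) (snd i))" by auto
    then show ?thesis unfolding A_def using El by (intro fmeasurable_Diff) auto
  qed
  have "(\<lambda>N. measure lebesgue (A N)) \<longlonglongrightarrow> measure lebesgue (\<Inter>N. A N)"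
  proof (rule Lim_measure_decseq)
    show "range A \<subseteq> sets lebesgue" using Al by (auto simp: fmeasurableD)
    show "decseq A" unfolding decseq_def A_def I_def by (auto; force)
    show "emeasure lebesgue (A i) \<noteq> \<infinity>" for i using Al[of i] by (auto simp: fmeasurable_def)
  qed
  moreover have "(\<Inter>N. A N) = E - (\<Union>i\<in>C. ball (fst i) (snd i))"
    unfolding A_def UI[symmetric] by auto
  then have "measure lebesgue (\<Inter>N. A N) = 0"
    using negligible_imp_measure0[OF C(4)] by simp
  ultimately obtain N where N: "measure lebesgue (A N) < \<eta>"
    using \<eta> order_tendstoD(2)[of _ 0 sequentially \<eta>] by (auto simp: eventually_sequentially)
  show ?thesis
  proof (rule that[of "I N"])
    show "ball (fst i) (snd i) \<inter> ball (fst j) (snd j) = {}" if "i \<in> I N" "j \<in> I N" "i \<noteq> j" for i j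
      using C(3) that by (auto simp: I_def pairwise_def disjnt_def)
  qed (use N C(2) in \<open>auto simp: I_def A_def K_def\<close>)
qed

context linear_constraint
begin

text \<open>\<open>lev\<close> selects the target set, \<open>\<beta>\<close> bounds the local bad
  fraction, and \<open>H\<close> lists the fields to which the new gradient has to be nearly
  orthogonal. Small disjoint balls, on which \<open>lev\<close> is constant and the rest almost so,
  carry perturbations from \<open>perturb_local\<close>; off the balls nothing changes and the hull
  condition persists. The missed measure adds up to a Riemann sum of \<open>\<beta>\<close>, and on
  each ball only the oscillation of \<open>h\<close> contributes, because gradients of test
  functions have mean zero.\<close>

lemma patching:
  fixes E :: "(real^'n) set" and g :: "real^'n \<Rightarrow> real^'n^'m" and Us :: "nat \<Rightarrow> (real^'n^'m) set"
  assumes E: "open E" "bounded E" and lev: "\<And>j. open {x \<in> E. lev x = (j::nat)}"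
    and Us: "\<And>j. openin (top_of_set S) (Us j)" and R: "\<And>j. lhull (Us j) \<subseteq> cball 0 R"
    and g: "continuous_on E g" "\<And>x. x \<in> E \<Longrightarrow> g x \<in> lhull (Us (lev x))"
    and \<beta>: "continuous_on E \<beta>" "integrable (lebesgue_on E) \<beta>" "\<And>x. x \<in> E \<Longrightarrow> bad (Us (lev x)) (g x) < \<beta> x"
    and H: "finite H" "\<And>h. h \<in> H \<Longrightarrow> continuous_on E h"
    and \<epsilon>: "\<epsilon> > 0"
  obtains \<phi> where "pert E \<phi>" "\<And>x. norm (\<phi> x) \<le> \<epsilon>" "\<And>x. x \<in> E \<Longrightarrow> g x + J \<phi> x \<in> lhull (Us (lev x))"
    "measure lebesgue {x \<in> E. g x + J \<phi> x \<notin> Us (lev x)} \<le> integral\<^sup>L (lebesgue_on E) \<beta> + \<epsilon>"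
    "\<And>h. h \<in> H \<Longrightarrow> \<bar>integral\<^sup>L (lebesgue_on E) (\<lambda>x. h x \<bullet> J \<phi> x)\<bar> \<le> \<epsilon>"
proof (cases "E = {}")
  case True
  show ?thesis
    by (rule that[of "\<lambda>_. 0"]) (use True \<epsilon> in \<open>auto simp: pert_zero J_zero\<close>)
next
  case False
  have El: "E \<in> lmeasurable" using E by (rule lmeasurable_open[rotated])
  obtain x1 where "x1 \<in> E" using False by blast
  then have R0: "0 \<le> R" using g(2) R by (metis mem_cball_0 norm_ge_zero order_trans subsetD)
  \<comment> \<open>Nonnegativity lets the integral of \<open>\<beta>\<close> over the balls be
    bounded by the integral over \<open>E\<close>.\<close>
  have \<beta>0: "0 \<le> \<beta> x" if "x \<in> E" for x
    using \<beta>(3)[OF that] bad_nonneg[OF g(2)[OF that]] by simp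
  \<comment> \<open>One tolerance for all oscillations: the missed measure changes by at most
    \<open>e * measure lebesgue E\<close>, the inner products by at most
    \<open>e * (2 * R) * measure lebesgue E\<close>, where \<open>2 * R\<close> bounds the
    difference of two matrices in the hulls.\<close>
  define e where "e = \<epsilon> / (2 * (measure lebesgue E + 1) * (2 * R + 1))"
  have den: "2 * (measure lebesgue E + 1) * (2 * R + 1) > 0" using R0 by (intro mult_pos_pos) (auto simp: add_nonneg_pos)
  have e: "e > 0" using \<epsilon> den by (simp add: e_def)
  have e1: "e * measure lebesgue E \<le> \<epsilon> / 2" and e2: "e * (2 * R) * measure lebesgue E \<le> \<epsilon>"
  proof -
    let ?m = "measure lebesgue E"
    have eq: "e * (2 * (?m + 1) * (2 * R + 1)) = \<epsilon>"
      using den unfolding e_def by (metis less_irrefl nonzero_eq_divide_eq)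
    have "e * (2 * ?m) \<le> e * (2 * (?m + 1) * (2 * R + 1))"
      using R0 e by (intro mult_left_mono) (auto simp: algebra_simps)
    then show "e * ?m \<le> \<epsilon> / 2" using eq by simp
    have "e * (2 * R * ?m) \<le> e * (2 * (?m + 1) * (2 * R + 1))"
      using R0 e by (intro mult_left_mono) (auto simp: algebra_simps)
    then show "e * (2 * R) * ?m \<le> \<epsilon>" using eq by (simp add: mult_ac)
  qed
  define Q where "Q x r \<longleftrightarrow> ball x r \<subseteq> E \<and> (\<forall>y\<in>ball x r. lev y = lev x) \<and>
      (\<forall>y\<in>ball x r. \<beta> x - e \<le> \<beta> y) \<and> (\<forall>h\<in>H. \<forall>y\<in>ball x r. norm (h y - h x) \<le> e) \<and>
      (\<exists>\<phi>. pert (ball x r) \<phi> \<and> (\<forall>y. norm (\<phi> y) \<le> \<epsilon>) \<and>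
        (\<forall>y\<in>ball x r. g y + J \<phi> y \<in> lhull (Us (lev x))) \<and>
        measure lebesgue {y \<in> ball x r. g y + J \<phi> y \<notin> Us (lev x)} \<le> \<beta> x * measure lebesgue (ball x r))" for x r
  have loc: "\<exists>r0>0. \<forall>r. 0 < r \<and> r < r0 \<longrightarrow> Q x r"
    if x: "x \<in> E" for x
  proof -
    have near: "\<exists>d>0. \<forall>y\<in>ball x d \<inter> E. norm (f y - f x) \<le> e" if cf: "continuous_on E f"
      for f :: "real^'n \<Rightarrow> 'z::real_normed_vector"
    proof -
      obtain d where "d > 0" "\<And>y. y \<in> E \<Longrightarrow> dist y x < d \<Longrightarrow> dist (f y) (f x) < e"
        using cf x e unfolding continuous_on_iff by metis
      then show ?thesis by (intro exI[of _ d]) (auto simp: dist_commute dist_norm less_imp_le)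
    qed
    obtain d1 where d1: "d1 > 0" "\<And>y. y \<in> ball x d1 \<inter> E \<Longrightarrow> norm (\<beta> y - \<beta> x) \<le> e"
      using near[OF \<beta>(1)] by blast
    have "\<exists>d>0. \<forall>h\<in>H. \<forall>y\<in>ball x d \<inter> E. norm (h y - h x) \<le> e"
      using H(1,2)
    proof (induction H rule: finite_induct)
      case empty then show ?case by (auto intro: exI[of _ 1])
    next
      case (insert h H)
      then obtain d d' where d: "d > 0" "\<forall>h\<in>H. \<forall>y\<in>ball x d \<inter> E. norm (h y - h x) \<le> e"
        "d' > 0" "\<forall>y\<in>ball x d' \<inter> E. norm (h y - h x) \<le> e"
        using near[of h] by (metis insertCI)
      then show ?case by (intro exI[of _ "min d d'"]) auto
    qed
    then obtain d2 where d2: "d2 > 0" "\<And>h y. h \<in> H \<Longrightarrow> y \<in> ball x d2 \<inter> E \<Longrightarrow> norm (h y - h x) \<le> e"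
      by blast
    obtain d3 where d3: "d3 > 0" "ball x d3 \<subseteq> {y \<in> E. lev y = lev x}"
      using lev[of "lev x"] x open_contains_ball by (metis (mono_tags, lifting) mem_Collect_eq)
    have gS: "g y \<in> S" if "y \<in> E" for y using g(2)[OF that] hull_subset_S by blast
    obtain r0 where r0: "r0 > 0" "\<And>r. 0 < r \<Longrightarrow> r < r0 \<Longrightarrow> ball x r \<subseteq> E"
      "\<And>r. 0 < r \<Longrightarrow> r < r0 \<Longrightarrow> \<exists>\<phi>. pert (ball x r) \<phi> \<and> (\<forall>x. norm (\<phi> x) \<le> \<epsilon>) \<and>
      (\<forall>y\<in>ball x r. g y + J \<phi> y \<in> lhull (Us (lev x))) \<and>
      measure lebesgue {y \<in> ball x r. g y + J \<phi> y \<notin> Us (lev x)} \<le> \<beta> x * measure lebesgue (ball x r)"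
      using perturb_local[OF Us E(1) x g(1) gS g(2)[OF x] \<beta>(3)[OF x] \<epsilon>] by blast
    define m where "m = min (min r0 d3) (min d1 d2)"
    have "Q x r" if r: "0 < r" "r < m" for r
      unfolding Q_def
    proof (intro conjI)
      have rr: "r < r0" "r \<le> d3" "r \<le> d1" "r \<le> d2" using r by (auto simp: m_def)
      show sub: "ball x r \<subseteq> E" by (rule r0(2)[OF r(1) rr(1)])
      show "\<forall>y\<in>ball x r. lev y = lev x" using d3(2) subset_ball[OF rr(2), of x] by auto
      show "\<forall>y\<in>ball x r. \<beta> x - e \<le> \<beta> y"
      proof
        fix y assume "y \<in> ball x r"
        then have "norm (\<beta> y - \<beta> x) \<le> e" using sub subset_ball[OF rr(3), of x] by (intro d1(2)) blast
        then show "\<beta> x - e \<le> \<beta> y" by (simp add: abs_le_iff)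
      qed
      show "\<forall>h\<in>H. \<forall>y\<in>ball x r. norm (h y - h x) \<le> e" using d2(2) subset_ball[OF rr(4), of x] sub by blast
      show "\<exists>\<phi>. pert (ball x r) \<phi> \<and> (\<forall>y. norm (\<phi> y) \<le> \<epsilon>) \<and>
        (\<forall>y\<in>ball x r. g y + J \<phi> y \<in> lhull (Us (lev x))) \<and>
        measure lebesgue {y \<in> ball x r. g y + J \<phi> y \<notin> Us (lev x)} \<le> \<beta> x * measure lebesgue (ball x r)"
        by (rule r0(3)[OF r(1) rr(1)])
    qed
    moreover have "m > 0" using r0(1) d1(1) d2(1) d3(1) by (simp add: m_def)
    ultimately show ?thesis by blast
  qed
  then obtain r0 where r0: "\<And>x. x \<in> E \<Longrightarrow> r0 x > 0" "\<And>x r. x \<in> E \<Longrightarrow> 0 < r \<Longrightarrow> r < r0 x \<Longrightarrow>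
      Q x r"
    by metis
  have subE: "ball x r \<subseteq> E" if "x \<in> E" "0 < r" "r < r0 x" for x r
    using r0(2)[OF that] by (simp add: Q_def)
  have e20: "\<epsilon> / 2 > 0" using \<epsilon> by simp
  obtain I where I: "finite I" "\<And>x r. (x, r) \<in> I \<Longrightarrow> x \<in> E \<and> 0 < r \<and> r < r0 x"
    "\<And>i j. i \<in> I \<Longrightarrow> j \<in> I \<Longrightarrow> i \<noteq> j \<Longrightarrow> ball (fst i) (snd i) \<inter> ball (fst j) (snd j) = {}"
    "measure lebesgue (E - (\<Union>i\<in>I. ball (fst i) (snd i))) < \<epsilon> / 2"
  proof (rule vitali_finite_balls[OF E r0(1) subE e20])
    fix I :: "((real^'n) \<times> real) set"
    assume "finite I" "\<And>x r. (x, r) \<in> I \<Longrightarrow> x \<in> E \<and> 0 < r \<and> r < r0 x"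
      "\<And>i j. i \<in> I \<Longrightarrow> j \<in> I \<Longrightarrow> i \<noteq> j \<Longrightarrow> ball (fst i) (snd i) \<inter> ball (fst j) (snd j) = {}"
      "measure lebesgue (E - (\<Union>i\<in>I. ball (fst i) (snd i))) < \<epsilon> / 2"
    then show thesis by (rule that)
  qed
  define B where "B i = ball (fst i) (snd i)" for i :: "(real^'n) \<times> real"
  have i: "fst i \<in> E" "B i \<subseteq> E" "\<And>y. y \<in> B i \<Longrightarrow> lev y = lev (fst i)"
    "\<And>y. y \<in> B i \<Longrightarrow> \<beta> (fst i) - e \<le> \<beta> y" "\<And>h y. h \<in> H \<Longrightarrow> y \<in> B i \<Longrightarrow> norm (h y - h (fst i)) \<le> e"
    "\<exists>\<phi>. pert (B i) \<phi> \<and> (\<forall>y. norm (\<phi> y) \<le> \<epsilon>) \<and>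
        (\<forall>y\<in>B i. g y + J \<phi> y \<in> lhull (Us (lev (fst i)))) \<and>
        measure lebesgue {y \<in> B i. g y + J \<phi> y \<notin> Us (lev (fst i))} \<le> \<beta> (fst i) * measure lebesgue (B i)"
    if "i \<in> I" for i
  proof -
    have a: "fst i \<in> E" "0 < snd i" "snd i < r0 (fst i)"
      using I(2)[of "fst i" "snd i"] that by simp_all
    note k = r0(2)[OF a, unfolded Q_def, folded B_def]
    show "fst i \<in> E" by (rule a(1))
    show "B i \<subseteq> E" using k by blast
    show "lev y = lev (fst i)" if "y \<in> B i" for y using k that by blast
    show "\<beta> (fst i) - e \<le> \<beta> y" if "y \<in> B i" for y using k that by blast
    show "norm (h y - h (fst i)) \<le> e" if "h \<in> H" "y \<in> B i" for h y using k that by blast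
    show "\<exists>\<phi>. pert (B i) \<phi> \<and> (\<forall>y. norm (\<phi> y) \<le> \<epsilon>) \<and>
        (\<forall>y\<in>B i. g y + J \<phi> y \<in> lhull (Us (lev (fst i)))) \<and>
        measure lebesgue {y \<in> B i. g y + J \<phi> y \<notin> Us (lev (fst i))} \<le> \<beta> (fst i) * measure lebesgue (B i)"
      using k by blast
  qed
  define \<Phi> where "\<Phi> i = (SOME \<phi>. pert (B i) \<phi> \<and> (\<forall>y. norm (\<phi> y) \<le> \<epsilon>) \<and>
        (\<forall>y\<in>B i. g y + J \<phi> y \<in> lhull (Us (lev (fst i)))) \<and>
        measure lebesgue {y \<in> B i. g y + J \<phi> y \<notin> Us (lev (fst i))} \<le> \<beta> (fst i) * measure lebesgue (B i))" for i
  note \<Phi>0 = someI_ex[OF i(6), folded \<Phi>_def]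
  have \<Phi>: "pert (B i) (\<Phi> i)" "\<And>y. norm (\<Phi> i y) \<le> \<epsilon>"
    "\<And>y. y \<in> B i \<Longrightarrow> g y + J (\<Phi> i) y \<in> lhull (Us (lev (fst i)))"
    "measure lebesgue {y \<in> B i. g y + J (\<Phi> i) y \<notin> Us (lev (fst i))} \<le> \<beta> (fst i) * measure lebesgue (B i)"
    if "i \<in> I" for i
    using \<Phi>0[OF that] by simp_all
  define \<phi> where "\<phi> x = (\<Sum>i\<in>I. \<Phi> i x)" for x
  have dis: "B i \<inter> B j = {}" if "i \<in> I" "j \<in> I" "i \<noteq> j" for i j
    using I(3)[OF that] by (simp add: B_def)
  have \<phi>_eq: "\<phi> = (\<lambda>x. \<Sum>i\<in>I. \<Phi> i x)" by (simp add: fun_eq_iff \<phi>_def)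
  have \<phi>: "pert E \<phi>" "\<And>x. J \<phi> x = (\<Sum>i\<in>I. J (\<Phi> i) x)"
    "\<And>i x. i \<in> I \<Longrightarrow> x \<in> B i \<Longrightarrow> \<phi> x = \<Phi> i x \<and> J \<phi> x = J (\<Phi> i) x"
    "\<And>x. (\<And>i. i \<in> I \<Longrightarrow> x \<notin> B i) \<Longrightarrow> \<phi> x = 0 \<and> J \<phi> x = 0"
    unfolding \<phi>_eq
    by (rule pert_disjoint_sum(1)[OF I(1) dis \<Phi>(1) i(2)] pert_disjoint_sum(2)[OF I(1) dis \<Phi>(1) i(2)]
        pert_disjoint_sum(3)[OF I(1) dis \<Phi>(1) i(2)] pert_disjoint_sum(4)[OF I(1) dis \<Phi>(1) i(2)]; assumption?; blast)+
  have Bl: "B i \<in> lmeasurable" for i by (simp add: B_def)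
  have sumB: "(\<Sum>i\<in>I. measure lebesgue (B i)) \<le> measure lebesgue E"
  proof -
    have "(\<Sum>i\<in>I. measure lebesgue (B i)) = measure lebesgue (\<Union>i\<in>I. B i)"
      using I(1,3) Bl by (intro measure_UNION'[symmetric]) (auto simp: pairwise_def disjnt_def B_def)
    also have "\<dots> \<le> measure lebesgue E"
      using i(2) El I(1) Bl by (intro measure_mono_fmeasurable sets.finite_UN) (auto simp: fmeasurableD)
    finally show ?thesis .
  qed
  have hull: "g x + J \<phi> x \<in> lhull (Us (lev x))" if x: "x \<in> E" for x
  proof (cases "\<exists>i\<in>I. x \<in> B i")
    case True
    then obtain k where k: "k \<in> I" "x \<in> B k" by blast
    then show ?thesis using \<Phi>(3)[OF k] \<phi>(3)[OF k] i(3)[OF k] by simp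
  qed (use \<phi>(4) g(2)[OF x] in auto)
  have intB: "integrable (lebesgue_on E) (\<lambda>x. f x * indicator (B k) x)" if "integrable (lebesgue_on E) f" "k \<in> I"
    for f :: "real^'n \<Rightarrow> real" and k
    using integrable_real_mult_indicator[OF _ that(1), of "B k"] i(2)[OF that(2)] Bl[of k] E(1)
    by (simp add: sets_restrict_space_iff fmeasurableD)
  have mB: "integral\<^sup>L (lebesgue_on E) (\<lambda>x. c * indicator (B k) x) = c * measure lebesgue (B k)" if "k \<in> I" for c k
    using i(2)[OF that] El Bl[of k]
    by (simp add: measure_restrict_space fmeasurableD Int_absorb2)
  have constE: "integrable (lebesgue_on E) (\<lambda>x. c::real)" for c
    by (rule finite_measure.integrable_const[OF finite_measure_lebesgue_on[OF El]])
  have "measure lebesgue {x \<in> E. g x + J \<phi> x \<notin> Us (lev x)} \<le> integral\<^sup>L (lebesgue_on E) \<beta> + \<epsilon>"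
  proof -
    have Tex: "\<exists>T. open T \<and> Us j = S \<inter> T" for j using Us[of j] by (auto simp: openin_open)
    then obtain T where T: "\<And>j. open (T j)" "\<And>j. Us j = S \<inter> T j" by metis
    have inS: "g x + J \<phi> x \<in> S" if "x \<in> E" for x using hull[OF that] hull_subset_S by blast
    have cont: "continuous_on A (\<lambda>x. g x + J \<phi> x)" if "A \<subseteq> E" for A
      by (intro continuous_intros continuous_on_J[OF pert_test[OF \<phi>(1)]] continuous_on_subset[OF g(1) that])
    have meas: "{x \<in> A. g x + J \<phi> x \<notin> Us (lev x)} \<in> sets lebesgue" if A: "open A" "A \<subseteq> E" for A
    proof -
      have o: "open ((A \<inter> {x \<in> E. lev x = j}) \<inter> (\<lambda>x. g x + J \<phi> x) -` T j)" for j
        using A lev by (intro continuous_open_preimage T(1) cont) auto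
      have "{x \<in> A. g x + J \<phi> x \<notin> Us (lev x)}
          = A - (\<Union>j. (A \<inter> {x \<in> E. lev x = j}) \<inter> (\<lambda>x. g x + J \<phi> x) -` T j)"
        using inS A(2) by (auto simp: T(2))
      moreover have "open (\<Union>j. (A \<inter> {x \<in> E. lev x = j}) \<inter> (\<lambda>x. g x + J \<phi> x) -` T j)"
        using o by blast
      ultimately show ?thesis using A(1) by auto
    qed
    define b where "b k = {x \<in> B k. g x + J \<phi> x \<notin> Us (lev x)}" for k
    have bl: "b k \<in> lmeasurable" if "k \<in> I" for k
      using meas[of "B k"] i(2)[OF that] Bl[of k] by (intro fmeasurableI2[OF Bl[of k]]) (auto simp: b_def B_def)
    have bm: "measure lebesgue (b k) \<le> \<beta> (fst k) * measure lebesgue (B k)" if "k \<in> I" for k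
    proof -
      have "b k = {y \<in> B k. g y + J (\<Phi> k) y \<notin> Us (lev (fst k))}"
        unfolding b_def using \<phi>(3)[OF that] i(3)[OF that] by auto
      then show ?thesis using \<Phi>(4)[OF that] by simp
    qed
    let ?rest = "E - (\<Union>i\<in>I. B i)"
    have restl: "?rest \<in> lmeasurable" using El I(1) Bl by (intro fmeasurable.Diff sets.finite_UN) (auto simp: fmeasurableD)
    have "measure lebesgue {x \<in> E. g x + J \<phi> x \<notin> Us (lev x)} \<le> measure lebesgue (?rest \<union> (\<Union>k\<in>I. b k))"
    proof (rule measure_mono_fmeasurable)
      show "{x \<in> E. g x + J \<phi> x \<notin> Us (lev x)} \<subseteq> ?rest \<union> (\<Union>k\<in>I. b k)" by (auto simp: b_def)
      show "{x \<in> E. g x + J \<phi> x \<notin> Us (lev x)} \<in> sets lebesgue" using meas E(1) by blast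
      show "?rest \<union> (\<Union>k\<in>I. b k) \<in> lmeasurable" using restl bl I(1) by (intro fmeasurable.Un fmeasurable.finite_UN) auto
    qed
    also have "\<dots> \<le> measure lebesgue ?rest + measure lebesgue (\<Union>k\<in>I. b k)"
      using restl bl I(1) by (intro measure_Un_le sets.finite_UN) (auto simp: fmeasurableD)
    also have "measure lebesgue (\<Union>k\<in>I. b k) \<le> (\<Sum>k\<in>I. measure lebesgue (b k))"
      using bl I(1) by (intro measure_UNION_le) (auto simp: fmeasurableD)
    also have "\<dots> \<le> (\<Sum>k\<in>I. integral\<^sup>L (lebesgue_on E) (\<lambda>x. \<beta> x * indicator (B k) x) + e * measure lebesgue (B k))"
    proof (rule sum_mono)
      fix k assume k: "k \<in> I"
      have "(\<beta> (fst k) - e) * measure lebesgue (B k) \<le> integral\<^sup>L (lebesgue_on E) (\<lambda>x. \<beta> x * indicator (B k) x)"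
        unfolding mB[OF k, symmetric]
        using i(4)[OF k] by (intro integral_mono intB[OF constE k] intB[OF \<beta>(2) k]) (auto simp: indicator_def)
      then show "measure lebesgue (b k) \<le> integral\<^sup>L (lebesgue_on E) (\<lambda>x. \<beta> x * indicator (B k) x) + e * measure lebesgue (B k)"
        using bm[OF k] by (simp add: algebra_simps)
    qed
    also have "\<dots> = integral\<^sup>L (lebesgue_on E) (\<lambda>x. \<Sum>k\<in>I. \<beta> x * indicator (B k) x) + e * (\<Sum>k\<in>I. measure lebesgue (B k))"
      using intB[OF \<beta>(2)] by (subst Bochner_Integration.integral_sum) (auto simp: sum.distrib sum_distrib_left)
    also have "integral\<^sup>L (lebesgue_on E) (\<lambda>x. \<Sum>k\<in>I. \<beta> x * indicator (B k) x) \<le> integral\<^sup>L (lebesgue_on E) \<beta>"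
    proof (rule integral_mono)
      show "integrable (lebesgue_on E) (\<lambda>x. \<Sum>k\<in>I. \<beta> x * indicator (B k) x)"
        using intB[OF \<beta>(2)] by (intro Bochner_Integration.integrable_sum) auto
      fix x assume "x \<in> space (lebesgue_on E)"
      then have x: "x \<in> E" by simp
      have "(\<Sum>k\<in>I. indicator (B k) x) = (indicator (\<Union>k\<in>I. B k) x :: real)"
        using I(3) by (intro indicator_UN_disjoint[symmetric] I(1)) (auto simp: disjoint_family_on_def B_def)
      then have "(\<Sum>k\<in>I. \<beta> x * indicator (B k) x) = \<beta> x * indicator (\<Union>k\<in>I. B k) x"
        by (simp add: sum_distrib_left[symmetric])
      also have "\<dots> \<le> \<beta> x" using \<beta>0[OF x] by (simp add: indicator_def)
      finally show "(\<Sum>k\<in>I. \<beta> x * indicator (B k) x) \<le> \<beta> x" .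
    qed (rule \<beta>(2))
    also have "e * (\<Sum>k\<in>I. measure lebesgue (B k)) \<le> e * measure lebesgue E"
      using sumB e by (intro mult_left_mono) auto
    finally show ?thesis using e1 I(4) by (simp add: B_def)
  qed
  moreover have "\<bar>integral\<^sup>L (lebesgue_on E) (\<lambda>x. h x \<bullet> J \<phi> x)\<bar> \<le> \<epsilon>" if h: "h \<in> H" for h
  proof -
    have Jb: "norm (J (\<Phi> k) x) \<le> 2 * R * indicator (B k) x" if k: "k \<in> I" for k x
    proof (cases "x \<in> B k")
      case True
      have "norm (g x + J (\<Phi> k) x) \<le> R" using \<Phi>(3)[OF k True] R by (meson mem_cball_0 subsetD)
      moreover have "norm (g x) \<le> R" using g(2) i(2)[OF k] True R by (meson mem_cball_0 subsetD)
      ultimately have "norm (J (\<Phi> k) x) \<le> 2 * R"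
        using norm_triangle_ineq4[of "g x + J (\<Phi> k) x" "g x"] by simp
      then show ?thesis using True by simp
    qed (use J_outside[OF pert_test[OF \<Phi>(1)[OF k]]] in auto)
    have hm: "h \<in> borel_measurable (lebesgue_on E)"
      using H(2)[OF h] El by (intro continuous_imp_measurable_on_sets_lebesgue) (auto simp: fmeasurableD)
    have Jm: "J (\<Phi> k) \<in> borel_measurable (lebesgue_on E)" if "k \<in> I" for k
      using continuous_on_J[OF pert_test[OF \<Phi>(1)[OF that]]] El
      by (intro continuous_imp_measurable_on_sets_lebesgue) (auto simp: fmeasurableD)
    have i1: "integrable (lebesgue_on E) (\<lambda>x. 2 * R * e * indicator (B k) x)" if "k \<in> I" for k
      using intB[OF constE that] .
    have b1: "\<bar>(h x - h (fst k)) \<bullet> J (\<Phi> k) x\<bar> \<le> 2 * R * e * indicator (B k) x" if k: "k \<in> I" for k x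
    proof (cases "x \<in> B k")
      case True
      have "\<bar>(h x - h (fst k)) \<bullet> J (\<Phi> k) x\<bar> \<le> norm (h x - h (fst k)) * norm (J (\<Phi> k) x)"
        by (rule Cauchy_Schwarz_ineq2)
      also have "\<dots> \<le> e * (2 * R)" using i(5)[OF k h True] Jb[OF k, of x] True e by (intro mult_mono) auto
      finally show ?thesis using True by (simp add: mult_ac)
    qed (use J_outside[OF pert_test[OF \<Phi>(1)[OF k]]] in auto)
    have i2: "integrable (lebesgue_on E) (\<lambda>x. (h x - h (fst k)) \<bullet> J (\<Phi> k) x)" if k: "k \<in> I" for k
      using b1[OF k] hm Jm[OF k]
    by (intro Bochner_Integration.integrable_bound[OF i1[OF k]] borel_measurable_inner borel_measurable_diff)
      (auto intro!: AE_I2 intro: order_trans[OF _ abs_ge_self])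
    have i3: "integrable (lebesgue_on E) (\<lambda>x. c \<bullet> J (\<Phi> k) x)" "integral\<^sup>L (lebesgue_on E) (\<lambda>x. c \<bullet> J (\<Phi> k) x) = 0"
      if k: "k \<in> I" for k c
    proof -
      have z: "c \<bullet> J (\<Phi> k) x = 0" if "x \<notin> E" for x
      proof -
        have "x \<notin> B k" using that i(2)[OF k] by blast
        then show ?thesis using J_outside[OF pert_test[OF \<Phi>(1)[OF k]]] by simp
      qed
      have "integrable lebesgue (\<lambda>x. c \<bullet> J (\<Phi> k) x)"
        by (rule integrable_inner_right) (rule J_integrable[OF pert_test[OF \<Phi>(1)[OF k]]])
      then show "integrable (lebesgue_on E) (\<lambda>x. c \<bullet> J (\<Phi> k) x)"
        using integral_lebesgue_on_eq(2)[OF fmeasurableD[OF El], of "\<lambda>x. c \<bullet> J (\<Phi> k) x"] z by blast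
      show "integral\<^sup>L (lebesgue_on E) (\<lambda>x. c \<bullet> J (\<Phi> k) x) = 0"
        using integral_lebesgue_on_eq(1)[OF fmeasurableD[OF El], of "\<lambda>x. c \<bullet> J (\<Phi> k) x"] z
          J_integral_inner[OF pert_test[OF \<Phi>(1)[OF k]]] by simp
    qed
    have "integral\<^sup>L (lebesgue_on E) (\<lambda>x. h x \<bullet> J \<phi> x)
      = integral\<^sup>L (lebesgue_on E) (\<lambda>x. \<Sum>k\<in>I. ((h x - h (fst k)) \<bullet> J (\<Phi> k) x + h (fst k) \<bullet> J (\<Phi> k) x))"
      unfolding \<phi>(2) inner_sum_right by (simp add: inner_diff_left)
    also have "\<dots> = (\<Sum>k\<in>I. integral\<^sup>L (lebesgue_on E) (\<lambda>x. (h x - h (fst k)) \<bullet> J (\<Phi> k) x))"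
      using i2 i3 by (subst Bochner_Integration.integral_sum) (auto intro!: sum.cong)
    finally have "\<bar>integral\<^sup>L (lebesgue_on E) (\<lambda>x. h x \<bullet> J \<phi> x)\<bar>
        \<le> (\<Sum>k\<in>I. \<bar>integral\<^sup>L (lebesgue_on E) (\<lambda>x. (h x - h (fst k)) \<bullet> J (\<Phi> k) x)\<bar>)"
      by simp
    also have "\<dots> \<le> (\<Sum>k\<in>I. 2 * R * e * measure lebesgue (B k))"
    proof (rule sum_mono)
      fix k assume k: "k \<in> I"
      have "\<bar>integral\<^sup>L (lebesgue_on E) (\<lambda>x. (h x - h (fst k)) \<bullet> J (\<Phi> k) x)\<bar>
          \<le> integral\<^sup>L (lebesgue_on E) (\<lambda>x. 2 * R * e * indicator (B k) x)"
      proof -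
        have "\<bar>integral\<^sup>L (lebesgue_on E) (\<lambda>x. (h x - h (fst k)) \<bullet> J (\<Phi> k) x)\<bar>
            \<le> integral\<^sup>L (lebesgue_on E) (\<lambda>x. \<bar>(h x - h (fst k)) \<bullet> J (\<Phi> k) x\<bar>)"
          by (rule integral_abs_bound)
        also have "\<dots> \<le> integral\<^sup>L (lebesgue_on E) (\<lambda>x. 2 * R * e * indicator (B k) x)"
          using b1[OF k] by (intro integral_mono integrable_abs i1[OF k] i2[OF k]) auto
        finally show ?thesis .
      qed
      then show "\<bar>integral\<^sup>L (lebesgue_on E) (\<lambda>x. (h x - h (fst k)) \<bullet> J (\<Phi> k) x)\<bar> \<le> 2 * R * e * measure lebesgue (B k)"
        by (simp only: mB[OF k])
    qed
    also have "\<dots> = e * (2 * R) * (\<Sum>k\<in>I. measure lebesgue (B k))" by (simp add: sum_distrib_left mult_ac)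
    also have "\<dots> \<le> e * (2 * R) * measure lebesgue E" using sumB e R0 by (intro mult_left_mono) auto
    finally show ?thesis using e2 by simp
  qed
  moreover have "norm (\<phi> x) \<le> \<epsilon>" for x
  proof (cases "\<exists>i\<in>I. x \<in> B i")
    case True
    then show ?thesis using \<phi>(3) \<Phi>(2) by metis
  next
    case False
    then have "\<phi> x = 0" using \<phi>(4) by blast
    then show ?thesis using \<epsilon> by simp
  qed
  ultimately show ?thesis using \<phi>(1) hull that by blast
qed

end

section \<open>The building block\<close>

lemma expinv_0_le_1: "expinv 0 s \<le> 1"
  by (simp add: expinv_def)

lemma expinv_2_le_2: "expinv 2 s \<le> 2"
proof (cases "s > 0")
  case True
  define z where "z = inverse s"
  have z: "z > 0" using True by (simp add: z_def)
  have "z\<^sup>2 \<le> 2 * exp z"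
    using exp_lower_Taylor_quadratic[of z] z by simp
  then have "exp (- z) * z\<^sup>2 \<le> 2" by (simp add: exp_minus field_simps)
  then show ?thesis using True by (simp add: expinv_def z_def)
qed (simp add: expinv_def)

text \<open>The squared anisotropic norm: distances in the unit direction \<open>b\<close> are stretched by
  \<open>1 / \<delta>\<close>.\<close>

definition qsq :: "real \<Rightarrow> real^'n \<Rightarrow> real^'n \<Rightarrow> real" where
  "qsq \<delta> b x = (b \<bullet> x)\<^sup>2 / \<delta>\<^sup>2 + (norm (x - (b \<bullet> x) *\<^sub>R b))\<^sup>2"

lemma perp_norm:
  fixes x b :: "'a::real_inner"
  assumes "norm b = 1"
  shows "(norm (x - (b \<bullet> x) *\<^sub>R b))\<^sup>2 = x \<bullet> x - (b \<bullet> x)\<^sup>2"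
proof -
  have "b \<bullet> b = 1" using assms by (simp add: norm_eq_1)
  then show ?thesis
    unfolding power2_norm_eq_inner
    by (simp add: inner_simps inner_commute power2_eq_square algebra_simps)
qed

lemma norm_sq_le_qsq:
  assumes "norm b = 1" "0 < \<delta>" "\<delta> \<le> 1"
  shows "(norm x)\<^sup>2 \<le> qsq \<delta> b x"
proof -
  have "\<delta>\<^sup>2 \<le> 1" using assms by (simp add: power_le_one)
  then have "(b \<bullet> x)\<^sup>2 \<le> (b \<bullet> x)\<^sup>2 / \<delta>\<^sup>2"
    using assms(2) by (simp add: field_simps mult_left_le_one_le)
  then show ?thesis
    using perp_norm[OF assms(1), of x] by (simp add: qsq_def power2_norm_eq_inner)
qed

lemma qsq_nonneg: "0 \<le> qsq \<delta> b x"
  by (simp add: qsq_def)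

lemma qsq_scale: "qsq \<delta> b (r *\<^sub>R x) = r\<^sup>2 * qsq \<delta> b x"
proof -
  have "r *\<^sub>R x - (b \<bullet> r *\<^sub>R x) *\<^sub>R b = r *\<^sub>R (x - (b \<bullet> x) *\<^sub>R b)"
    by (simp add: algebra_simps)
  then have "(norm (r *\<^sub>R x - (b \<bullet> r *\<^sub>R x) *\<^sub>R b))\<^sup>2 = r\<^sup>2 * (norm (x - (b \<bullet> x) *\<^sub>R b))\<^sup>2"
    by (simp only: norm_scaleR power_mult_distrib power2_abs)
  then show ?thesis unfolding qsq_def by (simp only:) (simp add: power_mult_distrib distrib_left)
qed

lemma continuous_on_qsq: "continuous_on A (qsq \<delta> b)"
  unfolding qsq_def[abs_def] divide_inverse by (intro continuous_intros)

text \<open>The \<open>a\<close> component has gradient close to a multiple of \<open>outer a b\<close>; with \<open>p = L\<^sup>T a\<close> and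
  \<open>L\<^sup>T d = b\<close> the \<open>d\<close> component, of order \<open>\<delta>\<^sup>2\<close>, cancels its constraint violation exactly.\<close>

definition block :: "real \<Rightarrow> real^'m \<Rightarrow> real^'n \<Rightarrow> real^'m \<Rightarrow> real^'n \<Rightarrow> real^'n \<Rightarrow> real^'m" where
  "block \<delta> a b d p x = expinv 0 (1/4 - qsq \<delta> b x) *\<^sub>R ((b \<bullet> x) *\<^sub>R a - (\<delta>\<^sup>2 * (p \<bullet> x)) *\<^sub>R d)"

lemma qsq_has_derivative:
  assumes "norm b = 1"
  shows "(qsq \<delta> b has_derivative (\<lambda>h. 2 * ((((b \<bullet> x) / \<delta>\<^sup>2) *\<^sub>R b + (x - (b \<bullet> x) *\<^sub>R b)) \<bullet> h))) (at x)"
proof -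
  have eq: "qsq \<delta> b = (\<lambda>x. (b \<bullet> x)\<^sup>2 * inverse (\<delta>\<^sup>2) + (x \<bullet> x - (b \<bullet> x)\<^sup>2))"
    by (simp add: fun_eq_iff qsq_def perp_norm[OF assms] divide_inverse)
  show ?thesis unfolding eq
    by (auto intro!: derivative_eq_intros simp: inner_simps inner_commute algebra_simps fun_eq_iff divide_inverse)
qed

lemma C_k_inner: "C_k k (\<lambda>x::real^'n. c \<bullet> x)"
  by (rule C_k_linear) (rule bounded_linear_inner_right)

lemma C_k_norm_sq: "C_k k (\<lambda>x::real^'n. x \<bullet> x)"
proof -
  have "C_k k (\<lambda>x::real^'n. \<Sum>i\<in>UNIV. x $ i * x $ i)"
    by (intro C_k_sum C_k_mult C_k_linear bounded_linear_vec_nth)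
  then show ?thesis by (simp add: inner_vec_def)
qed

lemma C_k_block:
  assumes "norm b = 1"
  shows "C_k k (block \<delta> a b d p)"
proof -
  have eq: "qsq \<delta> b = (\<lambda>x. (b \<bullet> x) * (b \<bullet> x) * inverse (\<delta>\<^sup>2) + (x \<bullet> x - (b \<bullet> x) * (b \<bullet> x)))"
    by (simp add: fun_eq_iff qsq_def perp_norm[OF assms] divide_inverse flip: power2_eq_square)
  show ?thesis
    unfolding block_def[abs_def] eq
    by (intro C_k_scaleR C_k_expinv C_k_diff C_k_add C_k_mult C_k_const C_k_inner C_k_norm_sq)
qed

lemma J_block:
  assumes "norm b = 1"
  shows "J (block \<delta> a b d p) x = expinv 0 (1/4 - qsq \<delta> b x) *\<^sub>R (outer a b - \<delta>\<^sup>2 *\<^sub>R outer d p)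
    - (2 * expinv 2 (1/4 - qsq \<delta> b x)) *\<^sub>R outer ((b \<bullet> x) *\<^sub>R a - (\<delta>\<^sup>2 * (p \<bullet> x)) *\<^sub>R d)
        (((b \<bullet> x) / \<delta>\<^sup>2) *\<^sub>R b + (x - (b \<bullet> x) *\<^sub>R b))"
proof (rule J_eqI)
  let ?w = "((b \<bullet> x) / \<delta>\<^sup>2) *\<^sub>R b + (x - (b \<bullet> x) *\<^sub>R b)"
  let ?v = "\<lambda>x. (b \<bullet> x) *\<^sub>R a - (\<delta>\<^sup>2 * (p \<bullet> x)) *\<^sub>R d"
  have "((\<lambda>x. 1/4 - qsq \<delta> b x) has_derivative (\<lambda>h. - (2 * (?w \<bullet> h)))) (at x)"
    by (auto intro!: derivative_eq_intros qsq_has_derivative[OF assms])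
  \<comment> \<open>At index 0 the derivative of the cutoff profile is \<open>expinv 2\<close>, the
    second term in \<open>DERIV_expinv\<close> being zero.\<close>
  then have 1: "((\<lambda>x. expinv 0 (1/4 - qsq \<delta> b x)) has_derivative
      (\<lambda>h. expinv 2 (1/4 - qsq \<delta> b x) * - (2 * (?w \<bullet> h)))) (at x)"
    by (rule has_derivative_compose[THEN has_derivative_eq_rhs])
       (use DERIV_expinv[of 0] in \<open>auto simp: has_field_derivative_def numeral_2_eq_2\<close>)
  have 2: "(?v has_derivative ?v) (at x)"
    by (auto intro!: derivative_eq_intros)
  show "(block \<delta> a b d p has_derivative (\<lambda>h. (expinv 0 (1/4 - qsq \<delta> b x) *\<^sub>R (outer a b - \<delta>\<^sup>2 *\<^sub>R outer d p)
    - (2 * expinv 2 (1/4 - qsq \<delta> b x)) *\<^sub>R outer (?v x) ?w) *v h)) (at x)"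
    unfolding block_def[abs_def]
    by (rule has_derivative_eq_rhs[OF has_derivative_scaleR[OF 1 2]])
       (simp add: fun_eq_iff matrix_vector_mult_diff_rdistrib outer_mult_vec scaleR_matrix_vector_assoc[symmetric]
         algebra_simps)
qed

context linear_constraint
begin

text \<open>Without the cutoff, \<open>transpose L\<close> maps the block to the field \<open>(b
  \<bullet> x) *\<^sub>R p - (\<delta>\<^sup>2 * (p \<bullet> x)) *\<^sub>R b\<close>. It is tangent
  to the ellipsoids on which \<open>qsq \<delta> b\<close> is constant, and its divergence vanishes
  because \<open>p \<bullet> b = 0\<close>. A cutoff depending on \<open>qsq\<close> alone therefore
  keeps it divergence free.\<close>

lemma L_J_block:
  assumes b: "norm b = 1" and \<delta>: "\<delta> \<noteq> 0" and ab: "L \<bullet> outer a b = 0"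
    and d: "transpose L *v d = b" and p: "p = transpose L *v a"
  shows "L \<bullet> J (block \<delta> a b d p) x = 0"
proof -
  have tr: "L \<bullet> outer v w = (transpose L *v v) \<bullet> w" for v w
    by (simp add: inner_outer dot_lmul_matrix[symmetric] transpose_matrix_vector inner_commute)
  have bb: "b \<bullet> b = 1" using b by (simp add: norm_eq_1)
  have pb: "p \<bullet> b = 0" using ab by (simp add: tr p)
  then have bp: "b \<bullet> p = 0" by (simp add: inner_commute)
  have d': "d v* L = b" and p': "a v* L = p" using d p by simp_all
  have "(transpose L *v ((b \<bullet> x) *\<^sub>R a - (\<delta>\<^sup>2 * (p \<bullet> x)) *\<^sub>R d)) = (b \<bullet> x) *\<^sub>R p - (\<delta>\<^sup>2 * (p \<bullet> x)) *\<^sub>R b"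
    by (simp only: matrix_vector_mult_diff_distrib matrix_vector_mult_scaleR d p)
  then show ?thesis
    unfolding J_block[OF b] using \<delta>
    by (simp add: inner_diff_right tr d' p' bb pb bp inner_simps algebra_simps power2_eq_square)
qed

lemma pert_block:
  assumes b: "norm b = 1" and \<delta>: "0 < \<delta>" "\<delta> \<le> 1" and ab: "L \<bullet> outer a b = 0"
    and d: "transpose L *v d = b" and p: "p = transpose L *v a"
  shows "pert (ball 0 1) (block \<delta> a b d p)"
  unfolding pert_def
proof (intro conjI allI)
  show "block \<delta> a b d p \<in> test_functions (ball 0 1)"
  proof (rule test_functionsI[of _ "cball 0 (1/2)"])
    show "block \<delta> a b d p x = 0" if "x \<notin> cball 0 (1/2)" for x
    proof -
      have "(1/2)\<^sup>2 < (norm x)\<^sup>2" using that by (intro power_strict_mono) auto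
      then have "1/4 - qsq \<delta> b x < 0" using norm_sq_le_qsq[OF b \<delta>, of x] by (simp add: power2_eq_square)
      then show ?thesis by (simp add: block_def expinv_def)
    qed
  qed (use C_k_block[OF b] in auto)
qed (use L_J_block[OF b _ ab d p] \<delta> in auto)

text \<open>With \<open>y = (b \<bullet> x) / \<delta>\<close> and the perpendicular part of
  \<open>x\<close> kept fixed, this is the derivative in \<open>y\<close> of \<open>y\<close> times
  the cutoff. It is the coefficient of \<open>outer a b\<close> in the gradient of the block, up to
  errors of order \<open>\<delta>\<close>.\<close>

definition block_slope :: "real \<Rightarrow> real^'n \<Rightarrow> real^'n \<Rightarrow> real" where
  "block_slope \<delta> b x = expinv 0 (1/4 - qsq \<delta> b x) - 2 * expinv 2 (1/4 - qsq \<delta> b x) * ((b \<bullet> x) / \<delta>)\<^sup>2"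

lemma J_block_outside:
  assumes "norm b = 1" "1/4 \<le> qsq \<delta> b x"
  shows "J (block \<delta> a b d p) x = 0"
  using assms by (simp add: J_block expinv_def)

lemma qsq_bounds:
  assumes "qsq \<delta> b x \<le> r\<^sup>2" "0 \<le> r"
  shows "\<bar>(b \<bullet> x) / \<delta>\<bar> \<le> r" "norm (x - (b \<bullet> x) *\<^sub>R b) \<le> r"
proof -
  have "((b \<bullet> x) / \<delta>)\<^sup>2 \<le> r\<^sup>2" "(norm (x - (b \<bullet> x) *\<^sub>R b))\<^sup>2 \<le> r\<^sup>2"
    using assms(1) zero_le_power2[of "(b \<bullet> x) / \<delta>"] zero_le_power2[of "norm (x - (b \<bullet> x) *\<^sub>R b)"]
    unfolding qsq_def power_divide by linarith+
  then show "\<bar>(b \<bullet> x) / \<delta>\<bar> \<le> r" "norm (x - (b \<bullet> x) *\<^sub>R b) \<le> r"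
    using assms(2) by (auto simp: abs_le_square_iff[symmetric] power2_le_iff_abs_le intro: power2_le_imp_le)
qed

text \<open>Where the cutoff is nonzero, \<open>\<bar>(b \<bullet> x) / \<delta>\<bar>\<close> is at
  most 1/2, so the subtracted term is at most 1. The bound 2 is the reason for the choice
  \<open>\<rho> = \<rho>0 / 2\<close> in \<open>bad_no_left_max\<close>.\<close>

lemma block_slope_bound: "\<bar>block_slope \<delta> b x\<bar> \<le> 2"
proof (cases "qsq \<delta> b x \<le> (1/2)\<^sup>2")
  case True
  have "\<bar>(b \<bullet> x) / \<delta>\<bar> \<le> 1/2" using qsq_bounds(1)[OF True] by simp
  then have "((b \<bullet> x) / \<delta>)\<^sup>2 \<le> (1/2)\<^sup>2" by (simp add: power2_le_iff_abs_le)
  define W where "W = expinv 2 (1/4 - qsq \<delta> b x) * ((b \<bullet> x) / \<delta>)\<^sup>2"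
  have "((b \<bullet> x) / \<delta>)\<^sup>2 \<le> (1/2)\<^sup>2" using \<open>\<bar>(b \<bullet> x) / \<delta>\<bar> \<le> 1/2\<close> by (simp add: power2_le_iff_abs_le)
  then have "W \<le> 2 * (1/2)\<^sup>2"
    unfolding W_def by (intro mult_mono expinv_2_le_2) auto
  then have "W \<le> 1/2" by (simp add: power2_eq_square)
  moreover have "0 \<le> W" by (simp add: W_def expinv_nonneg)
  moreover have "block_slope \<delta> b x = expinv 0 (1/4 - qsq \<delta> b x) - 2 * W"
    by (simp add: block_slope_def W_def)
  ultimately show ?thesis
    using expinv_0_le_1[of "1/4 - qsq \<delta> b x"] expinv_nonneg[of 0 "1/4 - qsq \<delta> b x"] by linarith
next
  case False
  then show ?thesis by (simp add: block_slope_def expinv_def power2_eq_square)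
qed

text \<open>In the variables \<open>y\<close> and \<open>z\<close>, the scaled and the perpendicular
  part of \<open>x\<close>, both of size at most 1/2 on the support, every remaining term of the
  gradient carries a factor \<open>\<delta>\<close>. Gradients of the block thus stay close to a
  segment in direction \<open>outer a b\<close>, which is where \<open>bad\<close> will be under
  control.\<close>

lemma J_block_near_line:
  fixes a d :: "real^'m" and b p :: "real^'n"
  assumes b: "norm b = 1" and \<delta>: "0 < \<delta>" "\<delta> \<le> 1" and pb: "p \<bullet> b = 0"
  shows "norm (J (block \<delta> a b d p) x - block_slope \<delta> b x *\<^sub>R outer a b) \<le> \<delta> * (norm a + 3 * (norm p * norm d))"
proof (cases "1/4 \<le> qsq \<delta> b x")
  case True
  then have "J (block \<delta> a b d p) x = 0" "block_slope \<delta> b x = 0"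
    by (simp_all add: J_block_outside[OF b] block_slope_def expinv_def)
  then show ?thesis using \<delta> by simp
next
  case False
  define y where "y = (b \<bullet> x) / \<delta>"
  define z where "z = x - (b \<bullet> x) *\<^sub>R b"
  define H where "H = expinv 0 (1/4 - qsq \<delta> b x)"
  define K where "K = expinv 2 (1/4 - qsq \<delta> b x)"
  have yz: "\<bar>y\<bar> \<le> 1/2" "norm z \<le> 1/2"
    using qsq_bounds[of \<delta> b x "1/2"] False by (auto simp: y_def z_def power2_eq_square)
  have HK: "0 \<le> H" "H \<le> 1" "0 \<le> K" "K \<le> 2"
    by (auto simp: H_def K_def expinv_nonneg expinv_0_le_1 expinv_2_le_2)
  have bx: "b \<bullet> x = \<delta> * y" using \<delta> by (simp add: y_def)
  have px: "p \<bullet> x = p \<bullet> z" by (simp add: z_def inner_diff_right pb)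
  have y': "(b \<bullet> x) / \<delta>\<^sup>2 = y / \<delta>" by (simp add: y_def power2_eq_square)
  have "J (block \<delta> a b d p) x - block_slope \<delta> b x *\<^sub>R outer a b
    = \<delta> *\<^sub>R ((- (\<delta> * H)) *\<^sub>R outer d p - (2 * K * y) *\<^sub>R outer a z
        + (2 * K * (p \<bullet> z) * y) *\<^sub>R outer d b + (2 * K * \<delta> * (p \<bullet> z)) *\<^sub>R outer d z)"
    unfolding J_block[OF b] block_slope_def y' H_def[symmetric] K_def[symmetric] z_def[symmetric] y_def[symmetric] px
    unfolding bx using \<delta> by (simp add: outer_simps algebra_simps power2_eq_square)
  also have "norm \<dots> \<le> \<delta> * (norm a + 3 * (norm p * norm d))"
  proof -
    have pz: "\<bar>p \<bullet> z\<bar> \<le> norm p * (1/2)"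
      using Cauchy_Schwarz_ineq2[of p z] yz(2) mult_left_mono[of "norm z" "1/2" "norm p"] by simp
    have 1: "norm ((- (\<delta> * H)) *\<^sub>R outer d p) \<le> norm p * norm d"
    proof -
      have "\<delta> * H \<le> 1 * 1" using \<delta> HK by (intro mult_mono) auto
      then have "\<delta> * H * (norm d * norm p) \<le> 1 * (norm d * norm p)" by (intro mult_right_mono) auto
      then show ?thesis using \<delta> HK by (simp add: norm_outer abs_mult mult.commute)
    qed
    have 2: "norm ((2 * K * y) *\<^sub>R outer a z) \<le> norm a"
    proof -
      have "K * \<bar>y\<bar> \<le> 2 * (1/2)" using HK yz by (intro mult_mono) auto
      then have "(2 * (K * \<bar>y\<bar>)) * (norm a * norm z) \<le> 2 * (norm a * (1/2))"
        using yz HK by (intro mult_mono mult_left_mono) auto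
      then show ?thesis using HK by (simp add: norm_outer abs_mult mult.assoc)
    qed
    have 3: "norm ((2 * K * (p \<bullet> z) * y) *\<^sub>R outer d b) \<le> norm p * norm d"
    proof -
      have "K * (\<bar>p \<bullet> z\<bar> * \<bar>y\<bar>) \<le> 2 * (norm p * (1/2) * (1/2))"
        using HK yz pz by (intro mult_mono) auto
      then have "2 * (K * (\<bar>p \<bullet> z\<bar> * \<bar>y\<bar>)) * norm d \<le> 2 * (2 * (norm p * (1/2) * (1/2))) * norm d"
        by (intro mult_right_mono mult_left_mono) auto
      then show ?thesis using HK b by (simp add: norm_outer abs_mult mult.assoc)
    qed
    have 4: "norm ((2 * K * \<delta> * (p \<bullet> z)) *\<^sub>R outer d z) \<le> norm p * norm d"
    proof -
      have "K * (\<delta> * \<bar>p \<bullet> z\<bar>) \<le> 2 * (1 * (norm p * (1/2)))"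
        using HK \<delta> pz by (intro mult_mono) auto
      then have A: "2 * (K * (\<delta> * \<bar>p \<bullet> z\<bar>)) \<le> 2 * norm p" by simp
      have "norm d * norm z \<le> norm d * (1/2)" using yz by (intro mult_left_mono) auto
      with A have "2 * (K * (\<delta> * \<bar>p \<bullet> z\<bar>)) * (norm d * norm z) \<le> 2 * norm p * (norm d * (1/2))"
        by (rule mult_mono) auto
      then show ?thesis using HK \<delta> by (simp add: norm_outer abs_mult mult.assoc)
    qed
    have tri: "norm (u1 - u2 + u3 + u4) \<le> norm u1 + norm u2 + norm u3 + norm u4" for u1 u2 u3 u4 :: "real^'n^'m"
      using norm_triangle_ineq[of "u1 - u2 + u3" u4] norm_triangle_ineq[of "u1 - u2" u3] norm_triangle_ineq4[of u1 u2]
      by linarith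
    show ?thesis
      using \<delta> order_trans[OF tri add_mono[OF add_mono[OF add_mono[OF 1 2] 3] 4]]
      by (simp add: mult_left_mono mult.commute[of "norm p"])
  qed
  finally show ?thesis .
qed

text \<open>The radius is measured in \<open>qsq\<close> and depends neither on
  \<open>\<delta>\<close> nor on \<open>b\<close>. It can therefore be fixed before
  \<open>\<delta>\<close> is made small.\<close>

lemma block_slope_center:
  assumes "\<epsilon> > 0"
  obtains r where "0 < r" "r \<le> 1/2"
    "\<And>\<delta> b x. qsq \<delta> b x < r\<^sup>2 \<Longrightarrow> \<bar>block_slope \<delta> b x - expinv 0 (1/4)\<bar> \<le> \<epsilon>"
proof -
  have "isCont (expinv 0) (1/4)" using DERIV_expinv DERIV_isCont by blast
  then obtain e where e: "e > 0" "\<And>s. \<bar>s - 1/4\<bar> < e \<Longrightarrow> \<bar>expinv 0 s - expinv 0 (1/4)\<bar> < \<epsilon> / 2"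
    using assms unfolding isCont_def LIM_eq by (metis (no_types, lifting) abs_0 half_gt_zero real_norm_def right_minus_eq)
  define r where "r = min (1/2) (min (e / 2) (\<epsilon> / 8))"
  have r: "0 < r" "r \<le> 1/2" "r < e" "r \<le> \<epsilon> / 8" using e(1) assms by (auto simp: r_def)
  have "r * r \<le> r * 1" using r by (intro mult_left_mono) auto
  then have r2: "r\<^sup>2 \<le> r" by (simp add: power2_eq_square)
  show ?thesis
  proof (rule that[OF r(1,2)])
    fix \<delta> :: real and b x :: "real^'n" assume q: "qsq \<delta> b x < r\<^sup>2"
    have 1: "\<bar>expinv 0 (1/4 - qsq \<delta> b x) - expinv 0 (1/4)\<bar> < \<epsilon> / 2"
      using q r r2 qsq_nonneg[of \<delta> b x] by (intro e(2)) auto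
    have "\<bar>(b \<bullet> x) / \<delta>\<bar> \<le> r" using q r by (intro qsq_bounds(1)) auto
    then have "((b \<bullet> x) / \<delta>)\<^sup>2 \<le> r\<^sup>2" using r(1) by (simp add: power2_le_iff_abs_le)
    then have "expinv 2 (1/4 - qsq \<delta> b x) * ((b \<bullet> x) / \<delta>)\<^sup>2 \<le> 2 * r\<^sup>2"
      by (intro mult_mono expinv_2_le_2) auto
    moreover have "0 \<le> expinv 2 (1/4 - qsq \<delta> b x) * ((b \<bullet> x) / \<delta>)\<^sup>2"
      by (simp add: expinv_nonneg)
    ultimately show "\<bar>block_slope \<delta> b x - expinv 0 (1/4)\<bar> \<le> \<epsilon>"
      using 1 r2 r(4) unfolding block_slope_def by linarith
  qed
qed

end

section \<open>Vanishing of the bad fraction on the hull\<close>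

lemma integrable_continuous_bounded:
  fixes f :: "'a::euclidean_space \<Rightarrow> real"
  assumes "continuous_on UNIV f" "D \<in> sets lebesgue" "bounded D"
  shows "integrable (lebesgue_on D) f"
proof -
  obtain c where c: "D \<subseteq> cbox (- c) c"
    using bounded_subset_cbox_symmetric[OF assms(3)] by blast
  have "f absolutely_integrable_on cbox (- c) c"
    by (rule absolutely_integrable_continuous[OF continuous_on_subset[OF assms(1)]]) simp
  then have "f absolutely_integrable_on D"
    using assms(2) c by (rule set_integrable_subset)
  then show ?thesis using assms(2) by (simp add: integrable_restrict_space set_integrable_def)
qed

context linear_constraint
begin

lemma pert_scale:
  assumes "pert D \<phi>"
  shows "pert D (\<lambda>x. c *\<^sub>R \<phi> x)" "J (\<lambda>x. c *\<^sub>R \<phi> x) x = c *\<^sub>R J \<phi> x"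
proof -
  have J: "J (\<lambda>x. c *\<^sub>R \<phi> x) x = c *\<^sub>R J \<phi> x" for x
    by (rule J_eqI) (auto simp: scaleR_matrix_vector_assoc[symmetric]
        intro!: has_derivative_scaleR_right J_has_derivative[OF pert_test[OF assms]])
  then show "J (\<lambda>x. c *\<^sub>R \<phi> x) x = c *\<^sub>R J \<phi> x" .
  show "pert D (\<lambda>x. c *\<^sub>R \<phi> x)"
    using assms J test_function_bounded_linear[OF bounded_linear_scaleR_right, of \<phi> D c]
    by (simp add: pert_def)
qed

text \<open>Upper semicontinuity of \<open>bad\<close> against a continuous affine function.
  Openness is what turns bounds on a segment into bounds on a neighbourhood of it.\<close>

lemma openin_bad_sublevel:
  assumes U: "openin (top_of_set S) U"
  shows "openin (top_of_set S) {\<zeta> \<in> lhull U. bad U \<zeta> < c + A \<bullet> \<zeta>}"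
  unfolding openin_euclidean_subtopology_iff
proof (intro conjI ballI)
  fix \<xi> assume "\<xi> \<in> {\<zeta> \<in> lhull U. bad U \<zeta> < c + A \<bullet> \<zeta>}"
  then have \<xi>: "\<xi> \<in> lhull U" "bad U \<xi> < c + A \<bullet> \<xi>" by auto
  define m where "m = (bad U \<xi> + (c + A \<bullet> \<xi>)) / 2"
  have m: "bad U \<xi> < m" "m < c + A \<bullet> \<xi>" using \<xi>(2) by (auto simp: m_def)
  obtain \<mu> where \<mu>: "\<mu> > 0" "\<And>\<zeta>. \<zeta> \<in> S \<Longrightarrow> dist \<xi> \<zeta> < \<mu> \<Longrightarrow> \<zeta> \<in> lhull U \<and> bad U \<zeta> < m"
    using bad_usc[OF U \<xi>(1) m(1)] by blast
  have "open {\<zeta>. m < c + A \<bullet> \<zeta>}"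
    by (intro open_Collect_less continuous_intros)
  then obtain d where d: "d > 0" "ball \<xi> d \<subseteq> {\<zeta>. m < c + A \<bullet> \<zeta>}"
    using m(2) open_contains_ball by (metis mem_Collect_eq)
  show "\<exists>e>0. \<forall>x'\<in>S. dist x' \<xi> < e \<longrightarrow> x' \<in> {\<zeta> \<in> lhull U. bad U \<zeta> < c + A \<bullet> \<zeta>}"
  proof (intro exI[of _ "min \<mu> d"] conjI ballI impI)
    fix \<zeta> assume \<zeta>: "\<zeta> \<in> S" "dist \<zeta> \<xi> < min \<mu> d"
    then have "\<zeta> \<in> lhull U \<and> bad U \<zeta> < m" by (intro \<mu>(2)) (auto simp: dist_commute)
    moreover have "\<zeta> \<in> ball \<xi> d" using \<zeta>(2) by (simp add: dist_commute)
    then have "m < c + A \<bullet> \<zeta>" using d(2) by blast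
    ultimately show "\<zeta> \<in> {\<zeta> \<in> lhull U. bad U \<zeta> < c + A \<bullet> \<zeta>}" by auto
  qed (use \<mu> d in simp)
qed (use hull_subset_S in auto)

text \<open>Injectivity of \<open>L\<close> is full column rank. The preimage \<open>d\<close> of
  \<open>b\<close> lifts the correction of the divergence to a map.\<close>

lemma transpose_surj: "\<exists>d. transpose L *v d = b"
proof -
  have "inj ((*v) L)"
    using nondegenerate by (subst linear_injective_0) auto
  then have "rank L = CARD('n)" by (simp add: full_rank_injective)
  then have "rank (transpose L) = CARD('n)" by (simp add: rank_transpose)
  then have "surj ((*v) (transpose L))" using full_rank_surjective by blast
  then show ?thesis by (metis surjD)
qed

text \<open>Maximum principle: a perturbation by the building block pushes a fixed fraction of the mass to
  the side of \<open>\<xi>\<close> where \<open>bad\<close> lies strictly below the supporting affine function, and the rest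
  barely above it.\<close>

lemma bad_no_left_max:
  fixes a :: "real^'m" and b :: "real^'n"
  assumes U: "openin (top_of_set S) U" and R: "lhull U \<subseteq> cball 0 R"
    and b: "norm b = 1" and ab: "L \<bullet> outer a b = 0" and \<rho>0: "\<rho>0 > 0"
    and seg: "\<And>s. \<bar>s\<bar> \<le> \<rho>0 \<Longrightarrow> \<xi> + s *\<^sub>R outer a b \<in> lhull U"
    and le: "\<And>s. \<bar>s\<bar> \<le> \<rho>0 \<Longrightarrow> bad U (\<xi> + s *\<^sub>R outer a b) \<le> c + A \<bullet> (\<xi> + s *\<^sub>R outer a b)"
    and less: "\<And>s. - \<rho>0 \<le> s \<Longrightarrow> s < 0 \<Longrightarrow> bad U (\<xi> + s *\<^sub>R outer a b) < c + A \<bullet> (\<xi> + s *\<^sub>R outer a b)"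
    and eq: "bad U \<xi> = c + A \<bullet> \<xi>"
  shows False
proof -
  let ?D = "outer a b"
  let ?B = "ball (0::real^'n) 1"
  obtain d where d: "transpose L *v d = b" using transpose_surj by blast
  define p where "p = transpose L *v a"
  have pb: "p \<bullet> b = 0" using ab
    by (simp add: p_def inner_outer dot_lmul_matrix[symmetric] transpose_matrix_vector inner_commute)
  define \<sigma>0 where "\<sigma>0 = expinv 0 (1/4)"
  have \<sigma>0: "0 < \<sigma>0" "\<sigma>0 \<le> 1" by (auto simp: \<sigma>0_def expinv_def)
  \<comment> \<open>Slopes of the block are bounded by 2, so with half the room all gradients stay
    near the segment on which \<open>seg\<close> and \<open>le\<close> apply.\<close>
  define \<rho> where "\<rho> = \<rho>0 / 2"
  have \<rho>: "\<rho> > 0" using \<rho>0 by (simp add: \<rho>_def)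
  \<comment> \<open>Approximately the gradient at the centre of the block. The negative sign puts it
    to the left of \<open>\<xi>\<close>, where \<open>less\<close> gives a definite gap, recorded as
    \<open>2 * \<kappa>\<close>.\<close>
  define \<xi>0 where "\<xi>0 = \<xi> + (- \<rho> * \<sigma>0) *\<^sub>R ?D"
  have s0: "- \<rho>0 \<le> - \<rho> * \<sigma>0" "- \<rho> * \<sigma>0 < 0" "\<bar>- \<rho> * \<sigma>0\<bar> \<le> \<rho>0"
    using \<sigma>0 \<rho>0 mult_left_mono[of \<sigma>0 1 \<rho>] by (auto simp: \<rho>_def)
  define \<kappa> where "\<kappa> = (c + A \<bullet> \<xi>0 - bad U \<xi>0) / 2"
  have "bad U \<xi>0 < c + A \<bullet> \<xi>0" unfolding \<xi>0_def by (rule less[OF s0(1,2)])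
  then have \<kappa>: "\<kappa> > 0" "bad U \<xi>0 < (c - \<kappa>) + A \<bullet> \<xi>0" by (auto simp: \<kappa>_def field_simps)
  have \<xi>0: "\<xi>0 \<in> lhull U" unfolding \<xi>0_def by (rule seg[OF s0(3)])
  let ?O = "\<lambda>c. {\<zeta> \<in> lhull U. bad U \<zeta> < c + A \<bullet> \<zeta>}"
  have "compact {\<xi>0}" "{\<xi>0} \<subseteq> ?O (c - \<kappa>)" using \<kappa>(2) \<xi>0 by auto
  then obtain \<mu>0 where \<mu>0: "\<mu>0 > 0"
    "\<And>\<eta> \<zeta>. \<eta> \<in> {\<xi>0} \<Longrightarrow> \<zeta> \<in> S \<Longrightarrow> dist \<eta> \<zeta> < \<mu>0 \<Longrightarrow> \<zeta> \<in> ?O (c - \<kappa>)"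
    using openin_margin[OF openin_bad_sublevel[OF U]] by blast
  have e1: "\<mu>0 / (2 * (\<rho> * norm ?D + 1)) > 0"
    using \<mu>0(1) \<rho> by (intro divide_pos_pos mult_pos_pos add_nonneg_pos) auto
  obtain r where r: "0 < r" "r \<le> 1/2"
    "\<And>\<delta> x. qsq \<delta> b x < r\<^sup>2 \<Longrightarrow> \<bar>block_slope \<delta> b x - \<sigma>0\<bar> \<le> \<mu>0 / (2 * (\<rho> * norm ?D + 1))"
    using block_slope_center[OF e1] unfolding \<sigma>0_def by metis
  \<comment> \<open>Calibrated so that the gain
    \<open>\<kappa> / 2 * (r / 2) ^ CARD('n) * e1\<close> from the centre equals
    \<open>4 * (\<tau> * e1)\<close>, while the loss in the rest of the block is at most
    \<open>\<tau> * e1\<close>.\<close>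
  define \<tau> where "\<tau> = \<kappa> * (r / 2) ^ CARD('n) / 8"
  have \<tau>: "\<tau> > 0" using \<kappa> r by (simp add: \<tau>_def)
  let ?T = "(\<lambda>s. \<xi> + s *\<^sub>R ?D) ` {- \<rho>0..\<rho>0}"
  have "compact ?T" by (intro compact_continuous_image continuous_intros) auto
  moreover have "?T \<subseteq> ?O (c + \<tau>)"
  proof clarify
    fix s assume "s \<in> {- \<rho>0..\<rho>0}"
    then have "\<bar>s\<bar> \<le> \<rho>0" by auto
    then show "\<xi> + s *\<^sub>R ?D \<in> lhull U \<and> bad U (\<xi> + s *\<^sub>R ?D) < c + \<tau> + A \<bullet> (\<xi> + s *\<^sub>R ?D)"
      using seg le[of s] \<tau> by auto
  qed
  ultimately obtain \<mu>1 where \<mu>1: "\<mu>1 > 0" "\<And>\<eta> \<zeta>. \<eta> \<in> ?T \<Longrightarrow> \<zeta> \<in> S \<Longrightarrow> dist \<eta> \<zeta> < \<mu>1 \<Longrightarrow> \<zeta> \<in> ?O (c + \<tau>)"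
    using openin_margin[OF openin_bad_sublevel[OF U]] by blast
  define Cb where "Cb = norm a + 3 * (norm p * norm d)"
  have Cb: "0 \<le> Cb" by (simp add: Cb_def)
  \<comment> \<open>Chosen last, which is possible because \<open>r\<close>, \<open>\<tau>\<close>
    and both margins are independent of \<open>\<delta>\<close>; the errors of order
    \<open>\<delta>\<close> then fit into \<open>\<mu>0\<close> and \<open>\<mu>1\<close>.\<close>
  define \<delta> where "\<delta> = min 1 (min (\<mu>0 / 3) (\<mu>1 / 2) / (\<rho> * Cb + 1))"
  have den: "\<rho> * Cb + 1 > 0" using \<rho> Cb by (simp add: add_nonneg_pos)
  have \<delta>: "0 < \<delta>" "\<delta> \<le> 1" using \<mu>0(1) \<mu>1(1) den by (auto simp: \<delta>_def)
  have \<delta>C: "\<rho> * (\<delta> * Cb) \<le> min (\<mu>0 / 3) (\<mu>1 / 2)"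
  proof -
    have "\<rho> * (\<delta> * Cb) \<le> \<delta> * (\<rho> * Cb + 1)" using \<delta> by (simp add: algebra_simps)
    also have "\<dots> \<le> min (\<mu>0 / 3) (\<mu>1 / 2) / (\<rho> * Cb + 1) * (\<rho> * Cb + 1)"
      using den by (intro mult_right_mono) (auto simp: \<delta>_def)
    finally show ?thesis using den by simp
  qed
  define \<phi> where "\<phi> x = (- \<rho>) *\<^sub>R block \<delta> a b d p x" for x
  note pblock = pert_block[OF b \<delta> ab d p_def]
  have \<phi>: "pert ?B \<phi>" unfolding \<phi>_def by (rule pert_scale(1)[OF pblock])
  have J\<phi>: "J \<phi> x = (- \<rho>) *\<^sub>R J (block \<delta> a b d p) x" for x
    unfolding \<phi>_def by (rule pert_scale(2)[OF pblock])
  define g where "g x = \<xi> + J \<phi> x" for x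
  have \<xi>S: "\<xi> \<in> S" using seg[of 0] \<rho>0 hull_subset_S by auto
  have gS: "g x \<in> S" for x unfolding g_def using pert_S[OF \<phi>] \<xi>S by blast
  have dg: "dist (\<xi> + (- \<rho> * block_slope \<delta> b x) *\<^sub>R ?D) (g x) \<le> min (\<mu>0 / 3) (\<mu>1 / 2)" for x
  proof -
    have "dist (\<xi> + (- \<rho> * block_slope \<delta> b x) *\<^sub>R ?D) (g x)
      = norm (\<rho> *\<^sub>R (J (block \<delta> a b d p) x - block_slope \<delta> b x *\<^sub>R ?D))"
      unfolding g_def J\<phi> dist_norm by (rule arg_cong[of _ _ norm]) (simp add: algebra_simps)
    also have "\<dots> = \<rho> * norm (J (block \<delta> a b d p) x - block_slope \<delta> b x *\<^sub>R ?D)" using \<rho> by simp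
    also have "\<dots> \<le> \<rho> * (\<delta> * Cb)"
      unfolding Cb_def using \<rho> by (intro mult_left_mono J_block_near_line[OF b \<delta> pb]) auto
    finally show ?thesis using \<delta>C by linarith
  qed
  have g1: "g x \<in> ?O (c + \<tau>)" for x
  proof (rule \<mu>1(2)[OF _ gS])
    have "\<bar>\<rho> * block_slope \<delta> b x\<bar> \<le> \<rho> * 2"
      using \<rho> block_slope_bound[of \<delta> b x] by (simp add: abs_mult)
    then show "\<xi> + (- \<rho> * block_slope \<delta> b x) *\<^sub>R ?D \<in> ?T" by (intro imageI) (auto simp: \<rho>_def abs_le_iff)
    show "dist (\<xi> + (- \<rho> * block_slope \<delta> b x) *\<^sub>R ?D) (g x) < \<mu>1"
      using dg[of x] \<mu>1(1) by linarith
  qed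
  have g0: "g x \<in> ?O (c - \<kappa>)" if q: "qsq \<delta> b x < r\<^sup>2" for x
  proof (rule \<mu>0(2)[OF singletonI gS])
    have "dist \<xi>0 (\<xi> + (- \<rho> * block_slope \<delta> b x) *\<^sub>R ?D) = norm ((\<rho> * (block_slope \<delta> b x - \<sigma>0)) *\<^sub>R ?D)"
      unfolding \<xi>0_def dist_norm by (rule arg_cong[of _ _ norm]) (simp add: algebra_simps)
    also have "\<dots> = \<bar>block_slope \<delta> b x - \<sigma>0\<bar> * (\<rho> * norm ?D)" using \<rho> by (simp add: abs_mult)
    also have "\<dots> \<le> \<mu>0 / (2 * (\<rho> * norm ?D + 1)) * (\<rho> * norm ?D + 1)"
      using r(3)[OF q] \<rho> \<mu>0(1) by (intro mult_mono) auto
    also have "\<dots> = \<mu>0 / 2" 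
    proof -
      have "y / (2 * q) * q = y / 2" if "q > 0" for y q :: real
        using that by (simp add: field_simps)
      moreover have "\<rho> * norm ?D + 1 > 0" using \<rho> by (intro add_nonneg_pos) auto
      ultimately show ?thesis by blast
    qed
    finally have "dist \<xi>0 (\<xi> + (- \<rho> * block_slope \<delta> b x) *\<^sub>R ?D) \<le> \<mu>0 / 2" .
    then show "dist \<xi>0 (g x) < \<mu>0"
      using dg[of x] \<mu>0(1) dist_triangle[of \<xi>0 "g x" "\<xi> + (- \<rho> * block_slope \<delta> b x) *\<^sub>R ?D"] by linarith
  qed
  \<comment> \<open>The volume \<open>e1\<close> of the ellipsoid depends on
    \<open>\<delta>\<close>, but gain and loss are both measured against it: \<open>E2\<close> is
    its copy scaled by \<open>r / 2\<close>, hence of relative volume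
    \<open>(r / 2) ^ CARD('n)\<close>, whatever \<open>\<delta>\<close> is.\<close>
  define E1 where "E1 = {x::real^'n. qsq \<delta> b x < 1}"
  have E1o: "open E1" unfolding E1_def by (intro open_Collect_less continuous_on_qsq continuous_intros)
  have E1B: "E1 \<subseteq> ?B"
  proof
    fix x assume "x \<in> E1"
    then have "(norm x)\<^sup>2 < 1\<^sup>2" using norm_sq_le_qsq[OF b \<delta>, of x] by (simp add: E1_def)
    then show "x \<in> ?B" using power2_less_imp_less[of "norm x" 1] by simp
  qed
  have E1l: "E1 \<in> lmeasurable" using E1o E1B bounded_subset[OF bounded_ball] by (intro lmeasurable_open) auto
  define e1 where "e1 = measure lebesgue E1"
  have e1: "e1 > 0"
  proof -
    have "0 \<in> E1" by (simp add: E1_def qsq_def)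
    then obtain t where t: "t > 0" "ball 0 t \<subseteq> E1" using E1o open_contains_ball by blast
    have "0 < measure lebesgue (ball (0::real^'n) t)" by (rule ball_pos[OF t(1)])
    also have "\<dots> \<le> e1" unfolding e1_def using t E1l by (intro measure_mono_fmeasurable) auto
    finally show ?thesis .
  qed
  define E2 where "E2 = (\<lambda>x. 0 + (r / 2) *\<^sub>R x) ` E1"
  have mE2: "measure lebesgue E2 = (r / 2) ^ CARD('n) * e1"
    unfolding E2_def e1_def using r by (intro measure_ball_image(2)) auto
  have E2q: "qsq \<delta> b x < (r / 2)\<^sup>2" if "x \<in> E2" for x
    using that r(1) by (auto simp: E2_def qsq_scale E1_def)
  have E2B: "E2 \<subseteq> ?B"
  proof
    fix x assume "x \<in> E2"
    then have "qsq \<delta> b x < (r / 2)\<^sup>2" by (rule E2q)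
    also have "\<dots> \<le> 1" using r by (simp add: power_le_one)
    finally show "x \<in> ?B" using E1B by (auto simp: E1_def)
  qed
  have E2l: "E2 \<in> lmeasurable"
  proof -
    have "open E2" unfolding E2_def using r(1) open_affinity[OF E1o, of "r / 2" 0] by simp
    then show ?thesis using E2B bounded_subset[OF bounded_ball] by (intro lmeasurable_open) auto
  qed
  let ?w = "measure lebesgue ?B"
  have w: "?w > 0" by (rule ball_pos) simp
  \<comment> \<open>This slack enters twice and so costs half of \<open>\<tau> * e1\<close>, too
    little to offset the net gain of \<open>3 * (\<tau> * e1)\<close>.\<close>
  define \<epsilon> where "\<epsilon> = \<tau> * e1 / 4"
  have \<epsilon>: "\<epsilon> > 0" using \<tau> e1 by (simp add: \<epsilon>_def)
  \<comment> \<open>Continuous substitutes for the indicators of the block and of its centre, since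
    \<open>patching\<close> asks for a continuous bound: \<open>k\<close> is 1 on the support of the
    block and vanishes off \<open>E1\<close>; \<open>h\<close> vanishes where
    \<open>r\<^sup>2 \<le> qsq \<delta> b x\<close> and is at least 1/2 on
    \<open>E2\<close>.\<close>
  define k where "k x = max 0 (min 1 (2 - 4 * qsq \<delta> b x))" for x
  define h where "h x = max 0 (1 - qsq \<delta> b x / r\<^sup>2)" for x
  define \<beta> where "\<beta> x = c + \<epsilon> / ?w + A \<bullet> g x + \<tau> * k x - \<kappa> * h x" for x
  have cont_g: "continuous_on X g" for X
    unfolding g_def by (intro continuous_intros continuous_on_J[OF pert_test[OF \<phi>]])
  have cont_k: "continuous_on X k" for X
    unfolding k_def by (intro continuous_intros continuous_on_qsq)
  have cont_h: "continuous_on X h" for X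
    unfolding h_def divide_inverse by (intro continuous_intros continuous_on_qsq)
  have cont: "continuous_on X \<beta>" for X
    unfolding \<beta>_def by (intro continuous_intros cont_g cont_k cont_h)
  have int: "integrable (lebesgue_on ?B) f" if "\<And>X. continuous_on X f" for f :: "real^'n \<Rightarrow> real"
    by (rule integrable_continuous_bounded[OF that]) auto
  have h01: "0 \<le> h x" "h x \<le> 1" for x using qsq_nonneg[of \<delta> b x] by (auto simp: h_def)
  have bad_less: "bad U (g x) < \<beta> x" for x
  proof -
    have pos: "\<epsilon> / ?w > 0" using \<epsilon> w by simp
    consider "qsq \<delta> b x < r\<^sup>2" | "r\<^sup>2 \<le> qsq \<delta> b x" "qsq \<delta> b x < 1/4" | "1/4 \<le> qsq \<delta> b x" by linarith
    then show ?thesis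
    proof cases
      case 1
      have "bad U (g x) < c - \<kappa> + A \<bullet> g x" using g0[OF 1] by simp
      moreover have "\<kappa> * h x \<le> \<kappa>" using \<kappa>(1) h01 by (simp add: mult_left_le)
      moreover have "0 \<le> \<tau> * k x" using \<tau> by (simp add: k_def)
      ultimately show ?thesis using pos unfolding \<beta>_def by linarith
    next
      case 2
      have "h x = 0" using 2 r(1) by (simp add: h_def field_simps)
      moreover have "k x = 1" using 2 by (simp add: k_def)
      moreover have "bad U (g x) < c + \<tau> + A \<bullet> g x" using g1[of x] by simp
      ultimately show ?thesis using pos unfolding \<beta>_def by simp
    next
      case 3
      have "r\<^sup>2 \<le> (1/2)\<^sup>2" using r by (intro power_mono) auto
      then have "r\<^sup>2 \<le> qsq \<delta> b x" using 3 by (simp add: power2_eq_square)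
      then have "h x = 0" using r(1) by (simp add: h_def field_simps)
      moreover have "0 \<le> \<tau> * k x" using \<tau> by (simp add: k_def)
      moreover have "g x = \<xi>" unfolding g_def J\<phi> J_block_outside[OF b 3] by simp
      ultimately show ?thesis using pos eq unfolding \<beta>_def by simp
    qed
  qed
  have lev: "open {x \<in> ?B. 0 = (j::nat)}" for j
  proof -
    have "{x \<in> ?B. 0 = (j::nat)} = (if j = 0 then ?B else {})" by auto
    then show ?thesis by simp
  qed
  have gh: "g x \<in> lhull U" for x using g1 by blast
  obtain \<psi> where \<psi>: "pert ?B \<psi>" "\<And>x. x \<in> ?B \<Longrightarrow> g x + J \<psi> x \<in> lhull U"
    "measure lebesgue {x \<in> ?B. g x + J \<psi> x \<notin> U} \<le> integral\<^sup>L (lebesgue_on ?B) \<beta> + \<epsilon>"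
  proof (rule patching[of ?B "\<lambda>_. 0" "\<lambda>_. U" R g \<beta> "{}" \<epsilon>, OF open_ball bounded_ball lev U R cont_g gh
        cont int[OF cont] bad_less finite.emptyI _ \<epsilon>])
    fix \<psi> assume "pert ?B \<psi>" "\<And>x. x \<in> ?B \<Longrightarrow> g x + J \<psi> x \<in> lhull U"
      "measure lebesgue {x \<in> ?B. g x + J \<psi> x \<notin> U} \<le> integral\<^sup>L (lebesgue_on ?B) \<beta> + \<epsilon>"
    then show thesis by (rule that)
  qed simp
  define \<omega> where "\<omega> x = \<phi> x + \<psi> x" for x
  have \<omega>: "pert ?B \<omega>" unfolding \<omega>_def by (rule pert_add[OF \<phi> \<psi>(1)])
  have J\<omega>: "\<xi> + J \<omega> x = g x + J \<psi> x" for x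
    unfolding \<omega>_def g_def J_add[OF pert_test[OF \<phi>] pert_test[OF \<psi>(1)]] by simp
  have \<omega>h: "\<xi> + J \<omega> x \<in> lhull U" for x
  proof (cases "x \<in> ?B")
    case True
    then show ?thesis unfolding J\<omega> by (rule \<psi>(2))
  next
    case False
    then show ?thesis using J_outside[OF pert_test[OF \<omega>]] seg[of 0] \<rho>0 by simp
  qed
  define \<theta> where "\<theta> = max 0 ((integral\<^sup>L (lebesgue_on ?B) \<beta> + \<epsilon>) / ?w)"
  have "ach U \<xi> \<theta>"
    unfolding ach_def
  proof (intro conjI exI[of _ \<omega>] allI \<omega> \<omega>h)
    show "0 \<le> \<theta>" by (simp add: \<theta>_def)
    have "measure lebesgue {x \<in> ?B. \<xi> + J \<omega> x \<notin> U} \<le> (integral\<^sup>L (lebesgue_on ?B) \<beta> + \<epsilon>) / ?w * ?w"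
      using \<psi>(3) w unfolding J\<omega> by simp
    also have "\<dots> \<le> \<theta> * ?w" using w by (intro mult_right_mono) (auto simp: \<theta>_def)
    finally show "measure lebesgue {x \<in> ?B. \<xi> + J \<omega> x \<notin> U} \<le> \<theta> * ?w" .
  qed
  then have "bad U \<xi> \<le> \<theta>" by (rule bad_le)
  moreover have "\<theta> = (integral\<^sup>L (lebesgue_on ?B) \<beta> + \<epsilon>) / ?w"
    unfolding \<theta>_def
    by (rule max_absorb2[OF divide_nonneg_pos[OF order_trans[OF measure_nonneg \<psi>(3)] w]])
  ultimately have main: "bad U \<xi> * ?w \<le> integral\<^sup>L (lebesgue_on ?B) \<beta> + \<epsilon>"
    using w by (simp add: field_simps)
  have ind: "integrable (lebesgue_on ?B) (\<lambda>x. indicator X x :: real)"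
    "integral\<^sup>L (lebesgue_on ?B) (\<lambda>x. indicator X x) = measure lebesgue X" if "X \<in> lmeasurable" "X \<subseteq> ?B" for X
  proof -
    have z: "indicat_real X x = 0" if "x \<notin> ?B" for x using \<open>X \<subseteq> ?B\<close> that by (auto simp: indicator_def)
    show "integrable (lebesgue_on ?B) (\<lambda>x. indicator X x :: real)"
      using integral_lebesgue_on_eq(2)[of ?B "indicat_real X"] z that(1) by (simp add: lmeasurable_iff_integrable)
    show "integral\<^sup>L (lebesgue_on ?B) (\<lambda>x. indicator X x) = measure lebesgue X"
      using integral_lebesgue_on_eq(1)[of ?B "indicat_real X"] z that(1) by (simp add: fmeasurableD)
  qed
  have Ik: "integral\<^sup>L (lebesgue_on ?B) k \<le> e1"
  proof -
    have "integral\<^sup>L (lebesgue_on ?B) k \<le> integral\<^sup>L (lebesgue_on ?B) (indicat_real E1)"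
      by (intro integral_mono int cont_k ind(1) E1l E1B) (auto simp: k_def indicator_def E1_def)
    then show ?thesis using ind(2)[OF E1l E1B] by (simp add: e1_def)
  qed
  have Ih: "1/2 * ((r / 2) ^ CARD('n) * e1) \<le> integral\<^sup>L (lebesgue_on ?B) h"
  proof -
    have "integral\<^sup>L (lebesgue_on ?B) (\<lambda>x. 1/2 * indicat_real E2 x) \<le> integral\<^sup>L (lebesgue_on ?B) h"
    proof (rule integral_mono)
      show "integrable (lebesgue_on ?B) (\<lambda>x. 1/2 * indicat_real E2 x)"
        by (intro integrable_mult_right ind(1) E2l E2B)
      show "integrable (lebesgue_on ?B) h" by (rule int[OF cont_h])
      fix x show "1/2 * indicat_real E2 x \<le> h x"
      proof (cases "x \<in> E2")
        case True
        have "qsq \<delta> b x / r\<^sup>2 \<le> 1/4" using E2q[OF True] r(1) by (simp add: field_simps power2_eq_square)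
        then have "1/2 \<le> 1 - qsq \<delta> b x / r\<^sup>2" by linarith
        then have "1/2 \<le> h x" unfolding h_def by (rule max.coboundedI2)
        then show ?thesis using True by simp
      qed (simp add: h01)
    qed
    moreover have "integral\<^sup>L (lebesgue_on ?B) (\<lambda>x. 1/2 * indicat_real E2 x) = 1/2 * measure lebesgue E2"
      using ind(2)[OF E2l E2B] by simp
    ultimately show ?thesis using mE2 by simp
  qed
  \<comment> \<open>By mean zero, the affine function of the gradient contributes only its value at
    \<open>\<xi>\<close>, which is \<open>bad U \<xi>\<close>.\<close>
  have IA: "integral\<^sup>L (lebesgue_on ?B) (\<lambda>x. A \<bullet> J \<phi> x) = 0"
    using integral_lebesgue_on_eq(1)[of ?B "\<lambda>x. A \<bullet> J \<phi> x"] J_outside[OF pert_test[OF \<phi>]]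
      J_integral_inner[OF pert_test[OF \<phi>], of A] by simp
  have "integral\<^sup>L (lebesgue_on ?B) \<beta>
     = (c + \<epsilon> / ?w + A \<bullet> \<xi>) * ?w + \<tau> * integral\<^sup>L (lebesgue_on ?B) k - \<kappa> * integral\<^sup>L (lebesgue_on ?B) h"
  proof -
    have eq: "\<beta> = (\<lambda>x. (c + \<epsilon> / ?w + A \<bullet> \<xi>) + A \<bullet> J \<phi> x + \<tau> * k x - \<kappa> * h x)"
      by (simp add: fun_eq_iff \<beta>_def g_def inner_add_right)
    have cJ: "continuous_on X (\<lambda>x. A \<bullet> J \<phi> x)" for X
      by (intro continuous_intros continuous_on_J[OF pert_test[OF \<phi>]])
    have ic: "integrable (lebesgue_on ?B) (\<lambda>x. C::real)" for C
      by (rule int) simp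
    have cc: "integral\<^sup>L (lebesgue_on ?B) (\<lambda>x. C) = C * ?w" for C :: real
      using ind(2)[of ?B] by (simp add: measure_restrict_space)
    show ?thesis unfolding eq
      using int[OF cJ] int[OF cont_k] int[OF cont_h] ic IA cc by simp
  qed
  also have "\<dots> = bad U \<xi> * ?w + \<epsilon> + \<tau> * integral\<^sup>L (lebesgue_on ?B) k - \<kappa> * integral\<^sup>L (lebesgue_on ?B) h"
    using w eq by (simp add: field_simps)
  also have "\<dots> \<le> bad U \<xi> * ?w + \<epsilon> + \<tau> * e1 - \<kappa> * (1/2 * ((r / 2) ^ CARD('n) * e1))"
    using Ik Ih \<tau> \<kappa>(1) by (intro diff_mono add_left_mono mult_left_mono) auto
  also have "\<kappa> * (1/2 * ((r / 2) ^ CARD('n) * e1)) = 4 * (\<tau> * e1)"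
    by (simp add: \<tau>_def)
  finally have "bad U \<xi> * ?w \<le> bad U \<xi> * ?w + \<epsilon> + \<epsilon> + \<tau> * e1 - 4 * (\<tau> * e1)"
    using main by linarith
  moreover have "\<tau> * e1 > 0" using \<tau> e1 by simp
  ultimately show False by (simp add: \<epsilon>_def)
qed


text \<open>If \<open>bad\<close> exceeded its chord, the difference, upper semicontinuous on the
  segment, would attain a positive maximum. Its leftmost maximum point is interior, and this is
  exactly the situation excluded by \<open>bad_no_left_max\<close>.\<close>

lemma bad_convex:
  fixes a :: "real^'m" and b :: "real^'n"
  assumes U: "openin (top_of_set S) U" and R: "lhull U \<subseteq> cball 0 R"
    and seg: "\<And>s. 0 \<le> s \<Longrightarrow> s \<le> 1 \<Longrightarrow> s *\<^sub>R \<xi> + (1 - s) *\<^sub>R \<eta> \<in> lhull U"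
    and ab: "\<xi> - \<eta> = outer a b" and l: "0 \<le> l" "l \<le> 1"
  shows "bad U (l *\<^sub>R \<xi> + (1 - l) *\<^sub>R \<eta>) \<le> l * bad U \<xi> + (1 - l) * bad U \<eta>"
proof (cases "outer a b = 0")
  case True
  then have "\<xi> = \<eta>" using ab by simp
  then show ?thesis by (simp add: algebra_simps flip: scaleR_add_left)
next
  case False
  then have b0: "b \<noteq> 0" by (auto simp: outer_simps)
  \<comment> \<open>The building block needs a unit vector; the norm of \<open>b\<close> is moved to
    the other factor.\<close>
  define a' where "a' = norm b *\<^sub>R a"
  define b' where "b' = inverse (norm b) *\<^sub>R b"
  have b': "norm b' = 1" using b0 by (simp add: b'_def)
  have o: "outer a' b' = outer a b" using b0 by (simp add: a'_def b'_def outer_simps)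
  define D where "D = outer a b"
  have D0: "D \<noteq> 0" using False by (simp add: D_def)
  define p where "p s = s *\<^sub>R \<xi> + (1 - s) *\<^sub>R \<eta>" for s
  have p_eq: "p s = \<eta> + s *\<^sub>R D" for s
    by (simp add: p_def D_def ab[symmetric] algebra_simps)
  have \<xi>S: "\<xi> \<in> S" "\<eta> \<in> S" using seg[of 1] seg[of 0] hull_subset_S by auto
  have LD: "L \<bullet> D = 0" using \<xi>S by (simp add: D_def ab[symmetric] inner_diff_right Sigma_t_iff)
  \<comment> \<open>With \<open>c\<close> below, this is the affine function, varying only along
    \<open>D\<close>, that agrees with \<open>bad U\<close> at both end points.\<close>
  define A where "A = ((bad U \<xi> - bad U \<eta>) / (D \<bullet> D)) *\<^sub>R D"
  define c where "c = bad U \<eta> - A \<bullet> \<eta>"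
  have AD: "A \<bullet> D = bad U \<xi> - bad U \<eta>" using D0 by (simp add: A_def)
  have aff: "c + A \<bullet> p s = s * bad U \<xi> + (1 - s) * bad U \<eta>" for s
    by (simp add: c_def p_eq inner_add_right AD algebra_simps)
  define F where "F s = bad U (p s) - (c + A \<bullet> p s)" for s
  have F01: "F 0 = 0" "F 1 = 0" unfolding F_def aff by (simp_all add: p_def)
  have ph: "p s \<in> lhull U" if "0 \<le> s" "s \<le> 1" for s using seg[OF that] by (simp add: p_def)
  have cp: "continuous_on X p" for X unfolding p_def by (intro continuous_intros)
  have pS: "p s \<in> S" for s unfolding p_def using S_convex \<xi>S by blast
  have op: "openin (top_of_set {0..1}) {s \<in> {0..1}. F s < m}" for m
  proof -
    let ?O = "{\<zeta> \<in> lhull U. bad U \<zeta> < (c + m) + A \<bullet> \<zeta>}"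
    have "openin (top_of_set {0..1}) ({0..1} \<inter> p -` ?O)"
      by (rule continuous_openin_preimage[OF cp _ openin_bad_sublevel[OF U]]) (use pS in auto)
    moreover have "{0..1} \<inter> p -` ?O = {s \<in> {0..1}. F s < m}"
      using ph by (auto simp: F_def)
    ultimately show ?thesis by simp
  qed
  have clo: "closed {s \<in> {0..1}. m \<le> F s}" for m
  proof -
    have "closedin (top_of_set {0..1}) ({0..1} - {s \<in> {0..1}. F s < m})"
      using op[of m] by (metis closedin_diff closedin_topspace topspace_euclidean_subtopology)
    moreover have "{0..1} - {s \<in> {0..1}. F s < m} = {s \<in> {0..1}. m \<le> F s}" by auto
    ultimately show ?thesis using closedin_closed_trans by auto
  qed
  have "F s \<le> 0" if "0 \<le> s" "s \<le> 1" for s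
  proof (rule ccontr)
    assume pos: "\<not> F s \<le> 0"
    have bdd: "bdd_above (F ` {0..1})"
    proof (rule bdd_aboveI2)
      fix s :: real assume s: "s \<in> {0..1}"
      have "0 \<le> s * bad U \<xi> + (1 - s) * bad U \<eta>"
        using s bad_nonneg seg[of 0] seg[of 1] by (intro add_nonneg_nonneg mult_nonneg_nonneg) auto
      then show "F s \<le> 1" using bad_le_1[OF ph[of s]] s unfolding F_def aff by simp
    qed
    define M where "M = (SUP s\<in>{0..1}. F s)"
    have M: "F s \<le> M" if "0 \<le> s" "s \<le> 1" for s
      unfolding M_def using bdd that by (intro cSUP_upper) auto
    have M0: "0 < M" using pos M[of s] that by linarith
    \<comment> \<open>Semicontinuity makes these superlevel sets compact; a point of their
      intersection attains the supremum.\<close>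
    define An where "An k = {s \<in> {0..1}. M - inverse (real (Suc k)) \<le> F s}" for k
    have "\<Inter>(range An) \<noteq> {}"
    proof (rule compact_nest)
      show "compact (An k)" for k
        using clo[of "M - inverse (real (Suc k))"] by (auto simp: An_def compact_eq_bounded_closed intro: bounded_subset[of "{0..1}"])
      show "An k \<noteq> {}" for k
      proof -
        have "M - inverse (real (Suc k)) < M" by simp
        then obtain s where "s \<in> {0..1}" "M - inverse (real (Suc k)) < F s"
          using less_cSUP_iff[OF _ bdd] unfolding M_def by (metis atLeastAtMost_iff empty_iff order_refl zero_le_one)
        then show ?thesis by (auto simp: An_def)
      qed
      show "An n \<subseteq> An k" if "k \<le> n" for k n
      proof -
        have "inverse (real (Suc n)) \<le> inverse (real (Suc k))" using that by (simp add: le_imp_inverse_le)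
        then have "M - inverse (real (Suc n)) \<le> x \<Longrightarrow> M - inverse (real (Suc k)) \<le> x" for x
          by linarith
        then show ?thesis unfolding An_def by blast
      qed
    qed
    then obtain s1 where s1: "\<And>k. s1 \<in> An k" by blast
    have "M \<le> F s1"
    proof (rule field_le_epsilon)
      fix e :: real assume "e > 0"
      then obtain k where "inverse (real (Suc k)) < e" using reals_Archimedean by blast
      then show "M \<le> F s1 + e" using s1[of k] by (simp add: An_def)
    qed
    define As where "As = {s \<in> {0..1}. M \<le> F s}"
    have As: "closed As" "As \<noteq> {}" "bdd_below As"
      using clo[of M] s1[of 0] \<open>M \<le> F s1\<close> by (auto simp: As_def An_def intro: bdd_belowI[of _ 0])
    \<comment> \<open>The leftmost maximum point, so that the inequality is strict to its
      left.\<close>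
    define r where "r = Inf As"
    have rA: "r \<in> As" unfolding r_def by (rule closed_contains_Inf[OF As(2,3,1)])
    then have r: "0 \<le> r" "r \<le> 1" "F r = M" using M[of r] by (auto simp: As_def)
    have "r \<noteq> 0" "r \<noteq> 1" using r(3) F01 M0 by auto
    define \<rho> where "\<rho> = min r (1 - r)"
    have \<rho>: "\<rho> > 0" using r \<open>r \<noteq> 0\<close> \<open>r \<noteq> 1\<close> by (auto simp: \<rho>_def)
    have rng: "0 \<le> r + s" "r + s \<le> 1" if "\<bar>s\<bar> \<le> \<rho>" for s using that by (auto simp: \<rho>_def)
    have pr: "p r + s *\<^sub>R outer a' b' = p (r + s)" for s
      by (simp add: p_eq o D_def algebra_simps)
    show False
    proof (rule bad_no_left_max[OF U R b' _ \<rho>, of a' "p r" "c + M" A])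
      show "L \<bullet> outer a' b' = 0" using LD by (simp add: o D_def)
      show "p r + s *\<^sub>R outer a' b' \<in> lhull U" if "\<bar>s\<bar> \<le> \<rho>" for s
        unfolding pr using rng[OF that] by (rule ph)
      show "bad U (p r + s *\<^sub>R outer a' b') \<le> c + M + A \<bullet> (p r + s *\<^sub>R outer a' b')" if "\<bar>s\<bar> \<le> \<rho>" for s
        unfolding pr using M[OF rng[OF that]] by (simp add: F_def)
      show "bad U (p r) = c + M + A \<bullet> p r" using r(3) by (simp add: F_def)
      show "bad U (p r + s *\<^sub>R outer a' b') < c + M + A \<bullet> (p r + s *\<^sub>R outer a' b')" if "- \<rho> \<le> s" "s < 0" for s
      proof -
        have "\<bar>s\<bar> \<le> \<rho>" using that by simp
        note rs = rng[OF this]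
        have "r + s \<notin> As" using that(2) cInf_lower[OF _ As(3), of "r + s"] unfolding r_def[symmetric] by auto
        then have "F (r + s) < M" using rs by (auto simp: As_def)
        then show ?thesis unfolding pr by (simp add: F_def)
      qed
    qed
  qed
  from this[OF l] show ?thesis unfolding F_def aff by (simp add: p_def)
qed

theorem bad_lhull_eq_0:
  assumes U: "openin (top_of_set S) U" and R: "lhull U \<subseteq> cball 0 R" and \<xi>: "\<xi> \<in> lhull U"
  shows "bad U \<xi> = 0"
proof (rule lhull_localization[OF U _ _ _ \<xi>])
  show "0 \<le> bad U \<xi> \<and> bad U \<xi> \<le> 1" if "\<xi> \<in> lhull U" for \<xi>
    using bad_nonneg[OF that] bad_le_1[OF that] ..
  show "bad U \<xi> = 0" if "\<xi> \<in> U" for \<xi>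
    by (rule bad_eq_0[OF that openin_imp_subset[OF U]])
qed (rule bad_convex[OF U R])

end

section \<open>Averages of derivatives over small cubes\<close>

lemma One_eq_vec: "(One :: real^'n) = vec 1"
proof -
  have "(One :: real^'n) $ i = 1" for i
  proof -
    have "(One :: real^'n) $ i = One \<bullet> axis i (1::real)" by (rule cart_eq_inner_axis)
    also have "\<dots> = (\<Sum>b\<in>Basis. b \<bullet> axis i (1::real))" by (rule inner_sum_left)
    also have "\<dots> = (\<Sum>b\<in>Basis. if b = (axis i 1 :: real^'n) then 1 else 0)"
      by (intro sum.cong refl inner_Basis) (auto simp: axis_in_Basis_iff)
    also have "\<dots> = 1" by (simp add: axis_in_Basis_iff)
    finally show ?thesis .
  qed
  then show ?thesis by (simp add: vec_eq_iff)
qed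

lemma lebesgue_integral_translate_borel:
  fixes f :: "'a::euclidean_space \<Rightarrow> real"
  assumes [measurable]: "f \<in> borel_measurable borel"
  shows "integral\<^sup>L lebesgue (\<lambda>x. f (c + x)) = integral\<^sup>L lebesgue f"
proof -
  have "integral\<^sup>L lborel f = integral\<^sup>L (distr lborel borel ((+) c)) f"
    by (simp add: lborel_distr_plus)
  also have "\<dots> = integral\<^sup>L lborel (\<lambda>x. f (c + x))"
    by (subst integral_distr) auto
  finally show ?thesis by (simp add: integral_completion)
qed

lemma measure_cube_shift_diff:
  fixes x :: "real^'n" and j :: 'n
  assumes s: "0 \<le> s" "s \<le> h" and h: "0 < h"
  defines "Q \<equiv> cbox x (x + vec h)" and "Q' \<equiv> cbox (x + axis j s) (x + axis j s + vec h)"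
  shows "measure lebesgue (Q - Q') = s * h ^ (CARD('n) - 1)" "measure lebesgue (Q' - Q) = s * h ^ (CARD('n) - 1)"
proof -
  have box: "measure lebesgue (cbox y (y + vec h)) = h ^ CARD('n)" for y :: "real^'n"
  proof -
    have "cbox y (y + vec h) \<noteq> {}" using h by (auto simp: interval_ne_empty_cart)
    then show ?thesis by (simp add: content_cbox_cart)
  qed
  have int: "Q \<inter> Q' = cbox (x + axis j s) (x + vec h)"
    using s by (auto simp: Q_def Q'_def mem_box_cart axis_def split: if_splits; smt (verit))
  have ne: "cbox (x + axis j s) (x + vec h) \<noteq> {}"
    using s h by (auto simp: interval_ne_empty_cart axis_def)
  have "measure lebesgue (Q \<inter> Q') = (\<Prod>i\<in>UNIV. h - axis j s $ i)"
    unfolding int using ne by (simp add: content_cbox_cart algebra_simps)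
  also have "\<dots> = (h - s) * (\<Prod>i\<in>UNIV - {j}. h - axis j s $ i)"
    by (subst prod.remove[of _ j]) (auto simp: axis_def)
  also have "(\<Prod>i\<in>UNIV - {j}. h - axis j s $ i) = (\<Prod>i\<in>UNIV - {j}. h)"
    by (intro prod.cong) (auto simp: axis_def)
  finally have mi: "measure lebesgue (Q \<inter> Q') = (h - s) * h ^ (CARD('n) - 1)"
    by (simp add: card_Diff_singleton)
  have pow: "h ^ CARD('n) = h * h ^ (CARD('n) - 1)"
    by (metis Suc_diff_1 power_Suc zero_less_card_finite)
  have "measure lebesgue (Q - Q') = measure lebesgue Q - measure lebesgue (Q \<inter> Q')"
  proof -
    have "Q - Q' = Q - Q \<inter> Q'" by auto
    then show ?thesis using measurable_measure_Diff[of Q lebesgue "Q \<inter> Q'"] by (simp add: Q_def Q'_def)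
  qed
  then show "measure lebesgue (Q - Q') = s * h ^ (CARD('n) - 1)"
    using box[of x] mi pow by (simp add: Q_def algebra_simps)
  have "measure lebesgue (Q' - Q) = measure lebesgue Q' - measure lebesgue (Q \<inter> Q')"
  proof -
    have "Q' - Q = Q' - Q \<inter> Q'" by auto
    then show ?thesis using measurable_measure_Diff[of Q' lebesgue "Q \<inter> Q'"] by (simp add: Q_def Q'_def)
  qed
  then show "measure lebesgue (Q' - Q) = s * h ^ (CARD('n) - 1)"
    using box[of "x + axis j s"] mi pow by (simp add: Q'_def algebra_simps)
qed

text \<open>After translation, the integral of a difference quotient lives on the symmetric
  difference of two shifted cubes, two slabs of volume \<open>s * h ^ (CARD('n) - 1)\<close> each.
  Hence the sup norm \<open>B\<close> of \<open>\<phi>\<close> controls the mean of the derivative;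
  \<open>C\<close> serves as the dominating constant in the limit.\<close>

lemma integral_cube_partial_derivative:
  fixes \<phi> :: "real^'n \<Rightarrow> real"
  assumes der: "\<And>x. (\<phi> has_derivative \<phi>' x) (at x)"
    and cont: "continuous_on UNIV (\<lambda>x. \<phi>' x (axis j 1))"
    and C: "\<And>x. \<bar>\<phi>' x (axis j 1)\<bar> \<le> C" and B: "\<And>x. \<bar>\<phi> x\<bar> \<le> B" and h: "h > 0"
  shows "\<bar>integral\<^sup>L (lebesgue_on (cbox x (x + vec h))) (\<lambda>y. \<phi>' y (axis j 1))\<bar> \<le> 2 * B * h ^ (CARD('n) - 1)"
proof -
  let ?e = "axis j 1 :: real^'n"
  let ?Q = "cbox x (x + vec h)"
  define s where "s k = h / real (k + 2)" for k :: nat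
  have s: "0 < s k" "s k \<le> h" for k using h by (auto simp: s_def field_simps)
  have s0: "s \<longlonglongrightarrow> 0"
    unfolding s_def[abs_def] using LIMSEQ_ignore_initial_segment[OF lim_const_over_n[of h], of 2] by simp
  define q where "q k y = (\<phi> (s k *\<^sub>R ?e + y) - \<phi> y) / s k" for k y
  have c\<phi>: "continuous_on A \<phi>" for A
    using der by (meson has_derivative_continuous continuous_at_imp_continuous_on)
  have line: "((\<lambda>r. \<phi> (y + r *\<^sub>R ?e)) has_real_derivative \<phi>' (y + r *\<^sub>R ?e) ?e) (at r)" for y r
  proof -
    have "((\<lambda>r. \<phi> (y + r *\<^sub>R ?e)) has_derivative (\<lambda>d. \<phi>' (y + r *\<^sub>R ?e) (d *\<^sub>R ?e))) (at r)"
      by (rule has_derivative_compose[OF _ der]) (auto intro!: derivative_eq_intros)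
    moreover have "(\<lambda>d. \<phi>' (y + r *\<^sub>R ?e) (d *\<^sub>R ?e)) = (*) (\<phi>' (y + r *\<^sub>R ?e) ?e)"
      using linear_scale[OF has_derivative_linear[OF der]] by (auto simp: fun_eq_iff mult.commute)
    ultimately show ?thesis by (simp add: has_field_derivative_def)
  qed
  have qC: "\<bar>q k y\<bar> \<le> C" for k y
  proof -
    have "\<exists>r>0. r < s k \<and> \<phi> (y + s k *\<^sub>R ?e) - \<phi> (y + 0 *\<^sub>R ?e) = (s k - 0) * \<phi>' (y + r *\<^sub>R ?e) ?e"
      using MVT2[of 0 "s k" "\<lambda>r. \<phi> (y + r *\<^sub>R ?e)" "\<lambda>r. \<phi>' (y + r *\<^sub>R ?e) ?e"] s line by auto
    then obtain r where "\<phi> (y + s k *\<^sub>R ?e) - \<phi> y = s k * \<phi>' (y + r *\<^sub>R ?e) ?e" by auto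
    then have "q k y = \<phi>' (y + r *\<^sub>R ?e) ?e" using s(1)[of k] by (simp add: q_def add.commute)
    then show ?thesis using C by simp
  qed
  have qlim: "(\<lambda>k. q k y) \<longlonglongrightarrow> \<phi>' y ?e" for y
  proof -
    have "((\<lambda>r. (\<phi> (y + r *\<^sub>R ?e) - \<phi> y) / r) \<longlongrightarrow> \<phi>' y ?e) (at 0)"
      using line[of y 0] by (simp add: DERIV_def)
    moreover have "filterlim s (at 0) sequentially"
      unfolding filterlim_at using s0 s(1) by (auto simp: less_imp_neq[symmetric])
    ultimately show ?thesis
      unfolding q_def by (auto dest: filterlim_compose simp: add.commute)
  qed
  have cq: "continuous_on UNIV (q k)" for k
    unfolding q_def using s(1)[of k] by (intro continuous_intros continuous_on_compose2[OF c\<phi>[of UNIV]]) auto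
  have "(\<lambda>k. integral\<^sup>L (lebesgue_on ?Q) (q k)) \<longlonglongrightarrow> integral\<^sup>L (lebesgue_on ?Q) (\<lambda>y. \<phi>' y ?e)"
  proof (rule integral_dominated_convergence[where w="\<lambda>_. C"])
    show "(\<lambda>y. \<phi>' y ?e) \<in> borel_measurable (lebesgue_on ?Q)" "q k \<in> borel_measurable (lebesgue_on ?Q)" for k
      using continuous_on_subset[OF cont] continuous_on_subset[OF cq]
      by (auto intro!: continuous_imp_measurable_on_sets_lebesgue)
    show "integrable (lebesgue_on ?Q) (\<lambda>_. C)"
      by (rule finite_measure.integrable_const[OF finite_measure_lebesgue_on]) simp
  qed (use qlim qC in auto)
  moreover have "\<bar>integral\<^sup>L (lebesgue_on ?Q) (q k)\<bar> \<le> 2 * B * h ^ (CARD('n) - 1)" for k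
  proof -
    let ?Q' = "cbox (x + axis j (s k)) (x + axis j (s k) + vec h)"
    have ax: "s k *\<^sub>R ?e = axis j (s k)" by (simp add: vec_eq_iff axis_def)
    have m[measurable]: "\<phi> \<in> borel_measurable borel" using c\<phi> by (intro borel_measurable_continuous_onI)
    have iQ: "integrable lebesgue (\<lambda>y. indicat_real A y * \<phi> y)" if A: "A \<in> lmeasurable" "A \<in> sets borel" for A
    proof (rule Bochner_Integration.integrable_bound[where f="\<lambda>y. B * indicat_real A y"])
      show "integrable lebesgue (\<lambda>y. B * indicat_real A y)" using A(1) by (simp add: lmeasurable_iff_integrable)
      show "(\<lambda>y. indicat_real A y * \<phi> y) \<in> borel_measurable lebesgue" 
      proof -
        have [measurable]: "A \<in> sets borel" by (rule A(2))
        have "(\<lambda>y. indicat_real A y * \<phi> y) \<in> borel_measurable borel" by measurable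
        then show ?thesis by (simp add: measurable_completion)
      qed
      show "AE y in lebesgue. norm (indicat_real A y * \<phi> y) \<le> norm (B * indicat_real A y)"
        using B by (intro AE_I2) (auto simp: indicator_def intro: order_trans[OF _ abs_ge_self])
    qed
    have shift: "integral\<^sup>L lebesgue (\<lambda>y. indicat_real ?Q y * \<phi> (s k *\<^sub>R ?e + y)) = integral\<^sup>L lebesgue (\<lambda>y. indicat_real ?Q' y * \<phi> y)"
    proof -
      have "indicat_real ?Q y = indicat_real ?Q' (s k *\<^sub>R ?e + y)" for y
        by (auto simp: indicator_def ax mem_box_cart algebra_simps)
      then show ?thesis
        using lebesgue_integral_translate_borel[of "\<lambda>y. indicat_real ?Q' y * \<phi> y" "s k *\<^sub>R ?e"] by simp
    qed
    have i1: "integrable lebesgue (\<lambda>y. indicat_real ?Q y * \<phi> (s k *\<^sub>R ?e + y))"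
    proof (rule Bochner_Integration.integrable_bound[where f="\<lambda>y. B * indicat_real ?Q y"])
      show "integrable lebesgue (\<lambda>y. B * indicat_real ?Q y)" using lmeasurable_cbox lmeasurable_iff_integrable by auto
      show "(\<lambda>y. indicat_real ?Q y * \<phi> (s k *\<^sub>R ?e + y)) \<in> borel_measurable lebesgue"
      proof -
        have "(\<lambda>y. indicat_real ?Q y * \<phi> (s k *\<^sub>R ?e + y)) \<in> borel_measurable borel" by measurable
        then show ?thesis by (simp add: measurable_completion)
      qed
      show "AE y in lebesgue. norm (indicat_real ?Q y * \<phi> (s k *\<^sub>R ?e + y)) \<le> norm (B * indicat_real ?Q y)"
        using B by (intro AE_I2) (auto simp: indicator_def intro: order_trans[OF _ abs_ge_self])
    qed
    have "?Q - ?Q' \<in> lmeasurable" "?Q' - ?Q \<in> lmeasurable"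
      by (intro fmeasurable_Diff lmeasurable_cbox fmeasurableD)+
    then have di: "integrable lebesgue (indicat_real (?Q - ?Q'))" "integrable lebesgue (indicat_real (?Q' - ?Q))"
      by (simp_all only: lmeasurable_iff_integrable)
    have "s k * integral\<^sup>L (lebesgue_on ?Q) (q k) = integral\<^sup>L (lebesgue_on ?Q) (\<lambda>y. s k * q k y)" by simp
    also have "\<dots> = integral\<^sup>L lebesgue (\<lambda>y. indicat_real ?Q y * \<phi> (s k *\<^sub>R ?e + y) - indicat_real ?Q y * \<phi> y)"
    proof -
      have "s k * q k y = \<phi> (s k *\<^sub>R ?e + y) - \<phi> y" for y using s(1)[of k] by (simp add: q_def)
      then show ?thesis by (simp add: integral_restrict_space right_diff_distrib)
    qed
    also have "\<dots> = integral\<^sup>L lebesgue (\<lambda>y. indicat_real ?Q' y * \<phi> y) - integral\<^sup>L lebesgue (\<lambda>y. indicat_real ?Q y * \<phi> y)"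
      using i1 iQ[of ?Q] shift by simp
    also have "\<dots> = integral\<^sup>L lebesgue (\<lambda>y. indicat_real ?Q' y * \<phi> y - indicat_real ?Q y * \<phi> y)"
      using iQ[of ?Q] iQ[of ?Q'] by simp
    finally have "\<bar>s k * integral\<^sup>L (lebesgue_on ?Q) (q k)\<bar>
      \<le> integral\<^sup>L lebesgue (\<lambda>y. \<bar>indicat_real ?Q' y * \<phi> y - indicat_real ?Q y * \<phi> y\<bar>)"
      by (simp only: integral_abs_bound)
    also have "\<dots> \<le> integral\<^sup>L lebesgue (\<lambda>y. B * (indicat_real (?Q - ?Q') y + indicat_real (?Q' - ?Q) y))"
    proof (rule integral_mono)
      show "integrable lebesgue (\<lambda>y. \<bar>indicat_real ?Q' y * \<phi> y - indicat_real ?Q y * \<phi> y\<bar>)"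
        using iQ[of ?Q] iQ[of ?Q'] by simp
      show "integrable lebesgue (\<lambda>y. B * (indicat_real (?Q - ?Q') y + indicat_real (?Q' - ?Q) y))"
        by (intro integrable_mult_right Bochner_Integration.integrable_add di)
      show "\<bar>indicat_real ?Q' y * \<phi> y - indicat_real ?Q y * \<phi> y\<bar> \<le> B * (indicat_real (?Q - ?Q') y + indicat_real (?Q' - ?Q) y)" for y
        using B[of y] by (auto simp: indicator_def)
    qed
    also have "\<dots> = B * (measure lebesgue (?Q - ?Q') + measure lebesgue (?Q' - ?Q))"
      using Bochner_Integration.integral_add[OF di] by simp
    also have "\<dots> = s k * (2 * B * h ^ (CARD('n) - 1))"
      using measure_cube_shift_diff[OF less_imp_le[OF s(1)[of k]] s(2)[of k] h, where x=x and j=j] by (simp add: algebra_simps)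
    finally have "s k * \<bar>integral\<^sup>L (lebesgue_on ?Q) (q k)\<bar> \<le> s k * (2 * B * h ^ (CARD('n) - 1))"
      using s(1)[of k] by (simp add: abs_mult)
    then show ?thesis using s(1)[of k] by simp
  qed
  ultimately show ?thesis
    by (intro LIMSEQ_le_const2[OF tendsto_rabs]) auto
qed

text \<open>Uniform continuity on a compact neighbourhood of \<open>K\<close>. The side is divided
  by the dimension because the norm is estimated by the sum of the coordinates.\<close>

lemma compact_uniform_scale:
  fixes G :: "real^'n \<Rightarrow> 'b::metric_space"
  assumes E: "open E" and G: "continuous_on E G" and K: "compact K" "K \<subseteq> E" and \<tau>: "\<tau> > 0"
  obtains e where "e > 0" "\<And>x y. x \<in> K \<Longrightarrow> y \<in> cbox x (x + vec e) \<Longrightarrow> y \<in> E \<and> dist (G y) (G x) < \<tau>"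
proof -
  obtain d where d: "d > 0" "(\<Union>x\<in>K. cball x d) \<subseteq> E"
    using compact_subset_open_imp_cball_epsilon_subset[OF K(1) E K(2)] by blast
  let ?K = "\<Union>x\<in>K. cball x d"
  have "compact {x + y | x y. x \<in> K \<and> y \<in> cball 0 d}"
    using K(1) compact_cball by (rule compact_sums)
  moreover have "{x + y | x y. x \<in> K \<and> y \<in> cball 0 d} = ?K"
  proof (intro equalityI subsetI)
    fix z assume "z \<in> ?K"
    then obtain x where "x \<in> K" "z \<in> cball x d" by blast
    then have "z = x + (z - x)" "z - x \<in> cball 0 d" by (auto simp: dist_norm norm_minus_commute)
    then show "z \<in> {x + y | x y. x \<in> K \<and> y \<in> cball 0 d}" using \<open>x \<in> K\<close> by blast
  next
    fix z assume "z \<in> {x + y | x y. x \<in> K \<and> y \<in> cball 0 d}"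
    then obtain x y where "x \<in> K" "y \<in> cball 0 d" "z = x + y" by blast
    then have "x \<in> K" "z \<in> cball x d" by (auto simp: dist_norm)
    then show "z \<in> ?K" by blast
  qed
  ultimately have "compact ?K" by simp
  then have "uniformly_continuous_on ?K G"
    using compact_uniformly_continuous continuous_on_subset[OF G d(2)] by blast
  then obtain d' where d': "d' > 0" "\<And>x y. x \<in> ?K \<Longrightarrow> y \<in> ?K \<Longrightarrow> dist y x < d' \<Longrightarrow> dist (G y) (G x) < \<tau>"
    using \<tau> unfolding uniformly_continuous_on_def by metis
  define e where "e = min d (d' / 2) / real CARD('n)"
  have e: "e > 0" using d d' by (simp add: e_def)
  show ?thesis
  proof (rule that[OF e])
    fix x y assume x: "x \<in> K" and y: "y \<in> cbox x (x + vec e)"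
    have "norm (y - x) \<le> (\<Sum>i\<in>UNIV. \<bar>(y - x) $ i\<bar>)" by (rule norm_le_l1_cart)
    also have "\<dots> \<le> (\<Sum>i\<in>(UNIV::'n set). e)" using y by (intro sum_mono) (auto simp: mem_box_cart algebra_simps abs_le_iff; smt (verit))
    also have "\<dots> = min d (d' / 2)" by (simp add: e_def)
    finally have n: "norm (y - x) \<le> min d (d' / 2)" .
    then have "y \<in> cball x d" by (simp add: dist_norm norm_minus_commute)
    then have yK: "y \<in> ?K" using x by blast
    moreover have xK: "x \<in> ?K" using x d(1) by (intro UN_I[of x]) auto
    moreover have "dist y x < d'" using n d'(1) by (simp add: dist_norm)
    ultimately show "y \<in> E \<and> dist (G y) (G x) < \<tau>" using d(2) d'(2) by blast
  qed
qed

section \<open>Weak gradients\<close>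

lemma integrable_lebesgue_on_subset:
  fixes f :: "'a::euclidean_space \<Rightarrow> 'b::euclidean_space"
  assumes "integrable (lebesgue_on S) f" "S \<in> sets lebesgue" "T \<in> sets lebesgue" "T \<subseteq> S"
  shows "integrable (lebesgue_on T) f"
proof -
  have "set_integrable lebesgue S f" using assms by (simp add: integrable_restrict_space set_integrable_def)
  then have "set_integrable lebesgue T f" using assms(3,4) by (rule set_integrable_subset)
  then show ?thesis using assms by (simp add: integrable_restrict_space set_integrable_def)
qed

lemma integrable_mult_compact_support:
  fixes f \<psi> :: "real^'n \<Rightarrow> real"
  assumes f: "integrable (lebesgue_on K) f" and K: "compact K"
    and \<psi>: "continuous_on UNIV \<psi>" "\<And>x. x \<notin> K \<Longrightarrow> \<psi> x = 0"
  shows "integrable lebesgue (\<lambda>x. f x * \<psi> x)"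
proof -
  obtain B where B: "B > 0" "\<And>x. norm (\<psi> x) \<le> B"
    using bounded_continuous_compact_support[OF \<psi>(1) K \<psi>(2)] by blast
  have Ks: "K \<in> sets lebesgue" using K by (simp add: fmeasurableD lmeasurable_compact)
  have "integrable (lebesgue_on K) (\<lambda>x. f x * \<psi> x)"
  proof (rule Bochner_Integration.integrable_bound[where f="\<lambda>x. B * f x"])
    show "integrable (lebesgue_on K) (\<lambda>x. B * f x)" using f by simp
    have "\<psi> \<in> borel_measurable (lebesgue_on K)"
      using continuous_on_subset[OF \<psi>(1)] Ks by (intro continuous_imp_measurable_on_sets_lebesgue) auto
    then show "(\<lambda>x. f x * \<psi> x) \<in> borel_measurable (lebesgue_on K)"
      using borel_measurable_integrable[OF f] by measurable
    show "AE x in lebesgue_on K. norm (f x * \<psi> x) \<le> norm (B * f x)"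
      using B by (intro AE_I2) (auto simp: abs_mult mult.commute[of B] intro!: mult_left_mono)
  qed
  then show ?thesis using integral_lebesgue_on_eq(2)[OF Ks, of "\<lambda>x. f x * \<psi> x"] \<psi>(2) by simp
qed

lemma integrable_components:
  fixes u :: "'a \<Rightarrow> real^'m" and G :: "'a \<Rightarrow> real^'n^'m"
  shows "integrable M u \<Longrightarrow> integrable M (\<lambda>x. u x $ i)"
    "integrable M G \<Longrightarrow> integrable M (\<lambda>x. G x $ i $ j)"
  using integrable_bounded_linear[OF bounded_linear_vec_nth, of M u i]
    integrable_bounded_linear[OF bounded_linear_vec_nth integrable_bounded_linear[OF bounded_linear_vec_nth], of M G i j]
  by auto

lemma weak_gradient_integrable:
  fixes \<phi> :: "real^'n \<Rightarrow> real" and u :: "real^'n \<Rightarrow> real^'m"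
  assumes G: "has_weak_gradient \<Omega> u G" and \<phi>: "\<phi> \<in> test_functions \<Omega>"
  shows "integrable lebesgue (\<lambda>x. u x $ i * frechet_derivative \<phi> (at x) (axis j 1))"
    "integrable lebesgue (\<lambda>x. G x $ i $ j * \<phi> x)"
proof -
  obtain K where K: "compact K" "K \<subseteq> \<Omega>" "\<And>x. x \<notin> K \<Longrightarrow> \<phi> x = 0"
    "\<And>x. x \<notin> K \<Longrightarrow> frechet_derivative \<phi> (at x) = (\<lambda>_. 0)"
    using test_function_support[OF \<phi>] by blast
  have uG: "integrable (lebesgue_on K) u" "integrable (lebesgue_on K) G"
    using G K(1,2) by (auto simp: has_weak_gradient_def)
  show "integrable lebesgue (\<lambda>x. u x $ i * frechet_derivative \<phi> (at x) (axis j 1))"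
    using K by (intro integrable_mult_compact_support[OF integrable_components(1)[OF uG(1)] K(1)]
        test_function_continuous_partial[OF \<phi>]) auto
  show "integrable lebesgue (\<lambda>x. G x $ i $ j * \<phi> x)"
    using K by (intro integrable_mult_compact_support[OF integrable_components(2)[OF uG(2)] K(1)]
        test_function_continuous[OF \<phi>]) auto
qed

lemma test_function_integral_on:
  fixes f \<phi> :: "real^'n \<Rightarrow> real"
  assumes "\<Omega> \<in> sets lebesgue" "\<phi> \<in> test_functions \<Omega>"
  shows "(LINT x|lebesgue_on \<Omega>. f x * frechet_derivative \<phi> (at x) (axis j 1))
      = (LINT x|lebesgue. f x * frechet_derivative \<phi> (at x) (axis j 1))"
    "(LINT x|lebesgue_on \<Omega>. f x * \<phi> x) = (LINT x|lebesgue. f x * \<phi> x)"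
proof -
  obtain K where K: "K \<subseteq> \<Omega>" "\<And>x. x \<notin> K \<Longrightarrow> \<phi> x = 0"
    "\<And>x. x \<notin> K \<Longrightarrow> frechet_derivative \<phi> (at x) = (\<lambda>_. 0)"
    using test_function_support[OF assms(2)] by metis
  have nz: "\<phi> x = 0" "frechet_derivative \<phi> (at x) = (\<lambda>_. 0)" if "x \<notin> \<Omega>" for x
    using K(2,3)[of x] K(1) that by (meson subsetD)+
  show "(LINT x|lebesgue_on \<Omega>. f x * frechet_derivative \<phi> (at x) (axis j 1))
      = (LINT x|lebesgue. f x * frechet_derivative \<phi> (at x) (axis j 1))"
    by (rule integral_lebesgue_on_eq(1)[OF assms(1)]) (simp add: nz)
  show "(LINT x|lebesgue_on \<Omega>. f x * \<phi> x) = (LINT x|lebesgue. f x * \<phi> x)"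
    by (rule integral_lebesgue_on_eq(1)[OF assms(1)]) (simp add: nz)
qed

lemma weak_gradientD:
  fixes \<phi> :: "real^'n \<Rightarrow> real"
  assumes "has_weak_gradient \<Omega> u G" "\<Omega> \<in> sets lebesgue" "\<phi> \<in> test_functions \<Omega>"
  shows "(LINT x|lebesgue. u x $ i * frechet_derivative \<phi> (at x) (axis j 1)) = - (LINT x|lebesgue. G x $ i $ j * \<phi> x)"
proof -
  have "(LINT x|lebesgue_on \<Omega>. u x $ i * frechet_derivative \<phi> (at x) (axis j 1)) = - (LINT x|lebesgue_on \<Omega>. G x $ i $ j * \<phi> x)"
    using assms(1,3) by (simp add: has_weak_gradient_def)
  then show ?thesis unfolding test_function_integral_on[OF assms(2,3)] .
qed

lemma has_weak_gradient_add:
  assumes \<Omega>: "\<Omega> \<in> sets lebesgue" and u: "has_weak_gradient \<Omega> u G" "has_weak_gradient \<Omega> w W"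
  shows "has_weak_gradient \<Omega> (\<lambda>x. u x + w x) (\<lambda>x. G x + W x)"
  unfolding has_weak_gradient_def
proof (intro conjI allI impI)
  fix C assume "compact C \<and> C \<subseteq> \<Omega>"
  then show "integrable (lebesgue_on C) (\<lambda>x. u x + w x)" "integrable (lebesgue_on C) (\<lambda>x. G x + W x)"
    using u by (auto simp: has_weak_gradient_def)
next
  fix \<phi> :: "real^'a \<Rightarrow> real" and i j assume \<phi>: "\<phi> \<in> test_functions \<Omega>"
  note w = weak_gradient_integrable[OF u(1) \<phi>, of i j] weak_gradient_integrable[OF u(2) \<phi>, of i j]
  note e = weak_gradientD[OF u(1) \<Omega> \<phi>, of i j] weak_gradientD[OF u(2) \<Omega> \<phi>, of i j]
  show "(LINT x|lebesgue_on \<Omega>. (u x + w x) $ i * frechet_derivative \<phi> (at x) (axis j 1))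
      = - (LINT x|lebesgue_on \<Omega>. (G x + W x) $ i $ j * \<phi> x)"
    unfolding test_function_integral_on[OF \<Omega> \<phi>] using w e by (simp add: distrib_right)
qed

text \<open>On \<open>D\<close> the weak and the classical gradient satisfy the same integration by
  parts formula, so the difference of their entries annihilates all test functions.\<close>

lemma weak_gradient_eq_classical:
  fixes v :: "real^'n \<Rightarrow> real^'m"
  assumes \<Omega>: "open \<Omega>" and G: "has_weak_gradient \<Omega> v G" and D: "open D" "D \<subseteq> \<Omega>"
    and v: "\<And>x. x \<in> D \<Longrightarrow> (v has_derivative (\<lambda>h. V x *v h)) (at x)" and V: "continuous_on D V"
  shows "negligible {x \<in> D. G x \<noteq> V x}"
proof -
  have comp: "negligible {x \<in> D. G x $ i $ j - V x $ i $ j \<noteq> 0}" for i j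
  proof (rule weak_uniqueness[OF D(1)])
    fix C assume C: "compact C" "C \<subseteq> D"
    have "integrable (lebesgue_on C) G" using G C D by (auto simp: has_weak_gradient_def)
    moreover have "integrable (lebesgue_on C) (\<lambda>x. V x $ i $ j)"
    proof -
      have "continuous_on C (\<lambda>x. V x $ i $ j)"
        by (intro continuous_on_component continuous_on_subset[OF V C(2)])
      moreover have "C \<in> lmeasurable" using C(1) by (rule lmeasurable_compact)
      moreover have "bounded ((\<lambda>x. V x $ i $ j) ` C)"
        using calculation(1) C(1) by (intro compact_imp_bounded compact_continuous_image)
      then obtain B where "\<And>x. x \<in> C \<Longrightarrow> norm (V x $ i $ j) \<le> B" by (auto simp: bounded_iff)
      ultimately show ?thesis
        by (intro finite_measure.integrable_const_bound[OF finite_measure_lebesgue_on, of _ _ B]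
            continuous_imp_measurable_on_sets_lebesgue AE_I2) (auto simp: fmeasurableD)
    qed
    ultimately show "integrable (lebesgue_on C) (\<lambda>x. G x $ i $ j - V x $ i $ j)"
      by (rule Bochner_Integration.integrable_diff[OF integrable_components(2)])
  next
    fix \<phi> :: "real^'n \<Rightarrow> real" assume \<phi>: "\<phi> \<in> test_functions D"
    have \<phi>': "\<phi> \<in> test_functions \<Omega>" using \<phi> test_functions_mono[OF D(2)] by blast
    have Vj: "(V x *v axis j 1) $ i = V x $ i $ j" for x by (simp add: matrix_vector_mult_basis column_def)
    have der: "((\<lambda>x. v x $ i) has_derivative (\<lambda>h. (V x *v h) $ i)) (at x)" if "x \<in> D" for x
      by (rule bounded_linear.has_derivative[OF bounded_linear_vec_nth v[OF that]])
    have cont: "continuous_on D (\<lambda>x. (V x *v axis j 1) $ i)"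
      unfolding Vj by (intro continuous_on_component V)
    note ibp = integration_by_parts[OF D(1) der cont \<phi>, unfolded Vj]
    have Ds: "D \<in> sets lebesgue" "\<Omega> \<in> sets lebesgue" using D(1) \<Omega> by auto
    have "(LINT x|lebesgue. v x $ i * frechet_derivative \<phi> (at x) (axis j 1)) = - (LINT x|lebesgue. G x $ i $ j * \<phi> x)"
      by (rule weak_gradientD[OF G Ds(2) \<phi>'])
    then have "(LINT x|lebesgue. G x $ i $ j * \<phi> x) = (LINT x|lebesgue. V x $ i $ j * \<phi> x)"
      using ibp(3) by simp
    then show "(LINT x|lebesgue_on D. (G x $ i $ j - V x $ i $ j) * \<phi> x) = 0"
      unfolding test_function_integral_on[OF Ds(1) \<phi>]
      using weak_gradient_integrable(2)[OF G \<phi>', of i j] ibp(2) by (simp add: left_diff_distrib)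
  qed
  have "{x \<in> D. G x \<noteq> V x} = (\<Union>(i, j)\<in>UNIV. {x \<in> D. G x $ i $ j - V x $ i $ j \<noteq> 0})"
    by (auto simp: vec_eq_iff)
  moreover have "negligible (\<Union>(i, j)\<in>UNIV. {x \<in> D. G x $ i $ j - V x $ i $ j \<noteq> 0})"
    using comp by (intro negligible_Union) auto
  ultimately show ?thesis by simp
qed

section \<open>Essentially bounded functions\<close>

lemma LinfI:
  assumes "f \<in> borel_measurable (lebesgue_on \<Omega>)" "AE x in lebesgue_on \<Omega>. norm (f x) \<le> c"
  shows "f \<in> Linf \<Omega>" "Linf_norm \<Omega> f \<le> ereal c"
proof -
  show le: "Linf_norm \<Omega> f \<le> ereal c"
    unfolding Linf_norm_def using assms by (intro esssup_I) auto
  have "ereal c < \<infinity>" by simp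
  with le have "Linf_norm \<Omega> f < \<infinity>" by (rule le_less_trans)
  then show "f \<in> Linf \<Omega>" using assms(1) by (simp add: Linf_def)
qed

lemma Linf_bound:
  assumes "f \<in> Linf \<Omega>"
  obtains c where "AE x in lebesgue_on \<Omega>. norm (f x) \<le> c"
proof -
  have "AE x in lebesgue_on \<Omega>. ereal (norm (f x)) \<le> Linf_norm \<Omega> f"
    unfolding Linf_norm_def by (rule esssup_AE)
  moreover have "Linf_norm \<Omega> f < \<infinity>" using assms by (simp add: Linf_def)
  then obtain c where "Linf_norm \<Omega> f \<le> ereal c"
    by (cases "Linf_norm \<Omega> f") auto
  ultimately have "AE x in lebesgue_on \<Omega>. norm (f x) \<le> c"
    by (auto elim!: eventually_mono dest: order_trans)
  then show ?thesis by (rule that)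
qed

lemma Linf_add:
  fixes f g :: "real^'n \<Rightarrow> 'b::{second_countable_topology,real_normed_vector}"
  assumes "f \<in> Linf \<Omega>" "g \<in> Linf \<Omega>"
  shows "(\<lambda>x. f x + g x) \<in> Linf \<Omega>"
proof -
  obtain a b where "AE x in lebesgue_on \<Omega>. norm (f x) \<le> a" "AE x in lebesgue_on \<Omega>. norm (g x) \<le> b"
    using Linf_bound assms by metis
  then have "AE x in lebesgue_on \<Omega>. norm (f x + g x) \<le> a + b"
    by eventually_elim (rule norm_triangle_mono)
  then show ?thesis
    using assms by (intro LinfI(1)[where c="a + b"] borel_measurable_add) (auto simp: Linf_def)
qed

section \<open>The iteration\<close>

text \<open>The increments are nearly orthogonal to all earlier members, so the energies
  \<open>I k k\<close> increase, up to small errors, by the squared distances. Being bounded they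
  converge, and the squared distances tend to 0.\<close>

lemma energy_L1_Cauchy:
  fixes f :: "nat \<Rightarrow> 'a \<Rightarrow> 'b::euclidean_space"
  assumes M: "finite_measure M" and meas: "\<And>k. f k \<in> borel_measurable M"
    and bnd: "\<And>k. AE x in M. norm (f k x) \<le> R"
    and orth: "\<And>k i. k \<le> i \<Longrightarrow> \<bar>LINT x|M. f k x \<bullet> (f (Suc i) x - f i x)\<bar> \<le> (1/2) ^ i"
    and e: "e > 0"
  shows "\<exists>N. \<forall>i\<ge>N. \<forall>j\<ge>N. (LINT x|M. norm (f i x - f j x)) < e"
proof -
  interpret finite_measure M by (rule M)
  note [measurable] = meas
  define m where "m = measure M (space M)"
  have bi: "integrable M (\<lambda>x. f k x \<bullet> f l x)" for k l
  proof (rule integrable_const_bound[where B="R * R"])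
    show "AE x in M. norm (f k x \<bullet> f l x) \<le> R * R"
      using bnd[of k] bnd[of l]
    proof eventually_elim
      case (elim x)
      have "norm (f k x \<bullet> f l x) \<le> norm (f k x) * norm (f l x)" by (simp add: Cauchy_Schwarz_ineq2)
      also have "\<dots> \<le> R * R" using elim by (intro mult_mono) (auto intro: order_trans[OF norm_ge_zero])
      finally show ?case .
    qed
  qed measurable
  have fi: "integrable M (f k)" for k using integrable_const_bound[OF bnd[of k]] by simp
  define I where "I k l = (LINT x|M. f k x \<bullet> f l x)" for k l
  have orth': "\<bar>I k (Suc i) - I k i\<bar> \<le> (1/2) ^ i" if "k \<le> i" for k i
    using orth[OF that] bi[of k] by (simp add: I_def inner_diff_right)
  \<comment> \<open>Telescoping along the second index; the geometric errors sum to at most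
    \<open>2 * (1/2) ^ k\<close>.\<close>
  have cross: "\<bar>I k l - I k k\<bar> \<le> 2 * (1/2) ^ k" if "k \<le> l" for k l
  proof -
    have "\<bar>I k l - I k k\<bar> \<le> 2 * (1/2) ^ k - 2 * (1/2) ^ l"
      using that
    proof (induction l rule: dec_induct)
      case (step l)
      then show ?case using orth'[of k l] by simp
    qed simp
    moreover have "0 \<le> 2 * (1/2::real) ^ l" by simp
    ultimately show ?thesis by linarith
  qed
  have sq: "(LINT x|M. (norm (f l x - f k x))\<^sup>2) \<le> I l l - I k k + 4 * (1/2) ^ k" if "k \<le> l" for k l
  proof -
    have "(norm (f l x - f k x))\<^sup>2 = f l x \<bullet> f l x - f k x \<bullet> f k x - 2 * (f k x \<bullet> f l x - f k x \<bullet> f k x)" for x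
      unfolding power2_norm_eq_inner by (simp add: inner_simps inner_commute)
    then have "(LINT x|M. (norm (f l x - f k x))\<^sup>2) = I l l - I k k - 2 * (I k l - I k k)"
      using bi by (simp add: I_def)
    then show ?thesis using cross[OF that] by (simp add: abs_le_iff)
  qed
  have si: "integrable M (\<lambda>x. (norm (f l x - f k x))\<^sup>2)" for k l
    unfolding power2_norm_eq_inner using bi by (simp add: inner_diff_left inner_diff_right)
  have I_le: "I k k \<le> R * R * m" for k
  proof -
    have "I k k \<le> (LINT x|M. R * R)"
      unfolding I_def
    proof (rule integral_mono_AE[OF bi])
      show "AE x in M. f k x \<bullet> f k x \<le> R * R"
        using bnd[of k]
      proof eventually_elim
        case (elim x)
        then have "(norm (f k x))\<^sup>2 \<le> R\<^sup>2" by (rule power_mono) simp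
        then show ?case unfolding power2_norm_eq_inner by (simp add: power2_eq_square)
      qed
    qed simp
    then show ?thesis by (simp add: m_def mult.commute)
  qed
  have I_ge: "0 \<le> I k k" for k unfolding I_def by (intro Bochner_Integration.integral_nonneg) simp
  \<comment> \<open>The correction makes the almost increasing energies increasing: the error
    \<open>4 * (1/2) ^ k\<close> of one step is
    \<open>8 * (1/2) ^ k - 8 * (1/2) ^ Suc k\<close>.\<close>
  define P where "P k = I k k - 8 * (1/2) ^ k" for k
  have "P k \<le> P (Suc k)" for k
  proof -
    have "0 \<le> (LINT x|M. (norm (f (Suc k) x - f k x))\<^sup>2)"
      by (intro Bochner_Integration.integral_nonneg) simp
    from order_trans[OF this sq[of k "Suc k"]] show ?thesis by (simp add: P_def)
  qed
  then have "incseq P" by (rule incseq_SucI)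
  moreover have "P k \<le> R * R * m" for k
  proof -
    have "0 \<le> 8 * (1/2::real) ^ k" by simp
    then show ?thesis using I_le[of k] unfolding P_def by linarith
  qed
  ultimately have "convergent P" by (meson incseq_convergent convergentI)
  moreover have "(\<lambda>k. 12 * (1/2::real) ^ k) \<longlonglongrightarrow> 12 * 0" by (intro tendsto_intros) simp
  then have z: "(\<lambda>k. 12 * (1/2::real) ^ k) \<longlonglongrightarrow> 0" by simp
  define \<eta> where "\<eta> = e / (2 * (m + 1))"
  have m0: "0 \<le> m" by (simp add: m_def)
  have \<eta>: "\<eta> > 0" using e m0 by (simp add: \<eta>_def)
  have \<eta>m: "\<eta> * m < e / 2"
  proof -
    have "\<eta> * m < \<eta> * (m + 1)" using \<eta> by simp
    also have "\<dots> = e / 2" using m0 by (simp add: \<eta>_def field_simps)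
    finally show ?thesis .
  qed
  define \<delta> where "\<delta> = \<eta> * (e / 2) / 2"
  have \<delta>: "\<delta> > 0" using \<eta> e by (simp add: \<delta>_def)
  obtain N1 where N1: "\<And>i j. i \<ge> N1 \<Longrightarrow> j \<ge> N1 \<Longrightarrow> \<bar>P i - P j\<bar> < \<delta>"
    using convergent_Cauchy[OF \<open>convergent P\<close>] \<delta> unfolding Cauchy_def dist_real_def by metis
  obtain N2 where N2: "\<And>i. i \<ge> N2 \<Longrightarrow> 12 * (1/2::real) ^ i < \<delta>"
    using order_tendstoD(2)[OF z \<delta>] by (auto simp: eventually_sequentially)
  have half: "(LINT x|M. norm (f l x - f k x)) < e" if kl: "k \<le> l" "max N1 N2 \<le> k" for k l
  proof -
    have p: "(1/2::real) ^ l \<le> (1/2) ^ k" using kl(1) by (simp add: power_decreasing)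
    have p0: "0 \<le> (1/2::real) ^ k" by simp
    have "(LINT x|M. (norm (f l x - f k x))\<^sup>2) \<le> P l - P k + 12 * (1/2) ^ k"
      using sq[OF kl(1)] p p0 unfolding P_def by linarith
    also have "\<dots> < \<delta> + \<delta>" using N1[of l k] N2[of k] kl by (simp add: abs_less_iff)
    finally have q: "(LINT x|M. (norm (f l x - f k x))\<^sup>2) < \<eta> * (e / 2)" by (simp add: \<delta>_def)
    \<comment> \<open>A pointwise passage from the mean square to the mean, at the cost of
      \<open>\<eta>\<close> times the total mass.\<close>
    have pt: "y \<le> \<eta> + y\<^sup>2 / \<eta>" if "0 \<le> y" for y :: real
    proof (cases "y \<le> \<eta>")
      case True then show ?thesis using \<eta> by (simp add: add_increasing2)
    next
      case False
      then have "y * \<eta> \<le> y * y" using that by (intro mult_left_mono) auto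
      then have "y \<le> y\<^sup>2 / \<eta>" using \<eta> by (simp add: field_simps power2_eq_square)
      then show ?thesis using \<eta> by simp
    qed
    have "(LINT x|M. norm (f l x - f k x)) \<le> (LINT x|M. \<eta> + (norm (f l x - f k x))\<^sup>2 / \<eta>)"
      using fi si pt by (intro integral_mono) auto
    also have "\<dots> = \<eta> * m + (LINT x|M. (norm (f l x - f k x))\<^sup>2) / \<eta>"
      using si by (simp add: m_def mult.commute)
    also have "(LINT x|M. (norm (f l x - f k x))\<^sup>2) / \<eta> < e / 2" using q \<eta> by (simp add: field_simps)
    finally show ?thesis using \<eta>m by linarith
  qed
  have "(LINT x|M. norm (f i x - f j x)) < e" if "i \<ge> max N1 N2" "j \<ge> max N1 N2" for i j
  proof (cases "j \<le> i")
    case True then show ?thesis using half that by blast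
  next
    case False
    then show ?thesis using half[of i j] that by (simp add: norm_minus_commute)
  qed
  then show ?thesis by blast
qed

text \<open>Inner regularity supplies a compact set of almost full measure, and on it one scale
  works for all points.\<close>

lemma choose_scale:
  fixes E :: "(real^'n) set" and G :: "real^'n \<Rightarrow> 'b::metric_space"
  assumes E: "open E" "bounded E" and G: "continuous_on E G" and \<tau>: "\<tau> > 0" and e0: "e0 > 0"
  obtains e C where "0 < e" "e \<le> e0" "compact C" "C \<subseteq> E" "measure lebesgue (E - C) \<le> \<tau>"
    "\<And>x y. x \<in> C \<Longrightarrow> y \<in> cbox x (x + vec e) \<Longrightarrow> y \<in> E \<and> dist (G y) (G x) \<le> \<tau>"
proof -
  have El: "E \<in> lmeasurable" using E by (rule lmeasurable_open[rotated])
  obtain C where C: "closed C" "C \<subseteq> E" "E - C \<in> lmeasurable" "emeasure lebesgue (E - C) < ennreal \<tau>"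
    using sets_lebesgue_inner_closed[OF fmeasurableD[OF El] \<tau>] by blast
  have cC: "compact C" using C(1,2) E(2) bounded_subset by (auto simp: compact_eq_bounded_closed)
  have m: "measure lebesgue (E - C) \<le> \<tau>"
    using C(3,4) \<tau> by (simp add: emeasure_eq_measure2 ennreal_less_iff)
  obtain e where e: "e > 0" "\<And>x y. x \<in> C \<Longrightarrow> y \<in> cbox x (x + vec e) \<Longrightarrow> y \<in> E \<and> dist (G y) (G x) < \<tau>"
    using compact_uniform_scale[OF E(1) G cC C(2) \<tau>] by metis
  show ?thesis
  proof (rule that[of "min e e0" C])
    fix x y assume "x \<in> C" "y \<in> cbox x (x + vec (min e e0))"
    moreover have "cbox x (x + vec (min e e0)) \<subseteq> cbox x (x + vec e)"
      by (auto simp: mem_box_cart; smt (verit))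
    ultimately show "y \<in> E \<and> dist (G y) (G x) \<le> \<tau>" using e(2) by (meson less_imp_le subsetD)
  qed (use e e0 cC C(2) m in auto)
qed

context linear_constraint
begin

text \<open>\<open>lev x\<close> counts the sets \<open>U j\<close> already reached at \<open>x\<close>, \<open>e\<close> is the scale below which the current
  gradient hardly oscillates on most of \<open>E\<close>, and \<open>H\<close> collects all gradients so far.\<close>

definition stage where
  "stage \<Omega> V U (k::nat) \<Phi> E (lev :: real^'n \<Rightarrow> nat) e H \<longleftrightarrow>
     pert \<Omega> \<Phi> \<and> open E \<and> E \<subseteq> \<Omega> \<and> negligible (\<Omega> - E) \<and> continuous_on E V \<and>
     (\<forall>j. open {x \<in> E. lev x = j}) \<and> (\<forall>x\<in>E. V x + J \<Phi> x \<in> lhull (U (Suc (lev x)))) \<and>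
     0 < e \<and> e \<le> (1/2) ^ k \<and> finite H \<and> (\<forall>h\<in>H. continuous_on E h) \<and> (\<lambda>x. V x + J \<Phi> x) \<in> H \<and>
     (\<exists>C. compact C \<and> C \<subseteq> E \<and> measure lebesgue (E - C) \<le> (1/2) ^ k \<and>
       (\<forall>x\<in>C. \<forall>y\<in>cbox x (x + vec e). y \<in> E \<and> dist (V y + J \<Phi> y) (V x + J \<Phi> x) \<le> (1/2) ^ k))"

text \<open>The sup norm bound is relative to the old scale \<open>e\<close>: later perturbations
  then hardly change averages of the current gradient over cubes of side \<open>e\<close>. A point
  may stay at its level in any step, but when it rises the new gradient lies in the next target
  set.\<close>

definition step where
  "step V U (k::nat) \<Phi> E (lev :: real^'n \<Rightarrow> nat) e H \<Phi>' E' lev' e' H' \<longleftrightarrow>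
     E' \<subseteq> E \<and> H \<subseteq> H' \<and> e' \<le> e \<and> (\<forall>x. norm (\<Phi>' x - \<Phi> x) \<le> e * (1/2) ^ k) \<and>
     (\<forall>h\<in>H. \<bar>LINT x|lebesgue_on E. h x \<bullet> (J \<Phi>' x - J \<Phi> x)\<bar> \<le> (1/2) ^ k) \<and>
     (\<forall>x\<in>E'. lev' x = lev x \<or> lev' x = Suc (lev x) \<and> V x + J \<Phi>' x \<in> U (Suc (lev x))) \<and>
     measure lebesgue {x \<in> E'. lev' x \<noteq> Suc (lev x)} \<le> (1/2) ^ k"

text \<open>Since \<open>bad\<close> vanishes on the hull, \<open>patching\<close> applies with an
  arbitrarily small constant bound. The good set \<open>A\<close> is open, but its boundary could
  have positive measure, while levels have to be locally constant on an open set of full measure.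
  The level is therefore raised only on a finite union \<open>F\<close> of balls in
  \<open>A\<close>, whose boundary is negligible.\<close>

lemma stage_step:
  fixes \<Omega> :: "(real^'n) set" and V :: "real^'n \<Rightarrow> real^'n^'m"
  assumes \<Omega>: "open \<Omega>" "bounded \<Omega>" and U: "\<And>j. openin (top_of_set S) (U j)"
    and R: "\<And>j. lhull (U j) \<subseteq> cball 0 R" and nest: "\<And>j. U j \<subseteq> lhull (U (Suc j))"
    and st: "stage \<Omega> V U k \<Phi> E lev e H"
  shows "\<exists>\<Phi>' E' lev' e' H'. stage \<Omega> V U (Suc k) \<Phi>' E' lev' e' H' \<and> step V U k \<Phi> E lev e H \<Phi>' E' lev' e' H'"
proof -
  have \<Phi>: "pert \<Omega> \<Phi>" and E: "open E" "E \<subseteq> \<Omega>" "negligible (\<Omega> - E)" and V: "continuous_on E V"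
    and lev: "\<And>j. open {x \<in> E. lev x = j}" and g: "\<And>x. x \<in> E \<Longrightarrow> V x + J \<Phi> x \<in> lhull (U (Suc (lev x)))"
    and e: "0 < e" "e \<le> (1/2) ^ k" and H: "finite H" "\<And>h. h \<in> H \<Longrightarrow> continuous_on E h"
    using st by (auto simp: stage_def)
  have Eb: "bounded E" using \<Omega>(2) E(2) bounded_subset by blast
  have El: "E \<in> lmeasurable" using E(1) Eb by (rule lmeasurable_open[rotated])
  have cg: "continuous_on E (\<lambda>x. V x + J \<Phi> x)"
    by (intro continuous_intros V continuous_on_J[OF pert_test[OF \<Phi>]])
  define t :: real where "t = (1/2) ^ k"
  have t: "t > 0" by (simp add: t_def)
  \<comment> \<open>The budget for points that do not rise is \<open>t\<close>: at most
    \<open>t / 4 + t / 4\<close> is lost by patching, through \<open>c\<close> and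
    \<open>\<epsilon>\<close>, and \<open>t / 2\<close> by the passage from \<open>A\<close> to
    balls.\<close>
  define c where "c = t / (4 * (measure lebesgue E + 1))"
  define \<epsilon> where "\<epsilon> = min (e * t) (t / 4)"
  have c: "c > 0" using t by (simp add: c_def add_nonneg_pos)
  have cE: "c * measure lebesgue E \<le> t / 4"
  proof -
    have "c * measure lebesgue E \<le> c * (measure lebesgue E + 1)" using c by simp
    also have "\<dots> = t / 4"
    proof -
      have "y / (4 * q) * q = y / 4" if "q > 0" for y q :: real using that by simp
      moreover have "measure lebesgue E + 1 > 0" by (simp add: add_nonneg_pos)
      ultimately show ?thesis unfolding c_def by blast
    qed
    finally show ?thesis .
  qed
  have \<epsilon>: "\<epsilon> > 0" "\<epsilon> \<le> e * t" "\<epsilon> \<le> t / 4" "\<epsilon> \<le> t" using t e by (auto simp: \<epsilon>_def)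
  have intc: "integrable (lebesgue_on E) (\<lambda>_. c)" "(LINT x|lebesgue_on E. c) = c * measure lebesgue E"
  proof -
    show "integrable (lebesgue_on E) (\<lambda>_. c)"
      by (rule finite_measure.integrable_const[OF finite_measure_lebesgue_on[OF El]])
    show "(LINT x|lebesgue_on E. c) = c * measure lebesgue E"
      using El by (simp add: measure_restrict_space fmeasurableD)
  qed
  have bad0: "bad (U (Suc (lev x))) (V x + J \<Phi> x) < c" if "x \<in> E" for x
    using bad_lhull_eq_0[OF U R g[OF that]] c by simp
  obtain \<phi> where \<phi>: "pert E \<phi>" "\<And>x. norm (\<phi> x) \<le> \<epsilon>"
    "\<And>x. x \<in> E \<Longrightarrow> V x + J \<Phi> x + J \<phi> x \<in> lhull (U (Suc (lev x)))"
    "measure lebesgue {x \<in> E. V x + J \<Phi> x + J \<phi> x \<notin> U (Suc (lev x))} \<le> (LINT x|lebesgue_on E. c) + \<epsilon>"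
    "\<And>h. h \<in> H \<Longrightarrow> \<bar>LINT x|lebesgue_on E. h x \<bullet> J \<phi> x\<bar> \<le> \<epsilon>"
  proof (rule patching[of E lev "\<lambda>j. U (Suc j)" R "\<lambda>x. V x + J \<Phi> x" "\<lambda>_. c" H \<epsilon>,
          OF E(1) Eb lev U R cg g continuous_on_const intc(1) bad0 H \<epsilon>(1)])
    fix \<phi> assume "pert E \<phi>" "\<And>x. norm (\<phi> x) \<le> \<epsilon>"
      "\<And>x. x \<in> E \<Longrightarrow> V x + J \<Phi> x + J \<phi> x \<in> lhull (U (Suc (lev x)))"
      "measure lebesgue {x \<in> E. V x + J \<Phi> x + J \<phi> x \<notin> U (Suc (lev x))} \<le> (LINT x|lebesgue_on E. c) + \<epsilon>"
      "\<And>h. h \<in> H \<Longrightarrow> \<bar>LINT x|lebesgue_on E. h x \<bullet> J \<phi> x\<bar> \<le> \<epsilon>"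
    then show thesis by (rule that)
  qed
  define \<Phi>' where "\<Phi>' x = \<Phi> x + \<phi> x" for x
  have \<phi>\<Omega>: "pert \<Omega> \<phi>" using \<phi>(1) E(2) by (rule pert_mono)
  have \<Phi>': "pert \<Omega> \<Phi>'" unfolding \<Phi>'_def by (rule pert_add[OF \<Phi> \<phi>\<Omega>])
  have J': "J \<Phi>' x = J \<Phi> x + J \<phi> x" for x
    unfolding \<Phi>'_def by (rule J_add[OF pert_test[OF \<Phi>] pert_test[OF \<phi>\<Omega>]])
  define G where "G x = V x + J \<Phi>' x" for x
  have G: "G x \<in> lhull (U (Suc (lev x)))" if "x \<in> E" for x
    using \<phi>(3)[OF that] by (simp add: G_def J' add.assoc)
  have cG: "continuous_on E G"
    unfolding G_def by (intro continuous_intros V continuous_on_J[OF pert_test[OF \<Phi>']])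
  define A where "A = {x \<in> E. G x \<in> U (Suc (lev x))}"
  have A_open: "open A"
  proof -
    have "\<exists>T. open T \<and> U j = S \<inter> T" for j using U[of j] by (auto simp: openin_open)
    then obtain T where T: "\<And>j. open (T j)" "\<And>j. U j = S \<inter> T j" by metis
    have GS: "G x \<in> S" if "x \<in> E" for x using G[OF that] hull_subset_S by blast
    have "open ({x \<in> E. lev x = j} \<inter> G -` T (Suc j))" for j
      by (rule continuous_open_preimage[OF _ lev T(1)]) (rule continuous_on_subset[OF cG], blast)
    then have "open (\<Union>j. {x \<in> E. lev x = j} \<inter> G -` T (Suc j))" by blast
    moreover have "(\<Union>j. {x \<in> E. lev x = j} \<inter> G -` T (Suc j)) = A"
      using GS by (auto simp: A_def T(2))
    ultimately show ?thesis by simp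
  qed
  have AE: "A \<subseteq> E" by (auto simp: A_def)
  have Ab: "bounded A" using AE Eb bounded_subset by blast
  have Al: "A \<in> lmeasurable" using A_open Ab by (rule lmeasurable_open[rotated])
  have EA: "measure lebesgue (E - A) \<le> t / 2"
  proof -
    have "E - A = {x \<in> E. V x + J \<Phi> x + J \<phi> x \<notin> U (Suc (lev x))}"
      by (auto simp: A_def G_def J' add.assoc)
    then have "measure lebesgue (E - A) \<le> c * measure lebesgue E + \<epsilon>"
      using \<phi>(4) by (simp only: intc(2))
    then show ?thesis using cE \<epsilon>(3) by linarith
  qed
  have "\<forall>x\<in>A. \<exists>r>0. ball x r \<subseteq> A" using A_open open_contains_ball by blast
  then obtain r0 where r0: "\<And>x. x \<in> A \<Longrightarrow> r0 x > 0" "\<And>x. x \<in> A \<Longrightarrow> ball x (r0 x) \<subseteq> A"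
    by metis
  have r0': "ball x r \<subseteq> A" if "x \<in> A" "0 < r" "r < r0 x" for x r
    using r0(2)[OF that(1)] subset_ball[of r "r0 x" x] that(3) by (meson less_imp_le order_trans)
  have t2: "t / 2 > 0" using t by simp
  obtain I where I: "finite I" "\<And>x r. (x, r) \<in> I \<Longrightarrow> x \<in> A \<and> 0 < r \<and> r < r0 x"
      "measure lebesgue (A - (\<Union>i\<in>I. ball (fst i) (snd i))) < t / 2"
  proof (rule vitali_finite_balls[OF A_open Ab r0(1) r0' t2])
    fix I :: "((real^'n) \<times> real) set"
    assume "finite I" "\<And>x r. (x, r) \<in> I \<Longrightarrow> x \<in> A \<and> 0 < r \<and> r < r0 x"
      "measure lebesgue (A - (\<Union>i\<in>I. ball (fst i) (snd i))) < t / 2"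
    then show thesis by (rule that)
  qed
  define F where "F = (\<Union>i\<in>I. ball (fst i) (snd i))"
  define F' where "F' = (\<Union>i\<in>I. cball (fst i) (snd i))"
  have F: "open F" "F \<subseteq> A" "F \<subseteq> F'" "closed F'"
  proof -
    show "F \<subseteq> A" unfolding F_def using I(2) r0' by (intro UN_least) (metis prod.collapse)
    show "F \<subseteq> F'" unfolding F_def F'_def using ball_subset_cball by blast
    show "closed F'" unfolding F'_def using I(1) by (intro closed_UN) auto
  qed (auto simp: F_def)
  have negF: "negligible (F' - F)"
  proof -
    have "F' - F \<subseteq> (\<Union>i\<in>I. sphere (fst i) (snd i))"
    proof
      fix x assume x: "x \<in> F' - F"
      then obtain i where i: "i \<in> I" "x \<in> cball (fst i) (snd i)" by (auto simp: F'_def)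
      moreover have "x \<notin> ball (fst i) (snd i)" using x i(1) unfolding F_def by blast
      ultimately have "x \<in> sphere (fst i) (snd i)" by simp
      then show "x \<in> (\<Union>i\<in>I. sphere (fst i) (snd i))" using i(1) by blast
    qed
    moreover have "negligible (\<Union>i\<in>I. sphere (fst i) (snd i))"
      using I(1) by (intro negligible_Union) (auto intro: negligible_sphere)
    ultimately show ?thesis by (rule negligible_subset[rotated])
  qed
  define E' where "E' = F \<union> (E - F')"
  define lev' where "lev' x = (if x \<in> F then Suc (lev x) else lev x)" for x
  have E': "open E'" "E' \<subseteq> E"
    using F E(1) AE by (auto simp: E'_def intro: open_Un open_Diff)
  have E'b: "bounded E'" using Eb E'(2) bounded_subset by blast
  have negE': "negligible (\<Omega> - E')"
    by (rule negligible_subset[OF negligible_Un[OF E(3) negF]]) (auto simp: E'_def)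
  have lev'o: "open {x \<in> E'. lev' x = j}" for j
  proof -
    have "{x \<in> E'. lev' x = j} = (F \<inter> (\<Union>i\<in>{i. Suc i = j}. {x \<in> E. lev x = i})) \<union> ((E - F') \<inter> {x \<in> E. lev x = j})"
      using F(2,3) AE by (auto simp: E'_def lev'_def)
    moreover have "open (F \<inter> (\<Union>i\<in>{i. Suc i = j}. {x \<in> E. lev x = i}))"
      using F(1) lev by (intro open_Int open_UN) auto
    moreover have "open ((E - F') \<inter> {x \<in> E. lev x = j})"
      using F(4) E(1) lev by (intro open_Int open_Diff) auto
    ultimately show ?thesis by (simp add: open_Un)
  qed
  have g': "V x + J \<Phi>' x \<in> lhull (U (Suc (lev' x)))" if "x \<in> E'" for x
  proof (cases "x \<in> F")
    \<comment> \<open>A point that has risen lies in its target set, which by \<open>nest\<close> is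
      contained in the hull belonging to the next level.\<close>
    case True
    then have "G x \<in> U (Suc (lev x))" using F(2) by (auto simp: A_def)
    then show ?thesis using nest True by (auto simp: G_def lev'_def)
  next
    case False
    then show ?thesis using G[of x] that E'(2) by (auto simp: G_def lev'_def)
  qed
  have cG': "continuous_on E' (\<lambda>x. V x + J \<Phi>' x)"
    using continuous_on_subset[OF cG E'(2)] by (simp add: G_def[abs_def])
  have t4: "(1/2::real) ^ Suc k > 0" "min e ((1/2) ^ Suc k) > 0" using e(1) by auto
  obtain e' C where e': "0 < e'" "e' \<le> min e ((1/2) ^ Suc k)" "compact C" "C \<subseteq> E'"
    "measure lebesgue (E' - C) \<le> (1/2) ^ Suc k"
    "\<And>x y. x \<in> C \<Longrightarrow> y \<in> cbox x (x + vec e') \<Longrightarrow> y \<in> E' \<and> dist (V y + J \<Phi>' y) (V x + J \<Phi>' x) \<le> (1/2) ^ Suc k"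
    using choose_scale[OF E'(1) E'b cG' t4] by blast
  define H' where "H' = insert (\<lambda>x. V x + J \<Phi>' x) H"
  have "stage \<Omega> V U (Suc k) \<Phi>' E' lev' e' H'"
    unfolding stage_def
  proof (intro conjI allI ballI)
    show "continuous_on E' h" if "h \<in> H'" for h
      using that cG' H(2) continuous_on_subset[OF _ E'(2)] by (auto simp: H'_def)
    show "continuous_on E' V" by (rule continuous_on_subset[OF V E'(2)])
    show "\<exists>C. compact C \<and> C \<subseteq> E' \<and> measure lebesgue (E' - C) \<le> (1/2) ^ Suc k \<and>
       (\<forall>x\<in>C. \<forall>y\<in>cbox x (x + vec e'). y \<in> E' \<and> dist (V y + J \<Phi>' y) (V x + J \<Phi>' x) \<le> (1/2) ^ Suc k)"
      using e'(3-6) by blast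
  qed (use \<Phi>' E' E(2) negE' lev'o g' e'(1,2) H(1) in \<open>auto simp: H'_def\<close>)
  moreover have "step V U k \<Phi> E lev e H \<Phi>' E' lev' e' H'"
    unfolding step_def
  proof (intro conjI allI ballI)
    show "norm (\<Phi>' x - \<Phi> x) \<le> e * (1/2) ^ k" for x
      using \<phi>(2)[of x] \<epsilon>(2) by (simp add: \<Phi>'_def t_def)
    show "\<bar>LINT x|lebesgue_on E. h x \<bullet> (J \<Phi>' x - J \<Phi> x)\<bar> \<le> (1/2) ^ k" if "h \<in> H" for h
      using \<phi>(5)[OF that] \<epsilon>(4) by (simp add: J' t_def)
    show "lev' x = lev x \<or> lev' x = Suc (lev x) \<and> V x + J \<Phi>' x \<in> U (Suc (lev x))" if "x \<in> E'" for x
      using F(2) by (auto simp: lev'_def A_def G_def)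
    have "measure lebesgue {x \<in> E'. lev' x \<noteq> Suc (lev x)} \<le> measure lebesgue ((E - A) \<union> (A - F))"
    proof (rule measure_mono_fmeasurable)
      show "{x \<in> E'. lev' x \<noteq> Suc (lev x)} \<subseteq> (E - A) \<union> (A - F)"
        using E'(2) by (auto simp: lev'_def split: if_splits)
      have "{x \<in> E'. lev' x \<noteq> Suc (lev x)} = E' - F" by (auto simp: lev'_def)
      then show "{x \<in> E'. lev' x \<noteq> Suc (lev x)} \<in> sets lebesgue" using E'(1) F(1) by auto
      show "(E - A) \<union> (A - F) \<in> lmeasurable"
        using El Al F(1) by (intro fmeasurable.Un fmeasurable_Diff) (auto simp: fmeasurableD)
    qed
    also have "\<dots> \<le> measure lebesgue (E - A) + measure lebesgue (A - F)"
      using El Al F(1) by (intro measure_Un_le) (auto simp: fmeasurableD)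
    also have "\<dots> \<le> (1/2) ^ k" using EA I(3) by (simp add: F_def t_def)
    finally show "measure lebesgue {x \<in> E'. lev' x \<noteq> Suc (lev x)} \<le> (1/2) ^ k" .
  qed (use E'(2) e'(2) in \<open>auto simp: H'_def\<close>)
  ultimately show ?thesis by blast
qed

end

section \<open>The limit of the iteration\<close>

lemma AE_lebesgue_on_negligible:
  assumes "\<Omega> \<in> sets lebesgue" "negligible (\<Omega> - E)"
  shows "AE x in lebesgue_on \<Omega>. x \<in> E"
proof -
  have "AE x in lebesgue. x \<notin> \<Omega> - E"
    using assms(2) AE_not_in negligible_iff_null_sets by blast
  then have "AE x in lebesgue. x \<in> \<Omega> \<longrightarrow> x \<in> E" by eventually_elim auto
  then show ?thesis using assms(1) by (subst AE_restrict_space_iff) auto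
qed

lemma integral_lebesgue_on_negligible_diff:
  fixes f :: "'a::euclidean_space \<Rightarrow> real"
  assumes "\<Omega> \<in> sets lebesgue" "E \<in> sets lebesgue" "E \<subseteq> \<Omega>" "negligible (\<Omega> - E)"
    and f: "f \<in> borel_measurable (lebesgue_on \<Omega>)"
  shows "(LINT x|lebesgue_on E. f x) = (LINT x|lebesgue_on \<Omega>. f x)"
proof -
  have m: "(\<lambda>x. indicator \<Omega> x *\<^sub>R f x) \<in> borel_measurable lebesgue"
    using f assms(1) by (simp add: borel_measurable_restrict_space_iff)
  have "(\<lambda>x. indicator E x * (indicator \<Omega> x *\<^sub>R f x)) \<in> borel_measurable lebesgue"
    by (intro borel_measurable_times borel_measurable_indicator assms(2) m)
  moreover have "(\<lambda>x. indicator E x * (indicator \<Omega> x *\<^sub>R f x)) = (\<lambda>x. indicator E x *\<^sub>R f x)"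
    using assms(3) by (auto simp: fun_eq_iff indicator_def)
  ultimately have m': "(\<lambda>x. indicator E x *\<^sub>R f x) \<in> borel_measurable lebesgue" by simp
  have "AE x in lebesgue. x \<notin> \<Omega> - E"
    using assms(4) AE_not_in negligible_iff_null_sets by blast
  then have "AE x in lebesgue. indicator E x *\<^sub>R f x = indicator \<Omega> x *\<^sub>R f x"
    by eventually_elim (use assms(3) in \<open>auto simp: indicator_def\<close>)
  then have "(LINT x|lebesgue. indicator E x *\<^sub>R f x) = (LINT x|lebesgue. indicator \<Omega> x *\<^sub>R f x)"
    by (rule integral_cong_AE[OF m' m])
  then show ?thesis using assms(1,2) by (simp add: integral_restrict_space)
qed

text \<open>The measures are summable, so Borel-Cantelli applies.\<close>

lemma AE_eventually_notin:
  assumes \<Omega>: "\<Omega> \<in> lmeasurable" and A: "\<And>k. A k \<in> sets lebesgue" "\<And>k. A k \<subseteq> \<Omega>"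
    and m: "\<And>k. measure lebesgue (A k) \<le> (1/2) ^ k"
  shows "AE x in lebesgue_on \<Omega>. \<forall>\<^sub>F k in sequentially. x \<notin> A k"
proof -
  have \<Omega>s: "\<Omega> \<in> sets lebesgue" using \<Omega> by (rule fmeasurableD)
  have s: "A k \<in> sets (lebesgue_on \<Omega>)" for k using A \<Omega>s by (simp add: sets_restrict_space_iff)
  have eq: "measure (lebesgue_on \<Omega>) (A k) = measure lebesgue (A k)" for k
    using A \<Omega>s by (intro measure_restrict_space) auto
  have "summable (\<lambda>k. measure (lebesgue_on \<Omega>) (A k))"
    unfolding eq using m by (intro summable_comparison_test[OF _ summable_geometric[of "1/2::real"]]) auto
  moreover have "emeasure (lebesgue_on \<Omega>) (A k) < \<infinity>" for k
    using finite_measure.emeasure_finite[OF finite_measure_lebesgue_on[OF \<Omega>], of "A k"] by (simp add: top.not_eq_extremum)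
  ultimately have "AE x in lebesgue_on \<Omega>. \<forall>\<^sub>F k in sequentially. x \<in> space (lebesgue_on \<Omega>) - A k"
    by (intro borel_cantelli_AE1[OF s])
  then show ?thesis
    by eventually_elim (auto elim: eventually_mono)
qed

text \<open>The sequence takes the value of \<open>g\<close> at the first time
  \<open>\<kappa> j\<close> at which the level reaches \<open>j\<close>. Levels rise by at most one,
  so the level is then exactly \<open>j\<close> and \<open>g\<close> has just been placed in
  \<open>U j\<close>; and \<open>l k \<le> k\<close> forces these times to infinity, so the limit is
  inherited.\<close>

lemma level_diagonal:
  fixes l :: "nat \<Rightarrow> nat" and g :: "nat \<Rightarrow> 'a::topological_space"
  assumes l0: "l 0 = 0" and g0: "g 0 \<in> U 0"
    and lS: "\<And>k. l (Suc k) = l k \<or> l (Suc k) = Suc (l k) \<and> g (Suc k) \<in> U (Suc (l k))"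
    and ev: "\<forall>\<^sub>F k in sequentially. l (Suc k) = Suc (l k)"
    and lim: "g \<longlonglongrightarrow> \<xi>"
  shows "\<exists>X. (\<forall>i. X i \<in> U i) \<and> X \<longlonglongrightarrow> \<xi>"
proof -
  have lk: "l k \<le> k" for k
  proof (induction k)
    case (Suc k) then show ?case using lS[of k] by auto
  qed (simp add: l0)
  obtain N where N: "\<And>k. k \<ge> N \<Longrightarrow> l (Suc k) = Suc (l k)" using ev by (auto simp: eventually_sequentially)
  have "l (N + m) = l N + m" for m by (induction m) (auto simp: N)
  then have unb: "\<exists>k. j \<le> l k" for j by (metis le_add2)
  define \<kappa> where "\<kappa> j = (LEAST k. j \<le> l k)" for j
  have \<kappa>: "j \<le> l (\<kappa> j)" for j unfolding \<kappa>_def using unb by (rule LeastI_ex)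
  have "g (\<kappa> j) \<in> U j" for j
  proof (cases j)
    case 0
    have "\<kappa> 0 = 0" unfolding \<kappa>_def by (rule Least_eq_0) simp
    then show ?thesis using g0 0 by simp
  next
    case (Suc i)
    obtain p where p: "\<kappa> j = Suc p" using \<kappa>[of j] l0 Suc by (cases "\<kappa> j") auto
    have "\<not> j \<le> l p" using not_less_Least[of p "\<lambda>k. j \<le> l k"] p by (simp add: \<kappa>_def)
    then have "l (Suc p) = Suc (l p) \<and> g (Suc p) \<in> U (Suc (l p))" "j = Suc (l p)"
      using lS[of p] \<kappa>[of j] p by auto
    then show ?thesis using p by simp
  qed
  moreover have "(\<lambda>j. g (\<kappa> j)) \<longlonglongrightarrow> \<xi>"
  proof (rule filterlim_compose[OF lim])
    show "filterlim \<kappa> sequentially sequentially"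
      unfolding filterlim_at_top eventually_sequentially using \<kappa> lk by (meson le_trans)
  qed
  ultimately show ?thesis by (intro exI[of _ "\<lambda>j. g (\<kappa> j)"]) blast
qed

text \<open>Fixes one run of the stages; that a run exists is shown by dependent choice in
  \<open>convex_integration\<close>. \<open>V\<close> is zero off \<open>E 0\<close>, which makes it
  measurable on \<Omega>.\<close>

locale iteration = linear_constraint L t for L :: "real^'n^'m" and t :: real +
  fixes \<Omega> :: "(real^'n) set" and V :: "real^'n \<Rightarrow> real^'n^'m" and U :: "nat \<Rightarrow> (real^'n^'m) set"
    and R :: real and \<Phi> :: "nat \<Rightarrow> real^'n \<Rightarrow> real^'m" and E :: "nat \<Rightarrow> (real^'n) set"
    and lev :: "nat \<Rightarrow> real^'n \<Rightarrow> nat" and e :: "nat \<Rightarrow> real" and H :: "nat \<Rightarrow> (real^'n \<Rightarrow> real^'n^'m) set"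
  assumes \<Omega>: "open \<Omega>" "bounded \<Omega>" and R: "\<And>j. lhull (U j) \<subseteq> cball 0 R"
    and V0: "\<And>x. x \<notin> E 0 \<Longrightarrow> V x = 0" "\<And>x. x \<in> E 0 \<Longrightarrow> V x \<in> U 0" "\<And>x. x \<in> E 0 \<Longrightarrow> V x \<in> lhull (U 0)"
    and init: "\<Phi> 0 = (\<lambda>_. 0)" "lev 0 = (\<lambda>_. 0)"
    and st: "\<And>k. stage \<Omega> V U k (\<Phi> k) (E k) (lev k) (e k) (H k)"
    and sp: "\<And>k. step V U k (\<Phi> k) (E k) (lev k) (e k) (H k) (\<Phi> (Suc k)) (E (Suc k)) (lev (Suc k)) (e (Suc k)) (H (Suc k))"
begin

abbreviation G where "G k x \<equiv> V x + J (\<Phi> k) x"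

lemma stageD:
  "pert \<Omega> (\<Phi> k)" "open (E k)" "E k \<subseteq> \<Omega>" "negligible (\<Omega> - E k)" "continuous_on (E k) V"
  "open {x \<in> E k. lev k x = j}" "x \<in> E k \<Longrightarrow> G k x \<in> lhull (U (Suc (lev k x)))"
  "0 < e k" "e k \<le> (1/2) ^ k" "G k \<in> H k"
  using st[of k] by (auto simp: stage_def)

lemma stage_compact:
  obtains C where "compact C" "C \<subseteq> E k" "measure lebesgue (E k - C) \<le> (1/2) ^ k"
    "\<And>x y. x \<in> C \<Longrightarrow> y \<in> cbox x (x + vec (e k)) \<Longrightarrow> y \<in> E k \<and> dist (G k y) (G k x) \<le> (1/2) ^ k"
  using st[of k] by (auto simp: stage_def)

lemma stepD:
  "E (Suc k) \<subseteq> E k" "H k \<subseteq> H (Suc k)" "e (Suc k) \<le> e k"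
  "norm (\<Phi> (Suc k) x - \<Phi> k x) \<le> e k * (1/2) ^ k"
  "h \<in> H k \<Longrightarrow> \<bar>LINT x|lebesgue_on (E k). h x \<bullet> (J (\<Phi> (Suc k)) x - J (\<Phi> k) x)\<bar> \<le> (1/2) ^ k"
  "x \<in> E (Suc k) \<Longrightarrow> lev (Suc k) x = lev k x \<or> lev (Suc k) x = Suc (lev k x) \<and> G (Suc k) x \<in> U (Suc (lev k x))"
  "measure lebesgue {x \<in> E (Suc k). lev (Suc k) x \<noteq> Suc (lev k x)} \<le> (1/2) ^ k"
  using sp[of k] by (auto simp: step_def)

lemma \<Omega>l: "\<Omega> \<in> lmeasurable" and \<Omega>s: "\<Omega> \<in> sets lebesgue"
  using \<Omega> by (auto intro: lmeasurable_open simp: fmeasurableD)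

lemma finite_\<Omega>: "finite_measure (lebesgue_on \<Omega>)"
  by (rule finite_measure_lebesgue_on[OF \<Omega>l])

lemma test: "\<Phi> k \<in> test_functions \<Omega>"
  by (rule pert_test[OF stageD(1)])

lemma e_antimono: "k \<le> l \<Longrightarrow> e l \<le> e k"
  by (rule lift_Suc_antimono_le[of e]) (rule stepD(3))

lemma H_mono: "k \<le> l \<Longrightarrow> H k \<subseteq> H l"
  by (rule lift_Suc_mono_le[of H]) (rule stepD(2))

lemma E_le_0: "E k \<subseteq> E 0"
  using lift_Suc_antimono_le[of E, OF stepD(1), of 0 k] by simp

text \<open>Scales decrease, so all later moves are measured against \<open>e k\<close>, and the
  geometric series doubles the first term. The factor \<open>e k\<close> is what the averages over
  cubes of side \<open>e k\<close> need.\<close>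

lemma \<Phi>_diff: "k \<le> l \<Longrightarrow> norm (\<Phi> l x - \<Phi> k x) \<le> 2 * e k * (1/2) ^ k"
proof -
  assume kl: "k \<le> l"
  have "norm (\<Phi> l x - \<Phi> k x) \<le> e k * (2 * (1/2) ^ k - 2 * (1/2) ^ l)"
    using kl
  proof (induction l rule: dec_induct)
    case (step l)
    have "norm (\<Phi> (Suc l) x - \<Phi> k x) \<le> norm (\<Phi> (Suc l) x - \<Phi> l x) + norm (\<Phi> l x - \<Phi> k x)"
      using norm_triangle_ineq[of "\<Phi> (Suc l) x - \<Phi> l x" "\<Phi> l x - \<Phi> k x"] by simp
    also have "\<dots> \<le> e k * (1/2) ^ l + e k * (2 * (1/2) ^ k - 2 * (1/2) ^ l)"
    proof -
      have "e l * (1/2) ^ l \<le> e k * (1/2) ^ l"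
        by (rule mult_right_mono[OF e_antimono[OF step(1)]]) simp
      then show ?thesis using stepD(4)[of l x] step.IH by linarith
    qed
    also have "\<dots> = e k * (2 * (1/2) ^ k - 2 * (1/2) ^ Suc l)" by (simp add: algebra_simps)
    finally show ?case .
  qed simp
  also have "\<dots> \<le> e k * (2 * (1/2) ^ k)" using stageD(8)[of k] by (intro mult_left_mono) auto
  finally show ?thesis by (simp add: mult_ac)
qed

definition w where "w x = lim (\<lambda>k. \<Phi> k x)"

lemma \<Phi>_lim: "(\<lambda>k. \<Phi> k x) \<longlonglongrightarrow> w x"
proof -
  have "Cauchy (\<lambda>k. \<Phi> k x)"
  proof (rule metric_CauchyI)
    fix \<delta> :: real assume \<delta>: "\<delta> > 0"
    obtain N where "(1/2::real) ^ N < \<delta> / 4"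
      using real_arch_pow_inv[of "\<delta> / 4" "1/2"] \<delta> by auto
    then have N: "4 * (1/2::real) ^ N < \<delta>" by simp
    have le: "norm (\<Phi> k x - \<Phi> N x) \<le> 2 * (1/2) ^ N" if "k \<ge> N" for k
    proof -
      have "e N \<le> 1" using stageD(9)[of N] power_le_one[of "1/2::real" N] by simp
      then have "2 * e N * (1/2) ^ N \<le> 2 * 1 * (1/2) ^ N" by (intro mult_right_mono mult_left_mono) auto
      from order_trans[OF \<Phi>_diff[OF that] this] show ?thesis by simp
    qed
    have "dist (\<Phi> k x) (\<Phi> l x) < \<delta>" if "k \<ge> N" "l \<ge> N" for k l
    proof -
      have "dist (\<Phi> k x) (\<Phi> l x) \<le> norm (\<Phi> k x - \<Phi> N x) + norm (\<Phi> l x - \<Phi> N x)"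
        using dist_triangle2[of "\<Phi> k x" "\<Phi> l x" "\<Phi> N x"] by (simp add: dist_norm)
      then show ?thesis using le[OF that(1)] le[OF that(2)] N by simp
    qed
    then show "\<exists>M. \<forall>m\<ge>M. \<forall>n\<ge>M. dist (\<Phi> m x) (\<Phi> n x) < \<delta>" by blast
  qed
  then show ?thesis unfolding w_def using Cauchy_convergent convergent_LIMSEQ_iff by blast
qed

lemma w_diff: "norm (w x - \<Phi> k x) \<le> 2 * e k * (1/2) ^ k"
proof (rule LIMSEQ_le_const2)
  show "(\<lambda>l. norm (\<Phi> l x - \<Phi> k x)) \<longlonglongrightarrow> norm (w x - \<Phi> k x)"
    by (intro tendsto_intros \<Phi>_lim)
qed (use \<Phi>_diff in blast)

lemma AE_E: "AE x in lebesgue_on \<Omega>. \<forall>k. x \<in> E k"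
  unfolding AE_all_countable using AE_lebesgue_on_negligible[OF \<Omega>s stageD(4)] by blast

lemma G_bound: "x \<in> E k \<Longrightarrow> norm (G k x) \<le> R"
  using stageD(7) R by (meson mem_cball_0 subsetD)

lemma V_bound: "x \<in> E 0 \<Longrightarrow> norm (V x) \<le> R"
  using V0(3) R by (meson mem_cball_0 subsetD)

lemma J_bound: "x \<in> E k \<Longrightarrow> norm (J (\<Phi> k) x) \<le> 2 * R"
  using norm_triangle_ineq4[of "G k x" "V x"] G_bound[of x k] V_bound[of x] E_le_0[of k] by auto

lemma J_meas: "J (\<Phi> k) \<in> borel_measurable (lebesgue_on \<Omega>)"
  by (intro continuous_imp_measurable_on_sets_lebesgue continuous_on_J[OF test] \<Omega>s)

lemma V_meas: "V \<in> borel_measurable (lebesgue_on \<Omega>)"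
proof -
  have E0: "E 0 \<in> sets lebesgue" using stageD(2)[of 0] by simp
  have "V \<in> borel_measurable (lebesgue_on (E 0))"
    by (intro continuous_imp_measurable_on_sets_lebesgue stageD(5) E0)
  then have "(\<lambda>x. if x \<in> E 0 then V x else 0) \<in> borel_measurable lebesgue"
    using E0 by (rule borel_measurable_if_I)
  moreover have "(\<lambda>x. if x \<in> E 0 then V x else 0) = V" using V0(1) by auto
  ultimately show ?thesis by (simp add: measurable_restrict_space1)
qed

lemma G_meas: "G k \<in> borel_measurable (lebesgue_on \<Omega>)"
  using V_meas J_meas by (rule borel_measurable_add)

lemma J_int: "integrable (lebesgue_on \<Omega>) (J (\<Phi> k))"
  using integral_lebesgue_on_eq(2)[OF \<Omega>s, of "J (\<Phi> k)"] J_outside[OF test] J_integrable[OF test] by blast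

text \<open>\<open>V\<close> cancels in differences, so the energy argument is run on the full
  gradients: \<open>G k\<close> lies in \<open>H i\<close> for all \<open>i \<ge> k\<close>, which
  yields the required near orthogonality.\<close>

lemma L1_Cauchy:
  assumes "\<delta> > 0"
  shows "\<exists>N. \<forall>i\<ge>N. \<forall>j\<ge>N. (LINT x|lebesgue_on \<Omega>. norm (J (\<Phi> i) x - J (\<Phi> j) x)) < \<delta>"
proof -
  have "\<exists>N. \<forall>i\<ge>N. \<forall>j\<ge>N. (LINT x|lebesgue_on \<Omega>. norm (G i x - G j x)) < \<delta>"
  proof (rule energy_L1_Cauchy[OF finite_\<Omega> G_meas _ _ assms, where R=R])
    show "AE x in lebesgue_on \<Omega>. norm (G k x) \<le> R" for k
      using AE_E by eventually_elim (auto intro: G_bound)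
    show "\<bar>LINT x|lebesgue_on \<Omega>. G k x \<bullet> (G (Suc i) x - G i x)\<bar> \<le> (1/2) ^ i" if "k \<le> i" for k i
    proof -
      have m: "(\<lambda>x. G k x \<bullet> (J (\<Phi> (Suc i)) x - J (\<Phi> i) x)) \<in> borel_measurable (lebesgue_on \<Omega>)"
        by (intro borel_measurable_inner borel_measurable_diff G_meas J_meas)
      have "E i \<in> sets lebesgue" using stageD(2)[of i] by simp
      then have "(LINT x|lebesgue_on (E i). G k x \<bullet> (J (\<Phi> (Suc i)) x - J (\<Phi> i) x))
          = (LINT x|lebesgue_on \<Omega>. G k x \<bullet> (J (\<Phi> (Suc i)) x - J (\<Phi> i) x))"
        by (rule integral_lebesgue_on_negligible_diff[OF \<Omega>s _ stageD(3,4) m])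
      moreover have "G k \<in> H i" using stageD(10) H_mono[OF that] by blast
      ultimately show ?thesis using stepD(5)[of "G k" i] by simp
    qed
  qed
  then show ?thesis by simp
qed

text \<open>Serves to define the limit \<open>W\<close> pointwise. Convergence of the full sequence
  almost everywhere is a separate matter, settled by averaging.\<close>

definition r where "r = (SOME r. strict_mono r \<and> (AE x in lebesgue_on \<Omega>. Cauchy (\<lambda>i. J (\<Phi> (r i)) x)))"

lemma r: "strict_mono r" "AE x in lebesgue_on \<Omega>. Cauchy (\<lambda>i. J (\<Phi> (r i)) x)"
proof -
  obtain r' where "strict_mono r'" "AE x in lebesgue_on \<Omega>. Cauchy (\<lambda>i. J (\<Phi> (r' i)) x)"
    using cauchy_L1_AE_cauchy_subseq[OF J_int L1_Cauchy] by blast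
  then have "\<exists>r. strict_mono r \<and> (AE x in lebesgue_on \<Omega>. Cauchy (\<lambda>i. J (\<Phi> (r i)) x))" by blast
  from someI_ex[OF this] show "strict_mono r" "AE x in lebesgue_on \<Omega>. Cauchy (\<lambda>i. J (\<Phi> (r i)) x)"
    by (auto simp: r_def)
qed

definition W where "W x = lim (\<lambda>i. J (\<Phi> (r i)) x)"

lemma W_lim: "AE x in lebesgue_on \<Omega>. (\<lambda>i. J (\<Phi> (r i)) x) \<longlonglongrightarrow> W x"
  using r(2) by eventually_elim (auto simp: W_def Cauchy_convergent_iff convergent_LIMSEQ_iff)

lemma W_meas: "W \<in> borel_measurable (lebesgue_on \<Omega>)"
  unfolding W_def[abs_def] by (intro borel_measurable_lim_metric J_meas)

lemma AE_J_bound: "AE x in lebesgue_on \<Omega>. \<forall>k. norm (J (\<Phi> k) x) \<le> 2 * R"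
  using AE_E by eventually_elim (auto intro: J_bound)

lemma W_bound: "AE x in lebesgue_on \<Omega>. norm (W x) \<le> 2 * R"
  using W_lim AE_J_bound
proof eventually_elim
  case (elim x)
  then show ?case by (intro LIMSEQ_le_const2[OF tendsto_norm[OF elim(1)]]) auto
qed

lemma W_int: "integrable (lebesgue_on \<Omega>) W"
  by (rule finite_measure.integrable_const_bound[OF finite_\<Omega> W_bound W_meas])

text \<open>Dominated convergence along the subsequence, then the L1 Cauchy property for the full
  sequence.\<close>

lemma W_L1: "(\<lambda>k. LINT x|lebesgue_on \<Omega>. norm (J (\<Phi> k) x - W x)) \<longlonglongrightarrow> 0"
proof -
  have sub: "(\<lambda>i. LINT x|lebesgue_on \<Omega>. norm (J (\<Phi> (r i)) x - W x)) \<longlonglongrightarrow> (LINT x|lebesgue_on \<Omega>. 0)"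
  proof (rule integral_dominated_convergence[where w="\<lambda>_. 4 * R"])
    show "integrable (lebesgue_on \<Omega>) (\<lambda>_. 4 * R)" by (rule finite_measure.integrable_const[OF finite_\<Omega>])
    show "(\<lambda>x. norm (J (\<Phi> (r i)) x - W x)) \<in> borel_measurable (lebesgue_on \<Omega>)" for i
      by (intro borel_measurable_norm[THEN measurable_compose[rotated]] borel_measurable_diff J_meas W_meas)
    show "AE x in lebesgue_on \<Omega>. (\<lambda>i. norm (J (\<Phi> (r i)) x - W x)) \<longlonglongrightarrow> 0"
      using W_lim
    proof eventually_elim
      case (elim x)
      from tendsto_norm[OF tendsto_diff[OF elim tendsto_const[of "W x"]]] show ?case by simp
    qed
    show "AE x in lebesgue_on \<Omega>. norm (norm (J (\<Phi> (r i)) x - W x)) \<le> 4 * R" for i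
      using AE_J_bound W_bound
    proof eventually_elim
      case (elim x)
      then show ?case using norm_triangle_ineq4[of "J (\<Phi> (r i)) x" "W x"] by (auto dest: spec[of _ "r i"])
    qed
  qed simp
  show ?thesis
  proof (rule LIMSEQ_I)
    fix \<delta> :: real assume \<delta>: "\<delta> > 0"
    obtain N1 where N1: "\<And>i j. i \<ge> N1 \<Longrightarrow> j \<ge> N1 \<Longrightarrow> (LINT x|lebesgue_on \<Omega>. norm (J (\<Phi> i) x - J (\<Phi> j) x)) < \<delta> / 2"
      using L1_Cauchy[of "\<delta> / 2"] \<delta> by auto
    obtain N2 where N2: "\<And>i. i \<ge> N2 \<Longrightarrow> (LINT x|lebesgue_on \<Omega>. norm (J (\<Phi> (r i)) x - W x)) < \<delta> / 2"
      using order_tendstoD(2)[OF sub, of "\<delta> / 2"] \<delta> by (auto simp: eventually_sequentially)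
    have "norm ((LINT x|lebesgue_on \<Omega>. norm (J (\<Phi> k) x - W x)) - 0) < \<delta>" if k: "k \<ge> N1" for k
    proof -
      define i where "i = max N1 N2"
      have ri: "r i \<ge> N1" using seq_suble[OF r(1), of i] by (simp add: i_def)
      have "(LINT x|lebesgue_on \<Omega>. norm (J (\<Phi> k) x - W x))
        \<le> (LINT x|lebesgue_on \<Omega>. norm (J (\<Phi> k) x - J (\<Phi> (r i)) x) + norm (J (\<Phi> (r i)) x - W x))"
      proof (rule integral_mono)
        show "norm (J (\<Phi> k) x - W x) \<le> norm (J (\<Phi> k) x - J (\<Phi> (r i)) x) + norm (J (\<Phi> (r i)) x - W x)" for x
          using norm_triangle_ineq[of "J (\<Phi> k) x - J (\<Phi> (r i)) x" "J (\<Phi> (r i)) x - W x"] by simp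
      qed (intro integrable_norm Bochner_Integration.integrable_add Bochner_Integration.integrable_diff J_int W_int)+
      also have "\<dots> = (LINT x|lebesgue_on \<Omega>. norm (J (\<Phi> k) x - J (\<Phi> (r i)) x)) + (LINT x|lebesgue_on \<Omega>. norm (J (\<Phi> (r i)) x - W x))"
        by (intro Bochner_Integration.integral_add integrable_norm Bochner_Integration.integrable_diff J_int W_int)
      also have "\<dots> < \<delta>" using N1[OF k ri] N2[of i] by (simp add: i_def)
      finally show ?thesis by (simp add: Bochner_Integration.integral_nonneg)
    qed
    then show "\<exists>N. \<forall>k\<ge>N. norm ((LINT x|lebesgue_on \<Omega>. norm (J (\<Phi> k) x - W x)) - 0) < \<delta>" by blast
  qed
qed

end

lemma lebesgue_on_integral_mono_set:
  fixes f :: "'a::euclidean_space \<Rightarrow> real"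
  assumes "integrable (lebesgue_on \<Omega>) f" "\<Omega> \<in> sets lebesgue" "Q \<in> sets lebesgue" "Q \<subseteq> \<Omega>" "\<And>x. 0 \<le> f x"
  shows "(LINT x|lebesgue_on Q. f x) \<le> (LINT x|lebesgue_on \<Omega>. f x)"
proof -
  have Q: "integrable (lebesgue_on Q) f" by (rule integrable_lebesgue_on_subset[OF assms(1-4)])
  have i: "integrable lebesgue (\<lambda>x. indicator \<Omega> x *\<^sub>R f x)" "integrable lebesgue (\<lambda>x. indicator Q x *\<^sub>R f x)"
    using assms(1-3) Q by (simp_all add: integrable_restrict_space)
  have "(LINT x|lebesgue. indicator Q x *\<^sub>R f x) \<le> (LINT x|lebesgue. indicator \<Omega> x *\<^sub>R f x)"
    by (rule integral_mono[OF i(2,1)]) (use assms(4,5) in \<open>auto simp: indicator_def\<close>)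
  then show ?thesis using assms(2,3) by (simp add: integral_restrict_space)
qed

lemma entry_le_norm: "\<bar>A $ i $ j\<bar> \<le> norm A" for A :: "real^'n^'m"
  by (metis Finite_Cartesian_Product.norm_nth_le component_le_norm_cart order_trans)

section \<open>Averages over cubes and convergence of the whole sequence\<close>

context iteration
begin

definition C where
  "C k = (SOME C. compact C \<and> C \<subseteq> E k \<and> measure lebesgue (E k - C) \<le> (1/2) ^ k \<and>
    (\<forall>x\<in>C. \<forall>y\<in>cbox x (x + vec (e k)). y \<in> E k \<and> dist (G k y) (G k x) \<le> (1/2) ^ k))"

lemma C: "compact (C k)" "C k \<subseteq> E k" "measure lebesgue (E k - C k) \<le> (1/2) ^ k"
  "x \<in> C k \<Longrightarrow> y \<in> cbox x (x + vec (e k)) \<Longrightarrow> y \<in> E k \<and> dist (G k y) (G k x) \<le> (1/2) ^ k"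
proof -
  have "\<exists>C. compact C \<and> C \<subseteq> E k \<and> measure lebesgue (E k - C) \<le> (1/2) ^ k \<and>
    (\<forall>x\<in>C. \<forall>y\<in>cbox x (x + vec (e k)). y \<in> E k \<and> dist (G k y) (G k x) \<le> (1/2) ^ k)"
    using stage_compact[of k] by metis
  from someI_ex[OF this, folded C_def]
  show "compact (C k)" "C k \<subseteq> E k" "measure lebesgue (E k - C k) \<le> (1/2) ^ k"
    "x \<in> C k \<Longrightarrow> y \<in> cbox x (x + vec (e k)) \<Longrightarrow> y \<in> E k \<and> dist (G k y) (G k x) \<le> (1/2) ^ k"
    by blast+
qed

text \<open>The sup norm of \<open>\<Phi> l - \<Phi> k\<close> is at most
  \<open>2 * e k * (1/2) ^ k\<close>; its factor \<open>e k\<close> restores the full power of the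
  side length. The bound is uniform in \<open>l\<close>.\<close>

lemma cube_J_diff:
  assumes "k \<le> l"
  shows "\<bar>LINT y|lebesgue_on (cbox x (x + vec (e k))). (J (\<Phi> l) y - J (\<Phi> k) y) $ i $ j\<bar>
    \<le> 4 * (1/2) ^ k * e k ^ CARD('n)"
proof -
  obtain B1 where B1: "\<And>x. norm (J (\<Phi> l) x) \<le> B1" using J_bounded[OF test] by metis
  obtain B2 where B2: "\<And>x. norm (J (\<Phi> k) x) \<le> B2" using J_bounded[OF test] by metis
  have col: "((J (\<Phi> l) y - J (\<Phi> k) y) *v axis j 1) $ i = (J (\<Phi> l) y - J (\<Phi> k) y) $ i $ j" for y
    by (simp add: matrix_vector_mult_basis column_def)
  have "\<bar>LINT y|lebesgue_on (cbox x (x + vec (e k))). ((J (\<Phi> l) y - J (\<Phi> k) y) *v axis j 1) $ i\<bar>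
      \<le> 2 * (2 * e k * (1/2) ^ k) * e k ^ (CARD('n) - 1)"
  proof (rule integral_cube_partial_derivative[where \<phi>="\<lambda>y. (\<Phi> l y - \<Phi> k y) $ i"
        and \<phi>'="\<lambda>y h. ((J (\<Phi> l) y - J (\<Phi> k) y) *v h) $ i" and C="B1 + B2"])
    show "((\<lambda>y. (\<Phi> l y - \<Phi> k y) $ i) has_derivative (\<lambda>h. ((J (\<Phi> l) y - J (\<Phi> k) y) *v h) $ i)) (at y)" for y
      unfolding matrix_vector_mult_diff_rdistrib
      by (intro bounded_linear.has_derivative[OF bounded_linear_vec_nth] has_derivative_diff J_has_derivative[OF test])
    show "continuous_on UNIV (\<lambda>y. ((J (\<Phi> l) y - J (\<Phi> k) y) *v axis j 1) $ i)"
      unfolding col by (intro continuous_on_component continuous_on_diff continuous_on_J[OF test])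
    show "\<bar>((J (\<Phi> l) y - J (\<Phi> k) y) *v axis j 1) $ i\<bar> \<le> B1 + B2" for y
      unfolding col
      using entry_le_norm[of "J (\<Phi> l) y - J (\<Phi> k) y" i j] norm_triangle_ineq4[of "J (\<Phi> l) y" "J (\<Phi> k) y"]
        B1[of y] B2[of y] by linarith
    show "\<bar>(\<Phi> l y - \<Phi> k y) $ i\<bar> \<le> 2 * e k * (1/2) ^ k" for y
      using component_le_norm_cart[of "\<Phi> l y - \<Phi> k y" i] \<Phi>_diff[OF assms, of y] by linarith
  qed (rule stageD(8))
  also have "\<dots> = 4 * (1/2) ^ k * (e k * e k ^ (CARD('n) - 1))" by (simp add: mult_ac)
  also have "e k * e k ^ (CARD('n) - 1) = e k ^ CARD('n)"
    by (metis Suc_diff_1 power_Suc zero_less_card_finite)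
  finally show ?thesis unfolding col .
qed

text \<open>The bound for \<open>J (\<Phi> l)\<close> is uniform in \<open>l\<close> and so passes
  to the L1 limit.\<close>

lemma cube_W_diff:
  assumes Q: "cbox x (x + vec (e k)) \<subseteq> \<Omega>"
  shows "\<bar>LINT y|lebesgue_on (cbox x (x + vec (e k))). (W y - J (\<Phi> k) y) $ i $ j\<bar>
    \<le> 4 * (1/2) ^ k * e k ^ CARD('n)"
proof -
  let ?Q = "cbox x (x + vec (e k))"
  have Qs: "?Q \<in> sets lebesgue" by simp
  have i1: "integrable (lebesgue_on ?Q) (J (\<Phi> l))" "integrable (lebesgue_on ?Q) W" for l
    using integrable_lebesgue_on_subset[OF _ \<Omega>s Qs Q] J_int W_int by auto
  have i2: "integrable (lebesgue_on ?Q) (\<lambda>y. (J (\<Phi> l) y - J (\<Phi> k) y) $ i $ j)"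
    "integrable (lebesgue_on ?Q) (\<lambda>y. (W y - J (\<Phi> k) y) $ i $ j)" for l
    by (intro integrable_components(2) Bochner_Integration.integrable_diff i1)+
  have "(\<lambda>l. LINT y|lebesgue_on ?Q. (J (\<Phi> l) y - J (\<Phi> k) y) $ i $ j)
      \<longlonglongrightarrow> (LINT y|lebesgue_on ?Q. (W y - J (\<Phi> k) y) $ i $ j)"
  proof (rule Lim_null_comparison[THEN LIM_zero_cancel[THEN filterlim_mono[OF _ order_refl order_refl]]])
    show "\<forall>\<^sub>F l in sequentially. norm ((LINT y|lebesgue_on ?Q. (J (\<Phi> l) y - J (\<Phi> k) y) $ i $ j)
        - (LINT y|lebesgue_on ?Q. (W y - J (\<Phi> k) y) $ i $ j)) \<le> (LINT y|lebesgue_on \<Omega>. norm (J (\<Phi> l) y - W y))"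
    proof (intro always_eventually allI)
      fix l
      have n: "integrable (lebesgue_on \<Omega>) (\<lambda>y. norm (J (\<Phi> l) y - W y))"
        by (intro integrable_norm Bochner_Integration.integrable_diff J_int W_int)
      have "(LINT y|lebesgue_on ?Q. (J (\<Phi> l) y - J (\<Phi> k) y) $ i $ j) - (LINT y|lebesgue_on ?Q. (W y - J (\<Phi> k) y) $ i $ j)
        = (LINT y|lebesgue_on ?Q. (J (\<Phi> l) y - J (\<Phi> k) y) $ i $ j - (W y - J (\<Phi> k) y) $ i $ j)"
        by (rule Bochner_Integration.integral_diff[OF i2, symmetric])
      also have "norm \<dots> \<le> (LINT y|lebesgue_on ?Q. norm ((J (\<Phi> l) y - J (\<Phi> k) y) $ i $ j - (W y - J (\<Phi> k) y) $ i $ j))"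
        by (rule integral_norm_bound)
      also have "\<dots> \<le> (LINT y|lebesgue_on ?Q. norm (J (\<Phi> l) y - W y))"
      proof (rule integral_mono)
        show "integrable (lebesgue_on ?Q) (\<lambda>y. norm (J (\<Phi> l) y - W y))"
          by (rule integrable_lebesgue_on_subset[OF n \<Omega>s Qs Q])
        show "norm ((J (\<Phi> l) y - J (\<Phi> k) y) $ i $ j - (W y - J (\<Phi> k) y) $ i $ j) \<le> norm (J (\<Phi> l) y - W y)" for y
          using entry_le_norm[of "J (\<Phi> l) y - W y" i j] by simp
      qed (intro integrable_norm Bochner_Integration.integrable_diff i2)
      also have "\<dots> \<le> (LINT y|lebesgue_on \<Omega>. norm (J (\<Phi> l) y - W y))"
        by (rule lebesgue_on_integral_mono_set[OF n \<Omega>s Qs Q]) simp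
      finally show "norm ((LINT y|lebesgue_on ?Q. (J (\<Phi> l) y - J (\<Phi> k) y) $ i $ j)
        - (LINT y|lebesgue_on ?Q. (W y - J (\<Phi> k) y) $ i $ j)) \<le> (LINT y|lebesgue_on \<Omega>. norm (J (\<Phi> l) y - W y))" .
    qed
  qed (rule W_L1)
  from tendsto_rabs[OF this] show ?thesis
    by (rule LIMSEQ_le_const2) (use cube_J_diff in blast)
qed

text \<open>One \<open>(1/2) ^ k\<close> comes from the oscillation of \<open>G k\<close> on the
  cube, which is controlled for \<open>x \<in> C k\<close>, the other four from all later
  perturbations.\<close>

lemma cube_average:
  assumes x: "x \<in> C k"
  shows "\<bar>(LINT y|lebesgue_on (cbox x (x + vec (e k))). (V y + W y) $ i $ j) / e k ^ CARD('n) - G k x $ i $ j\<bar>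
    \<le> 5 * (1/2) ^ k"
proof -
  let ?Q = "cbox x (x + vec (e k))"
  have QE: "?Q \<subseteq> E k" using C(4)[OF x] by blast
  then have Q: "?Q \<subseteq> \<Omega>" using stageD(3) by blast
  have Qs: "?Q \<in> sets lebesgue" by simp
  have ek: "0 < e k" by (rule stageD(8))
  have V_int: "integrable (lebesgue_on \<Omega>) V"
  proof (rule finite_measure.integrable_const_bound[OF finite_\<Omega> _ V_meas])
    show "AE x in lebesgue_on \<Omega>. norm (V x) \<le> R" using AE_E by eventually_elim (auto intro: V_bound)
  qed
  have i1: "integrable (lebesgue_on ?Q) (G k)" "integrable (lebesgue_on ?Q) (\<lambda>y. W y - J (\<Phi> k) y)"
    using integrable_lebesgue_on_subset[OF _ \<Omega>s Qs Q] J_int W_int V_int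
    by (auto intro!: Bochner_Integration.integrable_add Bochner_Integration.integrable_diff)
  have i2: "integrable (lebesgue_on ?Q) (\<lambda>y. G k y $ i $ j)" "integrable (lebesgue_on ?Q) (\<lambda>y. (W y - J (\<Phi> k) y) $ i $ j)"
    using integrable_components(2)[OF i1(1)] integrable_components(2)[OF i1(2)] by auto
  have finQ: "finite_measure (lebesgue_on ?Q)" by (rule finite_measure_lebesgue_on) simp
  have ic: "integrable (lebesgue_on ?Q) (\<lambda>_. c)" for c :: real
    by (rule finite_measure.integrable_const[OF finQ])
  have ne: "?Q \<noteq> {}" using ek by (auto simp: interval_ne_empty_cart)
  have mQ: "measure (lebesgue_on ?Q) ?Q = e k ^ CARD('n)"
    using ne by (subst measure_restrict_space) (auto simp: content_cbox_cart)
  have Ic: "(LINT y|lebesgue_on ?Q. c) = c * e k ^ CARD('n)" for c :: real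
    using mQ by simp
  have "(LINT y|lebesgue_on ?Q. (V y + W y) $ i $ j) - G k x $ i $ j * e k ^ CARD('n)
      = (LINT y|lebesgue_on ?Q. G k y $ i $ j + (W y - J (\<Phi> k) y) $ i $ j) - (LINT y|lebesgue_on ?Q. G k x $ i $ j)"
    unfolding Ic by (simp add: algebra_simps)
  also have "\<dots> = (LINT y|lebesgue_on ?Q. G k y $ i $ j - G k x $ i $ j) + (LINT y|lebesgue_on ?Q. (W y - J (\<Phi> k) y) $ i $ j)"
    by (simp only: Bochner_Integration.integral_add[OF i2] Bochner_Integration.integral_diff[OF i2(1) ic])
  finally have eq: "(LINT y|lebesgue_on ?Q. (V y + W y) $ i $ j) - G k x $ i $ j * e k ^ CARD('n)
      = (LINT y|lebesgue_on ?Q. G k y $ i $ j - G k x $ i $ j) + (LINT y|lebesgue_on ?Q. (W y - J (\<Phi> k) y) $ i $ j)" .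
  have "\<bar>LINT y|lebesgue_on ?Q. G k y $ i $ j - G k x $ i $ j\<bar> \<le> (LINT y|lebesgue_on ?Q. \<bar>G k y $ i $ j - G k x $ i $ j\<bar>)"
    by (rule integral_abs_bound)
  also have "\<dots> \<le> (LINT y|lebesgue_on ?Q. (1/2) ^ k)"
  proof (rule integral_mono[OF _ ic])
    show "integrable (lebesgue_on ?Q) (\<lambda>y. \<bar>G k y $ i $ j - G k x $ i $ j\<bar>)"
      by (intro integrable_abs Bochner_Integration.integrable_diff i2 ic)
    fix y assume "y \<in> space (lebesgue_on ?Q)"
    then have "dist (G k y) (G k x) \<le> (1/2) ^ k" using C(4)[OF x, of y] by simp
    then show "\<bar>G k y $ i $ j - G k x $ i $ j\<bar> \<le> (1/2) ^ k"
      using entry_le_norm[of "G k y - G k x" i j] by (simp add: dist_norm)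
  qed
  finally have "\<bar>LINT y|lebesgue_on ?Q. G k y $ i $ j - G k x $ i $ j\<bar> \<le> (1/2) ^ k * e k ^ CARD('n)"
    unfolding Ic .
  then have "\<bar>(LINT y|lebesgue_on ?Q. (V y + W y) $ i $ j) - G k x $ i $ j * e k ^ CARD('n)\<bar>
      \<le> (1/2) ^ k * e k ^ CARD('n) + 4 * (1/2) ^ k * e k ^ CARD('n)"
    unfolding eq by (intro order_trans[OF abs_triangle_ineq] add_mono cube_W_diff[OF Q])
  also have "\<dots> = 5 * (1/2) ^ k * e k ^ CARD('n)" by (simp add: algebra_simps)
  finally have *: "\<bar>(LINT y|lebesgue_on ?Q. (V y + W y) $ i $ j) - G k x $ i $ j * e k ^ CARD('n)\<bar>
      \<le> 5 * (1/2) ^ k * e k ^ CARD('n)" .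
  have pos: "0 < e k ^ CARD('n)" using ek by simp
  have gen: "\<bar>a / p - b\<bar> \<le> c" if "\<bar>a - b * p\<bar> \<le> c * p" "0 < p" for a b c p :: real
  proof -
    have "a / p - b = (a - b * p) / p" using that(2) by (simp add: field_simps)
    then have "\<bar>a / p - b\<bar> = \<bar>a - b * p\<bar> / p" using that(2) by simp
    then show ?thesis using that by (simp add: divide_le_eq)
  qed
  show ?thesis by (rule gen[OF * pos])
qed

lemma AE_C: "AE x in lebesgue_on \<Omega>. \<forall>\<^sub>F k in sequentially. x \<in> C k"
proof -
  have Cl: "C k \<in> sets lebesgue" for k using C(1) by (simp add: fmeasurableD lmeasurable_compact)
  have El: "E k \<in> lmeasurable" for k
    using stageD(2,3) \<Omega>(2) bounded_subset by (intro lmeasurable_open) blast+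
  have m: "measure lebesgue (\<Omega> - C k) \<le> (1/2) ^ k" for k
  proof -
    have "measure lebesgue (\<Omega> - C k) \<le> measure lebesgue ((\<Omega> - E k) \<union> (E k - C k))"
      using \<Omega>l El Cl C(2)[of k] by (intro measure_mono_fmeasurable fmeasurable.Un fmeasurable_Diff) (auto simp: fmeasurableD)
    also have "\<dots> \<le> measure lebesgue (\<Omega> - E k) + measure lebesgue (E k - C k)"
      using \<Omega>s El Cl by (intro measure_Un_le) (auto simp: fmeasurableD)
    finally show ?thesis using negligible_imp_measure0[OF stageD(4)] C(3)[of k] by simp
  qed
  have "AE x in lebesgue_on \<Omega>. \<forall>\<^sub>F k in sequentially. x \<notin> \<Omega> - C k"
    using \<Omega>s Cl m by (intro AE_eventually_notin[OF \<Omega>l]) auto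
  moreover have "AE x in lebesgue_on \<Omega>. x \<in> \<Omega>" by (rule AE_I2) simp
  ultimately show ?thesis
    by eventually_elim (auto elim: eventually_mono)
qed

lemma e_lim: "e \<longlonglongrightarrow> 0"
proof (rule tendsto_sandwich[of "\<lambda>_. 0"])
  show "(\<lambda>k. (1/2::real) ^ k) \<longlonglongrightarrow> 0" by (rule LIMSEQ_realpow_zero) auto
qed (use stageD(8,9) less_imp_le in \<open>auto intro!: always_eventually\<close>)

text \<open>By the Lebesgue differentiation theorem along the scales \<open>e k\<close> the whole sequence of gradients,
  not only a subsequence, converges almost everywhere.\<close>

lemma G_entry_lim: "AE x in lebesgue_on \<Omega>. (\<lambda>k. G k x $ i $ j) \<longlonglongrightarrow> (V x + W x) $ i $ j"
proof -
  define F where "F x = (if x \<in> \<Omega> then (V x + W x) $ i $ j else 0)" for x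
  have V_int: "integrable (lebesgue_on \<Omega>) V"
  proof (rule finite_measure.integrable_const_bound[OF finite_\<Omega> _ V_meas])
    show "AE x in lebesgue_on \<Omega>. norm (V x) \<le> R" using AE_E by eventually_elim (auto intro: V_bound)
  qed
  have i: "integrable (lebesgue_on \<Omega>) (\<lambda>x. (V x + W x) $ i $ j)"
    by (intro integrable_components(2) Bochner_Integration.integrable_add V_int W_int)
  then have "integrable (lebesgue_on \<Omega>) F"
    by (subst Bochner_Integration.integrable_cong[where g="\<lambda>x. (V x + W x) $ i $ j"]) (auto simp: F_def)
  then have "integrable lebesgue F"
    by (subst (asm) integral_lebesgue_on_eq(2)[OF \<Omega>s]) (auto simp: F_def)
  then have "F integrable_on UNIV"
    using has_integral_integral_lebesgue integrable_on_def by blast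
  then have "F integrable_on cbox c d" for c d
    using integrable_on_subcbox by blast
  then obtain N where N: "negligible N" "\<And>x \<delta>. \<lbrakk>x \<notin> N; 0 < \<delta>\<rbrakk> \<Longrightarrow>
     \<exists>d>0. \<forall>h. 0 < h \<and> h < d \<longrightarrow> norm (integral (cbox x (x + h *\<^sub>R One)) F /\<^sub>R h ^ DIM(real^'n) - F x) < \<delta>"
    using integrable_ccontinuous_explicit[of F] by blast
  have "AE x in lebesgue_on \<Omega>. x \<in> - N"
    by (rule AE_lebesgue_on_negligible[OF \<Omega>s]) (rule negligible_subset[OF N(1)], auto)
  moreover have "AE x in lebesgue_on \<Omega>. x \<in> \<Omega>" by (rule AE_I2) simp
  ultimately show ?thesis
    using AE_C
  proof eventually_elim
    case (elim x)
    \<comment> \<open>Averages of the limit gradient, over cubes with corner \<open>x\<close> as in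
      the differentiation theorem; \<open>cube_average\<close> compares them with
      \<open>G k x\<close> for all large \<open>k\<close>.\<close>
    define a where "a k = integral (cbox x (x + vec (e k))) F / e k ^ CARD('n)" for k
    have "a \<longlonglongrightarrow> F x"
    proof (rule metric_LIMSEQ_I)
      fix \<delta> :: real assume "\<delta> > 0"
      then obtain d where d: "d > 0" "\<And>h. 0 < h \<Longrightarrow> h < d \<Longrightarrow>
          norm (integral (cbox x (x + h *\<^sub>R One)) F /\<^sub>R h ^ DIM(real^'n) - F x) < \<delta>"
        using N(2)[of x \<delta>] elim(1) by auto
      obtain K where K: "\<And>k. k \<ge> K \<Longrightarrow> e k < d"
        using order_tendstoD(2)[OF e_lim d(1)] by (auto simp: eventually_sequentially)
      have v: "h *\<^sub>R (One :: real^'n) = vec h" for h by (simp add: One_eq_vec vec_eq_iff)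
      have "dist (a k) (F x) < \<delta>" if "k \<ge> K" for k
        using d(2)[OF stageD(8) K[OF that]] unfolding v by (simp add: a_def dist_norm divide_inverse mult.commute)
      then show "\<exists>no. \<forall>n\<ge>no. dist (a n) (F x) < \<delta>" by blast
    qed
    moreover have "(\<lambda>k. G k x $ i $ j - a k) \<longlonglongrightarrow> 0"
    proof (rule Lim_null_comparison)
      have z: "(\<lambda>k. 5 * (1/2::real) ^ k) \<longlonglongrightarrow> 5 * 0" by (intro tendsto_intros) simp
      then show "(\<lambda>k. 5 * (1/2::real) ^ k) \<longlonglongrightarrow> 0" by simp
      show "\<forall>\<^sub>F k in sequentially. norm (G k x $ i $ j - a k) \<le> 5 * (1/2) ^ k"
        using elim(3)
      proof eventually_elim
        case (elim k)
        let ?Q = "cbox x (x + vec (e k))"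
        have Q: "?Q \<subseteq> \<Omega>" using C(4)[OF elim] stageD(3) by blast
        have "integral ?Q F = integral ?Q (\<lambda>y. (V y + W y) $ i $ j)"
          using Q by (intro integral_cong) (auto simp: F_def)
        also have "\<dots> = (LINT y|lebesgue_on ?Q. (V y + W y) $ i $ j)"
          using integrable_lebesgue_on_subset[OF i \<Omega>s _ Q] by (intro lebesgue_integral_eq_integral[symmetric]) auto
        finally have "a k = (LINT y|lebesgue_on ?Q. (V y + W y) $ i $ j) / e k ^ CARD('n)"
          by (simp add: a_def)
        then show ?case using cube_average[OF elim, of i j] by (simp only: real_norm_def abs_minus_commute)
      qed
    qed
    ultimately have "(\<lambda>k. a k + (G k x $ i $ j - a k)) \<longlonglongrightarrow> F x + 0" by (rule tendsto_add)
    then show ?case using elim(2) by (simp add: F_def)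
  qed
qed

lemma G_lim: "AE x in lebesgue_on \<Omega>. (\<lambda>k. G k x) \<longlonglongrightarrow> V x + W x"
proof -
  have "AE x in lebesgue_on \<Omega>. \<forall>i j. (\<lambda>k. G k x $ i $ j) \<longlonglongrightarrow> (V x + W x) $ i $ j"
    unfolding AE_all_countable using G_entry_lim by blast
  then show ?thesis
  proof eventually_elim
    case (elim x)
    then show ?case by (intro vec_tendstoI) auto
  qed
qed

lemma AE_level: "AE x in lebesgue_on \<Omega>. \<forall>\<^sub>F k in sequentially. lev (Suc k) x = Suc (lev k x)"
proof -
  define B where "B k = {x \<in> E (Suc k). lev (Suc k) x \<noteq> Suc (lev k x)}" for k
  have Bs: "B k \<in> sets lebesgue" for k
  proof -
    have "B k = E (Suc k) - (\<Union>j. {x \<in> E (Suc k). lev (Suc k) x = Suc j} \<inter> {x \<in> E k. lev k x = j})"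
      using stepD(1)[of k] by (auto simp: B_def)
    moreover have "open (\<Union>j. {x \<in> E (Suc k). lev (Suc k) x = Suc j} \<inter> {x \<in> E k. lev k x = j})"
      by (intro open_UN ballI open_Int stageD(6))
    ultimately show ?thesis using stageD(2)[of "Suc k"] by auto
  qed
  have "AE x in lebesgue_on \<Omega>. \<forall>\<^sub>F k in sequentially. x \<notin> B k"
  proof (rule AE_eventually_notin[OF \<Omega>l Bs])
    show "B k \<subseteq> \<Omega>" for k using stageD(3)[of "Suc k"] by (auto simp: B_def)
    show "measure lebesgue (B k) \<le> (1/2) ^ k" for k using stepD(7) by (simp add: B_def)
  qed
  then show ?thesis using AE_E
  proof eventually_elim
    case (elim x)
    from elim(1) show ?case by eventually_elim (use elim(2) in \<open>auto simp: B_def\<close>)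
  qed
qed

text \<open>Each \<open>G k x\<close> is in the closed plane, and \<open>level_diagonal\<close>
  supplies members of the successive sets. The conclusion is phrased so that property (iii) of the
  in-approximation applies to it directly.\<close>

lemma limit_in_K:
  "AE x in lebesgue_on \<Omega>. V x + W x \<in> S \<and> (\<exists>X. (\<forall>i. X i \<in> U i) \<and> X \<longlonglongrightarrow> V x + W x)"
  using G_lim AE_level AE_E
proof eventually_elim
  case (elim x)
  have "G k x \<in> S" for k using stageD(7) elim(3) hull_subset_S by blast
  then have "V x + W x \<in> S" using closed_sequentially[OF closed_S _ elim(1)] by blast
  moreover have "\<exists>X. (\<forall>i. X i \<in> U i) \<and> X \<longlonglongrightarrow> V x + W x"
  proof (rule level_diagonal[where l="\<lambda>k. lev k x" and g="\<lambda>k. G k x", OF _ _ _ elim(2,1)])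
    show "lev 0 x = 0" by (simp add: init)
    show "G 0 x \<in> U 0" using V0(2) elim(3) by (simp add: init J_zero)
    show "lev (Suc k) x = lev k x \<or> lev (Suc k) x = Suc (lev k x) \<and> G (Suc k) x \<in> U (Suc (lev k x))" for k
      using stepD(6) elim(3) by blast
  qed
  ultimately show ?case ..
qed

end

section \<open>The limit map\<close>

lemma L1_tendsto_weak:
  fixes f :: "nat \<Rightarrow> 'a \<Rightarrow> 'b::euclidean_space" and T :: "'b \<Rightarrow> real"
  assumes T: "bounded_linear T" "\<And>y. \<bar>T y\<bar> \<le> norm y"
    and int: "\<And>k. integrable M (f k)" "integrable M g"
    and \<psi>: "\<psi> \<in> borel_measurable M" "\<And>x. \<bar>\<psi> x\<bar> \<le> B"
    and lim: "(\<lambda>k. LINT x|M. norm (f k x - g x)) \<longlonglongrightarrow> 0"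
  shows "(\<lambda>k. LINT x|M. T (f k x) * \<psi> x) \<longlonglongrightarrow> (LINT x|M. T (g x) * \<psi> x)"
proof (rule LIM_zero_cancel, rule Lim_null_comparison)
  have m: "integrable M (\<lambda>x. T (h x) * \<psi> x)" if "integrable M h" for h
  proof (rule Bochner_Integration.integrable_bound)
    have Th: "integrable M (\<lambda>x. T (h x))" by (rule integrable_bounded_linear[OF T(1) that])
    then show "integrable M (\<lambda>x. T (h x) * B)" by simp
    show "(\<lambda>x. T (h x) * \<psi> x) \<in> borel_measurable M" using Th \<psi>(1) by simp
    show "AE x in M. norm (T (h x) * \<psi> x) \<le> norm (T (h x) * B)"
      using \<psi>(2) by (intro AE_I2) (simp add: abs_mult, metis abs_ge_self abs_ge_zero mult_left_mono order_trans)
  qed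
  show "(\<lambda>k. (LINT x|M. norm (f k x - g x)) * B) \<longlonglongrightarrow> 0"
    using tendsto_mult_right[OF lim, of B] by simp
  show "\<forall>\<^sub>F k in sequentially. norm ((LINT x|M. T (f k x) * \<psi> x) - (LINT x|M. T (g x) * \<psi> x))
      \<le> (LINT x|M. norm (f k x - g x)) * B"
  proof (intro always_eventually allI)
    fix k
    have "(LINT x|M. T (f k x) * \<psi> x) - (LINT x|M. T (g x) * \<psi> x) = (LINT x|M. T (f k x) * \<psi> x - T (g x) * \<psi> x)"
      by (rule Bochner_Integration.integral_diff[OF m[OF int(1)] m[OF int(2)], symmetric])
    also have "norm \<dots> \<le> (LINT x|M. norm (T (f k x) * \<psi> x - T (g x) * \<psi> x))" by (rule integral_norm_bound)
    also have "\<dots> \<le> (LINT x|M. norm (f k x - g x) * B)"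
    proof (rule integral_mono)
      fix x
      have "norm (T (f k x) * \<psi> x - T (g x) * \<psi> x) = \<bar>T (f k x - g x)\<bar> * \<bar>\<psi> x\<bar>"
        by (simp add: linear_diff[OF bounded_linear.linear[OF T(1)]] abs_mult flip: left_diff_distrib)
      also have "\<dots> \<le> norm (f k x - g x) * B" using T(2) \<psi>(2) by (intro mult_mono) auto
      finally show "norm (T (f k x) * \<psi> x - T (g x) * \<psi> x) \<le> norm (f k x - g x) * B" .
    qed (intro integrable_norm Bochner_Integration.integrable_diff integrable_mult_left m int)+
    finally show "norm ((LINT x|M. T (f k x) * \<psi> x) - (LINT x|M. T (g x) * \<psi> x)) \<le> (LINT x|M. norm (f k x - g x)) * B"
      by simp
  qed
qed

lemma test_function_weak_gradient:
  assumes \<Omega>: "open \<Omega>" and \<phi>: "\<phi> \<in> test_functions \<Omega>" and \<psi>: "(\<psi> :: real^'n \<Rightarrow> real) \<in> test_functions \<Omega>"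
  shows "(LINT x|lebesgue_on \<Omega>. \<phi> x $ i * frechet_derivative \<psi> (at x) (axis j 1))
      = - (LINT x|lebesgue_on \<Omega>. J \<phi> x $ i $ j * \<psi> x)"
proof -
  have Jj: "(J \<phi> x *v axis j 1) $ i = J \<phi> x $ i $ j" for x by (simp add: matrix_vector_mult_basis column_def)
  have der: "((\<lambda>x. \<phi> x $ i) has_derivative (\<lambda>h. (J \<phi> x *v h) $ i)) (at x)" for x
    by (rule bounded_linear.has_derivative[OF bounded_linear_vec_nth J_has_derivative[OF \<phi>]])
  have cont: "continuous_on \<Omega> (\<lambda>x. (J \<phi> x *v axis j 1) $ i)"
    unfolding Jj by (intro continuous_on_component continuous_on_J[OF \<phi>])
  have "\<Omega> \<in> sets lebesgue" using \<Omega> by simp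
  from integration_by_parts(3)[OF \<Omega> der cont \<psi>, unfolded Jj] show ?thesis
    unfolding test_function_integral_on[OF \<open>\<Omega> \<in> sets lebesgue\<close> \<psi>] .
qed

text \<open>Both sides of the integration by parts formula are pairings with bounded measurable
  functions, which pass to L1 limits.\<close>

lemma has_weak_gradient_limit:
  fixes w :: "real^'n \<Rightarrow> real^'m"
  assumes \<Omega>: "open \<Omega>" and \<phi>: "\<And>k. \<phi> k \<in> test_functions \<Omega>"
    and int: "\<And>k. integrable (lebesgue_on \<Omega>) (\<phi> k)" "\<And>k. integrable (lebesgue_on \<Omega>) (J (\<phi> k))"
      "integrable (lebesgue_on \<Omega>) w" "integrable (lebesgue_on \<Omega>) W"
    and lim: "(\<lambda>k. LINT x|lebesgue_on \<Omega>. norm (\<phi> k x - w x)) \<longlonglongrightarrow> 0"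
      "(\<lambda>k. LINT x|lebesgue_on \<Omega>. norm (J (\<phi> k) x - W x)) \<longlonglongrightarrow> 0"
  shows "has_weak_gradient \<Omega> w W"
  unfolding has_weak_gradient_def
proof (intro conjI allI impI)
  have \<Omega>s: "\<Omega> \<in> sets lebesgue" using \<Omega> by simp
  fix C assume C: "compact C \<and> C \<subseteq> \<Omega>"
  then have "C \<in> sets lebesgue" by (simp add: fmeasurableD lmeasurable_compact)
  then show "integrable (lebesgue_on C) w" "integrable (lebesgue_on C) W"
    using integrable_lebesgue_on_subset[OF _ \<Omega>s] int(3,4) C by blast+
next
  fix \<psi> :: "real^'n \<Rightarrow> real" and i j assume \<psi>: "\<psi> \<in> test_functions \<Omega>"
  have \<Omega>s: "\<Omega> \<in> sets lebesgue" using \<Omega> by simp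
  obtain K where K: "compact K" "\<And>x. x \<notin> K \<Longrightarrow> \<psi> x = 0"
    "\<And>x. x \<notin> K \<Longrightarrow> frechet_derivative \<psi> (at x) = (\<lambda>_. 0)"
    using test_function_support[OF \<psi>] by metis
  obtain B where B: "\<And>x. norm (\<psi> x) \<le> B"
    using bounded_continuous_compact_support[OF test_function_continuous[OF \<psi>] K(1,2)] by metis
  obtain B' where B': "\<And>x. norm (frechet_derivative \<psi> (at x) (axis j 1)) \<le> B'"
    using bounded_continuous_compact_support[OF test_function_continuous_partial[OF \<psi>, of _ j] K(1)] K(3) by metis
  have m: "\<psi> \<in> borel_measurable (lebesgue_on \<Omega>)"
    "(\<lambda>x. frechet_derivative \<psi> (at x) (axis j 1)) \<in> borel_measurable (lebesgue_on \<Omega>)"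
    by (intro continuous_imp_measurable_on_sets_lebesgue test_function_continuous[OF \<psi>]
        test_function_continuous_partial[OF \<psi>] \<Omega>s)+
  have "(\<lambda>k. LINT x|lebesgue_on \<Omega>. \<phi> k x $ i * frechet_derivative \<psi> (at x) (axis j 1))
      \<longlonglongrightarrow> (LINT x|lebesgue_on \<Omega>. w x $ i * frechet_derivative \<psi> (at x) (axis j 1))"
    by (rule L1_tendsto_weak[where T="\<lambda>y. y $ i", OF bounded_linear_vec_nth component_le_norm_cart int(1,3) m(2) _ lim(1)])
      (use B' in simp)
  moreover have "(\<lambda>k. LINT x|lebesgue_on \<Omega>. J (\<phi> k) x $ i $ j * \<psi> x) \<longlonglongrightarrow> (LINT x|lebesgue_on \<Omega>. W x $ i $ j * \<psi> x)"
    by (rule L1_tendsto_weak[where T="\<lambda>A. A $ i $ j", OF _ entry_le_norm int(2,4) m(1) _ lim(2)])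
      (use B bounded_linear_compose[OF bounded_linear_vec_nth bounded_linear_vec_nth] in auto)
  ultimately show "(LINT x|lebesgue_on \<Omega>. w x $ i * frechet_derivative \<psi> (at x) (axis j 1)) = - (LINT x|lebesgue_on \<Omega>. W x $ i $ j * \<psi> x)"
    unfolding test_function_weak_gradient[OF \<Omega> \<phi> \<psi>] using LIMSEQ_unique tendsto_minus by blast
qed

section \<open>Membership of the limit map in the space with zero boundary values\<close>

context iteration
begin

lemma w_bound: "norm (w x) \<le> 2 * e 0"
  using w_diff[of x 0] by (simp add: init)

lemma \<Phi>_meas: "\<Phi> k \<in> borel_measurable (lebesgue_on \<Omega>)"
  by (intro continuous_imp_measurable_on_sets_lebesgue test_function_continuous[OF test] \<Omega>s)

lemma w_meas: "w \<in> borel_measurable (lebesgue_on \<Omega>)"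
  by (rule borel_measurable_LIMSEQ_metric[OF \<Phi>_meas]) (rule \<Phi>_lim)

lemma \<Phi>_int: "integrable (lebesgue_on \<Omega>) (\<Phi> k)" and w_int: "integrable (lebesgue_on \<Omega>) w"
proof -
  obtain B where "\<And>x. norm (\<Phi> k x) \<le> B" using J_bounded[OF test] by metis
  then show "integrable (lebesgue_on \<Omega>) (\<Phi> k)"
    by (intro finite_measure.integrable_const_bound[OF finite_\<Omega> AE_I2 \<Phi>_meas])
  show "integrable (lebesgue_on \<Omega>) w"
    by (intro finite_measure.integrable_const_bound[OF finite_\<Omega> AE_I2 w_meas]) (rule w_bound)
qed

lemma w_L1: "(\<lambda>k. LINT x|lebesgue_on \<Omega>. norm (\<Phi> k x - w x)) \<longlonglongrightarrow> 0"
proof (rule Lim_null_comparison)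
  let ?m = "measure (lebesgue_on \<Omega>) (space (lebesgue_on \<Omega>))"
  have z: "(\<lambda>k. 2 * e k * ?m) \<longlonglongrightarrow> 2 * 0 * ?m" by (intro tendsto_intros e_lim)
  then show "(\<lambda>k. 2 * e k * ?m) \<longlonglongrightarrow> 0" by simp
  show "\<forall>\<^sub>F k in sequentially. norm (LINT x|lebesgue_on \<Omega>. norm (\<Phi> k x - w x)) \<le> 2 * e k * ?m"
  proof (intro always_eventually allI)
    fix k
    have le: "norm (\<Phi> k x - w x) \<le> 2 * e k" for x
    proof -
      have "2 * e k * (1/2) ^ k \<le> 2 * e k * 1"
        using stageD(8)[of k] by (intro mult_left_mono power_le_one) auto
      then show ?thesis using w_diff[of x k] by (simp add: norm_minus_commute)
    qed
    have "(LINT x|lebesgue_on \<Omega>. norm (\<Phi> k x - w x)) \<le> (LINT x|lebesgue_on \<Omega>. 2 * e k)"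
      by (intro integral_mono integrable_norm Bochner_Integration.integrable_diff \<Phi>_int w_int le
          finite_measure.integrable_const[OF finite_\<Omega>])
    then show "norm (LINT x|lebesgue_on \<Omega>. norm (\<Phi> k x - w x)) \<le> 2 * e k * ?m" by (simp add: mult.commute)
  qed
qed

lemma weak_gradient_w: "has_weak_gradient \<Omega> w W"
  by (rule has_weak_gradient_limit[OF \<Omega>(1) test \<Phi>_int J_int w_int W_int w_L1 W_L1])

lemma W_Linf: "W \<in> Linf \<Omega>"
  by (rule LinfI(1)[OF W_meas W_bound])

text \<open>The iterates \<open>\<Phi> k\<close> themselves are the approximating test
  functions.\<close>

lemma w_W1inf_0: "w \<in> W1inf_0 \<Omega>"
proof -
  have "w \<in> Linf \<Omega>" by (rule LinfI(1)[OF w_meas AE_I2]) (rule w_bound)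
  then have "w \<in> W1inf \<Omega>" using W_Linf weak_gradient_w by (auto simp: W1inf_def)
  moreover have "w \<in> W11_0 \<Omega>"
    unfolding W11_0_def
    using w_int W_int weak_gradient_w test w_L1 W_L1[unfolded J_def] by blast
  ultimately show ?thesis by (simp add: W1inf_0_def)
qed

end

text \<open>Dependent choice of an infinite run, started from the zero perturbation with all levels
  0.\<close>

lemma (in linear_constraint) convex_integration:
  fixes \<Omega> :: "(real^'n) set" and V :: "real^'n \<Rightarrow> real^'n^'m"
  assumes \<Omega>: "open \<Omega>" "bounded \<Omega>" and U: "\<And>j. openin (top_of_set S) (U j)"
    and R: "\<And>j. lhull (U j) \<subseteq> cball 0 R" and nest: "\<And>j. U j \<subseteq> lhull (U (Suc j))"
    and E: "open E" "E \<subseteq> \<Omega>" "negligible (\<Omega> - E)"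
    and V: "continuous_on E V" "\<And>x. x \<in> E \<Longrightarrow> V x \<in> U 0" "\<And>x. x \<notin> E \<Longrightarrow> V x = 0" and \<epsilon>: "\<epsilon> > 0"
  obtains w W where "w \<in> W1inf_0 \<Omega>" "has_weak_gradient \<Omega> w W" "W \<in> Linf \<Omega>" "\<And>x. norm (w x) \<le> \<epsilon>"
    "AE x in lebesgue_on \<Omega>. V x + W x \<in> S \<and> (\<exists>X. (\<forall>i. X i \<in> U i) \<and> X \<longlonglongrightarrow> V x + W x)"
proof -
  have Eb: "bounded E" using \<Omega>(2) E(2) bounded_subset by blast
  \<comment> \<open>The limit map is bounded by \<open>2 * e 0\<close>, so
    \<open>e0 \<le> \<epsilon> / 2\<close> yields the bound \<open>\<epsilon>\<close>; the bound 1
    is the requirement on the scale at stage 0.\<close>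
  obtain e0 C where e0: "0 < e0" "e0 \<le> min 1 (\<epsilon> / 2)" "compact C" "C \<subseteq> E" "measure lebesgue (E - C) \<le> 1"
    "\<And>x y. x \<in> C \<Longrightarrow> y \<in> cbox x (x + vec e0) \<Longrightarrow> y \<in> E \<and> dist (V y) (V x) \<le> 1"
    using choose_scale[OF E(1) Eb V(1) zero_less_one, of "min 1 (\<epsilon> / 2)"] \<epsilon> by auto
  \<comment> \<open>The five components of a stage are packed into a tuple for
    \<open>dependent_nat_choice\<close>; the clause for \<open>k = 0\<close> records the initial
    data that the locale asks for.\<close>
  define P where "P k s \<longleftrightarrow> (case s of (\<Phi>, E', lev, e, H) \<Rightarrow> stage \<Omega> V U k \<Phi> E' lev e H \<and>
      (k = 0 \<longrightarrow> \<Phi> = (\<lambda>_. 0) \<and> lev = (\<lambda>_. 0) \<and> E' = E \<and> e = e0))" for k s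
  define Q where "Q k s s' \<longleftrightarrow> (case s of (\<Phi>, E, lev, e, H) \<Rightarrow> case s' of (\<Phi>', E', lev', e', H') \<Rightarrow>
      step V U k \<Phi> E lev e H \<Phi>' E' lev' e' H')" for k s s'
  have "\<exists>s. P 0 s"
  proof
    have "stage \<Omega> V U 0 (\<lambda>_. 0) E (\<lambda>_. 0) e0 {\<lambda>x. V x + J (\<lambda>_. 0) x}"
      unfolding stage_def
    proof (intro conjI allI ballI)
      show "open {x \<in> E. 0 = j}" for j :: nat using E(1) by (cases "j = 0") auto
      show "V x + J (\<lambda>_. 0) x \<in> lhull (U (Suc 0))" if "x \<in> E" for x
        using V(2)[OF that] nest by (auto simp: J_zero)
      show "continuous_on E h" if "h \<in> {\<lambda>x. V x + J (\<lambda>_. 0) x}" for h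
        using that V(1) by (simp add: J_zero)
      show "\<exists>C. compact C \<and> C \<subseteq> E \<and> measure lebesgue (E - C) \<le> (1/2) ^ 0 \<and>
       (\<forall>x\<in>C. \<forall>y\<in>cbox x (x + vec e0). y \<in> E \<and> dist (V y + J (\<lambda>_. 0) y) (V x + J (\<lambda>_. 0) x) \<le> (1/2) ^ 0)"
        using e0(3-6) by (intro exI[of _ C]) (auto simp: J_zero)
    qed (use E V(1) e0(1,2) in \<open>auto simp: pert_zero\<close>)
    then show "P 0 (\<lambda>_. 0, E, \<lambda>_. 0, e0, {\<lambda>x. V x + J (\<lambda>_. 0) x})" by (simp add: P_def)
  qed
  moreover have "\<exists>s'. P (Suc k) s' \<and> Q k s s'" if "P k s" for s k
  proof -
    obtain \<Phi> E' lev e H where s: "s = (\<Phi>, E', lev, e, H)" by (metis prod.exhaust)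
    then have "stage \<Omega> V U k \<Phi> E' lev e H" using that by (simp add: P_def)
    from stage_step[OF \<Omega> U R nest this] obtain \<Phi>' E'' lev' e' H' where
      "stage \<Omega> V U (Suc k) \<Phi>' E'' lev' e' H'" "step V U k \<Phi> E' lev e H \<Phi>' E'' lev' e' H'" by blast
    then show ?thesis by (intro exI[of _ "(\<Phi>', E'', lev', e', H')"]) (simp add: P_def Q_def s)
  qed
  ultimately obtain s where s: "\<And>k. P k (s k)" "\<And>k. Q k (s k) (s (Suc k))"
    using dependent_nat_choice[of P Q] by metis
  define \<Phi> where "\<Phi> k = fst (s k)" for k
  define E' where "E' k = fst (snd (s k))" for k
  define lev where "lev k = fst (snd (snd (s k)))" for k
  define e where "e k = fst (snd (snd (snd (s k))))" for k
  define H where "H k = snd (snd (snd (snd (s k))))" for k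
  have sk: "s k = (\<Phi> k, E' k, lev k, e k, H k)" for k
    by (simp add: \<Phi>_def E'_def lev_def e_def H_def)
  have 0: "\<Phi> 0 = (\<lambda>_. 0)" "lev 0 = (\<lambda>_. 0)" "E' 0 = E" "e 0 = e0"
    using s(1)[of 0] by (simp_all add: P_def sk)
  have US: "U 0 \<subseteq> S" using U openin_imp_subset by blast
  interpret iteration L t \<Omega> V U R \<Phi> E' lev e H
  proof unfold_locales
    show "stage \<Omega> V U k (\<Phi> k) (E' k) (lev k) (e k) (H k)" for k
      using s(1)[of k] by (simp add: P_def sk)
    show "step V U k (\<Phi> k) (E' k) (lev k) (e k) (H k) (\<Phi> (Suc k)) (E' (Suc k)) (lev (Suc k)) (e (Suc k)) (H (Suc k))" for k
      using s(2)[of k] by (simp add: Q_def sk)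
    show "V x \<in> lhull (U 0)" if "x \<in> E' 0" for x using V(2)[of x] that subset_hull[OF US] by (auto simp: 0)
  qed (use \<Omega> R V 0 in auto)
  show ?thesis
  proof (rule that[OF w_W1inf_0 weak_gradient_w W_Linf _ limit_in_K])
    show "norm (w x) \<le> \<epsilon>" for x using w_bound[of x] e0(2) by (simp add: 0)
  qed
qed

section \<open>Piecewise smooth boundary data\<close>

text \<open>The countable family of pieces is merged into one open set; finiteness of the measure of
  \<Omega> turns equality of measures into a negligible difference.\<close>

lemma piecewise_C1_open_full:
  fixes v :: "real^'n \<Rightarrow> real^'m"
  assumes v: "piecewise_C1 \<Omega> v" and \<Omega>: "\<Omega> \<in> lmeasurable"
  obtains D where "open D" "D \<subseteq> \<Omega>" "negligible (\<Omega> - D)" "continuous_on D (J v)"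
    "\<And>x. x \<in> D \<Longrightarrow> (v has_derivative (\<lambda>h. J v x *v h)) (at x)"
proof -
  obtain D :: "nat \<Rightarrow> (real^'n) set" where D: "\<And>j. open (D j)" "\<And>j. D j \<subseteq> \<Omega>"
    "emeasure lebesgue (\<Union>j. D j) = emeasure lebesgue \<Omega>" "\<And>j. C1_closure (D j) v"
    using v unfolding piecewise_C1_def by metis
  have o: "open (\<Union>j. D j)" using D(1) by blast
  have "emeasure lebesgue (\<Omega> - (\<Union>j. D j)) = emeasure lebesgue \<Omega> - emeasure lebesgue (\<Union>j. D j)"
    using o D(2,3) \<Omega> fmeasurableD2[OF \<Omega>] by (intro emeasure_Diff) (auto simp: fmeasurableD)
  also have "\<dots> = 0" using D(3) fmeasurableD2[OF \<Omega>] by (simp add: diff_eq_0_ennreal less_top)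
  finally have "negligible (\<Omega> - (\<Union>j. D j))"
    using o \<Omega> by (auto simp: negligible_iff_null_sets null_sets_def fmeasurableD)
  moreover have der: "(v has_derivative (\<lambda>h. J v x *v h)) (at x)" and cont: "continuous_on (D j) (J v)"
    if "x \<in> D j" for x j
  proof -
    obtain w G where G: "continuous_on (closure (D j)) G" "\<And>x. x \<in> D j \<Longrightarrow> (v has_derivative (\<lambda>h. G x *v h)) (at x)"
      using D(4)[of j] by (auto simp: C1_closure_def)
    have eq: "J v x = G x" if "x \<in> D j" for x by (rule J_eqI[OF G(2)[OF that]])
    then show "(v has_derivative (\<lambda>h. J v x *v h)) (at x)" using G(2)[OF that] that by simp
    have "continuous_on (D j) G" by (rule continuous_on_subset[OF G(1) closure_subset])
    then show "continuous_on (D j) (J v)" using eq by (simp cong: continuous_on_cong)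
  qed
  moreover have "continuous_on (\<Union>j. D j) (J v)"
    by (rule continuous_on_open_UN[OF D(1)]) (metis cont continuous_on_empty ex_in_conv)
  moreover have "(\<Union>j. D j) \<subseteq> \<Omega>" using D(2) by blast
  ultimately show ?thesis using o by (intro that[of "\<Union>j. D j"]) auto
qed

lemma weak_gradient_ae_unique_classical:
  fixes v :: "real^'n \<Rightarrow> real^'m"
  assumes \<Omega>: "open \<Omega>" and D: "open D" "D \<subseteq> \<Omega>" "negligible (\<Omega> - D)" "continuous_on D (J v)"
    "\<And>x. x \<in> D \<Longrightarrow> (v has_derivative (\<lambda>h. J v x *v h)) (at x)"
    and G: "has_weak_gradient \<Omega> v G"
  shows "AE x in lebesgue_on \<Omega>. x \<in> D \<and> G x = J v x"
proof -
  have neg: "negligible {x \<in> D. G x \<noteq> J v x}"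
    by (rule weak_gradient_eq_classical[OF \<Omega> G D(1,2,5,4)])
  have "negligible (\<Omega> - {x \<in> D. G x = J v x})"
    by (rule negligible_subset[OF negligible_Un[OF neg D(3)]]) auto
  from AE_lebesgue_on_negligible[OF _ this] \<Omega> show ?thesis by simp
qed

lemma AE_lebesgue_on_imp_negligible:
  assumes "\<Omega> \<in> sets lebesgue" "AE x in lebesgue_on \<Omega>. x \<in> A"
  shows "negligible (\<Omega> - A)"
proof -
  have "AE x in lebesgue. x \<in> \<Omega> \<longrightarrow> x \<in> A"
    using assms by (subst (asm) AE_restrict_space_iff) auto
  then have "AE x in lebesgue. x \<notin> \<Omega> - A" by eventually_elim auto
  then obtain N where "\<And>x. x \<in> space lebesgue - N \<Longrightarrow> x \<notin> \<Omega> - A" "N \<in> null_sets lebesgue"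
    by (metis AE_E3)
  then have "\<Omega> - A \<subseteq> N" "negligible N" by (auto simp: negligible_iff_null_sets)
  then show ?thesis by (rule negligible_subset[rotated])
qed

text \<open>Continuity and closedness of the affine constraint upgrade the inclusion \<open>J v \<in> S\<close> from almost
  everywhere to everywhere on \<open>D\<close>, so that the preimage of a relatively open set is open.\<close>

lemma open_preimage_ae:
  fixes g :: "real^'n \<Rightarrow> 'b::metric_space"
  assumes D: "open D" "continuous_on D g" and S: "closed S" and U: "openin (top_of_set S) U"
    and ae: "negligible {x \<in> D. g x \<notin> U}"
  shows "open {x \<in> D. g x \<in> U}"
proof -
  have US: "U \<subseteq> S" using U by (rule openin_imp_subset)
  have "open (D \<inter> g -` (- S))" using D S by (intro continuous_open_preimage) auto
  moreover have "negligible (D \<inter> g -` (- S))" by (rule negligible_subset[OF ae]) (use US in auto)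
  ultimately have "D \<inter> g -` (- S) = {}" using open_not_negligible by blast
  then have "g ` D \<subseteq> S" by auto
  obtain T where T: "open T" "U = S \<inter> T" using U by (auto simp: openin_open)
  have "{x \<in> D. g x \<in> U} = D \<inter> g -` T" using \<open>g ` D \<subseteq> S\<close> T(2) by auto
  then show ?thesis using continuous_open_preimage[OF D(2,1) T(1)] by simp
qed

theorem theorem1p3:
  fixes \<Omega> :: "(real^'n) set"
    and L :: "real^'n^'m"
    and t :: real
    and K :: "(real^'n^'m) set"
    and U :: "nat \<Rightarrow> (real^'n^'m) set"
    and v :: "real^'n \<Rightarrow> real^'m"
  assumes "CARD('m) \<ge> 2" and "CARD('n) \<ge> 2"
    and "bounded_lipschitz_domain \<Omega>"
    and "L \<noteq> 0"
    and "\<forall>b. b \<noteq> 0 \<longrightarrow> L *v b \<noteq> 0"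
    and "K \<subseteq> Sigma_t L t"
    and "in_approximation (Sigma_t L t) K U"
    and "v \<in> W1inf \<Omega>"
    and "piecewise_C1 \<Omega> v"
    and "gradient_in_ae \<Omega> v (U 0)"
  shows "\<forall>\<epsilon>::real. \<epsilon> > 0 \<longrightarrow>
    (\<exists>u\<in>W1inf \<Omega>. gradient_in_ae \<Omega> u K \<and> eq_on_boundary \<Omega> u v \<and>
       Linf_norm \<Omega> (\<lambda>x. u x - v x) < ereal \<epsilon>)"
proof (intro allI impI)
  fix \<epsilon> :: real assume \<epsilon>: "\<epsilon> > 0"
  interpret linear_constraint L t by unfold_locales (use assms(5) in blast)
  have \<Omega>: "open \<Omega>" "bounded \<Omega>" using assms(3) by (auto simp: bounded_lipschitz_domain_def)
  then have \<Omega>l: "\<Omega> \<in> lmeasurable" and \<Omega>s: "\<Omega> \<in> sets lebesgue" by (auto intro: lmeasurable_open)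
  have U: "\<And>j. openin (top_of_set S) (U j)" "bounded (\<Union>j. U j)" "\<And>j. U j \<subseteq> rc_hull (U (Suc j))"
    and UK: "\<And>X \<xi>. \<xi> \<in> S \<Longrightarrow> (\<And>i. X i \<in> U i) \<Longrightarrow> X \<longlonglongrightarrow> \<xi> \<Longrightarrow> \<xi> \<in> K"
    using assms(7) unfolding in_approximation_def by blast+
  have US: "U j \<subseteq> S" for j using U(1) by (rule openin_imp_subset)
  have nest: "U j \<subseteq> lhull (U (Suc j))" for j
    using U(3)[of j] US[of j] rc_hull_subset_hull[OF US[of "Suc j"]] by blast
  obtain B where B: "\<And>j. U j \<subseteq> cball 0 B"
  proof -
    obtain B where "\<And>\<xi>. \<xi> \<in> (\<Union>j. U j) \<Longrightarrow> norm \<xi> \<le> B" using U(2) unfolding bounded_iff by blast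
    then show thesis by (intro that[of B]) fastforce
  qed
  \<comment> \<open>Uniform boundedness of the \<open>U j\<close> gives one radius for all
    hulls.\<close>
  have R: "lhull (U j) \<subseteq> cball 0 (sqrt (2 * B\<^sup>2))" for j
    unfolding subset_iff mem_cball_0 using hull_bounded[OF B] real_le_rsqrt by blast
  obtain D where D: "open D" "D \<subseteq> \<Omega>" "negligible (\<Omega> - D)" "continuous_on D (J v)"
    "\<And>x. x \<in> D \<Longrightarrow> (v has_derivative (\<lambda>h. J v x *v h)) (at x)"
    using piecewise_C1_open_full[OF assms(9) \<Omega>l] by blast
  have classical: "AE x in lebesgue_on \<Omega>. x \<in> D \<and> G x = J v x" if "has_weak_gradient \<Omega> v G" for G
    by (rule weak_gradient_ae_unique_classical[OF \<Omega>(1) D(1-4) _ that]) (rule D(5))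
  obtain G0 where G0: "has_weak_gradient \<Omega> v G0" "AE x in lebesgue_on \<Omega>. G0 x \<in> U 0"
    using assms(10) by (auto simp: gradient_in_ae_def)
  \<comment> \<open>Here the classical gradient lies in \<open>U 0\<close> at every point; the set
    still has full measure, and it is open by \<open>open_preimage_ae\<close>.\<close>
  define E where "E = {x \<in> D. J v x \<in> U 0}"
  have "AE x in lebesgue_on \<Omega>. x \<in> E"
    using classical[OF G0(1)] G0(2) by eventually_elim (auto simp: E_def)
  then have negE: "negligible (\<Omega> - E)" by (rule AE_lebesgue_on_imp_negligible[OF \<Omega>s])
  have E: "open E" "E \<subseteq> D" "E \<subseteq> \<Omega>"
  proof -
    have "negligible {x \<in> D. J v x \<notin> U 0}"
      by (rule negligible_subset[OF negE]) (use D(2) in \<open>auto simp: E_def\<close>)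
    then show "open E" unfolding E_def by (rule open_preimage_ae[OF D(1,4) closed_S U(1)])
  qed (use D(2) in \<open>auto simp: E_def\<close>)
  define V where "V x = (if x \<in> E then J v x else 0)" for x
  have cV: "continuous_on E V"
    using continuous_on_subset[OF D(4) E(2)] by (simp add: V_def cong: continuous_on_cong)
  \<comment> \<open>Half of \<open>\<epsilon>\<close> leaves room for the strict inequality.\<close>
  obtain w W where w: "w \<in> W1inf_0 \<Omega>" "has_weak_gradient \<Omega> w W" "W \<in> Linf \<Omega>" "\<And>x. norm (w x) \<le> \<epsilon> / 2"
    "AE x in lebesgue_on \<Omega>. V x + W x \<in> S \<and> (\<exists>X. (\<forall>i. X i \<in> U i) \<and> X \<longlonglongrightarrow> V x + W x)"
  proof (rule convex_integration[where U=U and V=V and \<epsilon>="\<epsilon> / 2", OF \<Omega> U(1) R nest E(1,3) negE cV])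
    show "V x \<in> U 0" if "x \<in> E" for x using that by (simp add: V_def E_def)
    show "V x = 0" if "x \<notin> E" for x using that by (simp add: V_def)
    show "0 < \<epsilon> / 2" using \<epsilon> by simp
    fix w W assume "w \<in> W1inf_0 \<Omega>" "has_weak_gradient \<Omega> w W" "W \<in> Linf \<Omega>" "\<And>x. norm (w x) \<le> \<epsilon> / 2"
      "AE x in lebesgue_on \<Omega>. V x + W x \<in> S \<and> (\<exists>X. (\<forall>i. X i \<in> U i) \<and> X \<longlonglongrightarrow> V x + W x)"
    then show thesis by (rule that)
  qed
  have VK: "AE x in lebesgue_on \<Omega>. V x + W x \<in> K"
    using w(5) by eventually_elim (use UK in blast)
  \<comment> \<open>A bounded weak gradient, possibly another representative than \<open>G0\<close>;
    both agree almost everywhere with the classical gradient on \<open>D\<close>.\<close>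
  obtain G where G: "G \<in> Linf \<Omega>" "has_weak_gradient \<Omega> v G" and vL: "v \<in> Linf \<Omega>"
    using assms(8) by (auto simp: W1inf_def)
  have GV: "AE x in lebesgue_on \<Omega>. G x = V x"
    using classical[OF G(2)] AE_lebesgue_on_negligible[OF \<Omega>s negE] by eventually_elim (simp add: V_def)
  define u where "u x = v x + w x" for x
  have uG: "has_weak_gradient \<Omega> u (\<lambda>x. G x + W x)"
    unfolding u_def by (rule has_weak_gradient_add[OF \<Omega>s G(2) w(2)])
  have wL: "w \<in> Linf \<Omega>" using w(1) by (simp add: W1inf_0_def W1inf_def)
  have diff: "(\<lambda>x. u x - v x) = w" by (simp add: u_def)
  show "\<exists>u\<in>W1inf \<Omega>. gradient_in_ae \<Omega> u K \<and> eq_on_boundary \<Omega> u v \<and> Linf_norm \<Omega> (\<lambda>x. u x - v x) < ereal \<epsilon>"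
  proof (intro bexI conjI)
    show "gradient_in_ae \<Omega> u K"
      unfolding gradient_in_ae_def
    proof (intro exI conjI)
      show "AE x in lebesgue_on \<Omega>. G x + W x \<in> K" using GV VK by eventually_elim simp
    qed (rule uG)
    show "eq_on_boundary \<Omega> u v" using w(1) by (simp add: eq_on_boundary_def diff)
    have "w \<in> borel_measurable (lebesgue_on \<Omega>)" using wL by (simp add: Linf_def)
    then have "Linf_norm \<Omega> w \<le> ereal (\<epsilon> / 2)" using w(4) by (intro LinfI(2) AE_I2)
    also have "\<dots> < ereal \<epsilon>" using \<epsilon> by simp
    finally show "Linf_norm \<Omega> (\<lambda>x. u x - v x) < ereal \<epsilon>" by (simp add: diff)
    have "u \<in> Linf \<Omega>" unfolding u_def by (rule Linf_add[OF vL wL])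
    then show "u \<in> W1inf \<Omega>" using uG Linf_add[OF G(1) w(3)] by (auto simp: W1inf_def)
  qed
qed

end
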